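(* Assume (B) the quasi-monotonicity of $\mu^{-1}$ in edge patches (stated in the context). Then there is a constant $C>0$, independent of $\mu$, such that the weighted Clément-type Nédélec interpolation operator $\widetilde\Pi_h$ defined in the context satisfies, for every $K\in\mathcal T_h$, $$\|\mu^{-1/2}(v-\widetilde\Pi_hv)\|_{L^2(K)}\le C\,h_K\,\|\mu^{-1/2}\nabla v\|_{L^2(\widetilde\omega_{K,e})}$$ and $$\|\mu^{-1/2}\,\nabla\times(v-\widetilde\Pi_hv)\|_{L^2(K)}\le C\,\|\mu^{-1/2}\nabla v\|_{L^2(\widetilde\omega_{K,e})}$$ for all $v\in H_0(\mathrm{curl};\Omega)$ such that $v|_{\omega_{K,e}}\in H(\mathrm{curl};\omega_{K,e})\cap PH^1(\omega_{K,e},\mathscr P)$, where the Jacobian $\nabla v$ is defined piecewise by $\nabla v|_{K'}:=\nabla(v|_{K'})$ on each element $K'$.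
   Context: $\Omega\subset\mathbb R^3$ is a bounded polyhedral domain with Lipschitz boundary, partitioned into polyhedral subdomains $\mathscr P=\{\Omega_j\}_{j=1}^m$, and $\mu$ is positive and constant on each $\Omega_j$. $H(\mathrm{curl};\mathcal O)=\{v\in L^2(\mathcal O)^3:\nabla\times v\in L^2(\mathcal O)^3\}$, and $H_0(\mathrm{curl};\Omega)$ is the subspace of $H(\mathrm{curl};\Omega)$ of fields with $v\times n=0$ on $\partial\Omega$. $PH^1(\mathcal O,\mathscr P)$ is the space of vector fields in $L^2(\mathcal O)^3$ whose restriction to $\mathcal O\cap\Omega_j$ is in $H^1$ for every $j$. $\mathcal T_h$ is a shape-regular conforming tetrahedral triangulation of $\Omega$ fitted to $\mathscr P$, so $\mu$ is a constant $\mu_K$ on each $K\in\mathcal T_h$. $\mathcal E_h$ is the set of edges, $\mathcal E_h(K)$ the set of edges of $K$, $h_K$ the diameter of $K$; each edge $e$ has a fixed unit tangent $t_e$. $ND_0=\{p\in H(\mathrm{curl};\Omega): p|_K=a+b\times x,\ a,b\in\mathbb R^3,\ \forall K\in\mathcal T_h\}$ with basis $\varphi_e$ ($e\in\mathcal E_h$) satisfying $\frac1{|e'|}\int_{e'}\varphi_e\cdot t_{e'}\,ds=\delta_{ee'}$. $\omega_e$ is the union of the elements having $e$ as an edge; $\omega_{K,e}=\bigcup_{e\in\mathcal E_h(K)}\omega_e$ is the union of the elements sharing an edge with $K$; $\widetilde\omega_e$ is the union of the elements $K\subset\omega_e$ for which $\mu_K^{-1}$ is maximal over the elements of $\omega_e$.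 **Interpolation.** For $v$ as in the claim, $\widetilde\Pi_hv|_K=\sum_{e\in\mathcal E_h(K)}\widetilde\alpha_e(v)\varphi_e$, where $\widetilde\alpha_e(v)=\Big(\frac1{|\widetilde\omega_e|}\int_{\widetilde\omega_e}v\,dx\Big)\cdot t_e$ if $e$ is an interior edge (i.e. $e\cap\partial\Omega$ has zero 1-dimensional measure), and $\widetilde\alpha_e(v)=0$ if $e$ is an edge on $\partial\Omega$. **(B) Quasi-monotonicity of $\mu^{-1}$ in edge patches.** For every $e\in\mathcal E_h$: if $e$ is an interior edge, then for every element $K\subset\omega_e$ and every element $K'\subset\widetilde\omega_e$, (i) there are elements $K_0=K,K_1,\dots,K_l=K'$ in $\omega_e$ such that $K_i$ shares a face with $K_{i-1}$ and $\mu_{K_{i-1}}^{-1}\le\mu_{K_i}^{-1}$ for $i=1,\dots,l$. If $e$ is a boundary edge, then (i) holds for every $K\subset\omega_e\setminus\widetilde\omega_e$ and every $K'\subset\widetilde\omega_e$, and the 2-dimensional measure of $\partial\widetilde\omega_e\cap\partial\Omega$ is positive. **Extended patch.** For $K\in\mathcal T_h$ and $e\in\mathcal E_h(K)$, $\omega_e'=\bigcup_{i=1}^lK_i$ denotes the union of the elements of a chosen path as in (B)(i) from $K$ to some element of $\widetilde\omega_e$ (empty if $K\subset\widetilde\omega_e$), and $$\widetilde\omega_{K,e}=K\cup\bigcup_{e\in\mathcal E_h(K)}\omega_e'\cup\bigcup_{e\in\mathcal E_h(K)}\widetilde\omega_e.$$ **Constants.** $C$ may depend on the shape-regularity constant of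 the mesh, but not on $\mu$, $v$, $K$ or $h_K$.
   Formalization: In (B), for a boundary edge e, only the part of ∂ω̃_e∩∂Ω on faces having e as an edge is required to have positive 2-dimensional measure; if any boundary face of ω̃_e is allowed, the estimate fails (fields normal to a face not containing e, cut off near edges). *)

theory Defs
  imports "HOL-Analysis.Analysis"
begin

section \<open>Measure and function spaces\<close>

text \<open>Unnormalised Hausdorff measure of dimension \<open>s > 0\<close>. It is used only to ask whether a
  subset of an edge or of a face is negligible, so the normalising constant is omitted.\<close>

definition hausdorff_measure :: "real \<Rightarrow> 'a::metric_space set \<Rightarrow> ennreal" where
  "hausdorff_measure s A =
     (SUP \<delta>\<in>{0<..}. INF U\<in>{U :: nat \<Rightarrow> 'a set. A \<subseteq> (\<Union>i. U i) \<and>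
         (\<forall>i. bounded (U i) \<and> diameter (U i) \<le> \<delta>)}.
        (\<Sum>i. ennreal (diameter (U i) powr s)))"

definition L2 :: "(real^3) set \<Rightarrow> (real^3 \<Rightarrow> 'b::euclidean_space) set" where
  "L2 U = {f. set_borel_measurable lebesgue U f \<and>
              set_integrable lebesgue U (\<lambda>x. (norm (f x))\<^sup>2)}"

text \<open>On matrices (\<^typ>\<open>real^3^3\<close>) the library norm is the Frobenius norm. The value of
  \<open>L2_norm U f\<close> is the norm of \<open>f\<close> only for \<open>f \<in> L2 U\<close>.\<close>

definition L2_norm :: "(real^3) set \<Rightarrow> (real^3 \<Rightarrow> 'b::euclidean_space) \<Rightarrow> real" where
  "L2_norm U f = sqrt (LINT x:U|lebesgue. (norm (f x))\<^sup>2)"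

primrec C_k :: "nat \<Rightarrow> ('a::real_normed_vector \<Rightarrow> 'b::real_normed_vector) \<Rightarrow> bool" where
  "C_k 0 = (\<lambda>f. continuous_on UNIV f)"
| "C_k (Suc k) = (\<lambda>f. \<exists>f'. (\<forall>x. (f has_derivative f' x) (at x)) \<and> (\<forall>h. C_k k (\<lambda>x. f' x h)))"

definition smooth :: "('a::real_normed_vector \<Rightarrow> 'b::real_normed_vector) \<Rightarrow> bool" where
  "smooth f \<longleftrightarrow> (\<forall>k. C_k k f)"

definition test_function :: "(real^3) set \<Rightarrow> (real^3 \<Rightarrow> 'b::real_normed_vector) \<Rightarrow> bool" where
  "test_function U \<phi> \<longleftrightarrow> smooth \<phi> \<and> compact (closure {x. \<phi> x \<noteq> 0}) \<and> closure {x. \<phi> x \<noteq> 0} \<subseteq> U"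

text \<open>The entry \<open>J $ i $ j\<close> of a Jacobian is the derivative of component \<open>i\<close> in direction \<open>j\<close>.\<close>

definition curl_of_jacobian :: "real^3^3 \<Rightarrow> real^3" where
  "curl_of_jacobian J = vector [J$3$2 - J$2$3, J$1$3 - J$3$1, J$2$1 - J$1$2]"

definition classical_curl :: "(real^3 \<Rightarrow> real^3) \<Rightarrow> real^3 \<Rightarrow> real^3" where
  "classical_curl \<phi> x = curl_of_jacobian (jacobian \<phi> (at x))"

definition has_weak_curl :: "(real^3) set \<Rightarrow> (real^3 \<Rightarrow> real^3) \<Rightarrow> (real^3 \<Rightarrow> real^3) \<Rightarrow> bool" where
  "has_weak_curl U v w \<longleftrightarrow>
     (\<forall>\<phi>. test_function U \<phi> \<longrightarrow>
        (LINT x:U|lebesgue. v x \<bullet> classical_curl \<phi> x) = (LINT x:U|lebesgue. w x \<bullet> \<phi> x))"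

definition has_weak_jacobian :: "(real^3) set \<Rightarrow> (real^3 \<Rightarrow> real^3) \<Rightarrow> (real^3 \<Rightarrow> real^3^3) \<Rightarrow> bool" where
  "has_weak_jacobian U v G \<longleftrightarrow>
     (\<forall>\<psi> :: real^3 \<Rightarrow> real. test_function U \<psi> \<longrightarrow>
        (\<forall>i j. (LINT x:U|lebesgue. v x $ i * frechet_derivative \<psi> (at x) (axis j 1))
               = - (LINT x:U|lebesgue. G x $ i $ j * \<psi> x)))"

definition H_curl :: "(real^3) set \<Rightarrow> (real^3 \<Rightarrow> real^3) set" where
  "H_curl U = {v \<in> L2 U. \<exists>w \<in> L2 U. has_weak_curl U v w}"

definition H1 :: "(real^3) set \<Rightarrow> (real^3 \<Rightarrow> real^3) set" where
  "H1 U = {v \<in> L2 U. \<exists>G \<in> L2 U. has_weak_jacobian U v G}"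

text \<open>For open \<open>U\<close> the next two are determined almost everywhere in \<open>U\<close> whenever \<open>v\<close> lies in
  \<open>H_curl U\<close> and \<open>H1 U\<close>, respectively.\<close>

definition weak_curl :: "(real^3) set \<Rightarrow> (real^3 \<Rightarrow> real^3) \<Rightarrow> real^3 \<Rightarrow> real^3" where
  "weak_curl U v = (SOME w. w \<in> L2 U \<and> has_weak_curl U v w)"

definition weak_jacobian :: "(real^3) set \<Rightarrow> (real^3 \<Rightarrow> real^3) \<Rightarrow> real^3 \<Rightarrow> real^3^3" where
  "weak_jacobian U v = (SOME G. G \<in> L2 U \<and> has_weak_jacobian U v G)"

text \<open>The tangential trace of \<open>v \<in> H_curl \<Omega>\<close> is the functional
  \<open>\<phi> \<mapsto> \<integral>\<^sub>\<Omega> curl v \<bullet> \<phi> - v \<bullet> curl \<phi>\<close> on fields smooth up to the boundary; by Green's formula it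
  is \<open>\<integral> (n \<times> v) \<bullet> \<phi>\<close> over the boundary when \<open>v\<close> is smooth. This is the meaning of \<open>v \<times> n = 0\<close>
  for fields that have no pointwise trace.\<close>

definition tangential_trace ::
    "(real^3) set \<Rightarrow> (real^3 \<Rightarrow> real^3) \<Rightarrow> (real^3 \<Rightarrow> real^3) \<Rightarrow> real" where
  "tangential_trace \<Omega> v \<phi> =
     (LINT x:\<Omega>|lebesgue. weak_curl \<Omega> v x \<bullet> \<phi> x) - (LINT x:\<Omega>|lebesgue. v x \<bullet> classical_curl \<phi> x)"

definition H0_curl :: "(real^3) set \<Rightarrow> (real^3 \<Rightarrow> real^3) set" where
  "H0_curl \<Omega> = {v \<in> H_curl \<Omega>. \<forall>\<phi>. smooth \<phi> \<longrightarrow> tangential_trace \<Omega> v \<phi> = 0}"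

definition PH1 :: "(real^3) set \<Rightarrow> (real^3) set set \<Rightarrow> (real^3 \<Rightarrow> real^3) set" where
  "PH1 U P = {v \<in> L2 U. \<forall>D\<in>P. v \<in> H1 (U \<inter> D)}"

section \<open>Domain and coefficient\<close>

definition polyhedral_domain :: "(real^3) set \<Rightarrow> bool" where
  "polyhedral_domain \<Omega> \<longleftrightarrow> open \<Omega> \<and> connected \<Omega> \<and> bounded \<Omega> \<and> \<Omega> \<noteq> {} \<and>
     (\<exists>F. finite F \<and> (\<forall>S\<in>F. polytope S) \<and> frontier \<Omega> = \<Union>F)"

text \<open>Near each boundary point \<open>\<Omega>\<close> is the epigraph, in some direction \<open>\<nu>\<close>, of a Lipschitz function
  \<open>g\<close> of the projection to the plane orthogonal to \<open>\<nu>\<close>.\<close>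

definition lipschitz_boundary :: "(real^3) set \<Rightarrow> bool" where
  "lipschitz_boundary \<Omega> \<longleftrightarrow>
     (\<forall>x\<in>frontier \<Omega>. \<exists>r>0. \<exists>\<nu> L. \<exists>g :: real^3 \<Rightarrow> real. norm \<nu> = 1 \<and> L-lipschitz_on UNIV g \<and>
        (\<forall>y\<in>ball x r. y \<in> \<Omega> \<longleftrightarrow> g (y - (y \<bullet> \<nu>) *\<^sub>R \<nu>) < y \<bullet> \<nu>))"

definition polyhedral_partition :: "(real^3) set \<Rightarrow> (real^3) set set \<Rightarrow> bool" where
  "polyhedral_partition \<Omega> P \<longleftrightarrow> finite P \<and> (\<forall>D\<in>P. polyhedral_domain D \<and> D \<subseteq> \<Omega>) \<and>
     pairwise disjnt P \<and> closure \<Omega> = (\<Union>D\<in>P. closure D)"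

text \<open>The values of \<open>\<mu>\<close> on the interfaces, a null set, are left arbitrary.\<close>

definition piecewise_constant_pos :: "(real^3) set set \<Rightarrow> (real^3 \<Rightarrow> real) \<Rightarrow> bool" where
  "piecewise_constant_pos P \<mu> \<longleftrightarrow> (\<forall>D\<in>P. \<exists>c>0. \<forall>x\<in>D. \<mu> x = c)"

section \<open>Meshes\<close>

text \<open>Elements are closed tetrahedra; conformity is the library's \<^const>\<open>triangulation\<close>.\<close>

definition fitted_mesh :: "(real^3) set \<Rightarrow> (real^3) set set \<Rightarrow> (real^3) set set \<Rightarrow> bool" where
  "fitted_mesh \<Omega> P T \<longleftrightarrow> triangulation T \<and> (\<forall>K\<in>T. 3 simplex K) \<and> \<Union>T = closure \<Omega> \<and>
     (\<forall>K\<in>T. \<exists>D\<in>P. interior K \<subseteq> D)"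

definition indiameter :: "(real^3) set \<Rightarrow> real" where
  "indiameter K = Sup {2 * r | r. 0 \<le> r \<and> (\<exists>x. cball x r \<subseteq> K)}"

definition shape_regular :: "real \<Rightarrow> (real^3) set set \<Rightarrow> bool" where
  "shape_regular \<sigma> T \<longleftrightarrow> (\<forall>K\<in>T. diameter K \<le> \<sigma> * indiameter K)"

definition coeff_on :: "(real^3 \<Rightarrow> real) \<Rightarrow> (real^3) set \<Rightarrow> real" where
  "coeff_on \<mu> K = (THE c. \<forall>x\<in>interior K. \<mu> x = c)"

definition edges_of :: "(real^3) set \<Rightarrow> (real^3) set set" where
  "edges_of K = {e. e edge_of K}"

definition mesh_edges :: "(real^3) set set \<Rightarrow> (real^3) set set" where
  "mesh_edges T = (\<Union>K\<in>T. edges_of K)"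

definition interior_edge :: "(real^3) set \<Rightarrow> (real^3) set \<Rightarrow> bool" where
  "interior_edge \<Omega> e \<longleftrightarrow> hausdorff_measure 1 (e \<inter> frontier \<Omega>) = 0"

text \<open>Patches are represented by their sets of elements, the patch itself being the union.\<close>

definition edge_patch :: "(real^3) set set \<Rightarrow> (real^3) set \<Rightarrow> (real^3) set set" where
  "edge_patch T e = {K\<in>T. e \<in> edges_of K}"

definition element_patch :: "(real^3) set set \<Rightarrow> (real^3) set \<Rightarrow> (real^3) set set" where
  "element_patch T K = (\<Union>e\<in>edges_of K. edge_patch T e)"

definition max_patch :: "(real^3 \<Rightarrow> real) \<Rightarrow> (real^3) set set \<Rightarrow> (real^3) set \<Rightarrow> (real^3) set set" where
  "max_patch \<mu> T e = {K \<in> edge_patch T e.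
     \<forall>K'\<in>edge_patch T e. inverse (coeff_on \<mu> K') \<le> inverse (coeff_on \<mu> K)}"

section \<open>Quasi-monotonicity\<close>

definition share_face :: "(real^3) set \<Rightarrow> (real^3) set \<Rightarrow> bool" where
  "share_face K K' \<longleftrightarrow> (K \<inter> K') facet_of K \<and> (K \<inter> K') facet_of K'"

definition monotone_path ::
    "(real^3 \<Rightarrow> real) \<Rightarrow> (real^3) set set \<Rightarrow> (real^3) set \<Rightarrow> (real^3) set \<Rightarrow> (real^3) set list \<Rightarrow> bool" where
  "monotone_path \<mu> S K K' Ks \<longleftrightarrow> Ks \<noteq> [] \<and> hd Ks = K \<and> last Ks = K' \<and> set Ks \<subseteq> S \<and>
     successively (\<lambda>A B. share_face A B \<and> inverse (coeff_on \<mu> A) \<le> inverse (coeff_on \<mu> B)) Ks"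

text \<open>The part of \<open>\<partial>\<omega> \<inter> \<partial>\<Omega>\<close> at the edge \<open>e\<close>, where \<open>\<omega>\<close> is the subpatch of maximal \<open>\<mu>\<^sup>-\<^sup>1\<close>: only
  faces having \<open>e\<close> as an edge count. A vanishing tangential trace on a face of \<open>\<omega>\<close> that does not
  contain \<open>e\<close> gives no information on the component of the field along \<open>e\<close>, and
  the interpolation estimates fail if such faces are admitted in the next definition.\<close>

definition boundary_part ::
    "(real^3) set \<Rightarrow> (real^3 \<Rightarrow> real) \<Rightarrow> (real^3) set set \<Rightarrow> (real^3) set \<Rightarrow> (real^3) set" where
  "boundary_part \<Omega> \<mu> T e = frontier (\<Union>(max_patch \<mu> T e)) \<inter> frontier \<Omega> \<inter>
     \<Union>{F. e \<subseteq> F \<and> (\<exists>K\<in>max_patch \<mu> T e. F facet_of K)}"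

definition quasi_monotone :: "(real^3) set \<Rightarrow> (real^3 \<Rightarrow> real) \<Rightarrow> (real^3) set set \<Rightarrow> bool" where
  "quasi_monotone \<Omega> \<mu> T \<longleftrightarrow> (\<forall>e\<in>mesh_edges T.
     if interior_edge \<Omega> e
     then \<forall>K\<in>edge_patch T e. \<forall>K'\<in>max_patch \<mu> T e. \<exists>Ks. monotone_path \<mu> (edge_patch T e) K K' Ks
     else (\<forall>K\<in>edge_patch T e - max_patch \<mu> T e. \<forall>K'\<in>max_patch \<mu> T e.
             \<exists>Ks. monotone_path \<mu> (edge_patch T e) K K' Ks) \<and>
          hausdorff_measure 2 (boundary_part \<Omega> \<mu> T e) > 0)"

text \<open>\<open>chain K e\<close> is the path \<open>K\<^sub>0 = K, \<dots>, K\<^sub>l\<close> chosen for \<open>K\<close> and its edge \<open>e\<close>; the path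
  \<open>[K]\<close> encodes the empty extended patch.\<close>

definition path_choice ::
    "(real^3 \<Rightarrow> real) \<Rightarrow> (real^3) set set \<Rightarrow> ((real^3) set \<Rightarrow> (real^3) set \<Rightarrow> (real^3) set list) \<Rightarrow> bool" where
  "path_choice \<mu> T chain \<longleftrightarrow> (\<forall>K\<in>T. \<forall>e\<in>edges_of K.
     if K \<in> max_patch \<mu> T e then chain K e = [K]
     else \<exists>K'\<in>max_patch \<mu> T e. monotone_path \<mu> (edge_patch T e) K K' (chain K e))"

definition monotone_patch ::
    "(real^3 \<Rightarrow> real) \<Rightarrow> (real^3) set set \<Rightarrow> ((real^3) set \<Rightarrow> (real^3) set \<Rightarrow> (real^3) set list) \<Rightarrow>
     (real^3) set \<Rightarrow> (real^3) set" where
  "monotone_patch \<mu> T chain K =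
     K \<union> (\<Union>e\<in>edges_of K. \<Union>(set (tl (chain K e)))) \<union> (\<Union>e\<in>edges_of K. \<Union>(max_patch \<mu> T e))"

section \<open>Lowest-order Nedelec elements and the interpolation\<close>

definition unit_tangents :: "(real^3) set set \<Rightarrow> ((real^3) set \<Rightarrow> real^3) \<Rightarrow> bool" where
  "unit_tangents T t \<longleftrightarrow> (\<forall>e\<in>mesh_edges T.
     \<exists>a b. a \<noteq> b \<and> e = closed_segment a b \<and> t e = (b - a) /\<^sub>R norm (b - a))"

definition nedelec_local :: "(real^3 \<Rightarrow> real^3) set" where
  "nedelec_local = {q. \<exists>a b. q = (\<lambda>x. a + cross3 b x)}"

text \<open>Fields are functions on the whole space whose values on the faces are irrelevant, so \<open>p|\<^sub>K\<close>
  is the polynomial that agrees with \<open>p\<close> in the interior of \<open>K\<close>.\<close>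

definition elem_restriction :: "(real^3) set \<Rightarrow> (real^3 \<Rightarrow> real^3) \<Rightarrow> real^3 \<Rightarrow> real^3" where
  "elem_restriction K p = (THE q. q \<in> nedelec_local \<and> (\<forall>x\<in>interior K. p x = q x))"

definition ND0 :: "(real^3) set \<Rightarrow> (real^3) set set \<Rightarrow> (real^3 \<Rightarrow> real^3) set" where
  "ND0 \<Omega> T = {p \<in> H_curl \<Omega>. \<forall>K\<in>T. \<exists>q\<in>nedelec_local. \<forall>x\<in>interior K. p x = q x}"

text \<open>\<open>1/|e| \<integral>\<^sub>e f ds\<close>, which in the affine parametrisation of the segment \<open>e\<close> over \<open>[0,1]\<close> (in
  either direction) is the integral of \<open>f\<close> over \<open>[0,1]\<close>.\<close>

definition edge_mean :: "(real^3) set \<Rightarrow> (real^3 \<Rightarrow> real) \<Rightarrow> real" where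
  "edge_mean e f = (let (a, b) = (SOME (a, b). e = closed_segment a b)
                    in integral {0..1} (\<lambda>s. f (linepath a b s)))"

text \<open>The edge moments of a member of \<open>ND0\<close> are taken from each element having the edge;
  they agree by tangential continuity.\<close>

definition nedelec_basis ::
    "(real^3) set \<Rightarrow> (real^3) set set \<Rightarrow> ((real^3) set \<Rightarrow> real^3) \<Rightarrow> ((real^3) set \<Rightarrow> real^3 \<Rightarrow> real^3) \<Rightarrow> bool" where
  "nedelec_basis \<Omega> T t \<phi> \<longleftrightarrow> (\<forall>e\<in>mesh_edges T. \<phi> e \<in> ND0 \<Omega> T \<and>
     (\<forall>e'\<in>mesh_edges T. \<forall>K\<in>edge_patch T e'.
        edge_mean e' (\<lambda>x. elem_restriction K (\<phi> e) x \<bullet> t e') = (if e = e' then 1 else 0)))"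

definition interp_coeff ::
    "(real^3) set \<Rightarrow> (real^3 \<Rightarrow> real) \<Rightarrow> (real^3) set set \<Rightarrow> ((real^3) set \<Rightarrow> real^3) \<Rightarrow>
     (real^3 \<Rightarrow> real^3) \<Rightarrow> (real^3) set \<Rightarrow> real" where
  "interp_coeff \<Omega> \<mu> T t v e =
     (if interior_edge \<Omega> e
      then ((1 / measure lebesgue (\<Union>(max_patch \<mu> T e))) *\<^sub>R
              (LINT x:\<Union>(max_patch \<mu> T e)|lebesgue. v x)) \<bullet> t e
      else 0)"

definition interp ::
    "(real^3) set \<Rightarrow> (real^3 \<Rightarrow> real) \<Rightarrow> (real^3) set set \<Rightarrow> ((real^3) set \<Rightarrow> real^3) \<Rightarrow>
     ((real^3) set \<Rightarrow> real^3 \<Rightarrow> real^3) \<Rightarrow> (real^3 \<Rightarrow> real^3) \<Rightarrow> (real^3) set \<Rightarrow> real^3 \<Rightarrow> real^3" where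
  "interp \<Omega> \<mu> T t \<phi> v K x = (\<Sum>e\<in>edges_of K. interp_coeff \<Omega> \<mu> T t v e *\<^sub>R \<phi> e x)"

definition broken_jacobian :: "(real^3) set set \<Rightarrow> (real^3 \<Rightarrow> real^3) \<Rightarrow> real^3 \<Rightarrow> real^3^3" where
  "broken_jacobian T v x = (\<Sum>K\<in>T. indicator (interior K) x *\<^sub>R weak_jacobian (interior K) v x)"

end

theory Submission
  imports Defs
begin

text \<open>Let \<open>c\<^sub>L\<close> be the mean of \<open>v\<close> over the element \<open>L\<close>. If \<open>L\<close> and \<open>L'\<close> share a face that contains the
  edge \<open>e\<close>, test the curl of \<open>v\<close> on the whole domain with \<open>\<beta> m\<close>, where \<open>\<beta>\<close> is a bump at the centroid
  of the face supported in \<open>L \<union> L'\<close> and \<open>m = t\<^sub>e \<times> n\<close>. Since \<open>\<nabla>\<beta>\<close> integrates over \<open>L\<close> and \<open>L'\<close> to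
  opposite multiples of the face normal \<open>n\<close>, the Poincare inequality turns this identity into
  \<open>\<bar>(c\<^sub>L - c\<^sub>L\<^sub>') \<bullet> t\<^sub>e\<bar> \<bar>e\<bar>\<^sup>1\<^sup>/\<^sup>2 \<le> C (\<parallel>\<nabla>v\<parallel>\<^sub>L + \<parallel>\<nabla>v\<parallel>\<^sub>L\<^sub>')\<close>. On a boundary face the vanishing tangential trace
  gives the same bound for \<open>c\<^sub>L \<bullet> t\<^sub>e\<close> alone.

  Summing along the monotone paths, whose lengths shape regularity bounds and along which
  \<open>\<mu>\<^sup>-\<^sup>1\<close> does not decrease, controls \<open>c\<^sub>K \<bullet> t\<^sub>e - \<alpha>\<^sub>e\<close>. At a boundary edge
  every maximal element must be joined, inside the maximal subpatch, to a maximal element with a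
  boundary face at \<open>e\<close>; this is a parity argument, as an element of the edge patch has at most two
  neighbours there.

  Finally \<open>v - \<Pi>v = (v - c\<^sub>K) + (c\<^sub>K - \<Pi>v)\<close> on \<open>K\<close>, and \<open>c\<^sub>K - \<Pi>v\<close> is a Nedelec polynomial whose edge
  moments are the numbers \<open>c\<^sub>K \<bullet> t\<^sub>e - \<alpha>\<^sub>e\<close>.\<close>

text \<open>No traces on faces are taken. Neighbours are compared through volume integrals against a
  bump field, and the main analytic inequality is Poincare's on a convex set, proved with an
  explicit constant so that it is uniform over all elements. The condition
  \<open>v \<times> n = 0\<close> is available only through \<open>tangential_trace\<close>, whose
  test fields are smooth on the whole space and need not vanish on the boundary; one identity thus
  serves interior and boundary faces. At a boundary face the ball of the bump may reach elements
  that are not neighbours across the face, so a cutoff is needed; it is constant on each element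
  within the ball, and its gradient never has to be estimated. The scale at an edge is its length
  \<open>l\<close>: bumps have radius \<open>l / (8 \<sigma>)\<close>, small enough to avoid the
  other faces of the two elements. The weight enters once: every element visited has a value of
  \<open>\<mu>\<close> at most that of \<open>K\<close>, so its unweighted gradient norm is at most
  \<open>sqrt (coeff_on \<mu> K)\<close> times the weighted norm on the patch. The rest is
  unweighted, with constants that depend on \<open>\<sigma>\<close> only and can be fixed before the
  mesh.\<close>

section \<open>Calculus of smooth functions\<close>

lemma C_k_SucD: "C_k (Suc k) f \<Longrightarrow> C_k k f"
proof (induction k arbitrary: f)
  case 0
  then obtain f' where "\<forall>x. (f has_derivative f' x) (at x)" by auto
  then have "\<And>x. isCont f x" using has_derivative_continuous by blast
  then show ?case by (simp add: continuous_at_imp_continuous_on)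
next
  case (Suc k)
  from Suc.prems obtain f' where "\<forall>x. (f has_derivative f' x) (at x)" "\<forall>h. C_k (Suc k) (\<lambda>x. f' x h)"
    unfolding C_k.simps(2)[of "Suc k"] by blast
  with Suc.IH show ?case unfolding C_k.simps(2)[of k] by blast
qed

lemma C_k_continuous: "C_k k f \<Longrightarrow> continuous_on UNIV f"
  by (induction k) (use C_k_SucD in auto)

lemma C_k_SucI:
  assumes "\<And>x. (f has_derivative f' x) (at x)" "\<And>h. C_k k (\<lambda>x. f' x h)"
  shows "C_k (Suc k) f"
  using assms by auto

lemma C_k_const: "C_k k (\<lambda>x. c)"
proof (induction k arbitrary: c)
  case (Suc k)
  show ?case by (rule C_k_SucI[where f'="\<lambda>x h. 0"]) (auto simp: Suc)
qed auto

lemma C_k_bounded_linear: "bounded_linear f \<Longrightarrow> C_k k f"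
proof (induction k)
  case 0
  then show ?case by (simp add: linear_continuous_on)
next
  case (Suc k)
  show ?case by (rule C_k_SucI[where f'="\<lambda>x. f"])
      (auto simp: C_k_const Suc bounded_linear_imp_has_derivative)
qed

lemma C_k_add: "C_k k f \<Longrightarrow> C_k k g \<Longrightarrow> C_k k (\<lambda>x. f x + g x)"
proof (induction k arbitrary: f g)
  case 0
  then show ?case by (auto intro: continuous_intros)
next
  case (Suc k)
  from Suc.prems obtain f' g' where "\<And>x. (f has_derivative f' x) (at x)" "\<And>h. C_k k (\<lambda>x. f' x h)"
     "\<And>x. (g has_derivative g' x) (at x)" "\<And>h. C_k k (\<lambda>x. g' x h)" by auto
  then show ?case by (intro C_k_SucI[where f'="\<lambda>x h. f' x h + g' x h"]) (auto intro: has_derivative_add Suc.IH)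
qed

lemma C_k_bilinear:
  assumes "bounded_bilinear b"
  shows "C_k k f \<Longrightarrow> C_k k g \<Longrightarrow> C_k k (\<lambda>x. b (f x) (g x))"
proof (induction k arbitrary: f g)
  case 0
  then show ?case using bounded_bilinear.continuous_on[OF assms] by auto
next
  case (Suc k)
  from Suc.prems obtain f' g' where 1: "\<And>x. (f has_derivative f' x) (at x)" "\<And>h. C_k k (\<lambda>x. f' x h)"
     "\<And>x. (g has_derivative g' x) (at x)" "\<And>h. C_k k (\<lambda>x. g' x h)" by auto
  have 2: "C_k k f" "C_k k g" using Suc.prems C_k_SucD by blast+
  show ?case
  proof (rule C_k_SucI)
    show "((\<lambda>x. b (f x) (g x)) has_derivative (\<lambda>h. b (f x) (g' x h) + b (f' x h) (g x))) (at x)" for x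
      by (rule bounded_bilinear.FDERIV[OF assms 1(1,3)])
    show "C_k k (\<lambda>x. b (f x) (g' x h) + b (f' x h) (g x))" for h
      by (rule C_k_add[OF Suc.IH[OF 2(1) 1(4)] Suc.IH[OF 1(2) 2(2)]])
  qed
qed

lemmas C_k_mult = C_k_bilinear[OF bounded_bilinear_mult]

lemma C_k_compose_linear:
  assumes "bounded_linear L"
  shows "C_k k f \<Longrightarrow> C_k k (\<lambda>x. f (c + L x))"
proof (induction k arbitrary: f)
  case 0
  then show ?case
    using continuous_on_compose2[of UNIV f UNIV "\<lambda>x. c + L x"]
      continuous_on_add[OF continuous_on_const linear_continuous_on[OF assms]]
    by auto
next
  case (Suc k)
  from Suc.prems obtain f' where 1: "\<And>x. (f has_derivative f' x) (at x)" "\<And>h. C_k k (\<lambda>x. f' x h)" by auto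
  have L: "(L has_derivative L) (at x)" for x using assms by (rule bounded_linear_imp_has_derivative)
  have L': "((\<lambda>x. c + L x) has_derivative L) (at x)" for x
    using has_derivative_add[OF has_derivative_const L, of c] by simp
  have "((\<lambda>x. f (c + L x)) has_derivative (\<lambda>h. f' (c + L x) (L h))) (at x)" for x
    using has_derivative_compose[OF L' 1(1)] by auto
  with 1(2) show ?case
    by (intro C_k_SucI[where f'="\<lambda>x h. f' (c + L x) (L h)"]) (auto intro: Suc.IH)
qed

lemma C_k_compose_real:
  fixes g :: "real \<Rightarrow> real" and q :: "'a::real_normed_vector \<Rightarrow> real"
  shows "C_k k g \<Longrightarrow> C_k k q \<Longrightarrow> C_k k (\<lambda>x. g (q x))"
proof (induction k arbitrary: g)
  case 0
  then show ?case using continuous_on_compose2[of UNIV g UNIV q] by auto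
next
  case (Suc k)
  from Suc.prems obtain g' q' where 1: "\<And>x. (g has_derivative g' x) (at x)" "\<And>h. C_k k (\<lambda>x. g' x h)"
     "\<And>x. (q has_derivative q' x) (at x)" "\<And>h. C_k k (\<lambda>x. q' x h)" by auto
  have q: "C_k k q" using Suc.prems C_k_SucD by blast
  have "((\<lambda>x. g (q x)) has_derivative (\<lambda>h. g' (q x) (q' x h))) (at x)" for x
    using has_derivative_compose[OF 1(3) 1(1)] by auto
  \<comment> \<open>A linear map on the reals is multiplication by its value at 1. This turns the
    chain rule into a product, to which \<open>C_k_mult\<close> applies.\<close>
  moreover have "g' (q x) (q' x h) = q' x h * g' (q x) 1" for x h
    using linear_cmul[OF has_derivative_linear[OF 1(1)], of _ "q' x h" 1] by simp
  ultimately have "((\<lambda>x. g (q x)) has_derivative (\<lambda>h. q' x h * g' (q x) 1)) (at x)" for x by simp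
  then show ?case
    by (rule C_k_SucI) (rule C_k_mult[OF 1(4) Suc.IH[OF 1(2) q]])
qed

lemma C_k_real_SucI:
  fixes f :: "real \<Rightarrow> real"
  assumes "\<And>x. (f has_real_derivative g x) (at x)" "C_k k g"
  shows "C_k (Suc k) f"
proof (rule C_k_SucI[where f'="\<lambda>x h. h * g x"])
  show "(f has_derivative (\<lambda>h. h * g x)) (at x)" for x
    using assms(1)[of x] by (simp add: has_field_derivative_def mult.commute[of _ "g x"])
  show "C_k k (\<lambda>x. h * g x)" for h by (rule C_k_mult[OF C_k_const assms(2)])
qed

lemma smooth_const: "smooth (\<lambda>x. c)"
  by (simp only: smooth_def C_k_const simp_thms)

lemma smooth_linear: "bounded_linear L \<Longrightarrow> smooth L"
  by (simp only: smooth_def C_k_bounded_linear simp_thms)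

lemma smooth_add: "smooth f \<Longrightarrow> smooth g \<Longrightarrow> smooth (\<lambda>x. f x + g x)"
  unfolding smooth_def by (rule allI, rule C_k_add) auto

lemma smooth_bilinear: "bounded_bilinear b \<Longrightarrow> smooth f \<Longrightarrow> smooth g \<Longrightarrow> smooth (\<lambda>x. b (f x) (g x))"
  unfolding smooth_def by (rule allI, rule C_k_bilinear) auto

lemmas smooth_mult = smooth_bilinear[OF bounded_bilinear_mult]
lemmas smooth_scaleR = smooth_bilinear[OF bounded_bilinear_scaleR]
lemmas smooth_inner = smooth_bilinear[OF bounded_bilinear_inner]

lemma smooth_compose_real:
  fixes g :: "real \<Rightarrow> real"
  shows "smooth g \<Longrightarrow> smooth q \<Longrightarrow> smooth (\<lambda>x. g (q x))"
  unfolding smooth_def by (rule allI, rule C_k_compose_real) auto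

lemma smooth_compose_linear:
  "bounded_linear L \<Longrightarrow> smooth f \<Longrightarrow> smooth (\<lambda>x. f (c + L x))"
  unfolding smooth_def by (rule allI, rule C_k_compose_linear) auto

lemma smooth_continuous: "smooth f \<Longrightarrow> continuous_on A f"
  using continuous_on_subset[OF C_k_continuous[of 0 f], of A] unfolding smooth_def by fast

lemma smooth_has_derivative:
  assumes "smooth f" shows "(f has_derivative frechet_derivative f (at x)) (at x)"
proof -
  have "C_k (Suc 0) f" using assms smooth_def by blast
  then have "f differentiable (at x)" unfolding differentiable_def by auto
  then show ?thesis using frechet_derivative_works by blast
qed

lemma smooth_frechet_derivative:
  assumes "smooth f" shows "smooth (\<lambda>x. frechet_derivative f (at x) h)"
  unfolding smooth_def
proof
  fix k
  have "C_k (Suc k) f" using assms smooth_def by blast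
  then obtain f' where f: "\<And>x. (f has_derivative f' x) (at x)" "\<And>h. C_k k (\<lambda>x. f' x h)" by auto
  then have "f' x = frechet_derivative f (at x)" for x
    using frechet_derivative_at by blast
  then show "C_k k (\<lambda>x. frechet_derivative f (at x) h)" using f(2)[of h] by simp
qed

lemma smooth_prod:
  fixes f :: "'i \<Rightarrow> 'a::real_normed_vector \<Rightarrow> real"
  assumes "finite I" "\<And>i. i \<in> I \<Longrightarrow> smooth (f i)"
  shows "smooth (\<lambda>x. \<Prod>i\<in>I. f i x)"
  using assms by (induction I rule: finite_induct) (simp_all add: smooth_const smooth_mult)

section \<open>Bump and step functions\<close>

text \<open>The functions \<open>p(1/x) exp(-1/x)\<close>, extended by zero. The polynomial
  parameter makes the family closed under differentiation, so that smoothness of the standard bump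
  profile is one induction over all members at once.\<close>

definition flat :: "real poly \<Rightarrow> real \<Rightarrow> real" where
  "flat p x = (if x > 0 then poly p (inverse x) * exp (- inverse x) else 0)"

lemma poly_exp_decay: "((\<lambda>y::real. poly p y * exp (-y)) \<longlongrightarrow> 0) at_top"
proof (induction p)
  case 0
  then show ?case by simp
next
  case (pCons a p)
  have *: "((\<lambda>y::real. y * exp (-y) :: real) \<longlongrightarrow> 0) at_top"
    using tendsto_power_div_exp_0[of 1] by (simp add: exp_minus field_simps)
  have "((\<lambda>y::real. exp (-y) :: real) \<longlongrightarrow> 0) at_top"
    using tendsto_power_div_exp_0[of 0] by (simp add: exp_minus field_simps)
  then have 1: "((\<lambda>y::real. a * exp (-y) :: real) \<longlongrightarrow> 0) at_top"
    using tendsto_mult_right_zero by blast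
  have h: "((\<lambda>y. poly q y * exp (- y)) \<longlongrightarrow> 0) at_top" if "degree q \<le> n" for q :: "real poly" and n
  proof -
    have "((\<lambda>y::real. coeff q i * (y ^ i * exp (- y))) \<longlongrightarrow> 0) at_top" for i
      using tendsto_mult_right_zero[OF tendsto_power_div_exp_0[of i]] by (simp add: exp_minus field_simps)
    then have "((\<lambda>y::real. \<Sum>i\<le>degree q. coeff q i * (y ^ i * exp (- y))) \<longlongrightarrow> 0) at_top"
      by (rule tendsto_null_sum)
    then show ?thesis by (simp add: poly_altdef sum_distrib_right mult.assoc)
  qed
  show ?case by (rule h[OF order_refl])
qed

text \<open>For \<open>x > 0\<close> and \<open>y = 1/x\<close> the chain rule multiplies
  \<open>p - p'\<close> by \<open>y^2\<close>, which is the factor \<open>[:0,0,1:]\<close>. At 0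
  the right difference quotient is \<open>y p(y) exp(-y)\<close> with \<open>y\<close> tending to
  infinity, so it vanishes by \<open>poly_exp_decay\<close>.\<close>

lemma flat_deriv:
  "(flat p has_real_derivative flat ([:0,0,1:] * (p - pderiv p)) x) (at x)"
proof -
  consider "x > 0" | "x < 0" | "x = 0" by linarith
  then show ?thesis
  proof cases
    case 1
    have "((\<lambda>x. poly p (inverse x) * exp (- inverse x)) has_real_derivative
        poly ([:0,0,1:] * (p - pderiv p)) (inverse x) * exp (- inverse x)) (at x)"
      using 1 by (auto intro!: derivative_eq_intros poly_DERIV[THEN DERIV_chain2]
          simp: power2_eq_square algebra_simps)
    then show ?thesis
      using 1 by (auto intro: has_field_derivative_transform_within_open[where S="{0<..}"] simp: flat_def)
  next
    case 2
    have "((\<lambda>x. 0) has_real_derivative 0) (at x)" by simp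
    then have "(flat p has_real_derivative 0) (at x)"
      by (rule has_field_derivative_transform_within_open[where S="{..<0}"])
         (use 2 in \<open>auto simp: flat_def\<close>)
    then show ?thesis using 2 by (simp add: flat_def)
  next
    case 3
    have "((\<lambda>h. poly [:0,1:] (inverse h) * poly p (inverse h) * exp (- inverse h)) \<longlongrightarrow> 0) (at_right (0::real))"
      using filterlim_compose[OF poly_exp_decay[of "[:0,1:] * p"] filterlim_inverse_at_top_right] by simp
    then have "((\<lambda>h. flat p h / h) \<longlongrightarrow> 0) (at_right 0)"
      by (rule Lim_transform_eventually)
         (auto simp: eventually_at flat_def field_simps intro!: exI[of _ 1])
    moreover have "((\<lambda>h. flat p h / h) \<longlongrightarrow> 0) (at_left 0)"
      by (rule Lim_transform_eventually[OF tendsto_const])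
         (auto simp: eventually_at flat_def intro!: exI[of _ 1])
    ultimately have "((\<lambda>h. flat p h / h) \<longlongrightarrow> 0) (at 0)"
      using filterlim_split_at by blast
    then show ?thesis using 3 by (simp add: DERIV_def flat_def)
  qed
qed

lemma smooth_flat: "smooth (flat p)"
proof -
  have "C_k k (flat p)" for k
  proof (induction k arbitrary: p)
    case 0
    have "isCont (flat p) x" for x by (rule DERIV_isCont[OF flat_deriv])
    then show ?case by (simp add: continuous_at_imp_continuous_on)
  next
    case (Suc k)
    then show ?case using C_k_real_SucI[OF flat_deriv] by blast
  qed
  then show ?thesis by (simp add: smooth_def)
qed

definition flat_exp :: "real \<Rightarrow> real" where "flat_exp = flat 1"
definition flat_exp' :: "real \<Rightarrow> real" where "flat_exp' = flat [:0,0,1:]"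

lemma flat_exp_deriv: "(flat_exp has_real_derivative flat_exp' x) (at x)"
  using flat_deriv[of 1 x] by (simp add: flat_exp_def flat_exp'_def)

lemma smooth_flat_exp: "smooth flat_exp" and smooth_flat_exp': "smooth flat_exp'"
  by (simp_all add: flat_exp_def flat_exp'_def smooth_flat)

lemma flat_exp_0: "x \<le> 0 \<Longrightarrow> flat_exp x = 0" "x \<le> 0 \<Longrightarrow> flat_exp' x = 0"
  by (auto simp: flat_exp_def flat_exp'_def flat_def)

lemma flat_exp_pos: "x > 0 \<Longrightarrow> flat_exp x > 0"
  by (auto simp: flat_exp_def flat_def)

lemma flat_exp_bounds: "0 \<le> flat_exp x" "flat_exp x \<le> 1" "0 \<le> flat_exp' x" "flat_exp' x \<le> 2"
proof -
  show "0 \<le> flat_exp x" "flat_exp x \<le> 1" "0 \<le> flat_exp' x"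
    by (auto simp: flat_exp_def flat_exp'_def flat_def)
  show "flat_exp' x \<le> 2"
  proof (cases "x > 0")
    case True
    define y where "y = inverse x"
    have "y > 0" using True by (simp add: y_def)
    then have "1 + y + y\<^sup>2 / 2 \<le> exp y" using exp_lower_Taylor_quadratic by simp
    then have "y * y \<le> 2 * exp y" using \<open>y > 0\<close> by (simp add: power2_eq_square)
    then have "y * y * exp (-y) \<le> 2" by (simp add: exp_minus field_simps)
    then show ?thesis using True by (simp add: flat_exp'_def flat_def y_def)
  qed (auto simp: flat_exp'_def flat_def)
qed

text \<open>The end point \<open>7/16 = 1 - (3/4)^2\<close> is the argument of the bump profile at
  distance \<open>3/4 \<rho>\<close> from the centre; \<open>bump_halfspace\<close> needs a lower
  bound for the slope up to that distance.\<close>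

lemma flat_exp'_ge: "7/16 \<le> x \<Longrightarrow> x \<le> 1 \<Longrightarrow> exp (-16/7) \<le> flat_exp' x"
proof -
  assume x: "7/16 \<le> x" "x \<le> 1"
  have i: "inverse x \<ge> 1" "inverse x \<le> 16/7" using x
    by (auto simp: field_simps)
  then have "exp (-16/7) \<le> exp (- inverse x)" by simp
  also have "\<dots> \<le> (inverse x * inverse x) * exp (- inverse x)"
    using mult_mono[OF i(1) i(1)] i x by (simp add: mult_le_cancel_right1)
  also have "\<dots> = flat_exp' x" using x by (simp add: flat_exp'_def flat_def)
  finally show ?thesis .
qed

text \<open>The normalised primitive of \<open>flat_exp u * flat_exp (1 - u)\<close>, a smooth
  function that is positive exactly on the open unit interval.\<close>

lemma smooth_step_exists:
  obtains s :: "real \<Rightarrow> real" where "smooth s" "\<And>x. x \<le> 0 \<Longrightarrow> s x = 0" "\<And>x. x \<ge> 1 \<Longrightarrow> s x = 1"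
    "\<And>x. 0 \<le> s x" "\<And>x. s x \<le> 1"
proof -
  define g where "g u = flat_exp u * flat_exp (1 - u)" for u
  have sm: "smooth g" unfolding g_def
    using smooth_mult[OF smooth_flat_exp, of "\<lambda>u. flat_exp (1 - u)"]
      smooth_compose_linear[OF _ smooth_flat_exp, of uminus 1] by (simp add: bounded_linear_minus[OF bounded_linear_ident])
  have g0: "0 \<le> g u" for u by (simp add: g_def flat_exp_bounds)
  have gc: "continuous_on A g" for A using sm smooth_continuous by blast
  have gi: "g integrable_on {a..b}" for a b using integrable_continuous_interval gc by blast
  define I where "I x = integral {-1..x} g" for x
  have dI: "(I has_real_derivative g x) (at x)" for x
  proof -
    \<comment> \<open>The fundamental theorem is applied on \<open>{-y..y}\<close>, which has both
      \<open>x\<close> and -1 in its interior. Moving the base point from \<open>-y\<close> to -1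
      changes the primitive by a constant only.\<close>
    define y where "y = \<bar>x\<bar> + 2"
    have *: "((\<lambda>x. integral {-y..x} g) has_vector_derivative g x) (at x within {-y..y})"
      by (rule integral_has_vector_derivative) (auto simp: gc y_def)
    have "at x within {-y..y} = at x" by (rule at_within_interior) (auto simp: y_def)
    then have "((\<lambda>x. integral {-y..x} g) has_real_derivative g x) (at x)"
      using * by (simp add: has_real_derivative_iff_has_vector_derivative)
    then have d: "((\<lambda>x. integral {-y..x} g - integral {-y..-1} g) has_real_derivative g x) (at x)"
      using DERIV_diff[OF _ DERIV_const] by fastforce
    have e: "I z = integral {-y..z} g - integral {-y..-1} g" if "z > -y" for z
    proof (cases "z \<ge> -1")
      case True
      have "integral {-y..-1} g + integral {-1..z} g = integral {-y..z} g"
        by (rule Henstock_Kurzweil_Integration.integral_combine) (use True gi in \<open>auto simp: y_def\<close>)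
      then show ?thesis by (simp add: I_def)
    next
      case False
      have "integral {a..b} g = 0" if "b \<le> 0" for a b
      proof -
        have "integral {a..b} g = integral {a..b} (\<lambda>x. 0)"
          by (rule integral_cong) (use that in \<open>auto simp: g_def flat_exp_0\<close>)
        then show ?thesis by simp
      qed
      then show ?thesis using False by (simp add: I_def)
    qed
    show ?thesis
      by (rule has_field_derivative_transform_within_open[OF d, where S="{-y<..}"])
         (use e in \<open>auto simp: y_def\<close>)
  qed
  have I0: "I x = 0" if "x \<le> 0" for x
  proof -
    have "I x = integral {-1..x} (\<lambda>x. 0)" unfolding I_def
      by (rule integral_cong) (use that in \<open>auto simp: g_def flat_exp_0\<close>)
    then show ?thesis by simp
  qed
  have mono: "I x \<le> I y" if "x \<le> y" for x y
    by (rule DERIV_nonneg_imp_nondecreasing[OF that]) (use dI g0 in blast)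
  have g1: "g z = 0" if "z > 1" for z using that by (simp add: g_def flat_exp_0)
  have I1: "I x = I 1" if "1 \<le> x" for x
  proof (cases "x = 1")
    case False
    then have "1 < x" using that by simp
    show ?thesis
    proof (rule DERIV_isconst_end[OF \<open>1 < x\<close>])
      show "continuous_on {1..x} I" by (intro continuous_at_imp_continuous_on ballI DERIV_isCont[OF dI])
      show "\<And>z. 1 < z \<Longrightarrow> z < x \<Longrightarrow> DERIV I z :> 0"
        using dI g1 by metis
    qed
  qed simp
  have pos: "I 1 > 0"
  proof -
    have "I (1/4) < I (3/4)"
    proof (rule DERIV_pos_imp_increasing[where f=I])
      fix x :: real assume *: "1/4 \<le> x" "x \<le> 3/4"
      then have "0 < g x" unfolding g_def by (intro mult_pos_pos flat_exp_pos) auto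
      then show "\<exists>y. DERIV I x :> y \<and> 0 < y" using dI by blast
    qed simp
    moreover have "I (1/4) \<ge> I 0" "I 1 \<ge> I (3/4)" using mono by auto
    ultimately show ?thesis using I0[of 0] by simp
  qed
  have smI: "smooth I" unfolding smooth_def
  proof
    fix k show "C_k k I"
      using C_k_real_SucI[OF dI, of k] sm C_k_SucD unfolding smooth_def by blast
  qed
  show thesis
  proof (rule that[of "\<lambda>x. (1 / I 1) * I x"])
    show "smooth (\<lambda>x. (1 / I 1) * I x)" by (rule smooth_mult[OF smooth_const smI])
    show "x \<le> 0 \<Longrightarrow> 1 / I 1 * I x = 0" for x by (simp add: I0)
    show "1 \<le> x \<Longrightarrow> 1 / I 1 * I x = 1" for x using I1[of x] pos by simp
    have "0 \<le> I x \<and> I x \<le> I 1" for x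
      using mono[of 0 x] mono[of x 1] I0[of 0] I0[of x] I1[of x] pos by (cases "x \<le> 0"; cases "x \<le> 1") auto
    then show "0 \<le> 1 / I 1 * I x" "1 / I 1 * I x \<le> 1" for x using pos by (auto simp: field_simps)
  qed
qed

section \<open>Averages of a test function along a segment\<close>

lemma has_derivative_integral_segment:
  fixes \<psi> :: "'a::euclidean_space \<Rightarrow> real"
  assumes d: "\<And>x. (\<psi> has_derivative \<psi>' x) (at x)" and c\<psi>': "\<And>h. continuous_on UNIV (\<lambda>x. \<psi>' x h)"
  shows "((\<lambda>z. integral {0..1} (\<lambda>t. \<psi> (z - t *\<^sub>R d))) has_derivative
       (\<lambda>h. integral {0..1} (\<lambda>t. \<psi>' (z - t *\<^sub>R d) h))) (at z)"
proof -
  have bl: "bounded_linear (\<psi>' x)" for x using d has_derivative_bounded_linear by blast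
  \<comment> \<open>\<open>leibniz_rule\<close> takes the derivative of the integrand as a bounded
    linear function object, so \<open>\<psi>'\<close> is packed by \<open>Blinfun\<close>; joint
    continuity is then checked on basis vectors.\<close>
  define fx where "fx z t = Blinfun (\<psi>' (z - t *\<^sub>R d))" for z t
  have fxa: "blinfun_apply (fx z t) = \<psi>' (z - t *\<^sub>R d)" for z t
    unfolding fx_def by (rule bounded_linear_Blinfun_apply[OF bl])
  have c\<psi>: "continuous_on UNIV \<psi>"
    by (rule continuous_at_imp_continuous_on) (use d has_derivative_continuous in blast)
  have cfx: "continuous_on (UNIV \<times> cbox 0 (1::real)) (\<lambda>(z, t). fx z t)"
    unfolding case_prod_unfold
  proof (rule continuous_on_blinfun_componentwise)
    fix i :: 'a
    show "continuous_on (UNIV \<times> cbox 0 (1::real)) (\<lambda>x. blinfun_apply (fx (fst x) (snd x)) i)"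
      unfolding fxa by (rule continuous_on_compose2[OF c\<psi>'[of i]]) (auto intro!: continuous_intros)
  qed
  have cfx1: "continuous_on (cbox 0 1) (fx z)" for z
  proof -
    have "continuous_on (cbox 0 1) (\<lambda>t. (\<lambda>(z, t). fx z t) (z, t))"
      by (rule continuous_on_compose2[OF cfx]) (auto intro!: continuous_intros)
    then show ?thesis by simp
  qed
  have der: "((\<lambda>z. integral (cbox 0 1) (\<lambda>t. \<psi> (z - t *\<^sub>R d))) has_derivative
      blinfun_apply (integral (cbox 0 (1::real)) (fx z))) (at z within UNIV)" for z
  proof (rule leibniz_rule)
    show "((\<lambda>x. \<psi> (x - t *\<^sub>R d)) has_derivative blinfun_apply (fx x t)) (at x within UNIV)" for x t
    proof -
      have "((\<lambda>x. x - t *\<^sub>R d) has_derivative (\<lambda>h. h)) (at x)"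
        by (auto intro!: derivative_eq_intros)
      from has_derivative_compose[OF this d] show ?thesis by (simp add: fxa)
    qed
    show "(\<lambda>t. \<psi> (x - t *\<^sub>R d)) integrable_on cbox 0 1" for x
      by (rule integrable_continuous) (auto intro!: continuous_intros continuous_on_compose2[OF c\<psi>])
  qed (use cfx in auto)
  have ap: "blinfun_apply (integral (cbox 0 (1::real)) (fx z)) h = integral {0..1} (\<lambda>t. \<psi>' (z - t *\<^sub>R d) h)" for z h
  proof -
    have "integral (cbox 0 1) ((\<lambda>f. blinfun_apply f h) \<circ> fx z) = blinfun_apply (integral (cbox 0 1) (fx z)) h"
      by (rule integral_linear[OF integrable_continuous[OF cfx1]]) (rule blinfun.bounded_linear_left)
    then show ?thesis by (simp add: comp_def fxa)
  qed
  show ?thesis using der[of z] unfolding ap by simp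
qed

lemma C_k_integral_segment:
  fixes \<psi> :: "'a::euclidean_space \<Rightarrow> real"
  shows "C_k k \<psi> \<Longrightarrow> C_k k (\<lambda>z. integral {0..1} (\<lambda>t. \<psi> (z - t *\<^sub>R d)))"
proof (induction k arbitrary: \<psi>)
  case 0
  then have "continuous_on (UNIV \<times> cbox 0 (1::real)) (\<lambda>(z, t). \<psi> (z - t *\<^sub>R d))"
    by (auto simp: case_prod_unfold intro!: continuous_intros continuous_on_compose2[of UNIV \<psi>])
  then show ?case using integral_continuous_on_param by fastforce
next
  case (Suc k)
  from Suc.prems obtain \<psi>' where d: "\<And>x. (\<psi> has_derivative \<psi>' x) (at x)" and ck: "\<And>h. C_k k (\<lambda>x. \<psi>' x h)" by auto
  show ?case
  proof (rule C_k_SucI)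
    show "((\<lambda>z. integral {0..1} (\<lambda>t. \<psi> (z - t *\<^sub>R d))) has_derivative
       (\<lambda>h. integral {0..1} (\<lambda>t. \<psi>' (z - t *\<^sub>R d) h))) (at z)" for z
      by (rule has_derivative_integral_segment[OF d C_k_continuous[OF ck]])
    show "C_k k (\<lambda>z. integral {0..1} (\<lambda>t. \<psi>' (z - t *\<^sub>R d) h))" for h
      by (rule Suc.IH[OF ck])
  qed
qed

section \<open>Test functions\<close>

lemma test_function_bounded:
  fixes \<psi> :: "real^3 \<Rightarrow> 'b::real_normed_vector"
  assumes "test_function U \<psi>" obtains B where "\<And>x. norm (\<psi> x) \<le> B"
proof -
  let ?S = "closure {x. \<psi> x \<noteq> 0}"
  have "compact (\<psi> ` ?S)" using assms unfolding test_function_def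
    by (intro compact_continuous_image smooth_continuous) auto
  then obtain B where B: "\<And>y. y \<in> \<psi> ` ?S \<Longrightarrow> norm y \<le> B"
    using compact_imp_bounded bounded_iff by metis
  have "norm (\<psi> x) \<le> max B 0" for x
  proof (cases "\<psi> x = 0")
    case False
    then have "x \<in> ?S" using closure_subset by fast
    then show ?thesis using B by fastforce
  qed simp
  then show thesis using that by blast
qed

lemma test_function_zero: "test_function U \<psi> \<Longrightarrow> x \<notin> U \<Longrightarrow> \<psi> x = 0"
  unfolding test_function_def using closure_subset[of "{x. \<psi> x \<noteq> 0}"] by auto

lemma test_functionI:
  assumes "smooth \<psi>" "compact S" "S \<subseteq> U" "\<And>x. x \<notin> S \<Longrightarrow> \<psi> x = 0"
  shows "test_function U \<psi>"
proof -
  have "closure {x. \<psi> x \<noteq> 0} \<subseteq> S"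
    by (rule closure_minimal) (use assms compact_imp_closed in auto)
  moreover have "bounded {x. \<psi> x \<noteq> 0}"
    by (rule bounded_subset[OF compact_imp_bounded[OF assms(2)]]) (use assms(4) in auto)
  then have "compact (closure {x. \<psi> x \<noteq> 0})" by simp
  ultimately show ?thesis using assms unfolding test_function_def by blast
qed

lemma test_function_mono: "test_function U \<psi> \<Longrightarrow> U \<subseteq> W \<Longrightarrow> test_function W \<psi>"
  unfolding test_function_def by auto

lemma test_function_frechet:
  fixes \<psi> :: "real^3 \<Rightarrow> 'b::real_normed_vector"
  assumes "test_function U \<psi>" shows "test_function U (\<lambda>x. frechet_derivative \<psi> (at x) h)"
proof (rule test_functionI)
  let ?S = "closure {x. \<psi> x \<noteq> 0}"
  show "smooth (\<lambda>x. frechet_derivative \<psi> (at x) h)"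
    using assms smooth_frechet_derivative test_function_def by blast
  show "compact ?S" "?S \<subseteq> U" using assms by (auto simp: test_function_def)
  fix x assume x: "x \<notin> ?S"
  have "((\<lambda>x. 0) has_derivative (\<lambda>h. 0)) (at x)" by simp
  then have "(\<psi> has_derivative (\<lambda>h. 0)) (at x)"
  proof (rule has_derivative_transform_within_open)
    show "open (- ?S)" "x \<in> - ?S" using x by auto
    show "\<And>y. y \<in> - ?S \<Longrightarrow> 0 = \<psi> y" using closure_subset[of "{x. \<psi> x \<noteq> 0}"] by auto
  qed
  then show "frechet_derivative \<psi> (at x) h = 0" by (simp add: frechet_derivative_at[symmetric])
qed

lemma test_function_scaleR:
  assumes "test_function U \<psi>" shows "test_function U (\<lambda>x. \<psi> x *\<^sub>R (m::'b::real_normed_vector))"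
proof (rule test_functionI)
  show "smooth (\<lambda>x. \<psi> x *\<^sub>R m)" by (rule smooth_scaleR[OF _ smooth_const]) (use assms test_function_def in blast)
  show "\<And>x. x \<notin> closure {x. \<psi> x \<noteq> 0} \<Longrightarrow> \<psi> x *\<^sub>R m = 0"
    using closure_subset[of "{x. \<psi> x \<noteq> 0}"] by auto
qed (use assms in \<open>auto simp: test_function_def\<close>)

lemma test_function_mult:
  fixes p \<psi> :: "real^3 \<Rightarrow> real"
  assumes "test_function U \<psi>" "smooth p" shows "test_function U (\<lambda>x. p x * \<psi> x)"
proof (rule test_functionI)
  show "smooth (\<lambda>x. p x * \<psi> x)" by (rule smooth_mult) (use assms test_function_def in auto)
  show "\<And>x. x \<notin> closure {x. \<psi> x \<noteq> 0} \<Longrightarrow> p x * \<psi> x = 0"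
    using closure_subset[of "{x. \<psi> x \<noteq> 0}"] by auto
qed (use assms in \<open>auto simp: test_function_def\<close>)

lemma smooth_borel: "smooth (f :: 'a::euclidean_space \<Rightarrow> 'b::real_normed_vector) \<Longrightarrow> f \<in> borel_measurable borel"
  by (rule borel_measurable_continuous_onI) (rule smooth_continuous)

lemma smooth_lebesgue: "smooth (f :: 'a::euclidean_space \<Rightarrow> 'b::real_normed_vector) \<Longrightarrow> f \<in> borel_measurable lebesgue"
  by (rule measurable_completion) (simp add: smooth_borel)

lemma set_integrable_mult_test:
  fixes f \<psi> :: "real^3 \<Rightarrow> real"
  assumes f: "set_integrable lebesgue U f" and "test_function W \<psi>"
  shows "set_integrable lebesgue U (\<lambda>x. f x * \<psi> x)"
proof -
  obtain B where B: "\<And>x. norm (\<psi> x) \<le> B" using test_function_bounded assms(2) by blast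
  have [measurable]: "\<psi> \<in> borel_measurable lebesgue"
    using assms(2) smooth_lebesgue test_function_def by blast
  have "integrable lebesgue (\<lambda>x. (indicator U x *\<^sub>R f x) * \<psi> x)"
  proof (rule Bochner_Integration.integrable_bound)
    show "integrable lebesgue (\<lambda>x. B * (indicator U x *\<^sub>R f x))" using f by (simp add: set_integrable_def)
    show "(\<lambda>x. (indicator U x *\<^sub>R f x) * \<psi> x) \<in> borel_measurable lebesgue"
      using f[unfolded set_integrable_def, THEN borel_measurable_integrable] by measurable
    have "0 \<le> B" using B[of 0] norm_ge_zero order_trans by blast
    then show "AE x in lebesgue. norm (indicator U x *\<^sub>R f x * \<psi> x) \<le> norm (B * (indicator U x *\<^sub>R f x))"
      using B by (auto simp: abs_mult mult.commute[of B] intro!: mult_left_mono split: split_indicator)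
  qed
  then show ?thesis by (simp add: set_integrable_def mult.assoc)
qed

section \<open>The fundamental lemma of the calculus of variations\<close>

text \<open>The test functions are products over the coordinates of two smooth steps, steepened by
  the factor \<open>n\<close>. They vanish off the open box, stay between 0 and 1 and converge
  pointwise to its indicator, so dominated convergence applies. The closed box has to lie in
  \<open>U\<close> because it carries the supports.\<close>

lemma box_integral_zero:
  fixes f :: "real^3 \<Rightarrow> real"
  assumes f: "set_integrable lebesgue U f" and U: "cbox a b \<subseteq> U"
    and z: "\<And>\<psi>. test_function U \<psi> \<Longrightarrow> (LINT x:U|lebesgue. f x * \<psi> x) = 0"
  shows "(LINT x:box a b|lebesgue. f x) = 0"
proof -
  obtain s :: "real \<Rightarrow> real" where s: "smooth s" "\<And>x. x \<le> 0 \<Longrightarrow> s x = 0" "\<And>x. x \<ge> 1 \<Longrightarrow> s x = 1"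
    "\<And>x. 0 \<le> s x" "\<And>x. s x \<le> 1" using smooth_step_exists by blast
  define \<phi> where "\<phi> n x = (\<Prod>i\<in>Basis. s (- real n * (a \<bullet> i) + (real n *\<^sub>R i) \<bullet> x) * s (real n * (b \<bullet> i) + (- real n *\<^sub>R i) \<bullet> x))"
    for n and x :: "real^3"
  have sm: "smooth (\<phi> n)" for n
    unfolding \<phi>_def
  proof (rule smooth_prod, simp, rule smooth_mult)
    fix i :: "real^3"
    have bl: "bounded_linear (\<lambda>x::real^3. c \<bullet> x)" for c by (rule bounded_linear_inner_right)
    have "smooth (\<lambda>x::real^3. k + c \<bullet> x)" for k c
      using smooth_add[OF smooth_const[of k] smooth_linear[OF bl[of c]]] by simp
    note this[THEN smooth_compose_real[OF s(1)]]
    then show "smooth (\<lambda>x. s (- real n * (a \<bullet> i) + (real n *\<^sub>R i) \<bullet> x))"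
      "smooth (\<lambda>x. s (real n * (b \<bullet> i) + (- real n *\<^sub>R i) \<bullet> x))" by blast+
  qed
  have out: "\<phi> n x = 0" if "x \<notin> box a b" for n x
  proof -
    from that obtain i where i: "i \<in> Basis" "\<not> (a \<bullet> i < x \<bullet> i) \<or> \<not> (x \<bullet> i < b \<bullet> i)" by (auto simp: mem_box)
    have "s (- real n * (a \<bullet> i) + (real n *\<^sub>R i) \<bullet> x) * s (real n * (b \<bullet> i) + (- real n *\<^sub>R i) \<bullet> x) = 0"
    proof -
      have "real n * (x \<bullet> i) \<le> real n * (a \<bullet> i) \<or> real n * (b \<bullet> i) \<le> real n * (x \<bullet> i)"
        using i by (auto intro: mult_left_mono)
      then show ?thesis by (auto simp: inner_commute s)
    qed
    then show ?thesis unfolding \<phi>_def using i(1) by (intro prod_zero) auto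
  qed
  have le1: "0 \<le> \<phi> n x \<and> \<phi> n x \<le> 1" for n x
    unfolding \<phi>_def using s(4,5) by (auto intro!: prod_nonneg prod_le_1 mult_le_one)
  have tf: "test_function U (\<phi> n)" for n
    by (rule test_functionI[OF sm compact_cbox U]) (use out box_subset_cbox in blast)
  have lim: "(\<lambda>n. \<phi> n x) \<longlonglongrightarrow> indicator (box a b) x" for x
  proof (cases "x \<in> box a b")
    case True
    have "eventually (\<lambda>n. \<phi> n x = 1) sequentially"
    proof -
      have "eventually (\<lambda>n. \<forall>i\<in>Basis. s (- real n * (a \<bullet> i) + (real n *\<^sub>R i) \<bullet> x) * s (real n * (b \<bullet> i) + (- real n *\<^sub>R i) \<bullet> x) = 1) sequentially"
      proof (rule eventually_ball_finite, simp, rule ballI)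
        fix i :: "real^3" assume i: "i \<in> Basis"
        have ev: "eventually (\<lambda>n. real n * c \<ge> 1) sequentially" if "c > 0" for c
        proof -
          have "filterlim (\<lambda>n. real n * c) at_top sequentially"
            using that filterlim_at_top_mult_tendsto_pos[OF tendsto_const that filterlim_real_sequentially] by simp
          then show ?thesis by (simp add: filterlim_at_top)
        qed
        have p: "x \<bullet> i - a \<bullet> i > 0" "b \<bullet> i - x \<bullet> i > 0" using True i by (auto simp: mem_box)
        show "eventually (\<lambda>n. s (- real n * (a \<bullet> i) + (real n *\<^sub>R i) \<bullet> x) * s (real n * (b \<bullet> i) + (- real n *\<^sub>R i) \<bullet> x) = 1) sequentially"
          using ev[OF p(1)] ev[OF p(2)]
        proof eventually_elim
          case (elim n)
          then show ?case by (subst (1 2) s(3)) (auto simp: inner_commute algebra_simps)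
        qed
      qed
      then show ?thesis by eventually_elim (simp add: \<phi>_def)
    qed
    then show ?thesis using True by (simp add: tendsto_eventually)
  qed (simp add: out)
  have meas: "(\<lambda>x. indicator U x *\<^sub>R f x) \<in> borel_measurable lebesgue"
    using f[unfolded set_integrable_def, THEN borel_measurable_integrable] .
  have "(\<lambda>n. LINT x|lebesgue. (indicator U x *\<^sub>R f x) * \<phi> n x) \<longlonglongrightarrow> (LINT x|lebesgue. (indicator U x *\<^sub>R f x) * indicator (box a b) x)"
  proof (rule integral_dominated_convergence)
    show "integrable lebesgue (\<lambda>x. norm (indicator U x *\<^sub>R f x))" using f by (simp add: set_integrable_def)
    show "(\<lambda>x. indicat_real U x *\<^sub>R f x * \<phi> n x) \<in> borel_measurable lebesgue" for n
      by (rule borel_measurable_times[OF meas smooth_lebesgue[OF sm]])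
    show "(\<lambda>x. indicat_real U x *\<^sub>R f x * indicator (box a b) x) \<in> borel_measurable lebesgue"
      by (intro borel_measurable_times meas borel_measurable_indicator) auto
    show "AE x in lebesgue. (\<lambda>i. indicat_real U x *\<^sub>R f x * \<phi> i x) \<longlonglongrightarrow> indicat_real U x *\<^sub>R f x * indicat_real (box a b) x"
      by (intro always_eventually allI tendsto_mult tendsto_const lim)
    show "AE x in lebesgue. norm (indicat_real U x *\<^sub>R f x * \<phi> i x) \<le> norm (indicat_real U x *\<^sub>R f x)" for i
      using le1 by (auto simp: abs_mult mult_left_le)
  qed
  moreover have "(LINT x|lebesgue. (indicator U x *\<^sub>R f x) * \<phi> n x) = 0" for n
    using z[OF tf[of n]] by (simp add: set_lebesgue_integral_def mult.assoc)
  ultimately have "(LINT x|lebesgue. (indicator U x *\<^sub>R f x) * indicator (box a b) x) = 0"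
    by (simp only: LIMSEQ_const_iff)
  moreover have "(indicator U x *\<^sub>R f x) * indicator (box a b) x = indicator (box a b) x *\<^sub>R f x" for x
    using U box_subset_cbox[of a b] by (auto split: split_indicator)
  ultimately show ?thesis by (simp only: set_lebesgue_integral_def)
qed

text \<open>Dynkin's argument: open boxes are an intersection-stable generator of the Borel sets,
  and vanishing integrals pass to complements (by \<open>tot\<close>) and to disjoint unions. A
  Borel representative is used because the generator argument reaches Borel sets only.\<close>

lemma integrable_box_integrals_zero_AE:
  fixes g :: "real^3 \<Rightarrow> real"
  assumes g: "integrable lebesgue g" and z: "\<And>a b. (LINT x:box a b|lebesgue. g x) = 0" and tot: "(LINT x|lebesgue. g x) = 0"
  shows "AE x in lebesgue. g x = 0"
proof -
  have "g \<in> borel_measurable lebesgue" using g by simp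
  then obtain g' where g'[measurable]: "g' \<in> borel_measurable lborel" and ae: "AE x in lborel. g x = g' x"
    using completion_ex_borel_measurable_real by blast
  have ae': "AE x in lebesgue. g x = g' x" using ae by (rule AE_completion)
  have il: "integrable lebesgue g'"
  proof (rule integrable_cong_AE_imp[OF g])
    show "g' \<in> borel_measurable lebesgue" by (rule measurable_completion) (rule g')
    show "AE x in lebesgue. g x = g' x" by (rule ae')
  qed
  then have ig': "integrable lborel g'" by (simp add: integrable_completion)
  have si: "set_integrable lborel A g'" if "A \<in> sets borel" for A
    unfolding set_integrable_def using that by (intro integrable_mult_indicator ig') auto
  have eq: "(LINT x:A|lborel. g' x) = (LINT x:A|lebesgue. g x)" if A: "A \<in> sets borel" for A
  proof -
    have "(LINT x:A|lborel. g' x) = (LINT x|lebesgue. indicator A x *\<^sub>R g' x)"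
      unfolding set_lebesgue_integral_def by (rule integral_completion[symmetric]) (use A in measurable)
    also have "\<dots> = (LINT x|lebesgue. indicator A x *\<^sub>R g x)"
    proof (rule integral_cong_AE)
      show "(\<lambda>x. indicator A x *\<^sub>R g' x) \<in> borel_measurable lebesgue"
        using il A by (intro borel_measurable_scaleR borel_measurable_indicator) auto
      show "(\<lambda>x. indicator A x *\<^sub>R g x) \<in> borel_measurable lebesgue"
        using g A by (intro borel_measurable_scaleR borel_measurable_indicator) auto
    qed (use ae' in auto)
    finally show ?thesis by (simp add: set_lebesgue_integral_def)
  qed
  have tot': "(LINT x|lborel. g' x) = 0" using eq[of UNIV] tot by (simp add: set_lebesgue_integral_def)
  have z0: "(LINT x:A|lborel. g' x) = 0" if "A \<in> sets borel" for A
  proof -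
    have "A \<in> sigma_sets UNIV (range (\<lambda>(a, b). box a b :: (real^3) set))"
      using that by (simp add: borel_eq_box)
    then show ?thesis
    proof (induction A rule: sigma_sets_induct_disjoint[rotated 2, consumes 1, case_names basic empty compl union stable closed])
      case (basic A)
      then show ?case using eq z by auto
    next
      case empty
      then show ?case by (simp add: set_lebesgue_integral_def)
    next
      case (compl A)
      then have A: "A \<in> sets borel" by (simp add: borel_eq_box)
      have "(LINT x:UNIV - A|lborel. g' x) = (LINT x|lborel. g' x - indicator A x *\<^sub>R g' x)"
        unfolding set_lebesgue_integral_def by (rule Bochner_Integration.integral_cong) (auto split: split_indicator)
      also have "\<dots> = 0" using compl ig' si[OF A] tot'
        by (subst Bochner_Integration.integral_diff) (auto simp: set_integrable_def set_lebesgue_integral_def)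
      finally show ?case .
    next
      case (union A)
      then have A: "A i \<in> sets borel" for i by (simp add: borel_eq_box range_subsetD)
      have "(LINT x:(\<Union>i. A i)|lborel. g' x) = (\<Sum>i. (LINT x:(A i)|lborel. g' x))"
        by (rule lebesgue_integral_countable_add) (use A union si in \<open>auto simp: disjoint_family_on_def\<close>)
      then show ?case using union by simp
    next
      case stable
      show ?case by (auto simp: Int_stable_def box_Int_box)
    qed simp
  qed
  have "AE x in lborel. g' x = 0"
    by (rule sigma_finite_measure.density_zero[OF sigma_finite_lborel ig']) (rule z0, simp)
  then have "AE x in lebesgue. g' x = 0" by (rule AE_completion)
  then show ?thesis using ae' by eventually_elim simp
qed

text \<open>An open set is a countable union of closed boxes. On each of them \<open>f\<close> is
  cut off to the open box; any box intersected with that one is again a box with closure in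
  \<open>U\<close>, so all box integrals of the cut-off function vanish. The frontier of a box is a
  null set.\<close>

lemma fundamental_lemma:
  fixes f :: "real^3 \<Rightarrow> real"
  assumes "open U" and f: "set_integrable lebesgue U f"
    and z: "\<And>\<psi>. test_function U \<psi> \<Longrightarrow> (LINT x:U|lebesgue. f x * \<psi> x) = 0"
  shows "AE x in lebesgue. x \<in> U \<longrightarrow> f x = 0"
proof -
  obtain \<D> where D: "countable \<D>" "\<D> \<subseteq> Pow U" "\<And>X. X \<in> \<D> \<Longrightarrow> \<exists>a b. X = cbox a b" "\<Union>\<D> = U"
    using open_countable_Union_open_cbox[OF assms(1)] by metis
  have "AE x in lebesgue. x \<in> X \<longrightarrow> f x = 0" if X: "X \<in> \<D>" for X
  proof -
    obtain c d where X': "X = cbox c d" using D X by blast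
    have sub: "cbox c d \<subseteq> U" using D X X' by blast
    define g where "g x = indicator (box c d) x *\<^sub>R f x" for x
    have gi: "integrable lebesgue g"
      using set_integrable_subset[OF f, of "box c d"] sub box_subset_cbox[of c d]
      unfolding g_def set_integrable_def by auto
    have "AE x in lebesgue. g x = 0"
    proof (rule integrable_box_integrals_zero_AE[OF gi])
      fix a b :: "real^3"
      obtain a' b' where ab: "box a b \<inter> box c d = box a' b'" by (auto simp: box_Int_box)
      have "(LINT x:box a' b'|lebesgue. f x) = 0"
      proof (cases "box a' b' = {}")
        case False
        then have "box c d \<noteq> {}" using ab by blast
        then have "closure (box c d) = cbox c d" "closure (box a' b') = cbox a' b'"
          using closure_box False by blast+
        then have "cbox a' b' \<subseteq> cbox c d" using ab by (metis Int_lower2 closure_mono)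
        then show ?thesis using box_integral_zero[OF f _ z, of a' b'] sub by auto
      qed (simp add: set_lebesgue_integral_def)
      then show "(LINT x:box a b|lebesgue. g x) = 0"
        unfolding g_def set_lebesgue_integral_def ab[symmetric] by (simp add: indicator_inter_arith mult.assoc)
    next
      show "(LINT x|lebesgue. g x) = 0"
        using box_integral_zero[OF f sub z] by (simp add: g_def set_lebesgue_integral_def)
    qed
    moreover have "AE x in lebesgue. x \<notin> cbox c d - box c d"
      by (rule AE_not_in) (use negligible_frontier_interval[of c d] in \<open>simp only: negligible_iff_null_sets\<close>)
    ultimately show ?thesis unfolding X' by eventually_elim (auto simp: g_def split: split_indicator_asm)
  qed
  then have "AE x in lebesgue. \<forall>X\<in>\<D>. x \<in> X \<longrightarrow> f x = 0" by (subst AE_ball_countable[OF D(1)]) auto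
  then show ?thesis by eventually_elim (use D(4) in auto)
qed

section \<open>Lines, translations and dilations under the integral\<close>

lemma smooth_line_derivative:
  fixes \<psi> :: "'a::euclidean_space \<Rightarrow> real"
  assumes "smooth \<psi>"
  shows "((\<lambda>s. \<psi> (x + s *\<^sub>R u)) has_real_derivative frechet_derivative \<psi> (at (x + s *\<^sub>R u)) u) (at s)"
proof -
  have "((\<lambda>s::real. x + s *\<^sub>R u) has_derivative (\<lambda>h. h *\<^sub>R u)) (at s)"
    by (auto intro!: derivative_eq_intros)
  from has_derivative_compose[OF this smooth_has_derivative[OF assms]]
  have "((\<lambda>s. \<psi> (x + s *\<^sub>R u)) has_derivative (\<lambda>h. frechet_derivative \<psi> (at (x + s *\<^sub>R u)) (h *\<^sub>R u))) (at s)" .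
  moreover have "linear (frechet_derivative \<psi> (at (x + s *\<^sub>R u)))"
    using smooth_has_derivative[OF assms] has_derivative_linear by blast
  ultimately show ?thesis by (simp add: has_field_derivative_def linear_cmul mult.commute[of _ "frechet_derivative \<psi> (at (x + s *\<^sub>R u)) u"])
qed

lemma lborel_integral_translate:
  fixes f :: "'a::euclidean_space \<Rightarrow> 'b::{banach, second_countable_topology}"
  assumes [measurable]: "f \<in> borel_measurable borel"
  shows "(LINT x|lborel. f (c + x)) = (LINT x|lborel. f x)"
  by (subst (2) lborel_distr_plus[of c, symmetric]) (simp add: integral_distr)

lemma lborel_nn_integral_translate:
  fixes f :: "'a::euclidean_space \<Rightarrow> ennreal"
  assumes [measurable]: "f \<in> borel_measurable borel"
  shows "(\<integral>\<^sup>+x. f (c + x) \<partial>lborel) = (\<integral>\<^sup>+x. f x \<partial>lborel)"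
  by (subst (2) lborel_distr_plus[of c, symmetric]) (simp add: nn_integral_distr)

lemma lborel_integrable_translate:
  fixes f :: "'a::euclidean_space \<Rightarrow> real"
  assumes "integrable lborel f"
  shows "integrable lborel (\<lambda>x. f (c + x))"
proof -
  have [measurable]: "f \<in> borel_measurable borel" using assms by (auto dest: borel_measurable_integrable)
  show ?thesis using assms lborel_nn_integral_translate[of "\<lambda>x. ennreal (norm (f x))" c]
    by (auto simp: integrable_iff_bounded)
qed

text \<open>The substitution has Jacobian \<open>c^3\<close>, which is at least 1/8 for
  \<open>c \<ge> 1/2\<close>. In the Poincare estimate one of the weights \<open>t\<close> and
  \<open>1 - t\<close> is always that large; this is the origin of the 8 there.\<close>

lemma lborel_nn_integral_scale:
  fixes F :: "real^3 \<Rightarrow> ennreal"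
  assumes [measurable]: "F \<in> borel_measurable borel" and c: "c \<ge> 1/2"
  shows "(\<integral>\<^sup>+y. F (a + c *\<^sub>R y) \<partial>lborel) \<le> 8 * (\<integral>\<^sup>+x. F x \<partial>lborel)"
proof -
  have "(\<integral>\<^sup>+x. F x \<partial>lborel) = (\<integral>\<^sup>+x. F x \<partial>(density (distr lborel borel (\<lambda>x. a + c *\<^sub>R x)) (\<lambda>_. ennreal (\<bar>c\<bar> ^ DIM(real^3)))))"
    using lborel_affine[of c a] c by simp
  also have "\<dots> = ennreal (c ^ 3) * (\<integral>\<^sup>+y. F (a + c *\<^sub>R y) \<partial>lborel)"
    using c by (simp add: nn_integral_density nn_integral_distr nn_integral_cmult)
  finally have eq: "(\<integral>\<^sup>+x. F x \<partial>lborel) = ennreal (c ^ 3) * (\<integral>\<^sup>+y. F (a + c *\<^sub>R y) \<partial>lborel)" .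
  have "(1/2) ^ 3 \<le> c ^ 3" using c by (intro power_mono) auto
  then have "1 \<le> 8 * c ^ 3" by (simp add: power3_eq_cube)
  then have "1 \<le> ennreal (8 * c ^ 3)" by simp
  then have "1 * (\<integral>\<^sup>+y. F (a + c *\<^sub>R y) \<partial>lborel) \<le> ennreal (8 * c ^ 3) * (\<integral>\<^sup>+y. F (a + c *\<^sub>R y) \<partial>lborel)"
    by (rule mult_right_mono) simp
  also have "\<dots> = 8 * (\<integral>\<^sup>+x. F x \<partial>lborel)" unfolding eq using c by (simp add: ennreal_mult mult.assoc)
  finally show ?thesis by simp
qed

text \<open>Translation along \<open>u\<close> preserves both the measure and \<open>H\<close>, so
  each difference quotient integrates to zero over \<open>H\<close>, and the quotients are dominated
  by a multiple of the indicator of a ball. With the whole space for \<open>H\<close> this is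
  integration by parts; with a half-space it removes the components parallel to the bounding
  plane.\<close>

lemma integral_derivative_invariant_set:
  fixes \<psi> :: "real^3 \<Rightarrow> real"
  assumes tf: "test_function UNIV \<psi>" and H[measurable]: "H \<in> sets borel"
    and inv: "\<And>x s. x + s *\<^sub>R u \<in> H \<longleftrightarrow> x \<in> H"
  shows "(LINT x:H|lebesgue. frechet_derivative \<psi> (at x) u) = 0"
proof -
  have sm: "smooth \<psi>" using tf test_function_def by blast
  have [measurable]: "\<psi> \<in> borel_measurable borel" by (rule smooth_borel[OF sm])
  define D where "D x = frechet_derivative \<psi> (at x) u" for x
  have smD: "smooth D" unfolding D_def by (rule smooth_frechet_derivative[OF sm])
  have [measurable]: "D \<in> borel_measurable borel" by (rule smooth_borel[OF smD])
  have "test_function UNIV D" unfolding D_def by (rule test_function_frechet[OF tf])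
  then obtain B where B: "\<And>x. \<bar>D x\<bar> \<le> B" using test_function_bounded by (metis real_norm_def)
  have "bounded (closure {x. \<psi> x \<noteq> 0})" using tf compact_imp_bounded by (auto simp: test_function_def)
  then obtain R where "\<forall>x\<in>closure {x. \<psi> x \<noteq> 0}. norm x \<le> R" using bounded_iff by blast
  then have R: "\<psi> x = 0" if "norm x > R" for x using that closure_subset[of "{x. \<psi> x \<noteq> 0}"] by force
  define e where "e n = inverse (real (Suc n))" for n
  have e: "e n > 0" "e n \<le> 1" for n by (auto simp: e_def field_simps)
  define q where "q n x = (\<psi> (x + e n *\<^sub>R u) - \<psi> x) / e n" for n x
  define S where "S = cball (0::real^3) (R + norm u)"
  have lim: "(\<lambda>n. q n x) \<longlonglongrightarrow> D x" for x
  proof -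
    have "((\<lambda>h. (\<psi> (x + h *\<^sub>R u) - \<psi> x) / h) \<longlongrightarrow> D x) (at 0)"
      using smooth_line_derivative[OF sm, of x u 0] by (simp add: DERIV_def D_def)
    moreover have "filterlim e (at 0) sequentially"
      unfolding e_def by (rule filterlim_atI[OF LIMSEQ_inverse_real_of_nat]) auto
    ultimately show ?thesis unfolding q_def by (rule filterlim_compose)
  qed
  have bound: "\<bar>q n x\<bar> \<le> B * indicator S x" for n x
  proof (cases "x \<in> S")
    case True
    obtain \<xi> where "\<psi> (x + e n *\<^sub>R u) - \<psi> (x + 0 *\<^sub>R u) = (e n - 0) * D (x + \<xi> *\<^sub>R u)"
      using MVT2[OF e(1)[of n], of "\<lambda>s. \<psi> (x + s *\<^sub>R u)" "\<lambda>s. D (x + s *\<^sub>R u)"] smooth_line_derivative[OF sm] unfolding D_def by blast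
    then have "q n x = D (x + \<xi> *\<^sub>R u)" using e(1)[of n] by (simp add: q_def)
    then show ?thesis using B True by simp
  next
    case False
    then have *: "norm x > R + norm u" by (simp add: S_def)
    have "norm (e n *\<^sub>R u) \<le> norm u" using e[of n] by (simp add: mult_left_le_one_le)
    then have "norm (x + e n *\<^sub>R u) > R" using * norm_triangle_ineq4[of "x + e n *\<^sub>R u" "e n *\<^sub>R u"] by simp
    moreover have "norm x > R" using * norm_ge_zero[of u] by linarith
    ultimately have "\<psi> (x + e n *\<^sub>R u) = 0" "\<psi> x = 0" using R by blast+
    then show ?thesis using False by (simp add: q_def)
  qed
  have Sfin: "emeasure lborel S < \<infinity>" unfolding S_def by (rule emeasure_lborel_cball_finite)
  have z: "(LINT x|lborel. indicator H x * q n x) = 0" for n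
  proof -
    let ?g = "\<lambda>x. indicator H x * \<psi> x"
    obtain C where C: "\<And>x. \<bar>\<psi> x\<bar> \<le> C" using test_function_bounded[OF tf] by (metis real_norm_def)
    have ig: "integrable lborel ?g"
    proof (rule Bochner_Integration.integrable_bound)
      have "emeasure lborel (cball (0::real^3) R) < \<infinity>" by (rule emeasure_lborel_cball_finite)
      then show "integrable lborel (\<lambda>x. C * indicator (cball (0::real^3) R) x)" by (simp add: less_top)
      have "\<bar>indicator H x * \<psi> x\<bar> \<le> \<bar>C * indicator (cball 0 R) x\<bar>" for x
        using C[of x] R[of x] by (auto split: split_indicator)
      then show "AE x in lborel. norm (indicator H x * \<psi> x) \<le> norm (C * indicator (cball 0 R) x)" by simp
    qed simp
    have "indicator H (e n *\<^sub>R u + x) * \<psi> (e n *\<^sub>R u + x) = indicator H x * \<psi> (x + e n *\<^sub>R u)" for x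
      using inv[of x "e n"] by (simp add: add.commute indicator_def)
    then have eq: "(\<lambda>x. indicator H x * \<psi> (x + e n *\<^sub>R u)) = (\<lambda>x. ?g (e n *\<^sub>R u + x))" by auto
    have "(LINT x|lborel. ?g (e n *\<^sub>R u + x) - ?g x) = 0"
      using lborel_integral_translate[of ?g "e n *\<^sub>R u"] ig lborel_integrable_translate[OF ig]
      by (subst Bochner_Integration.integral_diff) auto
    moreover have "indicator H x * q n x = (?g (e n *\<^sub>R u + x) - ?g x) / e n" for x
      using fun_cong[OF eq, of x] by (simp add: q_def diff_divide_distrib right_diff_distrib)
    ultimately show ?thesis by simp
  qed
  have "(\<lambda>n. LINT x|lborel. indicator H x * q n x) \<longlonglongrightarrow> (LINT x|lborel. indicator H x * D x)"
  proof (rule integral_dominated_convergence)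
    show "integrable lborel (\<lambda>x. B * indicator S x)" using Sfin by (simp add: S_def less_top)
    show "(\<lambda>x. indicat_real H x * q i x) \<in> borel_measurable lborel" for i unfolding q_def by measurable
    show "AE x in lborel. (\<lambda>i. indicat_real H x * q i x) \<longlonglongrightarrow> indicat_real H x * D x"
      by (intro always_eventually allI tendsto_mult tendsto_const lim)
    have "\<bar>indicat_real H x * q i x\<bar> \<le> B * indicat_real S x" for i x
      using bound[of i x] order_trans[OF abs_ge_zero bound] by (auto simp: abs_mult split: split_indicator)
    then show "AE x in lborel. norm (indicat_real H x * q i x) \<le> B * indicat_real S x" for i by simp
  qed simp
  then have "(LINT x|lborel. indicator H x * D x) = 0" unfolding z by (simp add: LIMSEQ_const_iff)
  moreover have "(LINT x:H|lebesgue. D x) = (LINT x|lborel. indicator H x *\<^sub>R D x)"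
    unfolding set_lebesgue_integral_def by (rule integral_completion) simp
  ultimately show ?thesis by (simp add: D_def)
qed

section \<open>Weakly differentiable functions along segments\<close>

lemma integrable_segment_product:
  fixes g :: "real^3 \<Rightarrow> real"
  assumes g: "integrable lborel g"
  shows "integrable (lborel \<Otimes>\<^sub>M lborel) (\<lambda>(x, t). indicator {0..1} t * g (x + t *\<^sub>R d))"
proof -
  have [measurable]: "g \<in> borel_measurable borel" using g by (auto dest: borel_measurable_integrable)
  have "(\<integral>\<^sup>+(x, t). ennreal (norm (indicator {0..1} t * g (x + t *\<^sub>R d))) \<partial>(lborel \<Otimes>\<^sub>M lborel))
      = (\<integral>\<^sup>+t. \<integral>\<^sup>+x. ennreal (norm (indicator {0..1} t * g (x + t *\<^sub>R d))) \<partial>lborel \<partial>lborel)"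
    by (subst lborel_pair.nn_integral_snd[symmetric]) auto
  also have "\<dots> = (\<integral>\<^sup>+t. indicator {0..1::real} t * (\<integral>\<^sup>+x. ennreal (norm (g x)) \<partial>lborel) \<partial>lborel)"
  proof (rule nn_integral_cong)
    fix t :: real
    have "(\<integral>\<^sup>+x. ennreal (norm (indicator {0..1} t * g (x + t *\<^sub>R d))) \<partial>lborel)
       = (\<integral>\<^sup>+x. indicator {0..1} t * ennreal (norm (g (t *\<^sub>R d + x))) \<partial>lborel)"
      by (rule nn_integral_cong) (auto simp: abs_mult add.commute split: split_indicator)
    also have "\<dots> = indicator {0..1} t * (\<integral>\<^sup>+x. ennreal (norm (g x)) \<partial>lborel)"
      using lborel_nn_integral_translate[of "\<lambda>x. ennreal (norm (g x))" "t *\<^sub>R d"] by (simp add: nn_integral_cmult)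
    finally show "(\<integral>\<^sup>+x. ennreal (norm (indicator {0..1} t * g (x + t *\<^sub>R d))) \<partial>lborel)
       = indicator {0..1} t * (\<integral>\<^sup>+x. ennreal (norm (g x)) \<partial>lborel)" .
  qed
  also have "\<dots> = (\<integral>\<^sup>+x. ennreal (norm (g x)) \<partial>lborel)" by (simp add: nn_integral_multc)
  also have "\<dots> < \<infinity>" using g by (simp add: integrable_iff_bounded)
  finally show ?thesis by (simp add: integrable_iff_bounded case_prod_unfold)
qed

text \<open>The fundamental theorem of calculus for a weak derivative, by duality. The average
  \<open>\<Psi> z\<close> of \<open>\<psi> (z - t d)\<close> over \<open>t\<close> has derivative
  \<open>\<psi> z - \<psi> (z - d)\<close> along \<open>d\<close>. Testing with
  \<open>\<Psi>\<close> and moving the translations onto \<open>f\<close> and \<open>g\<close> gives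
  the identity tested with \<open>\<psi>\<close>, and \<open>fundamental_lemma\<close> makes it hold
  almost everywhere.\<close>

lemma weak_derivative_segment:
  fixes f g :: "real^3 \<Rightarrow> real"
  assumes U: "open U" "convex U"
    and f: "integrable lborel f" and g: "integrable lborel g"
    and weak: "\<And>\<psi>. test_function U \<psi> \<Longrightarrow>
       (LINT x|lborel. f x * frechet_derivative \<psi> (at x) d) = - (LINT x|lborel. g x * \<psi> x)"
  shows "AE x in lborel. x \<in> U \<and> x + d \<in> U \<longrightarrow> f (x + d) - f x = (LINT t:{0..1}|lborel. g (x + t *\<^sub>R d))"
proof -
  have [measurable]: "f \<in> borel_measurable borel" "g \<in> borel_measurable borel"
    using f g by (auto dest: borel_measurable_integrable)
  \<comment> \<open>The points that stay in \<open>U\<close> when moved by \<open>d\<close>. For a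
    test function supported in \<open>V\<close>, convexity keeps the segments swept by its support,
    and with them the support of \<open>\<Psi>\<close>, inside \<open>U\<close>.\<close>
  define V where "V = U \<inter> (\<lambda>x. x + d) -` U"
  have V: "open V" unfolding V_def using U by (intro open_Int open_vimage continuous_intros)
  define K where "K = (\<lambda>(x, t). indicator {0..1::real} t * g (x + t *\<^sub>R d))"
  define G where "G x = (LINT t|lborel. K (x, t))" for x
  have iK: "integrable (lborel \<Otimes>\<^sub>M lborel) K" unfolding K_def by (rule integrable_segment_product[OF g])
  have iG: "integrable lborel G" unfolding G_def by (rule lborel_pair.integrable_fst'[OF iK])
  have [measurable]: "G \<in> borel_measurable borel" using iG by (auto dest: borel_measurable_integrable)
  have if1: "integrable lborel (\<lambda>x. f (x + d))" using lborel_integrable_translate[OF f, of d] by (simp add: add.commute)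
  define F where "F x = f (x + d) - f x - G x" for x
  have iF: "integrable lborel F" unfolding F_def using f if1 iG by auto
  have [measurable]: "F \<in> borel_measurable borel" using iF by (auto dest: borel_measurable_integrable)
  have "AE x in lebesgue. x \<in> V \<longrightarrow> F x = 0"
  proof (rule fundamental_lemma[OF V])
    have "integrable lebesgue F" using iF by (simp add: integrable_completion)
    then show "set_integrable lebesgue V F" unfolding set_integrable_def
      by (intro integrable_mult_indicator) (use V in auto)
    fix \<psi> :: "real^3 \<Rightarrow> real" assume tf: "test_function V \<psi>"
    have sm: "smooth \<psi>" using tf test_function_def by blast
    have [measurable]: "\<psi> \<in> borel_measurable borel" by (rule smooth_borel[OF sm])
    obtain B where B: "\<And>x. \<bar>\<psi> x\<bar> \<le> B" using test_function_bounded[OF tf] by (metis real_norm_def)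
    have ib: "integrable lborel (\<lambda>x. h x * \<psi> (x + c))" if h: "integrable lborel h" for h c
    proof (rule Bochner_Integration.integrable_bound)
      show "integrable lborel (\<lambda>x. B * h x)" using h by simp
      show "(\<lambda>x. h x * \<psi> (x + c)) \<in> borel_measurable lborel" using h by (auto dest: borel_measurable_integrable)
      have "\<bar>h x * \<psi> (x + c)\<bar> \<le> \<bar>B * h x\<bar>" for x
        using mult_left_mono[OF B[of "x + c"], of "\<bar>h x\<bar>"] B[of 0] by (simp add: abs_mult mult.commute)
      then show "AE x in lborel. norm (h x * \<psi> (x + c)) \<le> norm (B * h x)" by simp
    qed
    define \<Psi> where "\<Psi> z = integral {0..1} (\<lambda>t. \<psi> (z - t *\<^sub>R d))" for z
    have d\<Psi>: "(\<Psi> has_derivative (\<lambda>h. integral {0..1} (\<lambda>t. frechet_derivative \<psi> (at (z - t *\<^sub>R d)) h))) (at z)" for z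
      unfolding \<Psi>_def
      by (rule has_derivative_integral_segment[OF smooth_has_derivative[OF sm]])
         (rule smooth_continuous[OF smooth_frechet_derivative[OF sm]])
    have D\<Psi>: "frechet_derivative \<Psi> (at z) d = \<psi> z - \<psi> (z - d)" for z
    proof -
      have "((\<lambda>t. frechet_derivative \<psi> (at (z - t *\<^sub>R d)) d) has_integral (- \<psi> (z - 1 *\<^sub>R d)) - (- \<psi> (z - 0 *\<^sub>R d))) {0..1}"
      proof (rule fundamental_theorem_of_calculus)
        fix t :: real
        have "((\<lambda>s. \<psi> (z + s *\<^sub>R (-d))) has_real_derivative frechet_derivative \<psi> (at (z + t *\<^sub>R (-d))) (-d)) (at t)"
          by (rule smooth_line_derivative[OF sm])
        moreover have "frechet_derivative \<psi> (at y) (-d) = - frechet_derivative \<psi> (at y) d" for y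
          using linear_neg[OF has_derivative_linear[OF smooth_has_derivative[OF sm]]] .
        ultimately have "((\<lambda>s. \<psi> (z - s *\<^sub>R d)) has_real_derivative - frechet_derivative \<psi> (at (z - t *\<^sub>R d)) d) (at t)" by simp
        from DERIV_minus[OF this] have "((\<lambda>s. - \<psi> (z - s *\<^sub>R d)) has_real_derivative frechet_derivative \<psi> (at (z - t *\<^sub>R d)) d) (at t)" by simp
        then show "((\<lambda>s. - \<psi> (z - s *\<^sub>R d)) has_vector_derivative frechet_derivative \<psi> (at (z - t *\<^sub>R d)) d) (at t within {0..1})"
          by (simp add: has_real_derivative_iff_has_vector_derivative has_vector_derivative_at_within)
      qed simp
      then have "integral {0..1} (\<lambda>t. frechet_derivative \<psi> (at (z - t *\<^sub>R d)) d) = \<psi> z - \<psi> (z - d)"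
        by (simp add: integral_unique)
      then show ?thesis unfolding frechet_derivative_at[OF d\<Psi>[of z], symmetric] .
    qed
    have tf\<Psi>: "test_function U \<Psi>"
    proof (rule test_functionI)
      let ?S = "closure {x. \<psi> x \<noteq> 0}"
      define S where "S = (\<lambda>(s, t). s + t *\<^sub>R d) ` (?S \<times> {0..1::real})"
      show "smooth \<Psi>" unfolding \<Psi>_def smooth_def using C_k_integral_segment sm smooth_def by blast
      have "compact (?S \<times> {0..1::real})" using tf by (intro compact_Times) (auto simp: test_function_def)
      then show "compact S" unfolding S_def case_prod_unfold
        by (intro compact_continuous_image continuous_intros)
      show "S \<subseteq> U"
      proof
        fix y assume "y \<in> S"
        then obtain s t where st: "s \<in> ?S" "0 \<le> t" "t \<le> 1" "y = s + t *\<^sub>R d" by (auto simp: S_def)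
        then have "s \<in> V" using tf by (auto simp: test_function_def)
        then have "s \<in> U" "s + d \<in> U" by (auto simp: V_def)
        then have "(1 - t) *\<^sub>R s + t *\<^sub>R (s + d) \<in> U" using convexD[OF U(2), of s "s + d" "1 - t" t] st by simp
        then show "y \<in> U" using st by (simp add: algebra_simps)
      qed
      fix x assume x: "x \<notin> S"
      have "\<psi> (x - t *\<^sub>R d) = 0" if "t \<in> {0..1}" for t
      proof (rule ccontr)
        assume "\<psi> (x - t *\<^sub>R d) \<noteq> 0"
        then have "x - t *\<^sub>R d \<in> ?S" using closure_subset by fast
        then have "(x - t *\<^sub>R d) + t *\<^sub>R d \<in> S" using that unfolding S_def by (force intro!: image_eqI[of _ _ "(x - t *\<^sub>R d, t)"])
        then show False using x by simp
      qed
      then have "\<Psi> x = integral {0..1::real} (\<lambda>t. 0)" unfolding \<Psi>_def by (intro integral_cong) auto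
      then show "\<Psi> x = 0" by simp
    qed
    have \<Psi>L: "\<Psi> z = (LINT t|lborel. indicator {0..1} t * \<psi> (z - t *\<^sub>R d))" for z
    proof -
      have "continuous_on {0..1} (\<lambda>t. \<psi> (z - t *\<^sub>R d))"
        by (intro continuous_on_compose2[OF smooth_continuous[OF sm, of UNIV]] continuous_intros) auto
      then have "set_integrable lborel {0..1} (\<lambda>t. \<psi> (z - t *\<^sub>R d))" by (rule borel_integrable_atLeastAtMost')
      then show ?thesis unfolding \<Psi>_def using set_borel_integral_eq_integral(2)
        by (fastforce simp: set_lebesgue_integral_def)
    qed
    have "(LINT x|lborel. f x * (\<psi> x - \<psi> (x - d))) = - (LINT z|lborel. g z * \<Psi> z)"
      using weak[OF tf\<Psi>] unfolding D\<Psi> .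
    moreover have "(LINT x|lborel. f x * (\<psi> x - \<psi> (x - d))) = (LINT x|lborel. f x * \<psi> x) - (LINT x|lborel. f (x + d) * \<psi> x)"
    proof -
      have "(LINT x|lborel. f x * \<psi> (x - d)) = (LINT x|lborel. f (d + x) * \<psi> (d + x - d))"
        by (rule lborel_integral_translate[symmetric, of "\<lambda>x. f x * \<psi> (x - d)"]) measurable
      moreover have "integrable lborel (\<lambda>x. f x * \<psi> (x - d))" using ib[OF f, of "-d"] by simp
      ultimately show ?thesis using ib[OF f, of 0]
        by (simp add: right_diff_distrib Bochner_Integration.integral_diff add.commute)
    qed
    moreover have "(LINT z|lborel. g z * \<Psi> z) = (LINT x|lborel. G x * \<psi> x)"
    proof -
      define K2 where "K2 = (\<lambda>x t. K (x, t) * \<psi> x)"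
      have mK[measurable]: "K \<in> borel_measurable (lborel \<Otimes>\<^sub>M lborel)" using iK by simp
      have iK2: "integrable (lborel \<Otimes>\<^sub>M lborel) (case_prod K2)"
      proof (rule Bochner_Integration.integrable_bound)
        show "integrable (lborel \<Otimes>\<^sub>M lborel) (\<lambda>p. B * K p)" using iK by simp
        have B0: "0 \<le> B" using B[of 0] by linarith
        show "case_prod K2 \<in> borel_measurable (lborel \<Otimes>\<^sub>M lborel)" unfolding K2_def by measurable
        have "\<bar>K2 x t\<bar> \<le> \<bar>B * K (x, t)\<bar>" for x t
          unfolding K2_def abs_mult using B[of x] B0 mult_left_mono[OF B[of x], of "\<bar>K (x, t)\<bar>"] by (simp add: mult.commute)
        then show "AE p in lborel \<Otimes>\<^sub>M lborel. norm (case_prod K2 p) \<le> norm (B * K p)" by auto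
      qed
      have 1: "(LINT x|lborel. G x * \<psi> x) = (LINT x|lborel. LINT t|lborel. K2 x t)"
        unfolding G_def K2_def by simp
      have 2: "\<dots> = (LINT t|lborel. LINT x|lborel. K2 x t)"
        by (rule lborel_pair.Fubini_integral[symmetric]) (rule iK2)
      define L2 where "L2 = (\<lambda>z t. indicator {0..1::real} t * (g z * \<psi> (z - t *\<^sub>R d)))"
      have 3: "(LINT x|lborel. K2 x t) = (LINT z|lborel. L2 z t)" for t
      proof -
        have "(LINT x|lborel. L2 (t *\<^sub>R d + x) t) = (LINT z|lborel. L2 z t)"
          by (rule lborel_integral_translate[of "\<lambda>z. L2 z t"]) (simp add: L2_def)
        then show ?thesis by (simp add: L2_def K2_def K_def add.commute mult.assoc)
      qed
      have iL2: "integrable (lborel \<Otimes>\<^sub>M lborel) (case_prod L2)"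
      proof (rule Bochner_Integration.integrable_bound)
        have "integrable (lborel \<Otimes>\<^sub>M lborel) (\<lambda>(x, t). indicator {0..1::real} t * g (x + t *\<^sub>R 0))"
          by (rule integrable_segment_product[OF g])
        then show "integrable (lborel \<Otimes>\<^sub>M lborel) (\<lambda>(z, t). B * (indicator {0..1::real} t * g z))"
          by (simp add: case_prod_unfold)
        have B0: "0 \<le> B" using B[of 0] by linarith
        show "case_prod L2 \<in> borel_measurable (lborel \<Otimes>\<^sub>M lborel)" unfolding L2_def by measurable
        have "\<bar>L2 z t\<bar> \<le> \<bar>B * (indicator {0..1::real} t * g z)\<bar>" for z t
          unfolding L2_def abs_mult using B0 mult_left_mono[OF B[of "z - t *\<^sub>R d"], of "\<bar>g z\<bar>"] by (auto simp: mult.commute split: split_indicator)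
        then show "AE p in lborel \<Otimes>\<^sub>M lborel. norm (case_prod L2 p) \<le> norm (case p of (z, t) \<Rightarrow> B * (indicator {0..1::real} t * g z))" by auto
      qed
      have 4: "(LINT t|lborel. LINT z|lborel. L2 z t) = (LINT z|lborel. LINT t|lborel. L2 z t)"
        by (rule lborel_pair.Fubini_integral) (rule iL2)
      have 5: "(LINT t|lborel. L2 z t) = g z * \<Psi> z" for z
        unfolding L2_def \<Psi>L by (subst Bochner_Integration.integral_mult_right_zero[symmetric]) (simp add: mult_ac)
      show ?thesis using 1 2 3 4 5 by simp
    qed
    ultimately have eq: "(LINT x|lborel. f (x + d) * \<psi> x) - (LINT x|lborel. f x * \<psi> x) - (LINT x|lborel. G x * \<psi> x) = 0" by linarith
    have "(LINT x|lborel. F x * \<psi> x) = 0"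
      unfolding F_def left_diff_distrib using eq ib[OF f, of 0] ib[OF if1, of 0] ib[OF iG, of 0]
      by (simp add: Bochner_Integration.integral_diff)
    moreover have "(LINT x:V|lebesgue. F x * \<psi> x) = (LINT x|lebesgue. F x * \<psi> x)"
      unfolding set_lebesgue_integral_def
      by (rule Bochner_Integration.integral_cong) (use test_function_zero[OF tf] in \<open>auto split: split_indicator\<close>)
    moreover have "(LINT x|lebesgue. F x * \<psi> x) = (LINT x|lborel. F x * \<psi> x)" by (rule integral_completion) simp
    ultimately show "(LINT x:V|lebesgue. F x * \<psi> x) = 0" by simp
  qed
  moreover have "Measurable.pred lborel (\<lambda>x. x \<in> V \<longrightarrow> F x = 0)"
  proof -
    have [measurable]: "V \<in> sets borel" using V by simp
    show ?thesis by measurable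
  qed
  ultimately have "AE x in lborel. x \<in> V \<longrightarrow> F x = 0" by (simp add: AE_completion_iff)
  then show ?thesis
    by eventually_elim (auto simp: V_def F_def G_def K_def set_lebesgue_integral_def)
qed

section \<open>The Poincare inequality on convex sets\<close>

text \<open>Cauchy-Schwarz against the constant 1. The right-hand side is an \<open>ennreal\<close>
  so that \<open>h\<close> may fail to be square integrable: then it is infinite, unless
  \<open>A\<close> is null. In the regular case the claim is the nonnegativity of the integral of
  \<open>(m h - c)^2\<close>.\<close>

lemma sq_integral_le:
  fixes h :: "'a \<Rightarrow> real"
  assumes [measurable]: "A \<in> sets M" "h \<in> borel_measurable M" and m: "emeasure M A = ennreal m" "0 \<le> m"
  shows "ennreal ((LINT x:A|M. h x)\<^sup>2) \<le> ennreal m * (\<integral>\<^sup>+x\<in>A. ennreal ((h x)\<^sup>2) \<partial>M)"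
proof (cases "m = 0")
  case True
  then have "AE x in M. x \<notin> A" using m by (intro AE_not_in) (auto simp: null_sets_def)
  then have "(LINT x:A|M. h x) = (LINT x|M. 0)"
    unfolding set_lebesgue_integral_def by (intro integral_cong_AE) auto
  then show ?thesis by simp
next
  case False
  then have m0: "m > 0" using m by simp
  define N where "N = restrict_space M A"
  have eN: "emeasure N (space N) = ennreal m" using m sets.sets_into_space[OF assms(1)]
    by (simp add: N_def emeasure_restrict_space space_restrict_space Int_absorb2)
  interpret N: finite_measure N by (rule finite_measureI) (simp add: eN)
  have mN: "measure N (space N) = m" using eN m by (simp add: measure_def)
  have hN[measurable]: "h \<in> borel_measurable N" unfolding N_def by (rule measurable_restrict_space1) simp
  have iN: "(LINT x:A|M. h x) = (LINT x|N. h x)"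
    unfolding N_def set_lebesgue_integral_def by (subst integral_restrict_space) auto
  have nN: "(\<integral>\<^sup>+x\<in>A. ennreal ((h x)\<^sup>2) \<partial>M) = (\<integral>\<^sup>+x. ennreal ((h x)\<^sup>2) \<partial>N)"
    unfolding N_def by (subst nn_integral_restrict_space) auto
  show ?thesis
  proof (cases "(\<integral>\<^sup>+x. ennreal ((h x)\<^sup>2) \<partial>N) = \<infinity>")
    case True
    then show ?thesis unfolding nN using m0 by (simp add: ennreal_mult_top)
  next
    case F: False
    have i2: "integrable N (\<lambda>x. (h x)\<^sup>2)"
      by (rule integrableI_bounded) (use F in \<open>auto simp: less_top\<close>)
    have i1: "integrable N h"
    proof (rule Bochner_Integration.integrable_bound)
      show "integrable N (\<lambda>x. 1 + (h x)\<^sup>2)" using i2 by simp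
      have "\<bar>y\<bar> \<le> 1 + y\<^sup>2" for y :: real
        using sum_squares_ge_zero[of "\<bar>y\<bar> - 1/2" 0] by (simp add: power2_eq_square algebra_simps)
      then show "AE x in N. norm (h x) \<le> norm (1 + (h x)\<^sup>2)" by simp
    qed simp
    define c where "c = (LINT x|N. h x)"
    have "0 \<le> (LINT x|N. (m * h x - c)\<^sup>2)" by simp
    also have "\<dots> = (LINT x|N. m\<^sup>2 * (h x)\<^sup>2 - 2 * m * c * h x + c\<^sup>2)"
      by (rule Bochner_Integration.integral_cong) (auto simp: power2_eq_square algebra_simps)
    also have "\<dots> = m\<^sup>2 * (LINT x|N. (h x)\<^sup>2) - 2 * m * c * c + m * c\<^sup>2"
      using i1 i2 by (simp add: mN c_def)
    also have "\<dots> = m * (m * (LINT x|N. (h x)\<^sup>2) - c\<^sup>2)" by (simp add: power2_eq_square algebra_simps)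
    finally have "c\<^sup>2 \<le> m * (LINT x|N. (h x)\<^sup>2)" using m0 by (simp add: zero_le_mult_iff)
    then have "ennreal (c\<^sup>2) \<le> ennreal (m * (LINT x|N. (h x)\<^sup>2))" by (rule ennreal_leI)
    also have "\<dots> = ennreal m * (\<integral>\<^sup>+x. ennreal ((h x)\<^sup>2) \<partial>N)"
      using nn_integral_eq_integral[OF i2] m by (simp add: ennreal_mult)
    finally show ?thesis unfolding nN iN c_def .
  qed
qed

text \<open>Averaging \<open>f y - f x\<close> over \<open>y\<close> reduces the claim to the double
  integral of \<open>(f y - f x)^2\<close> over \<open>U \<times> U\<close>. Each difference is the
  integral of \<open>G \<bullet> (y - x)\<close> along a segment, so what remains is
  \<open>|G|^2\<close> at \<open>(1 - t) x + t y\<close>, integrated over \<open>x\<close>,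
  \<open>y\<close> and \<open>t\<close>. There is no compactness argument, and \<open>U\<close>
  enters the constant through its diameter only.\<close>

lemma poincare_borel:
  fixes f :: "real^3 \<Rightarrow> real" and G :: "real^3 \<Rightarrow> real^3"
  assumes U: "open U" "convex U" "bounded U" "U \<noteq> {}"
    and f: "integrable lborel f" "integrable lborel (\<lambda>x. (f x)\<^sup>2)"
    and Gi: "\<And>d. integrable lborel (\<lambda>x. G x \<bullet> d)" and GM[measurable]: "G \<in> borel_measurable borel"
    and weak: "\<And>\<psi> d. test_function U \<psi> \<Longrightarrow>
       (LINT x|lborel. f x * frechet_derivative \<psi> (at x) d) = - (LINT x|lborel. (G x \<bullet> d) * \<psi> x)"
  shows "(\<integral>\<^sup>+x\<in>U. ennreal ((f x - (1 / measure lborel U) * (LINT y:U|lborel. f y))\<^sup>2) \<partial>lborel)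
     \<le> ennreal (8 * (diameter U)\<^sup>2) * (\<integral>\<^sup>+x. ennreal ((norm (G x))\<^sup>2) \<partial>lborel)"
proof -
  have [measurable]: "f \<in> borel_measurable borel" using f by (auto dest: borel_measurable_integrable)
  have [measurable]: "U \<in> sets borel" using U by simp
  define m where "m = measure lborel U"
  define h where "h = diameter U"
  define N where "N = (\<integral>\<^sup>+x. ennreal ((norm (G x))\<^sup>2) \<partial>lborel)"
  have eU: "emeasure lborel U = ennreal m"
    unfolding m_def using emeasure_bounded_finite[OF U(3)] by (simp add: emeasure_eq_ennreal_measure less_top)
  have m0: "m > 0"
  proof -
    have "emeasure lborel U \<noteq> 0"
    proof
      assume "emeasure lborel U = 0"
      then have "negligible U" using U by (simp add: negligible_iff_null_sets null_sets_def)
      then show False using open_not_negligible U by blast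
    qed
    then show ?thesis using eU by (metis ennreal_neg ennreal_0 linorder_not_less measure_nonneg m_def order_le_less)
  qed
  define J where "J t = (\<integral>\<^sup>+x\<in>U. (\<integral>\<^sup>+y\<in>U. ennreal ((norm (G ((1 - t) *\<^sub>R x + t *\<^sub>R y)))\<^sup>2) \<partial>lborel) \<partial>lborel)" for t :: real
  have NN: "(\<integral>\<^sup>+y. ennreal ((norm (G (a + c *\<^sub>R y)))\<^sup>2) * indicator U y \<partial>lborel) \<le> 8 * N" if "c \<ge> 1/2" for a c
  proof -
    have "(\<integral>\<^sup>+y. ennreal ((norm (G (a + c *\<^sub>R y)))\<^sup>2) * indicator U y \<partial>lborel) \<le> (\<integral>\<^sup>+y. ennreal ((norm (G (a + c *\<^sub>R y)))\<^sup>2) \<partial>lborel)"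
      by (rule nn_integral_mono) (auto split: split_indicator)
    also have "\<dots> \<le> 8 * N" unfolding N_def
      using lborel_nn_integral_scale[of "\<lambda>z. ennreal ((norm (G z))\<^sup>2)" c a] that by simp
    finally show ?thesis .
  qed
  \<comment> \<open>For \<open>t \<ge> 1/2\<close> the variable \<open>y\<close> is substituted,
    otherwise \<open>x\<close>, so that the dilation factor never falls below 1/2.\<close>
  have J: "J t \<le> 8 * N * ennreal m" for t
  proof (cases "t \<ge> 1/2")
    case True
    have "J t \<le> (\<integral>\<^sup>+x\<in>U. 8 * N \<partial>lborel)" unfolding J_def
      by (intro nn_integral_mono mult_right_mono NN True) simp
    also have "\<dots> = 8 * N * ennreal m" by (simp add: nn_integral_cmult_indicator eU)
    finally show ?thesis .
  next
    case False
    have "J t = (\<integral>\<^sup>+x. \<integral>\<^sup>+y. ennreal ((norm (G ((1 - t) *\<^sub>R x + t *\<^sub>R y)))\<^sup>2) * indicator U y * indicator U x \<partial>lborel \<partial>lborel)"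
      unfolding J_def by (simp add: nn_integral_multc)
    also have "\<dots> = (\<integral>\<^sup>+y. \<integral>\<^sup>+x. ennreal ((norm (G ((1 - t) *\<^sub>R x + t *\<^sub>R y)))\<^sup>2) * indicator U y * indicator U x \<partial>lborel \<partial>lborel)"
      by (rule lborel_pair.Fubini') measurable
    also have "\<dots> = (\<integral>\<^sup>+y. (\<integral>\<^sup>+x. ennreal ((norm (G (t *\<^sub>R y + (1 - t) *\<^sub>R x)))\<^sup>2) * indicator U x \<partial>lborel) * indicator U y \<partial>lborel)"
      by (subst nn_integral_multc[symmetric]) (auto simp: mult_ac add.commute)
    also have "\<dots> \<le> (\<integral>\<^sup>+y\<in>U. 8 * N \<partial>lborel)"
      by (intro nn_integral_mono mult_right_mono NN) (use False in auto)
    also have "\<dots> = 8 * N * ennreal m" by (simp add: nn_integral_cmult_indicator eU)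
    finally show ?thesis .
  qed
  \<comment> \<open>The pair \<open>(x, y)\<close> is replaced by \<open>(x, d)\<close> with
    \<open>d = y - x\<close>, because \<open>weak_derivative_segment\<close> holds for almost every
    \<open>x\<close> once \<open>d\<close> is fixed.\<close>
  define P where "P = (\<lambda>x d. indicator U x * indicator U (d + x) * ennreal ((f (d + x) - f x)\<^sup>2))"
  define Q where "Q = (\<lambda>x d. indicator U x * indicator U (d + x) * (ennreal (h\<^sup>2) * (\<integral>\<^sup>+t. indicator {0..1} t * ennreal ((norm (G (x + t *\<^sub>R d)))\<^sup>2) \<partial>lborel)))"
  have PQ: "(\<integral>\<^sup>+x. P x d \<partial>lborel) \<le> (\<integral>\<^sup>+x. Q x d \<partial>lborel)" for d
  proof (rule nn_integral_mono_AE)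
    have "AE x in lborel. x \<in> U \<and> x + d \<in> U \<longrightarrow> f (x + d) - f x = (LINT t:{0..1}|lborel. G (x + t *\<^sub>R d) \<bullet> d)"
      by (rule weak_derivative_segment[OF U(1,2) f(1) Gi weak])
    then show "AE x in lborel. P x d \<le> Q x d"
    proof eventually_elim
      case (elim x)
      show ?case
      proof (cases "x \<in> U \<and> x + d \<in> U")
        case True
        have "norm d \<le> h" using diameter_bounded_bound[OF U(3), of "x + d" x] True by (simp add: h_def dist_norm)
        then have nd: "(norm d)\<^sup>2 \<le> h\<^sup>2" by (simp add: power_mono)
        have "ennreal ((f (x + d) - f x)\<^sup>2) = ennreal ((LINT t:{0..1::real}|lborel. G (x + t *\<^sub>R d) \<bullet> d)\<^sup>2)" using elim True by simp
        also have "\<dots> \<le> ennreal 1 * (\<integral>\<^sup>+t\<in>{0..1}. ennreal ((G (x + t *\<^sub>R d) \<bullet> d)\<^sup>2) \<partial>lborel)"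
          by (rule sq_integral_le) auto
        also have "\<dots> \<le> (\<integral>\<^sup>+t. ennreal (h\<^sup>2) * (indicator {0..1} t * ennreal ((norm (G (x + t *\<^sub>R d)))\<^sup>2)) \<partial>lborel)"
        proof (simp, rule nn_integral_mono)
          fix t :: real
          have "(G (x + t *\<^sub>R d) \<bullet> d)\<^sup>2 \<le> (norm (G (x + t *\<^sub>R d)) * norm d)\<^sup>2"
            using Cauchy_Schwarz_ineq2[of "G (x + t *\<^sub>R d)" d] by (metis abs_ge_zero power2_abs power_mono)
          also have "\<dots> \<le> h\<^sup>2 * (norm (G (x + t *\<^sub>R d)))\<^sup>2"
            using nd by (simp add: power_mult_distrib mult.commute mult_right_mono)
          finally have "ennreal ((G (x + t *\<^sub>R d) \<bullet> d)\<^sup>2) \<le> ennreal (h\<^sup>2) * ennreal ((norm (G (x + t *\<^sub>R d)))\<^sup>2)"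
            by (simp add: ennreal_mult[symmetric])
          then show "ennreal ((G (x + t *\<^sub>R d) \<bullet> d)\<^sup>2) * indicator {0..1} t \<le> ennreal (h\<^sup>2) * (indicator {0..1} t * ennreal ((norm (G (x + t *\<^sub>R d)))\<^sup>2))"
            by (auto split: split_indicator)
        qed
        also have "\<dots> = ennreal (h\<^sup>2) * (\<integral>\<^sup>+t. indicator {0..1} t * ennreal ((norm (G (x + t *\<^sub>R d)))\<^sup>2) \<partial>lborel)"
          by (rule nn_integral_cmult) measurable
        finally show ?thesis using True by (simp add: P_def Q_def add.commute)
      qed (auto simp: P_def add.commute)
    qed
  qed
  have tr: "(\<integral>\<^sup>+d. F (d + x) \<partial>lborel) = (\<integral>\<^sup>+y. F y \<partial>lborel)" if [measurable]: "F \<in> borel_measurable borel" for F :: "real^3 \<Rightarrow> ennreal" and x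
    using lborel_nn_integral_translate[OF that, of x] by (simp add: add.commute)
  have "(\<integral>\<^sup>+x. \<integral>\<^sup>+y. indicator U x * indicator U y * ennreal ((f y - f x)\<^sup>2) \<partial>lborel \<partial>lborel) = (\<integral>\<^sup>+x. \<integral>\<^sup>+d. P x d \<partial>lborel \<partial>lborel)"
    unfolding P_def
    by (rule nn_integral_cong) (rule tr[symmetric], measurable)
  also have "\<dots> = (\<integral>\<^sup>+d. \<integral>\<^sup>+x. P x d \<partial>lborel \<partial>lborel)"
    unfolding P_def by (rule lborel_pair.Fubini') measurable
  also have "\<dots> \<le> (\<integral>\<^sup>+d. \<integral>\<^sup>+x. Q x d \<partial>lborel \<partial>lborel)"
    by (intro nn_integral_mono PQ)
  also have "\<dots> = (\<integral>\<^sup>+x. \<integral>\<^sup>+d. Q x d \<partial>lborel \<partial>lborel)"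
    unfolding Q_def by (rule lborel_pair.Fubini'[symmetric]) measurable
  also have "\<dots> = (\<integral>\<^sup>+x. \<integral>\<^sup>+y. indicator U x * indicator U y * (ennreal (h\<^sup>2) * (\<integral>\<^sup>+t. indicator {0..1} t * ennreal ((norm (G (x + t *\<^sub>R (y - x))))\<^sup>2) \<partial>lborel)) \<partial>lborel \<partial>lborel)"
  proof (rule nn_integral_cong)
    fix x
    show "(\<integral>\<^sup>+d. Q x d \<partial>lborel) = (\<integral>\<^sup>+y. indicator U x * indicator U y * (ennreal (h\<^sup>2) * (\<integral>\<^sup>+t. indicator {0..1} t * ennreal ((norm (G (x + t *\<^sub>R (y - x))))\<^sup>2) \<partial>lborel)) \<partial>lborel)"
      using tr[of "\<lambda>y. indicator U x * indicator U y * (ennreal (h\<^sup>2) * (\<integral>\<^sup>+t. indicator {0..1} t * ennreal ((norm (G (x + t *\<^sub>R (y - x))))\<^sup>2) \<partial>lborel))" x]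
      by (simp add: Q_def)
  qed
  also have "\<dots> = (\<integral>\<^sup>+x. \<integral>\<^sup>+y. \<integral>\<^sup>+t. ennreal (h\<^sup>2) * indicator {0..1} t * (indicator U x * indicator U y * ennreal ((norm (G (x + t *\<^sub>R (y - x))))\<^sup>2)) \<partial>lborel \<partial>lborel \<partial>lborel)"
    by (intro nn_integral_cong) (simp add: nn_integral_cmult[symmetric] mult_ac)
  also have "\<dots> = (\<integral>\<^sup>+x. \<integral>\<^sup>+t. \<integral>\<^sup>+y. ennreal (h\<^sup>2) * indicator {0..1} t * (indicator U x * indicator U y * ennreal ((norm (G (x + t *\<^sub>R (y - x))))\<^sup>2)) \<partial>lborel \<partial>lborel \<partial>lborel)"
    by (intro nn_integral_cong lborel_pair.Fubini') measurable
  also have "\<dots> = (\<integral>\<^sup>+t. \<integral>\<^sup>+x. \<integral>\<^sup>+y. ennreal (h\<^sup>2) * indicator {0..1} t * (indicator U x * indicator U y * ennreal ((norm (G (x + t *\<^sub>R (y - x))))\<^sup>2)) \<partial>lborel \<partial>lborel \<partial>lborel)"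
    by (rule lborel_pair.Fubini') measurable
  also have "\<dots> = (\<integral>\<^sup>+t. ennreal (h\<^sup>2) * indicator {0..1} t * J t \<partial>lborel)"
  proof (rule nn_integral_cong)
    fix t :: real
    have e: "x + t *\<^sub>R (y - x) = (1 - t) *\<^sub>R x + t *\<^sub>R y" for x y :: "real^3" by (simp add: algebra_simps)
    show "(\<integral>\<^sup>+x. \<integral>\<^sup>+y. ennreal (h\<^sup>2) * indicator {0..1} t * (indicator U x * indicator U y * ennreal ((norm (G (x + t *\<^sub>R (y - x))))\<^sup>2)) \<partial>lborel \<partial>lborel) = ennreal (h\<^sup>2) * indicator {0..1} t * J t"
      unfolding J_def e by (simp add: nn_integral_cmult[symmetric] nn_integral_multc[symmetric] mult_ac)
  qed
  also have "\<dots> \<le> (\<integral>\<^sup>+t. ennreal (h\<^sup>2) * (8 * N * ennreal m) * indicator {0..1::real} t \<partial>lborel)"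
  proof (rule nn_integral_mono)
    fix t :: real
    show "ennreal (h\<^sup>2) * indicator {0..1} t * J t \<le> ennreal (h\<^sup>2) * (8 * N * ennreal m) * indicator {0..1} t"
      using mult_left_mono[OF J, of "ennreal (h\<^sup>2)" t] by (auto split: split_indicator)
  qed
  also have "\<dots> = ennreal (h\<^sup>2) * (8 * N * ennreal m)" by (simp add: nn_integral_cmult_indicator)
  finally have main: "(\<integral>\<^sup>+x. \<integral>\<^sup>+y. indicator U x * indicator U y * ennreal ((f y - f x)\<^sup>2) \<partial>lborel \<partial>lborel)
     \<le> ennreal (h\<^sup>2) * (8 * N * ennreal m)" .
  define c where "c = (1 / m) * (LINT y:U|lborel. f y)"
  have si: "set_integrable lborel U f" unfolding set_integrable_def using f by (intro integrable_mult_indicator) auto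
  \<comment> \<open>The integral of \<open>f y - f x\<close> over \<open>y\<close> is
    \<open>m (c - f x)\<close>; \<open>sq_integral_le\<close> bounds its square, and one factor
    \<open>m\<close> cancels.\<close>
  have pt: "ennreal m * ennreal ((f x - c)\<^sup>2) \<le> (\<integral>\<^sup>+y\<in>U. ennreal ((f y - f x)\<^sup>2) \<partial>lborel)" for x
  proof -
    have sc: "set_integrable lborel U (\<lambda>y. f x)"
      using eU by (simp add: set_integrable_def integrable_mult_left_iff less_top[symmetric])
    have "(LINT y:U|lborel. f y - f x) = (LINT y:U|lborel. f y) - (LINT y:U|lborel. f x)"
      by (rule set_integral_diff(2)[OF si sc])
    also have "(LINT y:U|lborel. f x) = m * f x" by (simp add: set_lebesgue_integral_def m_def)
    finally have "(LINT y:U|lborel. f y - f x) = m * (c - f x)" using m0 by (simp add: c_def right_diff_distrib)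
    then have "ennreal ((m * (c - f x))\<^sup>2) \<le> ennreal m * (\<integral>\<^sup>+y\<in>U. ennreal ((f y - f x)\<^sup>2) \<partial>lborel)"
      using sq_integral_le[of U lborel "\<lambda>y. f y - f x" m] eU m0 by simp
    moreover have "(m * (c - f x))\<^sup>2 = m * (m * (f x - c)\<^sup>2)" by (simp add: power2_eq_square algebra_simps)
    then have "ennreal ((m * (c - f x))\<^sup>2) = ennreal m * (ennreal m * ennreal ((f x - c)\<^sup>2))"
      using m0 by (simp add: ennreal_mult)
    ultimately show ?thesis using m0 by (simp add: ennreal_mult_le_mult_iff)
  qed
  have "ennreal m * (\<integral>\<^sup>+x\<in>U. ennreal ((f x - c)\<^sup>2) \<partial>lborel) = (\<integral>\<^sup>+x. (ennreal m * ennreal ((f x - c)\<^sup>2)) * indicator U x \<partial>lborel)"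
    by (simp add: nn_integral_cmult[symmetric] mult.assoc)
  also have "\<dots> \<le> (\<integral>\<^sup>+x. (\<integral>\<^sup>+y\<in>U. ennreal ((f y - f x)\<^sup>2) \<partial>lborel) * indicator U x \<partial>lborel)"
    by (intro nn_integral_mono mult_right_mono pt) simp
  also have "\<dots> = (\<integral>\<^sup>+x. \<integral>\<^sup>+y. indicator U x * indicator U y * ennreal ((f y - f x)\<^sup>2) \<partial>lborel \<partial>lborel)"
    by (intro nn_integral_cong) (simp add: nn_integral_cmult[symmetric] mult_ac)
  also note main
  also have "ennreal (h\<^sup>2) * (8 * N * ennreal m) = ennreal m * (ennreal (8 * h\<^sup>2) * N)"
    by (simp add: ennreal_mult mult_ac)
  finally have "ennreal m * (\<integral>\<^sup>+x\<in>U. ennreal ((f x - c)\<^sup>2) \<partial>lborel) \<le> ennreal m * (ennreal (8 * h\<^sup>2) * N)" .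
  then have "(\<integral>\<^sup>+x\<in>U. ennreal ((f x - c)\<^sup>2) \<partial>lborel) \<le> ennreal (8 * h\<^sup>2) * N"
    using m0 by (simp add: ennreal_mult_le_mult_iff)
  then show ?thesis unfolding c_def m_def h_def N_def .
qed

section \<open>Square integrable functions\<close>

lemma L2D:
  assumes "f \<in> L2 U"
  shows "(\<lambda>x. indicator U x *\<^sub>R f x) \<in> borel_measurable lebesgue"
    "integrable lebesgue (\<lambda>x. indicator U x *\<^sub>R (norm (f x))\<^sup>2)"
  using assms by (auto simp: L2_def set_borel_measurable_def set_integrable_def)

lemma L2_integrable_inner:
  fixes f g :: "real^3 \<Rightarrow> 'b::euclidean_space"
  assumes f: "f \<in> L2 U" and g: "g \<in> L2 U"
  shows "set_integrable lebesgue U (\<lambda>x. f x \<bullet> g x)"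
proof -
  have "integrable lebesgue (\<lambda>x. (indicator U x *\<^sub>R f x) \<bullet> (indicator U x *\<^sub>R g x))"
  proof (rule Bochner_Integration.integrable_bound)
    show "integrable lebesgue (\<lambda>x. indicator U x *\<^sub>R (norm (f x))\<^sup>2 + indicator U x *\<^sub>R (norm (g x))\<^sup>2)"
      using L2D(2)[OF f] L2D(2)[OF g] by (rule Bochner_Integration.integrable_add)
    show "(\<lambda>x. (indicator U x *\<^sub>R f x) \<bullet> (indicator U x *\<^sub>R g x)) \<in> borel_measurable lebesgue"
      using L2D(1)[OF f] L2D(1)[OF g] by (rule borel_measurable_inner)
    have "\<bar>a \<bullet> b\<bar> \<le> (norm a)\<^sup>2 + (norm b)\<^sup>2" for a b :: 'b
    proof -
      have "\<bar>a \<bullet> b\<bar> \<le> norm a * norm b" by (rule Cauchy_Schwarz_ineq2)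
      moreover have "0 \<le> (norm a - norm b)\<^sup>2" "0 \<le> norm a * norm b" by simp_all
      ultimately show ?thesis by (simp add: power2_diff)
    qed
    then show "AE x in lebesgue. norm ((indicator U x *\<^sub>R f x) \<bullet> (indicator U x *\<^sub>R g x))
       \<le> norm (indicator U x *\<^sub>R (norm (f x))\<^sup>2 + indicator U x *\<^sub>R (norm (g x))\<^sup>2)"
      by (auto split: split_indicator)
  qed
  then show ?thesis unfolding set_integrable_def
    by (rule Bochner_Integration.integrable_cong[THEN iffD1, rotated -1]) (auto split: split_indicator)
qed

lemma L2_norm_power2: "(L2_norm U f)\<^sup>2 = (LINT x:U|lebesgue. (norm (f x))\<^sup>2)"
  unfolding L2_norm_def by (rule real_sqrt_pow2) (auto simp: set_lebesgue_integral_def intro!: Bochner_Integration.integral_nonneg)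

lemma L2_norm_nonneg: "0 \<le> L2_norm U f"
  unfolding L2_norm_def by (auto simp: set_lebesgue_integral_def intro!: Bochner_Integration.integral_nonneg)

lemma L2_norm_le:
  assumes "(LINT x:U|lebesgue. (norm (f x))\<^sup>2) \<le> B\<^sup>2" "0 \<le> B"
  shows "L2_norm U f \<le> B"
  unfolding L2_norm_def using real_sqrt_le_mono[OF assms(1)] assms(2) by simp

text \<open>Young's inequality with a free parameter, read backwards: the optimal parameter is
  \<open>t = I / A\<close>, and for \<open>A = 0\<close> a large \<open>t\<close> contradicts
  \<open>I > 0\<close>. It yields Cauchy-Schwarz from a pointwise inequality without normalising the
  functions.\<close>

lemma sq_le_of_young:
  fixes I A B :: real
  assumes "\<And>t. 0 < t \<Longrightarrow> 2 * I \<le> t * A + B / t" "0 \<le> I" "0 \<le> A" "0 \<le> B"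
  shows "I\<^sup>2 \<le> A * B"
proof (cases "I = 0")
  case False
  then have I: "I > 0" using assms by simp
  show ?thesis
  proof (cases "A = 0")
    case True
    have "2 * I \<le> B / ((B + 1) / I)" using assms(1)[of "(B + 1) / I"] I assms(4) True by simp
    then have "2 * I * (B + 1) \<le> B * I" using I assms(4) by (simp add: field_simps)
    then have "I * (B + 2) \<le> 0" by (simp add: algebra_simps)
    then show ?thesis using I assms(4) by (simp add: mult_le_0_iff)
  next
    case F: False
    then have A: "A > 0" using assms by simp
    have "2 * I \<le> I + B * A / I" using assms(1)[of "I / A"] I A by simp
    then show ?thesis using I by (simp add: field_simps power2_eq_square)
  qed
qed (use assms in simp)

lemma L2_Cauchy_Schwarz:
  fixes f g :: "real^3 \<Rightarrow> 'b::euclidean_space"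
  assumes f: "f \<in> L2 U" and g: "g \<in> L2 U"
  shows "\<bar>LINT x:U|lebesgue. f x \<bullet> g x\<bar> \<le> L2_norm U f * L2_norm U g"
proof -
  let ?I = "\<bar>LINT x:U|lebesgue. f x \<bullet> g x\<bar>"
  have i: "integrable lebesgue (\<lambda>x. indicator U x *\<^sub>R (f x \<bullet> g x))" using L2_integrable_inner[OF f g] by (simp add: set_integrable_def)
  have "2 * ?I \<le> t * (L2_norm U f)\<^sup>2 + (L2_norm U g)\<^sup>2 / t" if t: "t > 0" for t
  proof -
    have "?I \<le> (LINT x|lebesgue. \<bar>indicator U x *\<^sub>R (f x \<bullet> g x)\<bar>)"
      unfolding set_lebesgue_integral_def by (rule integral_abs_bound)
    then have "2 * ?I \<le> (LINT x|lebesgue. 2 * \<bar>indicator U x *\<^sub>R (f x \<bullet> g x)\<bar>)" using i by simp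
    also have "\<dots> \<le> (LINT x|lebesgue. t * (indicator U x *\<^sub>R (norm (f x))\<^sup>2) + (indicator U x *\<^sub>R (norm (g x))\<^sup>2) / t)"
    proof (rule integral_mono)
      show "integrable lebesgue (\<lambda>x. 2 * \<bar>indicator U x *\<^sub>R (f x \<bullet> g x)\<bar>)" using i by simp
      show "integrable lebesgue (\<lambda>x. t * (indicator U x *\<^sub>R (norm (f x))\<^sup>2) + (indicator U x *\<^sub>R (norm (g x))\<^sup>2) / t)"
        using L2D(2)[OF f] L2D(2)[OF g] by auto
      fix x
      have "2 * \<bar>f x \<bullet> g x\<bar> \<le> t * (norm (f x))\<^sup>2 + (norm (g x))\<^sup>2 / t"
      proof -
        have "\<bar>f x \<bullet> g x\<bar> \<le> norm (f x) * norm (g x)" by (rule Cauchy_Schwarz_ineq2)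
        moreover have "0 \<le> (t * norm (f x) - norm (g x))\<^sup>2 / t" using t by simp
        moreover have "(t * norm (f x) - norm (g x))\<^sup>2 / t = t * (norm (f x))\<^sup>2 + (norm (g x))\<^sup>2 / t - 2 * (norm (f x) * norm (g x))"
          using t by (simp add: power2_eq_square field_simps)
        ultimately show ?thesis by linarith
      qed
      then show "2 * \<bar>indicator U x *\<^sub>R (f x \<bullet> g x)\<bar> \<le> t * (indicator U x *\<^sub>R (norm (f x))\<^sup>2) + (indicator U x *\<^sub>R (norm (g x))\<^sup>2) / t"
        by (auto split: split_indicator)
    qed
    also have "\<dots> = t * (L2_norm U f)\<^sup>2 + (L2_norm U g)\<^sup>2 / t"
      unfolding L2_norm_power2 set_lebesgue_integral_def using L2D(2)[OF f] L2D(2)[OF g]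
      by (subst Bochner_Integration.integral_add) auto
    finally show ?thesis .
  qed
  then have "?I\<^sup>2 \<le> (L2_norm U f)\<^sup>2 * (L2_norm U g)\<^sup>2" by (rule sq_le_of_young) auto
  then have "?I\<^sup>2 \<le> (L2_norm U f * L2_norm U g)\<^sup>2" by (simp add: power_mult_distrib)
  then show ?thesis by (rule power2_le_imp_le) (simp add: L2_norm_nonneg)
qed

lemma L2_scaleR:
  assumes f: "f \<in> L2 U" shows "(\<lambda>x. c *\<^sub>R f x) \<in> L2 U"
proof -
  have "(\<lambda>x. c *\<^sub>R (indicat_real U x *\<^sub>R f x)) \<in> borel_measurable lebesgue"
    by (rule borel_measurable_scaleR[OF borel_measurable_const L2D(1)[OF f]])
  then have "(\<lambda>x. indicat_real U x *\<^sub>R (c *\<^sub>R f x)) \<in> borel_measurable lebesgue"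
    by (simp only: scaleR_left_commute)
  moreover have "integrable lebesgue (\<lambda>x. c\<^sup>2 * (indicator U x *\<^sub>R (norm (f x))\<^sup>2))" using L2D(2)[OF f] by simp
  ultimately show ?thesis
    unfolding L2_def set_borel_measurable_def set_integrable_def by (simp add: power_mult_distrib mult.left_commute)
qed

lemma L2_add:
  assumes f: "f \<in> L2 U" and g: "g \<in> L2 U" shows "(\<lambda>x. f x + g x) \<in> L2 U"
proof -
  have m: "(\<lambda>x. indicator U x *\<^sub>R f x + indicator U x *\<^sub>R g x) \<in> borel_measurable lebesgue"
    using L2D(1)[OF f] L2D(1)[OF g] by simp
  have "integrable lebesgue (\<lambda>x. indicator U x *\<^sub>R (norm (f x))\<^sup>2 + 2 * (indicator U x *\<^sub>R (f x \<bullet> g x)) + indicator U x *\<^sub>R (norm (g x))\<^sup>2)"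
    using L2D(2)[OF f] L2D(2)[OF g] L2_integrable_inner[OF f g] by (auto simp: set_integrable_def)
  moreover have "indicator U x *\<^sub>R (norm (f x))\<^sup>2 + 2 * (indicator U x *\<^sub>R (f x \<bullet> g x)) + indicator U x *\<^sub>R (norm (g x))\<^sup>2
     = indicator U x *\<^sub>R (norm (f x + g x))\<^sup>2" for x
    by (simp add: power2_norm_eq_inner inner_simps inner_commute algebra_simps)
  ultimately show ?thesis using m
    by (simp add: L2_def set_borel_measurable_def set_integrable_def scaleR_add_right)
qed

lemma L2_diff: "f \<in> L2 U \<Longrightarrow> g \<in> L2 U \<Longrightarrow> (\<lambda>x. f x - g x) \<in> L2 U"
  using L2_add[of f U "\<lambda>x. (-1) *\<^sub>R g x"] L2_scaleR[of g U "-1"] by simp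

lemma L2_norm_triangle:
  assumes f: "f \<in> L2 U" and g: "g \<in> L2 U"
  shows "L2_norm U (\<lambda>x. f x + g x) \<le> L2_norm U f + L2_norm U g"
proof (rule L2_norm_le)
  have "(LINT x:U|lebesgue. (norm (f x + g x))\<^sup>2) = (LINT x|lebesgue. indicator U x *\<^sub>R (norm (f x))\<^sup>2 + 2 * (indicator U x *\<^sub>R (f x \<bullet> g x)) + indicator U x *\<^sub>R (norm (g x))\<^sup>2)"
    unfolding set_lebesgue_integral_def
    by (rule Bochner_Integration.integral_cong) (auto simp: power2_norm_eq_inner inner_simps inner_commute algebra_simps)
  also have "\<dots> = (L2_norm U f)\<^sup>2 + 2 * (LINT x:U|lebesgue. f x \<bullet> g x) + (L2_norm U g)\<^sup>2"
    unfolding L2_norm_power2 set_lebesgue_integral_def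
    using L2D(2)[OF f] L2D(2)[OF g] L2_integrable_inner[OF f g]
    by (subst Bochner_Integration.integral_add; (subst Bochner_Integration.integral_add)?) (auto simp: set_integrable_def)
  also have "\<dots> \<le> (L2_norm U f + L2_norm U g)\<^sup>2"
    using L2_Cauchy_Schwarz[OF f g] by (simp add: power2_sum abs_le_iff)
  finally show "(LINT x:U|lebesgue. (norm (f x + g x))\<^sup>2) \<le> (L2_norm U f + L2_norm U g)\<^sup>2" .
qed (simp add: L2_norm_nonneg)

lemma L2_norm_scaleR: "L2_norm U (\<lambda>x. c *\<^sub>R f x) = \<bar>c\<bar> * L2_norm U f"
proof -
  have "(LINT x:U|lebesgue. (norm (c *\<^sub>R f x))\<^sup>2) = c\<^sup>2 * (LINT x:U|lebesgue. (norm (f x))\<^sup>2)"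
    unfolding set_lebesgue_integral_def
    by (subst Bochner_Integration.integral_mult_right_zero[symmetric]) (simp add: power_mult_distrib mult_ac)
  then show ?thesis unfolding L2_norm_def by (simp add: real_sqrt_mult)
qed

lemma L2_mono:
  assumes f: "f \<in> L2 U" and V: "V \<in> sets lebesgue" "V \<subseteq> U" shows "f \<in> L2 V"
proof -
  have "(\<lambda>x. indicator V x *\<^sub>R (indicator U x *\<^sub>R f x)) \<in> borel_measurable lebesgue"
    by (rule borel_measurable_scaleR[OF borel_measurable_indicator[OF V(1)] L2D(1)[OF f]])
  moreover have "indicator V x *\<^sub>R (indicator U x *\<^sub>R f x) = indicator V x *\<^sub>R f x" for x
    using V by (auto split: split_indicator)
  ultimately have "set_borel_measurable lebesgue V f" by (simp only: set_borel_measurable_def)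
  moreover have "set_integrable lebesgue V (\<lambda>x. (norm (f x))\<^sup>2)"
    by (rule set_integrable_subset[of _ U]) (use f V in \<open>auto simp: L2_def\<close>)
  ultimately show ?thesis by (simp add: L2_def)
qed

lemma L2_norm_cong_AE:
  assumes f: "f \<in> L2 U" and g: "g \<in> L2 U" and "AE x in lebesgue. x \<in> U \<longrightarrow> f x = g x"
  shows "L2_norm U f = L2_norm U g"
proof -
  have "(LINT x:U|lebesgue. (norm (f x))\<^sup>2) = (LINT x:U|lebesgue. (norm (g x))\<^sup>2)"
    unfolding set_lebesgue_integral_def
  proof (rule integral_cong_AE)
    show "AE x in lebesgue. indicat_real U x *\<^sub>R (norm (f x))\<^sup>2 = indicat_real U x *\<^sub>R (norm (g x))\<^sup>2"
      using assms(3) by eventually_elim (auto split: split_indicator)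
  qed (use L2D(2)[OF f] L2D(2)[OF g] in auto)
  then show ?thesis by (simp add: L2_norm_def)
qed

text \<open>The set \<open>S\<close> localises the bound: with a ball for \<open>S\<close> and an
  element for \<open>U\<close> it gives the factor \<open>\<rho>^(3/2)\<close> on which the scaling
  of the bump estimates rests.\<close>

lemma L2_bounded:
  fixes f :: "real^3 \<Rightarrow> 'b::euclidean_space"
  assumes U: "U \<in> lmeasurable" and m: "f \<in> borel_measurable lebesgue"
    and S: "S \<in> lmeasurable" "\<And>x. x \<in> U \<Longrightarrow> norm (f x) \<le> B * indicator S x" "0 \<le> B"
  shows "f \<in> L2 U" "L2_norm U f \<le> B * sqrt (measure lebesgue S)"
proof -
  have Us: "U \<in> sets lebesgue" using U fmeasurableD by blast
  have le: "(norm (f x))\<^sup>2 \<le> B\<^sup>2 * indicator S x" if "x \<in> U" for x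
    using power_mono[OF S(2)[OF that], of 2] by (auto simp: power_mult_distrib split: split_indicator_asm split_indicator)
  have iS: "integrable lebesgue (\<lambda>x. B\<^sup>2 * indicator S x)"
    using S(1) by (auto simp: fmeasurable_def less_top)
  have i: "integrable lebesgue (\<lambda>x. indicator U x *\<^sub>R (norm (f x))\<^sup>2)"
  proof (rule Bochner_Integration.integrable_bound[OF iS])
    show "(\<lambda>x. indicator U x *\<^sub>R (norm (f x))\<^sup>2) \<in> borel_measurable lebesgue"
      using m Us by (intro borel_measurable_scaleR borel_measurable_indicator) auto
    have "norm (indicat_real U x *\<^sub>R (norm (f x))\<^sup>2) \<le> norm (B\<^sup>2 * indicat_real S x)" for x
      using le[of x] by (cases "x \<in> U") auto
    then show "AE x in lebesgue. norm (indicat_real U x *\<^sub>R (norm (f x))\<^sup>2) \<le> norm (B\<^sup>2 * indicat_real S x)" by simp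
  qed
  moreover have "(\<lambda>x. indicator U x *\<^sub>R f x) \<in> borel_measurable lebesgue"
    using m Us by (intro borel_measurable_scaleR borel_measurable_indicator) auto
  ultimately show "f \<in> L2 U" by (simp add: L2_def set_borel_measurable_def set_integrable_def)
  have "(LINT x:U|lebesgue. (norm (f x))\<^sup>2) \<le> (LINT x|lebesgue. B\<^sup>2 * indicator S x)"
    unfolding set_lebesgue_integral_def
  proof (rule integral_mono[OF i iS])
    show "indicat_real U x *\<^sub>R (norm (f x))\<^sup>2 \<le> B\<^sup>2 * indicat_real S x" for x
      using le[of x] by (cases "x \<in> U") auto
  qed
  also have "\<dots> = B\<^sup>2 * measure lebesgue S" by simp
  also have "\<dots> = (B * sqrt (measure lebesgue S))\<^sup>2" by (simp add: power_mult_distrib)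
  finally show "L2_norm U f \<le> B * sqrt (measure lebesgue S)" by (rule L2_norm_le) (use S(3) in auto)
qed

lemma L2_const:
  fixes c :: "'b::euclidean_space"
  assumes "U \<in> lmeasurable" shows "(\<lambda>x. c) \<in> L2 U"
  by (rule L2_bounded(1)[OF assms _ assms, of _ "norm c"]) auto

lemma L2_componentwise_integrable:
  fixes f :: "real^3 \<Rightarrow> 'b::euclidean_space"
  assumes "f \<in> L2 U" "U \<in> lmeasurable"
  shows "set_integrable lebesgue U (\<lambda>x. f x \<bullet> c)"
  by (rule L2_integrable_inner[OF assms(1) L2_const[OF assms(2)]])

lemma L2_set_integrable:
  fixes f :: "real^3 \<Rightarrow> 'b::euclidean_space"
  assumes "f \<in> L2 U" "U \<in> lmeasurable"
  shows "set_integrable lebesgue U f"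
proof -
  have "integrable lebesgue (\<lambda>x. \<Sum>b\<in>Basis. (indicator U x *\<^sub>R (f x \<bullet> b)) *\<^sub>R b)"
    using L2_componentwise_integrable[OF assms] unfolding set_integrable_def
    by (intro Bochner_Integration.integrable_sum integrable_scaleR_left) auto
  moreover have "(\<Sum>b\<in>Basis. (indicator U x *\<^sub>R (f x \<bullet> b)) *\<^sub>R b) = indicator U x *\<^sub>R f x" for x
    by (auto simp: euclidean_representation split: split_indicator)
  ultimately show ?thesis by (simp add: set_integrable_def)
qed

lemma L2_inner_const:
  fixes f :: "real^3 \<Rightarrow> 'b::euclidean_space"
  assumes f: "f \<in> L2 U" shows "(\<lambda>x. f x \<bullet> c) \<in> L2 U"
proof -
  have m: "(\<lambda>x. indicator U x *\<^sub>R (f x \<bullet> c)) \<in> borel_measurable lebesgue"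
    using borel_measurable_inner[OF L2D(1)[OF f], of "\<lambda>x. c"] by simp
  have "integrable lebesgue (\<lambda>x. indicator U x *\<^sub>R (f x \<bullet> c)\<^sup>2)"
  proof (rule Bochner_Integration.integrable_bound)
    show "integrable lebesgue (\<lambda>x. (norm c)\<^sup>2 * (indicator U x *\<^sub>R (norm (f x))\<^sup>2))" using L2D(2)[OF f] by simp
    have "(\<lambda>x. (indicator U x *\<^sub>R (f x \<bullet> c))\<^sup>2) \<in> borel_measurable lebesgue" using m by simp
    moreover have "(indicator U x *\<^sub>R (f x \<bullet> c))\<^sup>2 = indicator U x *\<^sub>R (f x \<bullet> c)\<^sup>2" for x by (auto split: split_indicator)
    ultimately show "(\<lambda>x. indicator U x *\<^sub>R (f x \<bullet> c)\<^sup>2) \<in> borel_measurable lebesgue" by simp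
    have "(f x \<bullet> c)\<^sup>2 \<le> (norm c)\<^sup>2 * (norm (f x))\<^sup>2" for x
      using power_mono[OF Cauchy_Schwarz_ineq2[of "f x" c], of 2] by (simp add: power_mult_distrib mult.commute)
    then show "AE x in lebesgue. norm (indicat_real U x *\<^sub>R (f x \<bullet> c)\<^sup>2) \<le> norm ((norm c)\<^sup>2 * (indicat_real U x *\<^sub>R (norm (f x))\<^sup>2))"
      by (auto split: split_indicator)
  qed
  with m show ?thesis by (simp add: L2_def set_borel_measurable_def set_integrable_def)
qed

lemma L2_component: "f \<in> L2 U \<Longrightarrow> (\<lambda>x. f x $ i) \<in> L2 U" for f :: "real^3 \<Rightarrow> real^'n"
  using L2_inner_const[of f U "axis i 1"] by (simp add: inner_axis)

lemma L2_component2: "G \<in> L2 U \<Longrightarrow> (\<lambda>x. G x $ i $ j) \<in> L2 U" for G :: "real^3 \<Rightarrow> real^3^3"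
  using L2_inner_const[of G U "axis i (axis j 1)"] by (simp add: inner_axis)

lemma L2_row: "G \<in> L2 U \<Longrightarrow> (\<lambda>x. G x $ i) \<in> L2 U" for G :: "real^3 \<Rightarrow> real^3^3"
proof -
  assume G: "G \<in> L2 U"
  have "(\<lambda>x. \<Sum>j\<in>UNIV. (G x $ i $ j) *\<^sub>R (axis j 1 :: real^3)) \<in> L2 U"
  proof -
    have a: "(\<lambda>x. f x *\<^sub>R (c::real^3)) \<in> L2 U" if f: "f \<in> L2 U" for f :: "real^3 \<Rightarrow> real" and c
    proof -
      have "(\<lambda>x. (indicator U x *\<^sub>R f x) *\<^sub>R c) \<in> borel_measurable lebesgue" using L2D(1)[OF f] by simp
      moreover have "integrable lebesgue (\<lambda>x. (norm c)\<^sup>2 * (indicator U x *\<^sub>R (norm (f x))\<^sup>2))" using L2D(2)[OF f] by simp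
      ultimately show ?thesis by (simp add: L2_def set_borel_measurable_def set_integrable_def power_mult_distrib mult_ac)
    qed
    show ?thesis unfolding sum_3 by (intro L2_add; rule a[OF L2_component2[OF G]])
  qed
  moreover have "(\<Sum>j\<in>UNIV. (G x $ i $ j) *\<^sub>R (axis j 1 :: real^3)) = G x $ i" for x
    by (simp add: vec_eq_iff sum_3 forall_3 axis_def)
  ultimately show ?thesis by simp
qed

lemma lebesgue_integral_borel_rep:
  fixes f f0 h :: "real^3 \<Rightarrow> real"
  assumes f: "(\<lambda>x. indicator U x *\<^sub>R f x) \<in> borel_measurable lebesgue" and f0[measurable]: "f0 \<in> borel_measurable borel"
    and ae: "AE x in lebesgue. indicator U x *\<^sub>R f x = f0 x" and h[measurable]: "h \<in> borel_measurable borel"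
  shows "(LINT x:U|lebesgue. f x * h x) = (LINT x|lborel. f0 x * h x)"
proof -
  have hl: "h \<in> borel_measurable lebesgue" "f0 \<in> borel_measurable lebesgue" by (rule measurable_completion, simp)+
  have "(LINT x:U|lebesgue. f x * h x) = (LINT x|lebesgue. (indicator U x *\<^sub>R f x) * h x)"
    unfolding set_lebesgue_integral_def by (simp add: mult.assoc)
  also have "\<dots> = (LINT x|lebesgue. f0 x * h x)"
  proof (rule integral_cong_AE)
    show "(\<lambda>x. indicator U x *\<^sub>R f x * h x) \<in> borel_measurable lebesgue" by (rule borel_measurable_times[OF f hl(1)])
    show "(\<lambda>x. f0 x * h x) \<in> borel_measurable lebesgue" by (rule borel_measurable_times[OF hl(2,1)])
    show "AE x in lebesgue. indicator U x *\<^sub>R f x * h x = f0 x * h x" using ae by eventually_elim simp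
  qed
  also have "\<dots> = (LINT x|lborel. f0 x * h x)" by (rule integral_completion) simp
  finally show ?thesis .
qed

text \<open>The Fubini arguments run over \<open>lborel\<close>, while \<open>L2\<close> is
  formulated with \<open>lebesgue\<close>; a Borel representative, extended by zero, is the bridge.
  Vanishing off \<open>U\<close> lets integrals over the whole space stand for integrals over
  \<open>U\<close>.\<close>

lemma borel_rep:
  fixes f :: "real^3 \<Rightarrow> real"
  assumes f: "f \<in> L2 U" and U: "open U" "bounded U"
  shows "\<exists>f0. f0 \<in> borel_measurable borel \<and> (AE x in lebesgue. indicator U x *\<^sub>R f x = f0 x) \<and>
    integrable lborel f0 \<and> integrable lborel (\<lambda>x. (f0 x)\<^sup>2) \<and> (\<forall>x. x \<notin> U \<longrightarrow> f0 x = 0)"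
proof -
  have Um: "U \<in> lmeasurable" using U by (simp add: lmeasurable_open)
  obtain f1 where f1[measurable]: "f1 \<in> borel_measurable lborel" and ae: "AE x in lborel. indicator U x *\<^sub>R f x = f1 x"
    using completion_ex_borel_measurable_real[OF L2D(1)[OF f]] by blast
  define f0 where "f0 x = indicator U x * f1 x" for x
  have [measurable]: "U \<in> sets borel" using U by simp
  have m[measurable]: "f0 \<in> borel_measurable borel" unfolding f0_def by measurable
  have ml: "f0 \<in> borel_measurable lebesgue" by (rule measurable_completion) simp
  have "AE x in lebesgue. indicator U x *\<^sub>R f x = f1 x" using ae by (rule AE_completion)
  then have ae0: "AE x in lebesgue. indicator U x *\<^sub>R f x = f0 x"
    by eventually_elim (auto simp: f0_def split: split_indicator_asm)
  have "integrable lebesgue (\<lambda>x. indicator U x *\<^sub>R f x)" using L2_set_integrable[OF f Um] by (simp add: set_integrable_def)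
  then have "integrable lebesgue f0" by (rule integrable_cong_AE_imp[OF _ ml]) (use ae0 in auto)
  then have i1: "integrable lborel f0" by (simp add: integrable_completion)
  have "integrable lebesgue (\<lambda>x. (f0 x)\<^sup>2)"
  proof (rule integrable_cong_AE_imp[OF L2D(2)[OF f]])
    show "(\<lambda>x. (f0 x)\<^sup>2) \<in> borel_measurable lebesgue" using ml by simp
    show "AE x in lebesgue. indicat_real U x *\<^sub>R (norm (f x))\<^sup>2 = (f0 x)\<^sup>2"
      using ae0 by eventually_elim (auto split: split_indicator split_indicator_asm)
  qed
  then have i2: "integrable lborel (\<lambda>x. (f0 x)\<^sup>2)" by (simp add: integrable_completion)
  show ?thesis by (intro exI[of _ f0] conjI m ae0 i1 i2) (simp add: f0_def)
qed

lemma norm_power2_vec3: "(norm (w::real^'n))\<^sup>2 = (\<Sum>i\<in>UNIV. (w $ i)\<^sup>2)"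
  unfolding power2_norm_eq_inner inner_vec_def by (simp add: power2_eq_square)

lemma norm_power2_mat: "(norm (A::real^'n^'m))\<^sup>2 = (\<Sum>i\<in>UNIV. (norm (A $ i))\<^sup>2)"
  unfolding power2_norm_eq_inner inner_vec_def ..

text \<open>\<open>poincare_borel\<close> for Borel representatives of \<open>f\<close> and of the
  components of \<open>G\<close>. The weak derivatives, given along the axes only, extend to all
  directions by linearity of the derivative.\<close>

lemma poincare_scalar:
  fixes f :: "real^3 \<Rightarrow> real" and G :: "real^3 \<Rightarrow> real^3"
  assumes U: "open U" "convex U" "bounded U" "U \<noteq> {}" and f: "f \<in> L2 U" and G: "G \<in> L2 U"
    and weak: "\<And>\<psi> j. test_function U \<psi> \<Longrightarrow>
       (LINT x:U|lebesgue. f x * frechet_derivative \<psi> (at x) (axis j 1)) = - (LINT x:U|lebesgue. G x $ j * \<psi> x)"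
  defines "c \<equiv> (1 / measure lebesgue U) * (LINT x:U|lebesgue. f x)"
  shows "(LINT x:U|lebesgue. (f x - c)\<^sup>2) \<le> 8 * (diameter U)\<^sup>2 * (LINT x:U|lebesgue. (norm (G x))\<^sup>2)"
proof -
  have Um: "U \<in> lmeasurable" using U by (simp add: lmeasurable_open)
  have [measurable]: "U \<in> sets borel" using U by simp
  obtain f0 where f0[measurable]: "f0 \<in> borel_measurable borel" and fae: "AE x in lebesgue. indicator U x *\<^sub>R f x = f0 x"
    and fi: "integrable lborel f0" "integrable lborel (\<lambda>x. (f0 x)\<^sup>2)" and f00: "\<forall>x. x \<notin> U \<longrightarrow> f0 x = 0"
    using borel_rep[OF f U(1,3)] by (elim exE conjE) (rule that)
  have gex: "\<forall>j. \<exists>g0. g0 \<in> borel_measurable borel \<and> (AE x in lebesgue. indicator U x *\<^sub>R (G x $ j) = g0 x) \<and>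
    integrable lborel g0 \<and> integrable lborel (\<lambda>x. (g0 x)\<^sup>2) \<and> (\<forall>x. x \<notin> U \<longrightarrow> g0 x = 0)"
    by (rule allI, rule borel_rep[OF L2_component[OF G] U(1,3)])
  obtain g0 where g: "\<forall>j. g0 j \<in> borel_measurable borel \<and> (AE x in lebesgue. indicator U x *\<^sub>R (G x $ j) = g0 j x) \<and>
    integrable lborel (g0 j) \<and> integrable lborel (\<lambda>x. (g0 j x)\<^sup>2) \<and> (\<forall>x. x \<notin> U \<longrightarrow> g0 j x = 0)"
    using choice[OF gex] by (elim exE) (rule that)
  have g0[measurable]: "g0 j \<in> borel_measurable borel" for j by (rule g[THEN spec, THEN conjunct1])
  have gae: "AE x in lebesgue. indicator U x *\<^sub>R (G x $ j) = g0 j x" for j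
    by (rule g[THEN spec, THEN conjunct2, THEN conjunct1])
  have gi: "integrable lborel (g0 j)" "integrable lborel (\<lambda>x. (g0 j x)\<^sup>2)" for j
    by (rule g[THEN spec, THEN conjunct2, THEN conjunct2, THEN conjunct1]
        g[THEN spec, THEN conjunct2, THEN conjunct2, THEN conjunct2, THEN conjunct1])+
  define G0 where "G0 x = (\<Sum>j\<in>UNIV. g0 j x *\<^sub>R (axis j 1 :: real^3))" for x
  have G0j: "G0 x $ j = g0 j x" for x j
    by (simp add: G0_def sum_component axis_def if_distrib cong: if_cong)
  have G0m[measurable]: "G0 \<in> borel_measurable borel" unfolding G0_def by measurable
  have G0d: "G0 x \<bullet> d = (\<Sum>j\<in>UNIV. g0 j x * d $ j)" for x d by (simp add: inner_vec_def G0j)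
  have nG0: "(norm (G0 x))\<^sup>2 = (\<Sum>j\<in>UNIV. (g0 j x)\<^sup>2)" for x
    by (simp add: norm_power2_vec3 G0j)
  have fm: "(\<lambda>x. indicator U x *\<^sub>R f x) \<in> borel_measurable lebesgue" by (rule L2D(1)[OF f])
  have gm: "(\<lambda>x. indicator U x *\<^sub>R (G x $ j)) \<in> borel_measurable lebesgue" for j by (rule L2D(1)[OF L2_component[OF G]])
  define c0 where "c0 = (1 / measure lborel U) * (LINT y:U|lborel. f0 y)"
  have cc: "c0 = c"
  proof -
    have "(LINT x:U|lebesgue. f x) = (LINT x|lborel. f0 x)" using lebesgue_integral_borel_rep[OF fm f0 fae, of "\<lambda>x. 1"] by simp
    also have "\<dots> = (LINT y:U|lborel. f0 y)" unfolding set_lebesgue_integral_def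
      by (rule Bochner_Integration.integral_cong) (use f00 in \<open>auto split: split_indicator\<close>)
    finally show ?thesis by (simp add: c0_def c_def)
  qed
  have P: "(\<integral>\<^sup>+x\<in>U. ennreal ((f0 x - c0)\<^sup>2) \<partial>lborel)
     \<le> ennreal (8 * (diameter U)\<^sup>2) * (\<integral>\<^sup>+x. ennreal ((norm (G0 x))\<^sup>2) \<partial>lborel)"
    unfolding c0_def
  proof (rule poincare_borel[OF U fi])
    show "integrable lborel (\<lambda>x. G0 x \<bullet> d)" for d unfolding G0d by (intro Bochner_Integration.integrable_sum integrable_mult_left gi)
    fix \<psi> :: "real^3 \<Rightarrow> real" and d assume tf: "test_function U \<psi>"
    have sm: "smooth \<psi>" using tf test_function_def by blast
    have [measurable]: "\<psi> \<in> borel_measurable borel" by (rule smooth_borel[OF sm])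
    have dm: "(\<lambda>x. frechet_derivative \<psi> (at x) h) \<in> borel_measurable borel" for h by (rule smooth_borel[OF smooth_frechet_derivative[OF sm]])
    have lin: "frechet_derivative \<psi> (at x) d = (\<Sum>j\<in>UNIV. d $ j * frechet_derivative \<psi> (at x) (axis j 1))" for x
    proof -
      have l: "linear (frechet_derivative \<psi> (at x))" using smooth_has_derivative[OF sm] has_derivative_linear by blast
      have "d = (\<Sum>j\<in>UNIV. d $ j *\<^sub>R axis j 1)" by (simp add: vec_eq_iff sum_3 forall_3 axis_def)
      then have "frechet_derivative \<psi> (at x) d = frechet_derivative \<psi> (at x) (\<Sum>j\<in>UNIV. d $ j *\<^sub>R axis j 1)" by simp
      then show ?thesis by (simp add: linear_sum[OF l] linear_cmul[OF l])
    qed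
    have bnd: "integrable lborel (\<lambda>x. g x * \<phi> x)" if g: "integrable lborel g" and t: "test_function W \<phi>" for g \<phi> :: "real^3 \<Rightarrow> real" and W
    proof -
      have "integrable lebesgue g" using g borel_measurable_integrable[OF g] by (simp add: integrable_completion)
      then have "set_integrable lebesgue UNIV (\<lambda>x. g x * \<phi> x)" by (intro set_integrable_mult_test[OF _ t]) (simp add: set_integrable_def)
      moreover have "(\<lambda>x. g x * \<phi> x) \<in> borel_measurable lborel" using borel_measurable_integrable[OF g] t smooth_borel[of \<phi>]
        by (auto simp: test_function_def)
      ultimately show ?thesis by (simp add: set_integrable_def integrable_completion)
    qed
    have "(LINT x|lborel. f0 x * frechet_derivative \<psi> (at x) d) = (LINT x|lborel. (\<Sum>j\<in>UNIV. d $ j * (f0 x * frechet_derivative \<psi> (at x) (axis j 1))))"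
      by (rule Bochner_Integration.integral_cong) (auto simp: lin sum_distrib_left mult_ac)
    also have "\<dots> = (\<Sum>j\<in>UNIV. d $ j * (LINT x|lborel. f0 x * frechet_derivative \<psi> (at x) (axis j 1)))"
      by (subst Bochner_Integration.integral_sum) (auto intro!: integrable_mult_right bnd[OF fi(1) test_function_frechet[OF tf]])
    also have "\<dots> = (\<Sum>j\<in>UNIV. d $ j * (- (LINT x|lborel. g0 j x * \<psi> x)))"
      using lebesgue_integral_borel_rep[OF fm f0 fae dm] lebesgue_integral_borel_rep[OF gm g0 gae, of \<psi>] weak[OF tf] by simp
    also have "\<dots> = - (\<Sum>j\<in>UNIV. (LINT x|lborel. d $ j * (g0 j x * \<psi> x)))" by (simp add: sum_negf)
    also have "(\<Sum>j\<in>UNIV. (LINT x|lborel. d $ j * (g0 j x * \<psi> x))) = (LINT x|lborel. (\<Sum>j\<in>UNIV. d $ j * (g0 j x * \<psi> x)))"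
      by (subst Bochner_Integration.integral_sum) (auto intro!: integrable_mult_right bnd[OF gi(1) tf])
    also have "\<dots> = (LINT x|lborel. (G0 x \<bullet> d) * \<psi> x)"
      by (rule Bochner_Integration.integral_cong) (auto simp: G0d sum_distrib_left sum_distrib_right mult_ac)
    finally show "(LINT x|lborel. f0 x * frechet_derivative \<psi> (at x) d) = - (LINT x|lborel. (G0 x \<bullet> d) * \<psi> x)" .
  qed (rule G0m)
  have "integrable lborel (\<lambda>x. (norm (G0 x))\<^sup>2)" unfolding nG0 by (intro Bochner_Integration.integrable_sum gi)
  then have R1: "(\<integral>\<^sup>+x. ennreal ((norm (G0 x))\<^sup>2) \<partial>lborel) = ennreal (LINT x|lborel. (norm (G0 x))\<^sup>2)"
    by (intro nn_integral_eq_integral) auto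
  have R2: "(LINT x|lborel. (norm (G0 x))\<^sup>2) = (LINT x:U|lebesgue. (norm (G x))\<^sup>2)"
  proof -
    have "(LINT x|lborel. (norm (G0 x))\<^sup>2) = (LINT x|lebesgue. (norm (G0 x))\<^sup>2)"
      by (rule integral_completion[symmetric]) simp
    also have "\<dots> = (LINT x:U|lebesgue. (norm (G x))\<^sup>2)" unfolding set_lebesgue_integral_def
    proof (rule integral_cong_AE)
      show "(\<lambda>x. (norm (G0 x))\<^sup>2) \<in> borel_measurable lebesgue" by (rule measurable_completion) simp
      show "(\<lambda>x. indicat_real U x *\<^sub>R (norm (G x))\<^sup>2) \<in> borel_measurable lebesgue" using L2D(2)[OF G] by auto
      have "AE x in lebesgue. \<forall>j\<in>UNIV. indicator U x *\<^sub>R (G x $ j) = g0 j x" by (rule AE_finite_allI) (use gae in auto)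
      then show "AE x in lebesgue. (norm (G0 x))\<^sup>2 = indicat_real U x *\<^sub>R (norm (G x))\<^sup>2"
      proof eventually_elim
        case (elim x)
        then have "g0 j x = indicator U x *\<^sub>R (G x $ j)" for j by simp
        then have "(norm (G0 x))\<^sup>2 = (\<Sum>j\<in>UNIV. (indicator U x *\<^sub>R (G x $ j))\<^sup>2)" by (simp add: nG0)
        then show ?case by (simp add: norm_power2_vec3 split: split_indicator)
      qed
    qed
    finally show ?thesis .
  qed
  have fc: "(\<lambda>x. f x - c) \<in> L2 U" by (intro L2_diff f L2_const Um)
  have "ennreal (LINT x:U|lebesgue. (f x - c)\<^sup>2) = (\<integral>\<^sup>+x. ennreal (indicator U x *\<^sub>R (f x - c)\<^sup>2) \<partial>lebesgue)"
    unfolding set_lebesgue_integral_def using L2D(2)[OF fc]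
    by (intro nn_integral_eq_integral[symmetric]) auto
  also have "\<dots> = (\<integral>\<^sup>+x. ennreal ((f0 x - c)\<^sup>2) * indicator U x \<partial>lebesgue)"
    by (rule nn_integral_cong_AE) (use fae in eventually_elim, auto split: split_indicator split_indicator_asm)
  also have "\<dots> = (\<integral>\<^sup>+x. ennreal ((f0 x - c)\<^sup>2) * indicator U x \<partial>lborel)"
    by (rule nn_integral_completion)
  also have "\<dots> \<le> ennreal (8 * (diameter U)\<^sup>2) * ennreal (LINT x:U|lebesgue. (norm (G x))\<^sup>2)"
    using P unfolding cc R1 R2 .
  also have "\<dots> = ennreal (8 * (diameter U)\<^sup>2 * (LINT x:U|lebesgue. (norm (G x))\<^sup>2))"
    by (rule ennreal_mult'[symmetric]) simp
  finally show ?thesis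
    by (subst (asm) ennreal_le_iff) (auto simp: L2_norm_power2[symmetric])
qed

definition mean :: "(real^3) set \<Rightarrow> (real^3 \<Rightarrow> real^3) \<Rightarrow> real^3" where
  "mean U v = (1 / measure lebesgue U) *\<^sub>R (LINT x:U|lebesgue. v x)"

lemma set_integral_component:
  fixes v :: "real^3 \<Rightarrow> real^3"
  assumes "set_integrable lebesgue U v"
  shows "(LINT x:U|lebesgue. v x) $ i = (LINT x:U|lebesgue. v x $ i)"
proof -
  have "(LINT x:U|lebesgue. v x) \<bullet> axis i 1 = (LINT x|lebesgue. (indicator U x *\<^sub>R v x) \<bullet> axis i 1)"
    using assms unfolding set_lebesgue_integral_def set_integrable_def by (intro integral_inner_left[symmetric]) auto
  then show ?thesis by (simp add: inner_axis set_lebesgue_integral_def)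
qed

lemma poincare:
  fixes v :: "real^3 \<Rightarrow> real^3" and G :: "real^3 \<Rightarrow> real^3^3"
  assumes U: "open U" "convex U" "bounded U" "U \<noteq> {}" and v: "v \<in> L2 U" and G: "G \<in> L2 U"
    and weak: "has_weak_jacobian U v G"
  shows "L2_norm U (\<lambda>x. v x - mean U v) \<le> 3 * diameter U * L2_norm U G"
proof (rule L2_norm_le)
  have Um: "U \<in> lmeasurable" using U by (simp add: lmeasurable_open)
  have d0: "0 \<le> diameter U" by (rule diameter_ge_0[OF U(3)])
  show "0 \<le> 3 * diameter U * L2_norm U G" using d0 by (simp add: L2_norm_nonneg)
  have mc: "mean U v $ i = (1 / measure lebesgue U) * (LINT x:U|lebesgue. v x $ i)" for i
    by (simp add: mean_def set_integral_component[OF L2_set_integrable[OF v Um]])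
  have vc: "(\<lambda>x. v x - mean U v) \<in> L2 U" by (intro L2_diff v L2_const Um)
  have i: "integrable lebesgue (\<lambda>x. indicator U x *\<^sub>R (v x $ i - mean U v $ i)\<^sup>2)" for i
    using L2D(2)[OF L2_component[OF vc, of i]] by simp
  have "(LINT x:U|lebesgue. (norm (v x - mean U v))\<^sup>2) = (LINT x|lebesgue. (\<Sum>i\<in>UNIV. indicator U x *\<^sub>R (v x $ i - mean U v $ i)\<^sup>2))"
    unfolding set_lebesgue_integral_def
    by (rule Bochner_Integration.integral_cong)
       (auto simp: norm_power2_vec3 sum_distrib_left)
  also have "\<dots> = (\<Sum>i\<in>UNIV. (LINT x:U|lebesgue. (v x $ i - mean U v $ i)\<^sup>2))"
    unfolding set_lebesgue_integral_def by (rule Bochner_Integration.integral_sum) (rule i)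
  also have "\<dots> \<le> (\<Sum>i\<in>UNIV. 8 * (diameter U)\<^sup>2 * (LINT x:U|lebesgue. (norm (G x $ i))\<^sup>2))"
    unfolding mc
    by (intro sum_mono poincare_scalar[OF U L2_component[OF v] L2_row[OF G]])
       (use weak in \<open>auto simp: has_weak_jacobian_def\<close>)
  also have "\<dots> = 8 * (diameter U)\<^sup>2 * (\<Sum>i\<in>UNIV. (LINT x:U|lebesgue. (norm (G x $ i))\<^sup>2))" by (rule sum_distrib_left[symmetric])
  also have "(\<Sum>i\<in>UNIV. (LINT x:U|lebesgue. (norm (G x $ i))\<^sup>2)) = (LINT x|lebesgue. (\<Sum>i\<in>UNIV. indicator U x *\<^sub>R (norm (G x $ i))\<^sup>2))"
    unfolding set_lebesgue_integral_def
    by (rule Bochner_Integration.integral_sum[symmetric]) (rule L2D(2)[OF L2_row[OF G]])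
  also have "\<dots> = (L2_norm U G)\<^sup>2" unfolding L2_norm_power2 set_lebesgue_integral_def
    by (rule Bochner_Integration.integral_cong)
       (auto simp: norm_power2_mat sum_distrib_left)
  \<comment> \<open>The 8 is rounded up to a square, which makes the constant in the statement
    3.\<close>
  also have "8 * (diameter U)\<^sup>2 * (L2_norm U G)\<^sup>2 \<le> 9 * (diameter U)\<^sup>2 * (L2_norm U G)\<^sup>2"
    by (intro mult_right_mono) auto
  also have "\<dots> = (3 * diameter U * L2_norm U G)\<^sup>2" by (simp add: power_mult_distrib)
  finally show "(LINT x:U|lebesgue. (norm (v x - mean U v))\<^sup>2) \<le> (3 * diameter U * L2_norm U G)\<^sup>2" .
qed

section \<open>Weak curls\<close>

lemma not_in_closureD: "x \<notin> closure {x. P x} \<Longrightarrow> \<not> P x"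
  using closure_subset[of "{x. P x}"] by auto

lemma norm_cross_le: "norm (cross3 x y) \<le> norm x * norm y"
  by (rule power2_le_imp_le) (use norm_cross_dot[of x y] zero_le_power2[of "x \<bullet> y"] in \<open>linarith, simp\<close>)

lemma norm_curl_of_jacobian: "norm (curl_of_jacobian J) \<le> 2 * norm J"
proof -
  have n2: "(norm (w::real^3))\<^sup>2 = (\<Sum>i\<in>UNIV. (w $ i)\<^sup>2)" for w
    unfolding power2_norm_eq_inner inner_vec_def by (simp add: power2_eq_square)
  have n3: "(norm J)\<^sup>2 = (\<Sum>i\<in>UNIV. (norm (J $ i))\<^sup>2)"
    unfolding power2_norm_eq_inner inner_vec_def ..
  have d: "(a - b)\<^sup>2 \<le> 2 * a\<^sup>2 + 2 * b\<^sup>2" for a b :: real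
    using zero_le_power2[of "a + b"] by (simp add: power2_sum power2_diff)
  have "(norm (curl_of_jacobian J))\<^sup>2 = (J$3$2 - J$2$3)\<^sup>2 + (J$1$3 - J$3$1)\<^sup>2 + (J$2$1 - J$1$2)\<^sup>2"
    by (simp add: n2 sum_3 curl_of_jacobian_def)
  also have "\<dots> \<le> (2 * (J$3$2)\<^sup>2 + 2 * (J$2$3)\<^sup>2) + (2 * (J$1$3)\<^sup>2 + 2 * (J$3$1)\<^sup>2) + (2 * (J$2$1)\<^sup>2 + 2 * (J$1$2)\<^sup>2)"
    by (intro add_mono d)
  also have "\<dots> \<le> 4 * (norm J)\<^sup>2" by (simp add: n2 n3 sum_3)
  also have "\<dots> = (2 * norm J)\<^sup>2" by (simp add: power_mult_distrib)
  finally show ?thesis by (rule power2_le_imp_le) simp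
qed

lemma L2_curl_of_jacobian:
  assumes G: "G \<in> L2 U"
  shows "(\<lambda>x. curl_of_jacobian (G x)) \<in> L2 U" "L2_norm U (\<lambda>x. curl_of_jacobian (G x)) \<le> 2 * L2_norm U G"
proof -
  have bl: "bounded_linear curl_of_jacobian"
  proof (rule bounded_linear_intro[where K=2])
    show "curl_of_jacobian (x + y) = curl_of_jacobian x + curl_of_jacobian y" for x y
      by (simp add: curl_of_jacobian_def vec_eq_iff forall_3)
    show "curl_of_jacobian (r *\<^sub>R x) = r *\<^sub>R curl_of_jacobian x" for r x
      by (simp add: curl_of_jacobian_def vec_eq_iff forall_3 right_diff_distrib)
    show "norm (curl_of_jacobian x) \<le> norm x * 2" for x using norm_curl_of_jacobian[of x] by simp
  qed
  have m0: "(\<lambda>x. curl_of_jacobian (indicator U x *\<^sub>R G x)) \<in> borel_measurable lebesgue"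
    using measurable_compose[OF L2D(1)[OF G] borel_measurable_continuous_onI[OF linear_continuous_on[OF bl]]] .
  then have m: "(\<lambda>x. indicator U x *\<^sub>R curl_of_jacobian (G x)) \<in> borel_measurable lebesgue"
    by (simp add: linear_cmul[OF bounded_linear.linear[OF bl]])
  have i4: "integrable lebesgue (\<lambda>x. 4 * (indicator U x *\<^sub>R (norm (G x))\<^sup>2))" using L2D(2)[OF G] by simp
  have le: "(norm (curl_of_jacobian J))\<^sup>2 \<le> 4 * (norm J)\<^sup>2" for J
    using power_mono[OF norm_curl_of_jacobian[of J], of 2] by (simp add: power_mult_distrib)
  have i: "integrable lebesgue (\<lambda>x. indicator U x *\<^sub>R (norm (curl_of_jacobian (G x)))\<^sup>2)"
  proof (rule Bochner_Integration.integrable_bound[OF i4])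
    have "(\<lambda>x. (norm (indicator U x *\<^sub>R curl_of_jacobian (G x)))\<^sup>2) \<in> borel_measurable lebesgue"
      by (rule borel_measurable_power[OF measurable_compose[OF m borel_measurable_norm]])
    moreover have "(norm (indicator U x *\<^sub>R curl_of_jacobian (G x)))\<^sup>2 = indicator U x *\<^sub>R (norm (curl_of_jacobian (G x)))\<^sup>2" for x
      by (auto split: split_indicator)
    ultimately show "(\<lambda>x. indicator U x *\<^sub>R (norm (curl_of_jacobian (G x)))\<^sup>2) \<in> borel_measurable lebesgue" by simp
    show "AE x in lebesgue. norm (indicat_real U x *\<^sub>R (norm (curl_of_jacobian (G x)))\<^sup>2) \<le> norm (4 * (indicat_real U x *\<^sub>R (norm (G x))\<^sup>2))"
      using le by (auto split: split_indicator)
  qed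
  show "(\<lambda>x. curl_of_jacobian (G x)) \<in> L2 U" using m i by (simp add: L2_def set_borel_measurable_def set_integrable_def)
  show "L2_norm U (\<lambda>x. curl_of_jacobian (G x)) \<le> 2 * L2_norm U G"
  proof (rule L2_norm_le)
    have "(LINT x:U|lebesgue. (norm (curl_of_jacobian (G x)))\<^sup>2) \<le> (LINT x|lebesgue. 4 * (indicator U x *\<^sub>R (norm (G x))\<^sup>2))"
      unfolding set_lebesgue_integral_def by (rule integral_mono[OF i i4]) (use le in \<open>simp split: split_indicator\<close>)
    also have "\<dots> = (2 * L2_norm U G)\<^sup>2" by (simp add: power_mult_distrib L2_norm_power2 set_lebesgue_integral_def)
    finally show "(LINT x:U|lebesgue. (norm (curl_of_jacobian (G x)))\<^sup>2) \<le> (2 * L2_norm U G)\<^sup>2" .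
  qed (simp add: L2_norm_nonneg)
qed

lemma test_function_component:
  fixes \<phi> :: "real^3 \<Rightarrow> real^3"
  assumes "test_function U \<phi>" shows "test_function U (\<lambda>x. \<phi> x $ k)"
proof (rule test_functionI)
  let ?S = "closure {x. \<phi> x \<noteq> 0}"
  have "smooth (\<lambda>x. \<phi> x \<bullet> axis k 1)"
    by (rule smooth_inner[OF _ smooth_const]) (use assms in \<open>simp add: test_function_def\<close>)
  then show "smooth (\<lambda>x. \<phi> x $ k)" by (simp add: inner_axis)
  show "x \<notin> ?S \<Longrightarrow> \<phi> x $ k = 0" for x using not_in_closureD[of x "\<lambda>x. \<phi> x \<noteq> 0"] by simp
qed (use assms in \<open>auto simp: test_function_def\<close>)

lemma jacobian_entry:
  fixes \<phi> :: "real^3 \<Rightarrow> real^3"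
  assumes "smooth \<phi>"
  shows "jacobian \<phi> (at x) $ k $ j = frechet_derivative (\<lambda>x. \<phi> x $ k) (at x) (axis j 1)"
proof -
  have "((\<lambda>x. \<phi> x $ k) has_derivative (\<lambda>h. frechet_derivative \<phi> (at x) h $ k)) (at x)"
    by (rule bounded_linear.has_derivative[OF bounded_linear_vec_nth smooth_has_derivative[OF assms]])
  then have "frechet_derivative (\<lambda>x. \<phi> x $ k) (at x) = (\<lambda>h. frechet_derivative \<phi> (at x) h $ k)"
    by (rule frechet_derivative_at[symmetric])
  then show ?thesis by (simp add: jacobian_def matrix_def)
qed

text \<open>The six terms of \<open>v \<bullet> classical_curl \<phi>\<close> are integrated by
  parts one by one; the antisymmetry of the curl absorbs the change of sign.\<close>

lemma weak_curl_of_weak_jacobian: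
  assumes U: "U \<in> lmeasurable" and v: "v \<in> L2 U" and G: "G \<in> L2 U" and J: "has_weak_jacobian U v G"
  shows "has_weak_curl U v (\<lambda>x. curl_of_jacobian (G x))"
  unfolding has_weak_curl_def
proof (intro allI impI)
  fix \<phi> :: "real^3 \<Rightarrow> real^3" assume tf: "test_function U \<phi>"
  have sm: "smooth \<phi>" using tf test_function_def by blast
  define d where "d k j x = frechet_derivative (\<lambda>x. \<phi> x $ k) (at x) (axis j 1)" for k j x
  have tk: "test_function U (\<lambda>x. \<phi> x $ k)" for k by (rule test_function_component[OF tf])
  have td: "test_function U (d k j)" for k j unfolding d_def by (rule test_function_frechet[OF tk])
  have vi: "set_integrable lebesgue U (\<lambda>x. v x $ i * d k j x)" for i k j
    by (rule set_integrable_mult_test[OF L2_set_integrable[OF L2_component[OF v] U] td])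
  have gi: "set_integrable lebesgue U (\<lambda>x. G x $ i $ j * \<phi> x $ k)" for i k j
    by (rule set_integrable_mult_test[OF L2_set_integrable[OF L2_component2[OF G] U] tk])
  have w: "(LINT x:U|lebesgue. v x $ i * d k j x) = - (LINT x:U|lebesgue. G x $ i $ j * \<phi> x $ k)" for i j k
    unfolding d_def using J[unfolded has_weak_jacobian_def, rule_format, OF tk] .
  have 1: "v x \<bullet> classical_curl \<phi> x = (v x $ 1 * d 3 2 x - v x $ 1 * d 2 3 x) + (v x $ 2 * d 1 3 x - v x $ 2 * d 3 1 x) + (v x $ 3 * d 2 1 x - v x $ 3 * d 1 2 x)" for x
    by (simp add: classical_curl_def curl_of_jacobian_def inner_vec_def sum_3 jacobian_entry[OF sm] d_def right_diff_distrib)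
  have 2: "curl_of_jacobian (G x) \<bullet> \<phi> x = (G x $ 1 $ 3 * \<phi> x $ 2 - G x $ 1 $ 2 * \<phi> x $ 3) + (G x $ 2 $ 1 * \<phi> x $ 3 - G x $ 2 $ 3 * \<phi> x $ 1) + (G x $ 3 $ 2 * \<phi> x $ 1 - G x $ 3 $ 1 * \<phi> x $ 2)" for x
    by (simp add: curl_of_jacobian_def inner_vec_def sum_3 left_diff_distrib)
  show "(LINT x:U|lebesgue. v x \<bullet> classical_curl \<phi> x) = (LINT x:U|lebesgue. curl_of_jacobian (G x) \<bullet> \<phi> x)"
    unfolding 1 2 by (simp only: set_integral_add set_integral_diff vi gi w)
qed

text \<open>\<open>weak_curl\<close> is a choice, and this transfers any computed curl to the chosen
  one. Test functions times an axis vector isolate the components for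
  \<open>fundamental_lemma\<close>.\<close>

lemma weak_curl_unique:
  assumes U: "open U" "U \<in> lmeasurable" and w: "w1 \<in> L2 U" "w2 \<in> L2 U" "has_weak_curl U v w1" "has_weak_curl U v w2"
  shows "AE x in lebesgue. x \<in> U \<longrightarrow> w1 x = w2 x"
proof -
  have "AE x in lebesgue. x \<in> U \<longrightarrow> w1 x $ k - w2 x $ k = 0" for k
  proof (rule fundamental_lemma[OF U(1)])
    have i: "set_integrable lebesgue U (\<lambda>x. w1 x $ k)" "set_integrable lebesgue U (\<lambda>x. w2 x $ k)"
      using L2_set_integrable[OF L2_component U(2)] w by auto
    then show "set_integrable lebesgue U (\<lambda>x. w1 x $ k - w2 x $ k)" by (rule set_integral_diff(1))
    fix \<psi> :: "real^3 \<Rightarrow> real" assume t: "test_function U \<psi>"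
    have t': "test_function U (\<lambda>x. \<psi> x *\<^sub>R (axis k 1 :: real^3))" by (rule test_function_scaleR[OF t])
    have "(LINT x:U|lebesgue. w1 x \<bullet> (\<psi> x *\<^sub>R axis k 1)) = (LINT x:U|lebesgue. w2 x \<bullet> (\<psi> x *\<^sub>R axis k 1))"
      using w(3)[unfolded has_weak_curl_def, rule_format, OF t'] w(4)[unfolded has_weak_curl_def, rule_format, OF t']
      by (rule trans[OF sym])
    then have "(LINT x:U|lebesgue. w1 x $ k * \<psi> x) = (LINT x:U|lebesgue. w2 x $ k * \<psi> x)"
      by (simp add: inner_axis mult.commute)
    then show "(LINT x:U|lebesgue. (w1 x $ k - w2 x $ k) * \<psi> x) = 0"
      using set_integral_diff(2)[OF set_integrable_mult_test[OF i(1) t] set_integrable_mult_test[OF i(2) t]]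
      by (simp add: left_diff_distrib)
  qed
  then have "AE x in lebesgue. \<forall>k\<in>UNIV. x \<in> U \<longrightarrow> w1 x $ k - w2 x $ k = 0" by (intro AE_finite_allI) auto
  then show ?thesis by eventually_elim (simp add: vec_eq_iff)
qed

lemma weak_curl_spec:
  assumes U: "open U" "U \<in> lmeasurable" and w: "w \<in> L2 U" "has_weak_curl U v w"
  shows "weak_curl U v \<in> L2 U" "has_weak_curl U v (weak_curl U v)" "AE x in lebesgue. x \<in> U \<longrightarrow> weak_curl U v x = w x"
proof -
  have "weak_curl U v \<in> L2 U \<and> has_weak_curl U v (weak_curl U v)"
    unfolding weak_curl_def by (rule someI[of _ w]) (use w in blast)
  then show "weak_curl U v \<in> L2 U" "has_weak_curl U v (weak_curl U v)" by auto
  then show "AE x in lebesgue. x \<in> U \<longrightarrow> weak_curl U v x = w x" by (intro weak_curl_unique[OF U _ w(1) _ w(2)])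
qed

lemma weak_jacobian_spec:
  assumes "v \<in> H1 U"
  shows "weak_jacobian U v \<in> L2 U" "has_weak_jacobian U v (weak_jacobian U v)"
proof -
  have "\<exists>G. G \<in> L2 U \<and> has_weak_jacobian U v G" using assms by (auto simp: H1_def)
  from someI_ex[OF this] show "weak_jacobian U v \<in> L2 U" "has_weak_jacobian U v (weak_jacobian U v)"
    unfolding weak_jacobian_def by auto
qed

lemma set_integral_restrict:
  fixes f :: "real^3 \<Rightarrow> 'b::{banach, second_countable_topology}"
  assumes "V \<subseteq> U" "\<And>x. x \<in> U - V \<Longrightarrow> f x = 0"
  shows "(LINT x:U|lebesgue. f x) = (LINT x:V|lebesgue. f x)"
  unfolding set_lebesgue_integral_def
  by (rule Bochner_Integration.integral_cong) (use assms in \<open>auto split: split_indicator\<close>)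

lemma has_weak_jacobian_restrict:
  assumes J: "has_weak_jacobian U v G" and V: "V \<subseteq> U"
  shows "has_weak_jacobian V v G"
  unfolding has_weak_jacobian_def
proof (intro allI impI)
  fix \<psi> :: "real^3 \<Rightarrow> real" and i j assume t: "test_function V \<psi>"
  have tU: "test_function U \<psi>" by (rule test_function_mono[OF t V])
  have z: "x \<in> U - V \<Longrightarrow> \<psi> x = 0" "x \<in> U - V \<Longrightarrow> frechet_derivative \<psi> (at x) h = 0" for x h
    using test_function_zero[OF t] test_function_zero[OF test_function_frechet[OF t]] by auto
  have "(LINT x:U|lebesgue. v x $ i * frechet_derivative \<psi> (at x) (axis j 1)) = - (LINT x:U|lebesgue. G x $ i $ j * \<psi> x)"
    using J[unfolded has_weak_jacobian_def, rule_format, OF tU] .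
  moreover have "(LINT x:U|lebesgue. v x $ i * frechet_derivative \<psi> (at x) (axis j 1)) = (LINT x:V|lebesgue. v x $ i * frechet_derivative \<psi> (at x) (axis j 1))"
    by (rule set_integral_restrict[OF V]) (simp add: z)
  moreover have "(LINT x:U|lebesgue. G x $ i $ j * \<psi> x) = (LINT x:V|lebesgue. G x $ i $ j * \<psi> x)"
    by (rule set_integral_restrict[OF V]) (simp add: z)
  ultimately show "(LINT x:V|lebesgue. v x $ i * frechet_derivative \<psi> (at x) (axis j 1)) = - (LINT x:V|lebesgue. G x $ i $ j * \<psi> x)" by simp
qed

lemma H1_restrict:
  assumes "v \<in> H1 U" "open V" "V \<subseteq> U"
  shows "v \<in> H1 V"
proof -
  obtain G where G: "v \<in> L2 U" "G \<in> L2 U" "has_weak_jacobian U v G" using assms(1) unfolding H1_def by auto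
  have V: "V \<in> sets lebesgue" using assms(2) by simp
  have "v \<in> L2 V" "G \<in> L2 V" "has_weak_jacobian V v G"
    by (rule L2_mono[OF G(1) V assms(3)] L2_mono[OF G(2) V assms(3)] has_weak_jacobian_restrict[OF G(3) assms(3)])+
  then show ?thesis unfolding H1_def by auto
qed

lemma has_weak_curl_restrict:
  assumes J: "has_weak_curl U v w" and V: "V \<subseteq> U"
  shows "has_weak_curl V v w"
  unfolding has_weak_curl_def
proof (intro allI impI)
  fix \<phi> :: "real^3 \<Rightarrow> real^3" assume t: "test_function V \<phi>"
  have tU: "test_function U \<phi>" by (rule test_function_mono[OF t V])
  have z: "\<phi> x = 0" "classical_curl \<phi> x = 0" if "x \<in> U - V" for x
  proof -
    show "\<phi> x = 0" using that test_function_zero[OF t] by auto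
    have "frechet_derivative (\<lambda>x. \<phi> x $ k) (at x) h = 0" for k h
      using that test_function_zero[OF test_function_frechet[OF test_function_component[OF t]]] by auto
    moreover have "smooth \<phi>" using t test_function_def by blast
    ultimately show "classical_curl \<phi> x = 0"
      by (simp add: classical_curl_def curl_of_jacobian_def jacobian_entry vec_eq_iff forall_3)
  qed
  have "(LINT x:U|lebesgue. v x \<bullet> classical_curl \<phi> x) = (LINT x:U|lebesgue. w x \<bullet> \<phi> x)"
    using J[unfolded has_weak_curl_def, rule_format, OF tU] .
  moreover have "(LINT x:U|lebesgue. v x \<bullet> classical_curl \<phi> x) = (LINT x:V|lebesgue. v x \<bullet> classical_curl \<phi> x)"
    by (rule set_integral_restrict[OF V]) (simp add: z)
  moreover have "(LINT x:U|lebesgue. w x \<bullet> \<phi> x) = (LINT x:V|lebesgue. w x \<bullet> \<phi> x)"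
    by (rule set_integral_restrict[OF V]) (simp add: z)
  ultimately show "(LINT x:V|lebesgue. v x \<bullet> classical_curl \<phi> x) = (LINT x:V|lebesgue. w x \<bullet> \<phi> x)" by simp
qed

lemma has_weak_curl_diff:
  assumes "has_weak_curl U v w" "has_weak_curl U q z"
    and U: "U \<in> lmeasurable" and L: "v \<in> L2 U" "w \<in> L2 U" "q \<in> L2 U" "z \<in> L2 U"
  shows "has_weak_curl U (\<lambda>x. v x - q x) (\<lambda>x. w x - z x)"
  unfolding has_weak_curl_def
proof (intro allI impI)
  fix \<phi> :: "real^3 \<Rightarrow> real^3" assume t: "test_function U \<phi>"
  have sm: "smooth \<phi>" using t test_function_def by blast
  have i: "set_integrable lebesgue U (\<lambda>x. f x \<bullet> g x)" if f: "f \<in> L2 U" and g: "\<And>k. \<exists>W. test_function W (\<lambda>x. g x $ k)" for f g :: "real^3 \<Rightarrow> real^3"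
  proof -
    have "set_integrable lebesgue U (\<lambda>x. f x $ k * g x $ k)" for k
      using g[of k] set_integrable_mult_test[OF L2_set_integrable[OF L2_component[OF f] U]] by blast
    then have "set_integrable lebesgue U (\<lambda>x. f x $ 1 * g x $ 1 + f x $ 2 * g x $ 2 + f x $ 3 * g x $ 3)"
      by (intro set_integral_add(1))
    then show ?thesis by (simp add: inner_vec_def sum_3)
  qed
  have c: "\<exists>W. test_function W (\<lambda>x. classical_curl \<phi> x $ k)" for k
  proof -
    have td: "test_function U (\<lambda>x. jacobian \<phi> (at x) $ k $ j)" for k j
      unfolding jacobian_entry[OF sm] by (rule test_function_frechet[OF test_function_component[OF t]])
    have tdd: "test_function U (\<lambda>x. jacobian \<phi> (at x) $ k $ j - jacobian \<phi> (at x) $ k' $ j')" for k j k' j'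
    proof (rule test_functionI)
      let ?S = "closure {x. jacobian \<phi> (at x) $ k $ j \<noteq> 0} \<union> closure {x. jacobian \<phi> (at x) $ k' $ j' \<noteq> 0}"
      have "smooth (\<lambda>x. jacobian \<phi> (at x) $ k $ j + (-1) * jacobian \<phi> (at x) $ k' $ j')"
        by (rule smooth_add[OF _ smooth_mult[OF smooth_const]]) (use td in \<open>auto simp: test_function_def\<close>)
      then show "smooth (\<lambda>x. jacobian \<phi> (at x) $ k $ j - jacobian \<phi> (at x) $ k' $ j')" by simp
      show "compact ?S" "?S \<subseteq> U" using td unfolding test_function_def by (blast intro: compact_Un)+
      show "x \<notin> ?S \<Longrightarrow> jacobian \<phi> (at x) $ k $ j - jacobian \<phi> (at x) $ k' $ j' = 0" for x
        using not_in_closureD[of x "\<lambda>x. jacobian \<phi> (at x) $ k $ j \<noteq> 0"] not_in_closureD[of x "\<lambda>x. jacobian \<phi> (at x) $ k' $ j' \<noteq> 0"] by simp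
    qed
    consider "k = 1" | "k = 2" | "k = 3" using exhaust_3 by blast
    then show ?thesis by cases (simp_all add: classical_curl_def curl_of_jacobian_def, (rule exI, rule tdd)+)
  qed
  have p: "\<exists>W. test_function W (\<lambda>x. \<phi> x $ k)" for k using test_function_component[OF t] by blast
  show "(LINT x:U|lebesgue. (v x - q x) \<bullet> classical_curl \<phi> x) = (LINT x:U|lebesgue. (w x - z x) \<bullet> \<phi> x)"
    unfolding inner_diff_left set_integral_diff(2)[OF i[OF L(1) c] i[OF L(3) c]] set_integral_diff(2)[OF i[OF L(2) p] i[OF L(4) p]]
    using assms(1)[unfolded has_weak_curl_def, rule_format, OF t] assms(2)[unfolded has_weak_curl_def, rule_format, OF t] by simp
qed

text \<open>The derivative of \<open>q x $ i * \<psi> x\<close> integrates to zero by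
  \<open>integral_derivative_invariant_set\<close> on the whole space, and the product rule splits
  it into the two sides.\<close>

lemma has_weak_jacobian_smooth:
  fixes q :: "real^3 \<Rightarrow> real^3"
  assumes U: "open U" "U \<in> lmeasurable" and q: "smooth q"
  shows "has_weak_jacobian U q (\<lambda>x. jacobian q (at x))"
  unfolding has_weak_jacobian_def
proof (intro allI impI)
  fix \<psi> :: "real^3 \<Rightarrow> real" and i j assume t: "test_function U \<psi>"
  have sm: "smooth \<psi>" using t test_function_def by blast
  define p where "p x = q x $ i" for x
  have "smooth (\<lambda>x. q x \<bullet> axis i 1)" by (rule smooth_inner[OF q smooth_const])
  then have smp: "smooth p" by (simp add: inner_axis p_def[abs_def])
  let ?h = "axis j 1 :: real^3"
  have d: "frechet_derivative (\<lambda>x. p x * \<psi> x) (at x) ?h = p x * frechet_derivative \<psi> (at x) ?h + frechet_derivative p (at x) ?h * \<psi> x" for x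
  proof -
    have "((\<lambda>x. p x * \<psi> x) has_derivative (\<lambda>h. p x * frechet_derivative \<psi> (at x) h + frechet_derivative p (at x) h * \<psi> x)) (at x)"
      by (rule has_derivative_mult[OF smooth_has_derivative[OF smp] smooth_has_derivative[OF sm]])
    then show ?thesis by (simp add: frechet_derivative_at[symmetric])
  qed
  have tp: "test_function U (\<lambda>x. p x * \<psi> x)" by (rule test_function_mult[OF t smp])
  have a: "(LINT x:UNIV|lebesgue. frechet_derivative (\<lambda>x. p x * \<psi> x) (at x) ?h) = 0"
    by (rule integral_derivative_invariant_set[OF test_function_mono[OF tp]]) auto
  have b: "(LINT x:UNIV|lebesgue. frechet_derivative (\<lambda>x. p x * \<psi> x) (at x) ?h) = (LINT x:U|lebesgue. frechet_derivative (\<lambda>x. p x * \<psi> x) (at x) ?h)"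
    by (rule set_integral_restrict) (use test_function_zero[OF test_function_frechet[OF tp]] in auto)
  have one: "set_integrable lebesgue U (\<lambda>x. 1 * g x)" if "test_function U g" for g :: "real^3 \<Rightarrow> real"
    by (rule set_integrable_mult_test[OF _ that]) (use U L2_set_integrable[OF L2_const[OF U(2)]] in blast)
  have i1: "set_integrable lebesgue U (\<lambda>x. p x * frechet_derivative \<psi> (at x) ?h)"
    using one[OF test_function_mult[OF test_function_frechet[OF t] smp]] by simp
  have i2: "set_integrable lebesgue U (\<lambda>x. frechet_derivative p (at x) ?h * \<psi> x)"
    using one[OF test_function_mult[OF t smooth_frechet_derivative[OF smp]]] by simp
  have "(LINT x:U|lebesgue. p x * frechet_derivative \<psi> (at x) ?h) + (LINT x:U|lebesgue. frechet_derivative p (at x) ?h * \<psi> x) = 0"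
    using a b set_integral_add(2)[OF i1 i2] unfolding d by simp
  moreover have "jacobian q (at x) $ i $ j = frechet_derivative p (at x) ?h" for x
    unfolding p_def[abs_def] by (rule jacobian_entry[OF q])
  ultimately show "(LINT x:U|lebesgue. q x $ i * frechet_derivative \<psi> (at x) ?h) = - (LINT x:U|lebesgue. jacobian q (at x) $ i $ j * \<psi> x)"
    by (simp add: p_def)
qed

lemma nedelec_curl:
  assumes U: "open U" "bounded U" and q: "q = (\<lambda>x. a + cross3 b x)"
  shows "has_weak_curl U q (\<lambda>x. 2 *\<^sub>R b)" "q \<in> L2 U"
proof -
  have Um: "U \<in> lmeasurable" using U by (simp add: lmeasurable_open)
  have bl: "bounded_linear (cross3 b)"
    by (rule bounded_linear_intro[where K="norm b"])
       (use norm_cross_le[of b] in \<open>auto simp: cross_add_right cross_mult_right mult.commute\<close>)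
  have smq: "smooth q" unfolding q by (rule smooth_add[OF smooth_const smooth_linear[OF bl]])
  have "(q has_derivative cross3 b) (at x)" for x
  proof -
    have "((\<lambda>x. a + cross3 b x) has_derivative (\<lambda>h. 0 + cross3 b h)) (at x)"
      by (rule has_derivative_add[OF has_derivative_const bounded_linear_imp_has_derivative[OF bl]])
    then show ?thesis by (simp add: q)
  qed
  then have "frechet_derivative q (at x) = cross3 b" for x by (rule frechet_derivative_at[symmetric])
  then have c: "curl_of_jacobian (jacobian q (at x)) = 2 *\<^sub>R b" for x
    by (simp add: jacobian_def matrix_def curl_of_jacobian_def cross3_def axis_def vec_eq_iff forall_3)
  have cj: "jacobian q (at x) = jacobian q (at 0)" for x
    by (simp add: jacobian_def \<open>\<And>x. frechet_derivative q (at x) = cross3 b\<close>)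
  have "bounded (q ` closure U)"
    by (intro compact_imp_bounded compact_continuous_image smooth_continuous[OF smq]) (use U in simp)
  then obtain B where B: "\<And>x. x \<in> closure U \<Longrightarrow> norm (q x) \<le> B" by (auto simp: bounded_iff)
  show qL: "q \<in> L2 U"
  proof (rule L2_bounded(1)[OF Um smooth_lebesgue[OF smq] Um])
    show "norm (q x) \<le> max B 0 * indicator U x" if "x \<in> U" for x
    proof -
      have "norm (q x) \<le> B" using B closure_subset[of U] that by blast
      then show ?thesis using that by simp
    qed
  qed simp
  have "(\<lambda>x. jacobian q (at x)) = (\<lambda>x. jacobian q (at 0))" by (rule ext) (rule cj)
  then have "(\<lambda>x. jacobian q (at x)) \<in> L2 U" using L2_const[OF Um] by metis
  then show "has_weak_curl U q (\<lambda>x. 2 *\<^sub>R b)"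
    using weak_curl_of_weak_jacobian[OF Um qL _ has_weak_jacobian_smooth[OF U(1) Um smq]] by (simp add: c)
qed

section \<open>Radial test fields\<close>

text \<open>Radial about \<open>p\<close> and vanishing outside the ball of radius
  \<open>\<rho>\<close>. The squared distance keeps it smooth at the centre.\<close>

definition bump :: "real^3 \<Rightarrow> real \<Rightarrow> real^3 \<Rightarrow> real" where
  "bump p \<rho> x = flat_exp (1 - (norm (x - p))\<^sup>2 / \<rho>\<^sup>2)"

definition bump_grad :: "real^3 \<Rightarrow> real \<Rightarrow> real^3 \<Rightarrow> real^3" where
  "bump_grad p \<rho> x = - (2 / \<rho>\<^sup>2 * flat_exp' (1 - (norm (x - p))\<^sup>2 / \<rho>\<^sup>2)) *\<^sub>R (x - p)"

lemma smooth_norm_power2: "smooth (\<lambda>x. (norm (x - p :: real^3))\<^sup>2)"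
proof -
  have "smooth (\<lambda>x. - p + x)" by (rule smooth_add[OF smooth_const smooth_linear[OF bounded_linear_ident]])
  from smooth_inner[OF this this] show ?thesis by (simp add: power2_norm_eq_inner)
qed

lemma smooth_bump: "smooth (bump p \<rho>)"
proof -
  have "smooth (\<lambda>x. 1 + (- (1 / \<rho>\<^sup>2)) * (norm (x - p))\<^sup>2)"
    by (rule smooth_add[OF smooth_const smooth_mult[OF smooth_const smooth_norm_power2]])
  from smooth_compose_real[OF smooth_flat_exp this] show ?thesis by (simp add: bump_def[abs_def])
qed

lemma bump_has_derivative: "(bump p \<rho> has_derivative (\<lambda>h. bump_grad p \<rho> x \<bullet> h)) (at x)"
proof -
  have "((\<lambda>x. (x - p) \<bullet> (x - p)) has_derivative (\<lambda>h. (x - p) \<bullet> h + h \<bullet> (x - p))) (at x)"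
    by (auto intro!: derivative_eq_intros)
  from has_derivative_diff[OF has_derivative_const[of 1] has_derivative_mult_right[OF this, of "1 / \<rho>\<^sup>2"]]
  have "((\<lambda>x. 1 - 1 / \<rho>\<^sup>2 * ((x - p) \<bullet> (x - p))) has_derivative (\<lambda>h. 0 - 1 / \<rho>\<^sup>2 * ((x - p) \<bullet> h + h \<bullet> (x - p)))) (at x)" .
  from has_derivative_compose[OF this flat_exp_deriv[THEN has_field_derivative_imp_has_derivative]]
  show ?thesis by (simp add: bump_def[abs_def] bump_grad_def power2_norm_eq_inner inner_commute mult_ac)
qed

lemma bump_frechet: "frechet_derivative (bump p \<rho>) (at x) h = bump_grad p \<rho> x \<bullet> h"
  using frechet_derivative_at[OF bump_has_derivative, of p \<rho> x] by metis

lemma bump_out: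
  assumes "\<rho> > 0" "x \<notin> ball p \<rho>" shows "bump p \<rho> x = 0" "bump_grad p \<rho> x = 0"
proof -
  have "\<rho> \<le> norm (x - p)" using assms by (simp add: dist_norm norm_minus_commute)
  then have "\<rho>\<^sup>2 \<le> (norm (x - p))\<^sup>2" using assms by (intro power_mono) auto
  then have "1 - (norm (x - p))\<^sup>2 / \<rho>\<^sup>2 \<le> 0" using assms by (simp add: field_simps)
  then show "bump p \<rho> x = 0" "bump_grad p \<rho> x = 0" by (simp_all add: bump_def bump_grad_def flat_exp_0)
qed

lemma test_function_bump: "\<rho> > 0 \<Longrightarrow> test_function UNIV (bump p \<rho>)"
  by (rule test_functionI[OF smooth_bump compact_cball[of p \<rho>]]) (use bump_out(1) in \<open>auto simp: not_le\<close>)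

lemma bump_bounds:
  assumes "\<rho> > 0"
  shows "\<bar>bump p \<rho> x\<bar> \<le> indicator (ball p \<rho>) x" "norm (bump_grad p \<rho> x) \<le> (4 / \<rho>) * indicator (ball p \<rho>) x"
proof -
  show "\<bar>bump p \<rho> x\<bar> \<le> indicator (ball p \<rho>) x"
    using flat_exp_bounds(1,2) bump_out(1)[OF assms, of x p] by (cases "x \<in> ball p \<rho>") (auto simp: bump_def)
  show "norm (bump_grad p \<rho> x) \<le> (4 / \<rho>) * indicator (ball p \<rho>) x"
  proof (cases "x \<in> ball p \<rho>")
    case True
    then have n: "norm (x - p) \<le> \<rho>" by (simp add: dist_norm norm_minus_commute)
    let ?f = "flat_exp' (1 - (norm (x - p))\<^sup>2 / \<rho>\<^sup>2)"
    have "norm (bump_grad p \<rho> x) = 2 / \<rho>\<^sup>2 * ?f * norm (x - p)"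
      using flat_exp_bounds(3) assms by (simp add: bump_grad_def)
    also have "\<dots> \<le> 2 / \<rho>\<^sup>2 * 2 * \<rho>"
      using flat_exp_bounds(3,4) n assms by (intro mult_mono) auto
    also have "\<dots> = 4 / \<rho>" using assms by (simp add: power2_eq_square)
    finally show ?thesis using True by simp
  qed (simp add: bump_out[OF assms])
qed

lemma bump_grad_borel: "bump_grad p \<rho> \<in> borel_measurable borel"
proof -
  have "continuous_on UNIV (bump_grad p \<rho>)"
    unfolding bump_grad_def[abs_def] divide_inverse
    by (intro continuous_intros continuous_on_compose2[OF smooth_continuous[OF smooth_flat_exp', of UNIV]]) auto
  then show ?thesis by (rule borel_measurable_continuous_onI)
qed

lemma bump_grad_integrable:
  assumes "\<rho> > 0" "H \<in> sets lebesgue"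
  shows "set_integrable lebesgue H (bump_grad p \<rho>)"
  unfolding set_integrable_def
proof (rule Bochner_Integration.integrable_bound)
  have "ball p \<rho> \<in> lmeasurable" by simp
  then show "integrable lebesgue (\<lambda>x. (4 / \<rho>) * indicator (ball p \<rho>) x)" by (auto simp: fmeasurable_def less_top)
  have "bump_grad p \<rho> \<in> borel_measurable lebesgue" by (rule measurable_completion) (simp add: bump_grad_borel)
  then show "(\<lambda>x. indicator H x *\<^sub>R bump_grad p \<rho> x) \<in> borel_measurable lebesgue"
    using assms(2) by (intro borel_measurable_scaleR borel_measurable_indicator) auto
  have "norm (indicat_real H x *\<^sub>R bump_grad p \<rho> x) \<le> norm ((4 / \<rho>) * indicat_real (ball p \<rho>) x)" for x
    using bump_bounds(2)[OF assms(1), of p x] assms(1) by (auto split: split_indicator)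
  then show "AE x in lebesgue. norm (indicat_real H x *\<^sub>R bump_grad p \<rho> x) \<le> norm ((4 / \<rho>) * indicat_real (ball p \<rho>) x)" by simp
qed

lemma set_integral_inner_left:
  fixes f :: "real^3 \<Rightarrow> real^3"
  assumes "set_integrable lebesgue H f"
  shows "(LINT x:H|lebesgue. f x \<bullet> u) = (LINT x:H|lebesgue. f x) \<bullet> u"
proof -
  have "(LINT x|lebesgue. (indicator H x *\<^sub>R f x) \<bullet> u) = (LINT x|lebesgue. indicator H x *\<^sub>R f x) \<bullet> u"
    using assms by (intro integral_inner_left) (auto simp: set_integrable_def)
  then show ?thesis by (simp add: set_lebesgue_integral_def)
qed

text \<open>The normal slope of the bump is at least \<open>exp (-16/7) / (2 \<rho>)\<close> on a
  ball of radius \<open>\<rho>/4\<close>, and \<open>1/2 * (1/4)^3 = 1/128\<close>.\<close>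

definition bump_flux :: real where "bump_flux = exp (-16/7) * unit_ball_vol 3 / 128"

lemma bump_flux_pos: "bump_flux > 0"
  by (simp add: bump_flux_def)

lemma measure_ball3: "r \<ge> 0 \<Longrightarrow> measure lebesgue (ball (p::real^3) r) = unit_ball_vol 3 * r ^ 3"
  using content_ball[of r p] by simp

text \<open>The half-space is invariant under translations orthogonal to \<open>n\<close>, so the
  integral of the gradient over it has no component in those directions; over the whole space it is
  zero, so the two halves are opposite. The gradient points towards \<open>p\<close>, which fixes
  the sign of \<open>A\<close>, and a ball inside the half-space bounds \<open>A\<close> from
  below.\<close>

lemma bump_halfspace:
  fixes n p :: "real^3"
  assumes \<rho>: "\<rho> > 0" and n: "norm n = 1"
  shows "\<exists>A \<ge> bump_flux * \<rho>\<^sup>2. (LINT x:{x. n \<bullet> (x - p) > 0}|lebesgue. bump_grad p \<rho> x) = - A *\<^sub>R n \<and>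
     (LINT x:{x. n \<bullet> (x - p) < 0}|lebesgue. bump_grad p \<rho> x) = A *\<^sub>R n"
proof -
  define H where "H = {x. n \<bullet> (x - p) > 0}"
  define H' where "H' = {x. n \<bullet> (x - p) < 0}"
  have oH: "open H" "open H'" unfolding H_def H'_def by (intro open_Collect_less continuous_intros)+
  then have sH: "H \<in> sets borel" "H' \<in> sets borel" "H \<in> sets lebesgue" "H' \<in> sets lebesgue" by auto
  define J where "J = (LINT x:H|lebesgue. bump_grad p \<rho> x)"
  define J' where "J' = (LINT x:H'|lebesgue. bump_grad p \<rho> x)"
  have i: "set_integrable lebesgue S (bump_grad p \<rho>)" if "S \<in> sets lebesgue" for S by (rule bump_grad_integrable[OF \<rho> that])
  have bm: "bump_grad p \<rho> \<in> borel_measurable lebesgue" by (rule measurable_completion) (simp add: bump_grad_borel)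
  have inv: "(LINT x:S|lebesgue. bump_grad p \<rho> x) \<bullet> u = 0" if "S \<in> sets borel" "\<And>x s. x + s *\<^sub>R u \<in> S \<longleftrightarrow> x \<in> S" for S u
    using integral_derivative_invariant_set[OF test_function_bump[OF \<rho>] that] set_integral_inner_left[OF i, of S u] that(1)
    by (simp add: bump_frechet)
  have Ju: "J \<bullet> u = 0" if "n \<bullet> u = 0" for u
    unfolding J_def by (rule inv[OF sH(1)]) (use that in \<open>simp add: H_def inner_simps algebra_simps\<close>)
  have nn: "n \<bullet> n = 1" using n by (simp add: dot_square_norm)
  define A where "A = - (J \<bullet> n)"
  have JA: "J = - A *\<^sub>R n"
  proof -
    define u where "u = J - (J \<bullet> n) *\<^sub>R n"
    have nu: "n \<bullet> u = 0" by (simp add: u_def inner_diff_right nn inner_commute)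
    have "u \<bullet> u = J \<bullet> u - (J \<bullet> n) * (n \<bullet> u)" by (simp add: u_def inner_diff_left)
    then have "u = 0" using Ju[OF nu] nu by simp
    then show ?thesis by (simp add: u_def A_def)
  qed
  have "(LINT x:UNIV|lebesgue. bump_grad p \<rho> x) \<bullet> u = 0" for u by (rule inv) auto
  then have z: "(LINT x:UNIV|lebesgue. bump_grad p \<rho> x) = 0" by (metis inner_eq_zero_iff)
  have "J + J' = (LINT x:H \<union> H'|lebesgue. bump_grad p \<rho> x)"
    unfolding J_def J'_def by (rule set_integral_Un[symmetric]) (use i sH in \<open>auto simp: H_def H'_def\<close>)
  also have "\<dots> = (LINT x:UNIV|lebesgue. bump_grad p \<rho> x)"
    unfolding set_lebesgue_integral_def
  proof (rule integral_cong_AE)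
    have "n \<noteq> 0" using n by auto
    then have "negligible {x. n \<bullet> x = n \<bullet> p}" by (simp add: negligible_hyperplane)
    then have "AE x in lebesgue. x \<notin> {x. n \<bullet> x = n \<bullet> p}" by (intro AE_not_in) (simp only: negligible_iff_null_sets)
    then show "AE x in lebesgue. indicat_real (H \<union> H') x *\<^sub>R bump_grad p \<rho> x = indicat_real UNIV x *\<^sub>R bump_grad p \<rho> x"
      by eventually_elim (auto simp: H_def H'_def inner_diff_right split: split_indicator)
  qed (intro borel_measurable_scaleR borel_measurable_indicator bm, use sH bm in auto)
  finally have "J + J' = 0" using z by simp
  then have "J' = - J" by (simp only: add_eq_0_iff)
  then have J': "J' = A *\<^sub>R n" using JA by simp
  have "bump_flux * \<rho>\<^sup>2 \<le> A"
  proof -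
    \<comment> \<open>The ball of radius \<open>\<rho>/4\<close> about \<open>q\<close> lies within
      distance \<open>3/4 \<rho>\<close> of \<open>p\<close> and at height at least
      \<open>\<rho>/4\<close> above the plane, so both the slope and the normal component are
      bounded below on it.\<close>
    define q where "q = p + (\<rho> / 2) *\<^sub>R n"
    define e where "e = exp (-16/7 :: real)"
    have "A = (LINT x:H|lebesgue. - (bump_grad p \<rho> x \<bullet> n))"
      unfolding A_def J_def using set_integral_inner_left[OF i[OF sH(3)], of n] by (simp add: set_lebesgue_integral_def)
    also have "\<dots> \<ge> (LINT x|lebesgue. (e / (2 * \<rho>)) * indicator (ball q (\<rho>/4)) x)"
      unfolding set_lebesgue_integral_def
    proof (rule integral_mono)
      have "ball q (\<rho>/4) \<in> lmeasurable" by simp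
      then show "integrable lebesgue (\<lambda>x. (e / (2 * \<rho>)) * indicator (ball q (\<rho>/4)) x)" by (auto simp: fmeasurable_def less_top)
      have "integrable lebesgue (\<lambda>x. (indicator H x *\<^sub>R bump_grad p \<rho> x) \<bullet> (-n))"
        using i[OF sH(3)] by (intro integrable_inner_left) (simp add: set_integrable_def)
      then show "integrable lebesgue (\<lambda>x. indicat_real H x *\<^sub>R - (bump_grad p \<rho> x \<bullet> n))" by simp
      fix x
      let ?f = "flat_exp' (1 - (norm (x - p))\<^sup>2 / \<rho>\<^sup>2)"
      have gn: "- (bump_grad p \<rho> x \<bullet> n) = 2 / \<rho>\<^sup>2 * ?f * (n \<bullet> (x - p))" by (simp add: bump_grad_def inner_commute)
      show "(e / (2 * \<rho>)) * indicator (ball q (\<rho>/4)) x \<le> indicat_real H x *\<^sub>R - (bump_grad p \<rho> x \<bullet> n)"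
      proof (cases "x \<in> ball q (\<rho>/4)")
        case True
        define y where "y = x - q"
        have ny: "norm y \<le> \<rho>/4" using True by (simp add: y_def dist_norm norm_minus_commute)
        have xp: "x - p = (\<rho>/2) *\<^sub>R n + y" by (simp add: y_def q_def)
        have "\<bar>n \<bullet> y\<bar> \<le> \<rho>/4" using Cauchy_Schwarz_ineq2[of n y] n ny by simp
        then have np: "n \<bullet> (x - p) \<ge> \<rho>/4" by (simp add: xp inner_add_right nn)
        then have xH: "x \<in> H" using \<rho> by (simp add: H_def)
        have "norm (x - p) \<le> \<rho>/2 + \<rho>/4" unfolding xp
          by (rule order_trans[OF norm_triangle_ineq]) (use n ny \<rho> in simp)
        then have "(norm (x - p))\<^sup>2 \<le> (3/4 * \<rho>)\<^sup>2" using \<rho> by (intro power_mono) auto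
        then have "(norm (x - p))\<^sup>2 \<le> 9/16 * \<rho>\<^sup>2" by (simp add: power_mult_distrib power2_eq_square)
        then have "(norm (x - p))\<^sup>2 / \<rho>\<^sup>2 \<le> 9/16" using \<rho> by (simp add: field_simps)
        then have "e \<le> ?f" unfolding e_def by (intro flat_exp'_ge) auto
        then have "2 / \<rho>\<^sup>2 * e * (\<rho>/4) \<le> 2 / \<rho>\<^sup>2 * ?f * (n \<bullet> (x - p))"
          using np \<rho> by (intro mult_mono mult_left_mono) (auto simp: e_def flat_exp_bounds)
        moreover have "2 / \<rho>\<^sup>2 * e * (\<rho>/4) = e / (2 * \<rho>)" using \<rho> by (simp add: power2_eq_square)
        ultimately show ?thesis using True xH gn by simp
      next
        case False
        have "0 \<le> indicat_real H x *\<^sub>R - (bump_grad p \<rho> x \<bullet> n)"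
          unfolding gn using flat_exp_bounds(3) by (auto simp: H_def split: split_indicator)
        then show ?thesis using False by simp
      qed
    qed
    also have "(LINT x|lebesgue. (e / (2 * \<rho>)) * indicator (ball q (\<rho>/4)) x) = (e / (2 * \<rho>)) * (unit_ball_vol 3 * (\<rho>/4) ^ 3)"
      using \<rho> measure_ball3[of "\<rho>/4" q] by simp
    also have "\<dots> = bump_flux * \<rho>\<^sup>2" using \<rho> by (simp add: bump_flux_def e_def power2_eq_square power3_eq_cube)
    finally show ?thesis .
  qed
  then show ?thesis
    by (intro exI[of _ A] conjI JA[unfolded J_def H_def] J'[unfolded J'_def H'_def])
qed

section \<open>Green's formula localised by a cutoff\<close>

lemma classical_curl_scaleR:
  fixes f :: "real^3 \<Rightarrow> real"
  assumes f: "smooth f"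
  shows "classical_curl (\<lambda>x. f x *\<^sub>R m) x = cross3 (\<chi> j. frechet_derivative f (at x) (axis j 1)) m"
proof -
  have "((\<lambda>x. f x *\<^sub>R m) has_derivative (\<lambda>h. frechet_derivative f (at x) h *\<^sub>R m)) (at x)"
    using has_derivative_scaleR_left[OF smooth_has_derivative[OF f]] .
  then have "frechet_derivative (\<lambda>x. f x *\<^sub>R m) (at x) = (\<lambda>h. frechet_derivative f (at x) h *\<^sub>R m)"
    by (rule frechet_derivative_at[symmetric])
  then show ?thesis
    by (simp add: classical_curl_def curl_of_jacobian_def jacobian_def matrix_def cross3_def)
qed

lemma smooth_classical_curl:
  fixes \<phi> :: "real^3 \<Rightarrow> real^3"
  assumes "smooth \<phi>" shows "smooth (classical_curl \<phi>)"
proof -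
  have c: "smooth (\<lambda>x. \<phi> x $ k)" for k
    using smooth_inner[OF assms smooth_const[of "axis k 1"]] by (simp add: inner_axis)
  define d where "d k j x = frechet_derivative (\<lambda>x. \<phi> x $ k) (at x) (axis j 1)" for k j x
  have sd: "smooth (d k j)" for k j unfolding d_def by (rule smooth_frechet_derivative[OF c])
  have s: "smooth (\<lambda>x. (d k j x + (-1) * d k' j' x) *\<^sub>R (axis i 1 :: real^3))" for k j k' j' i
    by (rule smooth_scaleR[OF smooth_add[OF sd smooth_mult[OF smooth_const sd]] smooth_const])
  have eq: "classical_curl \<phi> = (\<lambda>x. ((d 3 2 x + (-1) * d 2 3 x) *\<^sub>R axis 1 1 + (d 1 3 x + (-1) * d 3 1 x) *\<^sub>R axis 2 1) + (d 2 1 x + (-1) * d 1 2 x) *\<^sub>R axis 3 1)"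
    by (rule ext) (simp add: classical_curl_def curl_of_jacobian_def jacobian_entry[OF assms] d_def vec_eq_iff forall_3 axis_def)
  show ?thesis unfolding eq by (rule smooth_add, rule smooth_add, (rule s)+)
qed

lemma smooth_L2:
  fixes f :: "real^3 \<Rightarrow> 'b::euclidean_space"
  assumes f: "smooth f" and U: "U \<in> lmeasurable" "bounded U"
  shows "f \<in> L2 U"
proof -
  have "bounded (f ` closure U)"
    by (intro compact_imp_bounded compact_continuous_image smooth_continuous[OF f]) (use U in simp)
  then obtain B where B: "\<And>x. x \<in> closure U \<Longrightarrow> norm (f x) \<le> B" by (auto simp: bounded_iff)
  show ?thesis
  proof (rule L2_bounded(1)[OF U(1) smooth_lebesgue[OF f] U(1)])
    show "norm (f x) \<le> max B 0 * indicator U x" if "x \<in> U" for x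
    proof -
      have "norm (f x) \<le> B" using B closure_subset[of U] that by blast
      then show ?thesis using that by simp
    qed
  qed simp
qed

lemma set_integral_partition:
  fixes f :: "real^3 \<Rightarrow> real"
  assumes T: "finite T" and U: "\<And>K. K \<in> T \<Longrightarrow> U K \<in> sets lebesgue" "\<And>K. K \<in> T \<Longrightarrow> U K \<subseteq> \<Omega>"
    and dis: "\<And>K K'. K \<in> T \<Longrightarrow> K' \<in> T \<Longrightarrow> K \<noteq> K' \<Longrightarrow> U K \<inter> U K' = {}"
    and null: "\<Omega> - (\<Union>K\<in>T. U K) \<in> null_sets lebesgue" and f: "set_integrable lebesgue \<Omega> f"
  shows "(LINT x:\<Omega>|lebesgue. f x) = (\<Sum>K\<in>T. LINT x:U K|lebesgue. f x)"
proof -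
  have i: "integrable lebesgue (\<lambda>x. indicator (U K) x *\<^sub>R f x)" if "K \<in> T" for K
    using set_integrable_subset[OF f U(1) U(2)] that by (simp add: set_integrable_def)
  have "(LINT x:\<Omega>|lebesgue. f x) = (LINT x|lebesgue. (\<Sum>K\<in>T. indicator (U K) x *\<^sub>R f x))"
    unfolding set_lebesgue_integral_def
  proof (rule integral_cong_AE)
    show "(\<lambda>x. indicat_real \<Omega> x *\<^sub>R f x) \<in> borel_measurable lebesgue" using f by (auto simp: set_integrable_def)
    show "(\<lambda>x. \<Sum>K\<in>T. indicat_real (U K) x *\<^sub>R f x) \<in> borel_measurable lebesgue"
      by (rule borel_measurable_sum) (use i in auto)
    have "AE x in lebesgue. x \<notin> \<Omega> - (\<Union>K\<in>T. U K)" by (rule AE_not_in[OF null])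
    then show "AE x in lebesgue. indicat_real \<Omega> x *\<^sub>R f x = (\<Sum>K\<in>T. indicat_real (U K) x *\<^sub>R f x)"
    proof eventually_elim
      case (elim x)
      show ?case
      proof (cases "x \<in> \<Omega>")
        case True
        then obtain K where K: "K \<in> T" "x \<in> U K" using elim by blast
        have "(\<Sum>K'\<in>T. indicat_real (U K') x *\<^sub>R f x) = (\<Sum>K'\<in>T. if K' = K then f x else 0)"
          by (rule sum.cong) (use dis K in \<open>auto split: split_indicator\<close>)
        then show ?thesis using K T True by simp
      next
        case False
        then have "x \<notin> U K" if "K \<in> T" for K using U that by blast
        then show ?thesis using False by simp
      qed
    qed
  qed
  also have "\<dots> = (\<Sum>K\<in>T. LINT x:U K|lebesgue. f x)"
    unfolding set_lebesgue_integral_def by (rule Bochner_Integration.integral_sum) (rule i)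
  finally show ?thesis .
qed

text \<open>On the part of \<open>U\<close> inside the ball the cutoff is constant, and outside the
  ball both the bump and its gradient vanish. The gradient of \<open>\<eta>\<close> therefore never
  contributes and needs no bound.\<close>

lemma cutoff_derivative:
  fixes \<eta> :: "real^3 \<Rightarrow> real"
  assumes \<rho>: "\<rho> > 0" and \<eta>: "smooth \<eta>" and U: "open U" "x \<in> U" and k: "\<And>y. y \<in> U \<inter> ball p \<rho> \<Longrightarrow> \<eta> y = k"
  shows "\<eta> x * bump p \<rho> x = k * bump p \<rho> x"
    "frechet_derivative (\<lambda>x. \<eta> x * bump p \<rho> x) (at x) h = k * (bump_grad p \<rho> x \<bullet> h)"
proof -
  show "\<eta> x * bump p \<rho> x = k * bump p \<rho> x"
    using k[of x] U bump_out(1)[OF \<rho>, of x p] by (cases "x \<in> ball p \<rho>") auto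
  have d: "((\<lambda>x. \<eta> x * bump p \<rho> x) has_derivative (\<lambda>h. \<eta> x * (bump_grad p \<rho> x \<bullet> h) + frechet_derivative \<eta> (at x) h * bump p \<rho> x)) (at x)"
    by (rule has_derivative_mult[OF smooth_has_derivative[OF \<eta>] bump_has_derivative])
  have "\<eta> x * (bump_grad p \<rho> x \<bullet> h) + frechet_derivative \<eta> (at x) h * bump p \<rho> x = k * (bump_grad p \<rho> x \<bullet> h)" for h
  proof (cases "x \<in> ball p \<rho>")
    case True
    have "((\<lambda>y. k) has_derivative (\<lambda>h. 0)) (at x)" by simp
    then have "(\<eta> has_derivative (\<lambda>h. 0)) (at x)"
    proof (rule has_derivative_transform_within_open)
      show "open (U \<inter> ball p \<rho>)" "x \<in> U \<inter> ball p \<rho>" using U True by auto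
      show "\<And>y. y \<in> U \<inter> ball p \<rho> \<Longrightarrow> k = \<eta> y" using k by simp
    qed
    then have "frechet_derivative \<eta> (at x) = (\<lambda>h. 0)" by (rule frechet_derivative_at[symmetric])
    then show ?thesis using k[of x] U True by simp
  qed (simp add: bump_out[OF \<rho>])
  then show "frechet_derivative (\<lambda>x. \<eta> x * bump p \<rho> x) (at x) h = k * (bump_grad p \<rho> x \<bullet> h)"
    using fun_cong[OF frechet_derivative_at[OF d], of h] by simp
qed

text \<open>The vanishing tangential trace moves the curl from \<open>v\<close> to the test field on
  \<open>\<Omega>\<close>, whatever the support of that field. Both sides then split over the
  elements: in the ball the cutoff is 1 on those of \<open>N\<close> and 0 on the others, which
  contribute nothing. On an element of \<open>N\<close> the global weak curl is the curl of the
  local weak Jacobian, by uniqueness.\<close>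

lemma green_cutoff:
  fixes \<eta> :: "real^3 \<Rightarrow> real"
  assumes v: "v \<in> H0_curl \<Omega>" and \<Omega>: "open \<Omega>" "bounded \<Omega>"
    and T: "finite T" and U: "\<And>K. K \<in> T \<Longrightarrow> open (U K)" "\<And>K. K \<in> T \<Longrightarrow> U K \<subseteq> \<Omega>"
    and dis: "\<And>K K'. K \<in> T \<Longrightarrow> K' \<in> T \<Longrightarrow> K \<noteq> K' \<Longrightarrow> U K \<inter> U K' = {}"
    and null: "\<Omega> - (\<Union>K\<in>T. U K) \<in> null_sets lebesgue"
    and N: "N \<subseteq> T" "\<And>K. K \<in> N \<Longrightarrow> v \<in> H1 (U K)"
    and \<eta>: "smooth \<eta>" "\<And>K x. K \<in> N \<Longrightarrow> x \<in> U K \<inter> ball p \<rho> \<Longrightarrow> \<eta> x = 1"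
      "\<And>K x. K \<in> T - N \<Longrightarrow> x \<in> U K \<inter> ball p \<rho> \<Longrightarrow> \<eta> x = 0"
    and \<rho>: "\<rho> > 0"
  shows "(\<Sum>K\<in>N. LINT x:U K|lebesgue. v x \<bullet> cross3 (bump_grad p \<rho> x) m)
     = (\<Sum>K\<in>N. LINT x:U K|lebesgue. curl_of_jacobian (weak_jacobian (U K) v x) \<bullet> (bump p \<rho> x *\<^sub>R m))"
proof -
  define f where "f x = \<eta> x * bump p \<rho> x" for x
  define \<phi> where "\<phi> x = f x *\<^sub>R m" for x
  define w where "w = weak_curl \<Omega> v"
  have \<Omega>m: "\<Omega> \<in> lmeasurable" using \<Omega> by (simp add: lmeasurable_open)
  have Ul: "U K \<in> sets lebesgue" if "K \<in> T" for K using U(1)[OF that] by simp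
  have UlN: "U K \<in> sets lebesgue" if "K \<in> N" for K using Ul that N(1) by blast
  have smf: "smooth f" unfolding f_def by (rule smooth_mult[OF \<eta>(1) smooth_bump])
  have sm\<phi>: "smooth \<phi>" unfolding \<phi>_def by (rule smooth_scaleR[OF smf smooth_const])
  obtain w0 where w0: "v \<in> L2 \<Omega>" "w0 \<in> L2 \<Omega>" "has_weak_curl \<Omega> v w0" and tr: "tangential_trace \<Omega> v \<phi> = 0"
    using v sm\<phi> unfolding H0_curl_def H_curl_def by blast
  note w = weak_curl_spec[OF \<Omega>(1) \<Omega>m w0(2,3), folded w_def]
  have eq: "(LINT x:\<Omega>|lebesgue. w x \<bullet> \<phi> x) = (LINT x:\<Omega>|lebesgue. v x \<bullet> classical_curl \<phi> x)"
    using tr by (simp add: tangential_trace_def w_def)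
  have i1: "set_integrable lebesgue \<Omega> (\<lambda>x. w x \<bullet> \<phi> x)"
    by (rule L2_integrable_inner[OF w(1) smooth_L2[OF sm\<phi> \<Omega>m \<Omega>(2)]])
  have i2: "set_integrable lebesgue \<Omega> (\<lambda>x. v x \<bullet> classical_curl \<phi> x)"
    by (rule L2_integrable_inner[OF w0(1) smooth_L2[OF smooth_classical_curl[OF sm\<phi>] \<Omega>m \<Omega>(2)]])
  have loc: "f x = k * bump p \<rho> x \<and> classical_curl \<phi> x = k *\<^sub>R cross3 (bump_grad p \<rho> x) m"
    if "K \<in> T" "x \<in> U K" "\<And>y. y \<in> U K \<inter> ball p \<rho> \<Longrightarrow> \<eta> y = k" for K x k
  proof
    show "f x = k * bump p \<rho> x" unfolding f_def by (rule cutoff_derivative(1)[OF \<rho> \<eta>(1) U(1)[OF that(1)] that(2,3)])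
    have "frechet_derivative f (at x) h = k * (bump_grad p \<rho> x \<bullet> h)" for h
      unfolding f_def[abs_def] by (rule cutoff_derivative(2)[OF \<rho> \<eta>(1) U(1)[OF that(1)] that(2,3)])
    then have "(\<chi> j. frechet_derivative f (at x) (axis j 1)) = k *\<^sub>R bump_grad p \<rho> x"
      by (simp add: vec_eq_iff inner_axis)
    then show "classical_curl \<phi> x = k *\<^sub>R cross3 (bump_grad p \<rho> x) m"
      unfolding \<phi>_def[abs_def] classical_curl_scaleR[OF smf] by (simp add: cross_mult_left)
  qed
  have z: "(LINT x:S|lebesgue. h x) = 0" if "\<And>x. x \<in> S \<Longrightarrow> h x = 0" for S and h :: "real^3 \<Rightarrow> real"
  proof -
    have "(\<lambda>x. indicat_real S x *\<^sub>R h x) = (\<lambda>x. 0)" by (rule ext) (use that in \<open>simp split: split_indicator\<close>)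
    then show ?thesis by (simp add: set_lebesgue_integral_def)
  qed
  have "(LINT x:\<Omega>|lebesgue. v x \<bullet> classical_curl \<phi> x) = (\<Sum>K\<in>T. LINT x:U K|lebesgue. v x \<bullet> classical_curl \<phi> x)"
    by (rule set_integral_partition[OF T Ul U(2) dis null i2])
  also have "\<dots> = (\<Sum>K\<in>N. LINT x:U K|lebesgue. v x \<bullet> classical_curl \<phi> x)"
  proof (rule sum.mono_neutral_right[OF T N(1)], rule ballI, rule z)
    fix K x assume "K \<in> T - N" "x \<in> U K"
    then show "v x \<bullet> classical_curl \<phi> x = 0" using loc[of K x 0] \<eta>(3) by auto
  qed
  also have "\<dots> = (\<Sum>K\<in>N. LINT x:U K|lebesgue. v x \<bullet> cross3 (bump_grad p \<rho> x) m)"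
  proof (rule sum.cong[OF refl])
    fix K assume K: "K \<in> N"
    have "classical_curl \<phi> x = cross3 (bump_grad p \<rho> x) m" if "x \<in> U K" for x
      using loc[of K x 1] \<eta>(2)[OF K] K N(1) that by auto
    then show "(LINT x:U K|lebesgue. v x \<bullet> classical_curl \<phi> x) = (LINT x:U K|lebesgue. v x \<bullet> cross3 (bump_grad p \<rho> x) m)"
      by (intro set_lebesgue_integral_cong UlN[OF K]) auto
  qed
  finally have e1: "(LINT x:\<Omega>|lebesgue. v x \<bullet> classical_curl \<phi> x) = (\<Sum>K\<in>N. LINT x:U K|lebesgue. v x \<bullet> cross3 (bump_grad p \<rho> x) m)" .
  have "(LINT x:\<Omega>|lebesgue. w x \<bullet> \<phi> x) = (\<Sum>K\<in>T. LINT x:U K|lebesgue. w x \<bullet> \<phi> x)"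
    by (rule set_integral_partition[OF T Ul U(2) dis null i1])
  also have "\<dots> = (\<Sum>K\<in>N. LINT x:U K|lebesgue. w x \<bullet> \<phi> x)"
  proof (rule sum.mono_neutral_right[OF T N(1)], rule ballI, rule z)
    fix K x assume "K \<in> T - N" "x \<in> U K"
    then show "w x \<bullet> \<phi> x = 0" using loc[of K x 0] \<eta>(3) by (auto simp: \<phi>_def)
  qed
  also have "\<dots> = (\<Sum>K\<in>N. LINT x:U K|lebesgue. curl_of_jacobian (weak_jacobian (U K) v x) \<bullet> (bump p \<rho> x *\<^sub>R m))"
  proof (rule sum.cong[OF refl])
    fix K assume K: "K \<in> N"
    then have KT: "K \<in> T" using N(1) by blast
    have UKm: "U K \<in> lmeasurable" using bounded_subset[OF \<Omega>(2) U(2)[OF KT]] U(1)[OF KT] by (simp add: lmeasurable_open)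
    have UKb: "bounded (U K)" using bounded_subset[OF \<Omega>(2) U(2)[OF KT]] .
    note G = weak_jacobian_spec[OF N(2)[OF K]]
    have vL: "v \<in> L2 (U K)" by (rule L2_mono[OF w0(1) Ul[OF KT] U(2)[OF KT]])
    have wL: "w \<in> L2 (U K)" by (rule L2_mono[OF w(1) Ul[OF KT] U(2)[OF KT]])
    let ?c = "\<lambda>x. curl_of_jacobian (weak_jacobian (U K) v x)"
    have cL: "?c \<in> L2 (U K)" by (rule L2_curl_of_jacobian[OF G(1)])
    have ae: "AE x in lebesgue. x \<in> U K \<longrightarrow> w x = ?c x"
      by (rule weak_curl_unique[OF U(1)[OF KT] UKm wL cL has_weak_curl_restrict[OF w(2) U(2)[OF KT]]
            weak_curl_of_weak_jacobian[OF UKm vL G]])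
    have fx: "\<phi> x = bump p \<rho> x *\<^sub>R m" if "x \<in> U K" for x
      using loc[of K x 1] \<eta>(2)[OF K] KT that by (auto simp: \<phi>_def)
    have bL: "(\<lambda>x. bump p \<rho> x *\<^sub>R m) \<in> L2 (U K)" by (rule smooth_L2[OF smooth_scaleR[OF smooth_bump smooth_const] UKm UKb])
    have pL: "\<phi> \<in> L2 (U K)" by (rule smooth_L2[OF sm\<phi> UKm UKb])
    show "(LINT x:U K|lebesgue. w x \<bullet> \<phi> x) = (LINT x:U K|lebesgue. ?c x \<bullet> (bump p \<rho> x *\<^sub>R m))"
      unfolding set_lebesgue_integral_def
    proof (rule integral_cong_AE)
      show "(\<lambda>x. indicat_real (U K) x *\<^sub>R (w x \<bullet> \<phi> x)) \<in> borel_measurable lebesgue"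
        using L2_integrable_inner[OF wL pL] unfolding set_integrable_def by (rule borel_measurable_integrable)
      show "(\<lambda>x. indicat_real (U K) x *\<^sub>R (?c x \<bullet> (bump p \<rho> x *\<^sub>R m))) \<in> borel_measurable lebesgue"
        using L2_integrable_inner[OF cL bL] unfolding set_integrable_def by (rule borel_measurable_integrable)
      show "AE x in lebesgue. indicat_real (U K) x *\<^sub>R (w x \<bullet> \<phi> x) = indicat_real (U K) x *\<^sub>R (?c x \<bullet> (bump p \<rho> x *\<^sub>R m))"
        using ae by eventually_elim (use fx in \<open>simp split: split_indicator\<close>)
    qed
  qed
  finally show ?thesis using e1 eq by simp
qed

text \<open>Inside the ball the element coincides with \<open>H\<close>, a half-space in the
  applications, so replacing \<open>v\<close> by its mean leaves an explicit flux. The replacement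
  costs Poincare's \<open>3 h\<close> times the gradient bound \<open>4 / \<rho>\<close>, hence
  \<open>12 h / \<rho>\<close>; the curl term costs the 2 of
  \<open>L2_curl_of_jacobian\<close>.\<close>

lemma element_flux_estimate:
  assumes U: "open U" "convex U" "bounded U" "U \<noteq> {}" and v: "v \<in> L2 U" "v \<in> H1 U"
    and \<rho>: "\<rho> > 0" and m: "norm m \<le> 1" and h: "diameter U \<le> h"
    and H: "H \<in> sets lebesgue" "U \<inter> ball p \<rho> = H \<inter> ball p \<rho>"
  defines "G \<equiv> weak_jacobian U v"
  shows "\<bar>(LINT x:U|lebesgue. v x \<bullet> cross3 (bump_grad p \<rho> x) m)
      - (LINT x:U|lebesgue. curl_of_jacobian (G x) \<bullet> (bump p \<rho> x *\<^sub>R m))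
      - mean U v \<bullet> cross3 (LINT x:H|lebesgue. bump_grad p \<rho> x) m\<bar>
    \<le> (12 * h / \<rho> + 2) * sqrt (unit_ball_vol 3 * \<rho> ^ 3) * L2_norm U G"
proof -
  have Um: "U \<in> lmeasurable" using U by (simp add: lmeasurable_open)
  note G = weak_jacobian_spec[OF v(2), folded G_def]
  let ?g = "\<lambda>x. cross3 (bump_grad p \<rho> x) m" and ?c = "mean U v" and ?B = "sqrt (unit_ball_vol 3 * \<rho> ^ 3)"
  have mB: "measure lebesgue (ball p \<rho>) = unit_ball_vol 3 * \<rho> ^ 3" using measure_ball3 \<rho> by simp
  have ng: "norm (?g x) \<le> (4 / \<rho>) * indicator (ball p \<rho>) x" for x
  proof -
    have "norm (?g x) \<le> norm (bump_grad p \<rho> x) * norm m" by (rule norm_cross_le)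
    also have "\<dots> \<le> norm (bump_grad p \<rho> x) * 1" using m by (intro mult_left_mono) auto
    also have "\<dots> \<le> (4 / \<rho>) * indicator (ball p \<rho>) x" using bump_bounds(2)[OF \<rho>] by simp
    finally show ?thesis .
  qed
  have "bounded_linear (\<lambda>y. cross3 y m)"
    by (rule bounded_linear_intro[where K="norm m"]) (use norm_cross_le in \<open>auto simp: cross_add_left cross_mult_left\<close>)
  note lc = this
  have gm: "?g \<in> borel_measurable lebesgue"
  proof (rule measurable_completion)
    show "?g \<in> borel_measurable lborel"
      using measurable_compose[OF bump_grad_borel borel_measurable_continuous_onI[OF linear_continuous_on[OF lc]]] by simp
  qed
  have gL: "?g \<in> L2 U" "L2_norm U ?g \<le> (4 / \<rho>) * ?B"
    using L2_bounded[OF Um gm lmeasurable_ball ng] \<rho> by (simp_all add: mB)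
  have bL: "(\<lambda>x. bump p \<rho> x *\<^sub>R m) \<in> L2 U" "L2_norm U (\<lambda>x. bump p \<rho> x *\<^sub>R m) \<le> 1 * ?B"
  proof -
    have "norm (bump p \<rho> x *\<^sub>R m) \<le> 1 * indicator (ball p \<rho>) x" for x
      using mult_mono[OF bump_bounds(1)[OF \<rho>, of p x] m] by simp
    note L2_bounded[OF Um smooth_lebesgue[OF smooth_scaleR[OF smooth_bump smooth_const]] lmeasurable_ball this zero_le_one]
    then show "(\<lambda>x. bump p \<rho> x *\<^sub>R m) \<in> L2 U" "L2_norm U (\<lambda>x. bump p \<rho> x *\<^sub>R m) \<le> 1 * ?B"
      unfolding mB by auto
  qed
  have vL: "(\<lambda>x. v x - ?c) \<in> L2 U" by (intro L2_diff v L2_const Um)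
  have cL: "(\<lambda>x. ?c) \<in> L2 U" by (rule L2_const[OF Um])
  note curlL = L2_curl_of_jacobian[OF G(1)]
  have gi: "set_integrable lebesgue U ?g" by (rule L2_set_integrable[OF gL(1) Um])
  have si: "set_integrable lebesgue H (bump_grad p \<rho>)" "set_integrable lebesgue U (bump_grad p \<rho>)"
    by (rule bump_grad_integrable[OF \<rho>], use H Um in auto)+
  have "(LINT x:U|lebesgue. v x \<bullet> ?g x) = (LINT x:U|lebesgue. (v x - ?c) \<bullet> ?g x) + (LINT x:U|lebesgue. ?c \<bullet> ?g x)"
    by (subst set_integral_add(2)[symmetric, OF L2_integrable_inner[OF vL gL(1)] L2_integrable_inner[OF cL gL(1)]])
       (simp add: inner_diff_left)
  moreover have "(LINT x:U|lebesgue. ?c \<bullet> ?g x) = ?c \<bullet> cross3 (LINT x:H|lebesgue. bump_grad p \<rho> x) m"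
  proof -
    have A1: "(LINT x:U|lebesgue. ?g x \<bullet> ?c) = (LINT x:U|lebesgue. ?g x) \<bullet> ?c" by (rule set_integral_inner_left[OF gi])
    have A2: "(LINT x:U|lebesgue. ?g x) = cross3 (LINT x:U|lebesgue. bump_grad p \<rho> x) m"
    proof -
      have "(LINT x|lebesgue. cross3 (indicator U x *\<^sub>R bump_grad p \<rho> x) m) = cross3 (LINT x|lebesgue. indicator U x *\<^sub>R bump_grad p \<rho> x) m"
        by (rule integral_bounded_linear[OF lc]) (use si(2) in \<open>simp add: set_integrable_def\<close>)
      then show ?thesis by (simp add: set_lebesgue_integral_def cross_mult_left)
    qed
    have A3: "(LINT x:U|lebesgue. bump_grad p \<rho> x) = (LINT x:H|lebesgue. bump_grad p \<rho> x)"
    proof -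
      have "indicat_real U x *\<^sub>R bump_grad p \<rho> x = indicat_real H x *\<^sub>R bump_grad p \<rho> x" for x
      proof (cases "x \<in> ball p \<rho>")
        case True
        then have "x \<in> U \<longleftrightarrow> x \<in> H" using H(2) by blast
        then show ?thesis by (simp add: indicator_def)
      qed (simp add: bump_out(2)[OF \<rho>])
      then show ?thesis by (simp only: set_lebesgue_integral_def)
    qed
    show ?thesis by (simp only: inner_commute[of ?c] A1 A2 A3)
  qed
  moreover have "\<bar>LINT x:U|lebesgue. (v x - ?c) \<bullet> ?g x\<bar> \<le> (12 * h / \<rho>) * ?B * L2_norm U G"
  proof -
    have d0: "0 \<le> diameter U" by (rule diameter_ge_0[OF U(3)])
    have "\<bar>LINT x:U|lebesgue. (v x - ?c) \<bullet> ?g x\<bar> \<le> L2_norm U (\<lambda>x. v x - ?c) * L2_norm U ?g"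
      by (rule L2_Cauchy_Schwarz[OF vL gL(1)])
    also have "\<dots> \<le> (3 * h * L2_norm U G) * ((4 / \<rho>) * ?B)"
    proof (rule mult_mono)
      have "L2_norm U (\<lambda>x. v x - ?c) \<le> 3 * diameter U * L2_norm U G" by (rule poincare[OF U v(1) G])
      also have "\<dots> \<le> 3 * h * L2_norm U G" using h by (intro mult_right_mono) (auto simp: L2_norm_nonneg)
      finally show "L2_norm U (\<lambda>x. v x - ?c) \<le> 3 * h * L2_norm U G" .
    qed (use gL(2) d0 h in \<open>auto simp: L2_norm_nonneg\<close>)
    finally show ?thesis by (simp add: mult_ac)
  qed
  moreover have "\<bar>LINT x:U|lebesgue. curl_of_jacobian (G x) \<bullet> (bump p \<rho> x *\<^sub>R m)\<bar> \<le> 2 * ?B * L2_norm U G"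
  proof -
    have "\<bar>LINT x:U|lebesgue. curl_of_jacobian (G x) \<bullet> (bump p \<rho> x *\<^sub>R m)\<bar> \<le> L2_norm U (\<lambda>x. curl_of_jacobian (G x)) * L2_norm U (\<lambda>x. bump p \<rho> x *\<^sub>R m)"
      by (rule L2_Cauchy_Schwarz[OF curlL(1) bL(1)])
    also have "\<dots> \<le> (2 * L2_norm U G) * (1 * ?B)"
      by (rule mult_mono[OF curlL(2) bL(2)]) (auto simp: L2_norm_nonneg)
    finally show ?thesis by (simp add: mult_ac)
  qed
  moreover have "(12 * h / \<rho> + 2) * ?B * L2_norm U G = (12 * h / \<rho>) * ?B * L2_norm U G + 2 * ?B * L2_norm U G"
    by (simp only: distrib_right)
  ultimately show ?thesis unfolding abs_le_iff by linarith
qed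

section \<open>Barycentric coordinates of a tetrahedron\<close>

definition tetra :: "(real^3) set \<Rightarrow> bool" where
  "tetra V \<longleftrightarrow> card V = 4 \<and> \<not> affine_dependent V"

lemma tetra_finite: "tetra V \<Longrightarrow> finite V"
  by (simp add: tetra_def aff_independent_finite)

lemma simplex3_tetra: "3 simplex K \<longleftrightarrow> (\<exists>V. tetra V \<and> K = convex hull V)"
  unfolding simplex_def tetra_def by auto

text \<open>Affine independence makes the differences to another vertex \<open>a\<close> linearly
  independent, so a linear functional with the prescribed values exists; its representing vector is
  \<open>g\<close>.\<close>

lemma bary_exists:
  assumes "tetra V" "v \<in> V"
  shows "\<exists>g k. \<forall>w\<in>V. k + g \<bullet> w = (if w = v then 1 else 0 :: real)"
proof -
  have f: "finite V" using assms tetra_finite by blast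
  have "card (V - {v}) = 3" using assms by (simp add: tetra_def)
  then obtain a where a: "a \<in> V - {v}" by (metis card.empty ex_in_conv zero_neq_numeral)
  have "\<not> dependent ((\<lambda>x. -a + x) ` (V - {a}))"
    using assms(1) affine_dependent_iff_dependent2[OF DiffD1[OF a]] unfolding tetra_def by blast
  then have "\<exists>f. linear f \<and> (\<forall>x\<in>(\<lambda>x. -a + x) ` (V - {a}). f x = (if x = v - a then 1 else (0::real)))"
    by (rule linear_independent_extend)
  then obtain f :: "real^3 \<Rightarrow> real" where "linear f"
    and f: "\<forall>x\<in>(\<lambda>x. -a + x) ` (V - {a}). f x = (if x = v - a then 1 else 0)" by blast
  define g where "g = adjoint f 1"
  have g: "g \<bullet> x = f x" for x
    using adjoint_works[OF \<open>linear f\<close>, of x 1] by (simp add: g_def inner_commute)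
  have "- (g \<bullet> a) + g \<bullet> w = (if w = v then 1 else 0)" if "w \<in> V" for w
  proof (cases "w = a")
    case False
    have "- (g \<bullet> a) + g \<bullet> w = f (-a + w)" by (simp add: g[symmetric] inner_simps)
    also have "\<dots> = (if -a + w = v - a then 1 else 0)" using f False that by blast
    finally show ?thesis by auto
  qed (use a in auto)
  then show ?thesis by blast
qed

text \<open>The gradient of the barycentric coordinate of \<open>v\<close>. Only the gradient is
  chosen; \<open>bary\<close> recovers the constant term from the value 1 at
  \<open>v\<close>.\<close>

definition bgrad :: "(real^3) set \<Rightarrow> real^3 \<Rightarrow> real^3" where
  "bgrad V v = (SOME g. \<exists>k. \<forall>w\<in>V. k + g \<bullet> w = (if w = v then 1 else 0 :: real))"

definition bary :: "(real^3) set \<Rightarrow> real^3 \<Rightarrow> real^3 \<Rightarrow> real" where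
  "bary V v x = 1 + bgrad V v \<bullet> (x - v)"

lemma bary_vertex:
  assumes "tetra V" "v \<in> V" "w \<in> V"
  shows "bary V v w = (if w = v then 1 else 0)"
proof -
  have "\<exists>k. \<forall>w\<in>V. k + bgrad V v \<bullet> w = (if w = v then 1 else 0 :: real)"
    unfolding bgrad_def by (rule someI_ex) (rule bary_exists[OF assms(1,2)])
  then obtain k where k: "\<And>w. w \<in> V \<Longrightarrow> k + bgrad V v \<bullet> w = (if w = v then 1 else 0 :: real)" by blast
  show ?thesis using k[OF assms(3)] k[OF assms(2)] by (simp add: bary_def inner_diff_right split: if_splits)
qed

lemma bary_diff: "bary V v x - bary V v y = bgrad V v \<bullet> (x - y)"
  by (simp add: bary_def inner_simps)

lemma bary_comb:
  assumes "sum u S = 1"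
  shows "bary V v (\<Sum>w\<in>S. u w *\<^sub>R f w) = (\<Sum>w\<in>S. u w * bary V v (f w))"
proof -
  have "(\<Sum>w\<in>S. u w * bary V v (f w)) = sum u S * (1 - bgrad V v \<bullet> v) + (\<Sum>w\<in>S. u w * (bgrad V v \<bullet> f w))"
    by (simp add: bary_def inner_simps algebra_simps sum.distrib sum_distrib_left sum_distrib_right sum_subtractf)
  then show ?thesis using assms by (simp add: bary_def inner_simps inner_sum_right)
qed

lemma bary_rep:
  assumes V: "tetra V"
  shows "(\<Sum>v\<in>V. bary V v x) = 1" "(\<Sum>v\<in>V. bary V v x *\<^sub>R v) = x"
proof -
  have f: "finite V" using V tetra_finite by blast
  have "affine hull V = UNIV"
    using V by (intro affine_independent_span_eq) (auto simp: tetra_def)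
  then have "x \<in> {y. \<exists>u. sum u V = 1 \<and> (\<Sum>v\<in>V. u v *\<^sub>R v) = y}" using affine_hull_finite[OF f] by simp
  then obtain u where u: "sum u V = 1" "(\<Sum>v\<in>V. u v *\<^sub>R v) = x" by blast
  have "bary V v x = u v" if "v \<in> V" for v
  proof -
    have "bary V v x = (\<Sum>w\<in>V. u w * bary V v w)" using bary_comb[OF u(1), of V v "\<lambda>w. w"] u(2) by simp
    also have "\<dots> = (\<Sum>w\<in>V. if w = v then u w else 0)" by (rule sum.cong) (auto simp: bary_vertex[OF V that])
    also have "\<dots> = u v" using f that by simp
    finally show ?thesis .
  qed
  then show "(\<Sum>v\<in>V. bary V v x) = 1" "(\<Sum>v\<in>V. bary V v x *\<^sub>R v) = x" using u by (auto cong: sum.cong)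
qed

lemma bary_other:
  assumes V: "tetra V" and W: "tetra W" "w \<in> W"
  shows "bary W w x = (\<Sum>v\<in>V. bary V v x * bary W w v)"
  using bary_comb[OF bary_rep(1)[OF V], of W w x "\<lambda>v. v"] bary_rep(2)[OF V] by simp

lemma hull_subset_bary:
  assumes V: "tetra V" and S: "S \<subseteq> V"
  shows "x \<in> convex hull S \<longleftrightarrow> (\<forall>v\<in>V. bary V v x \<ge> 0) \<and> (\<forall>v\<in>V - S. bary V v x = 0)"
proof
  have fV: "finite V" using V tetra_finite by blast
  then have f: "finite S" using S finite_subset by blast
  assume "x \<in> convex hull S"
  then obtain u where u: "\<forall>v\<in>S. 0 \<le> u v" "sum u S = 1" "(\<Sum>v\<in>S. u v *\<^sub>R v) = x" using convex_hull_finite[OF f] by auto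
  have "bary V v x = (if v \<in> S then u v else 0)" if "v \<in> V" for v
  proof -
    have "bary V v x = (\<Sum>w\<in>S. u w * bary V v w)" using bary_comb[OF u(2), of V v "\<lambda>w. w"] u(3) by simp
    also have "\<dots> = (\<Sum>w\<in>S. if w = v then u w else 0)"
      by (rule sum.cong) (use S in \<open>auto simp: bary_vertex[OF V that] subset_iff\<close>)
    also have "\<dots> = (if v \<in> S then u v else 0)" using f by simp
    finally show ?thesis .
  qed
  then show "(\<forall>v\<in>V. bary V v x \<ge> 0) \<and> (\<forall>v\<in>V - S. bary V v x = 0)" using u by simp
next
  have fV: "finite V" using V tetra_finite by blast
  then have f: "finite S" using S finite_subset by blast
  assume *: "(\<forall>v\<in>V. bary V v x \<ge> 0) \<and> (\<forall>v\<in>V - S. bary V v x = 0)"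
  have "(\<Sum>v\<in>S. bary V v x) = (\<Sum>v\<in>V. bary V v x)" "(\<Sum>v\<in>S. bary V v x *\<^sub>R v) = (\<Sum>v\<in>V. bary V v x *\<^sub>R v)"
    by (rule sum.mono_neutral_left; use * S fV in auto)+
  then have "sum (\<lambda>v. bary V v x) S = 1 \<and> (\<Sum>v\<in>S. bary V v x *\<^sub>R v) = x" using bary_rep[OF V] by simp
  then show "x \<in> convex hull S" unfolding convex_hull_finite[OF f]
    by (intro CollectI exI[of _ "\<lambda>v. bary V v x"]) (use * S in auto)
qed

lemma hull_bary: "tetra V \<Longrightarrow> x \<in> convex hull V \<longleftrightarrow> (\<forall>v\<in>V. bary V v x \<ge> 0)"
  using hull_subset_bary[of V V] by auto

lemma continuous_bary: "continuous_on A (bary V v)"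
  unfolding bary_def by (intro continuous_intros)

lemma bgrad_nonzero:
  assumes V: "tetra V" "v \<in> V" shows "bgrad V v \<noteq> 0"
proof
  assume z: "bgrad V v = 0"
  have "card (V - {v}) = 3" using assms by (simp add: tetra_def)
  then obtain a where a: "a \<in> V" "a \<noteq> v" by (metis Diff_iff card.empty ex_in_conv singletonI zero_neq_numeral)
  then show False using bary_vertex[OF V a(1)] z by (simp add: bary_def)
qed

lemma interior_bary:
  assumes V: "tetra V"
  shows "interior (convex hull V) = {x. \<forall>v\<in>V. bary V v x > 0}"
proof
  have f: "finite V" using V tetra_finite by blast
  have "open {x. \<forall>v\<in>V. bary V v x > 0}"
  proof -
    have "{x. \<forall>v\<in>V. bary V v x > 0} = (\<Inter>v\<in>V. {x. bary V v x > 0})" by auto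
    moreover have "open {x. bary V v x > 0}" for v
      by (rule open_Collect_less) (auto intro: continuous_bary)
    ultimately show ?thesis using f by auto
  qed
  moreover have "{x. \<forall>v\<in>V. bary V v x > 0} \<subseteq> convex hull V" using hull_bary[OF V] by (auto intro: less_imp_le)
  ultimately show "{x. \<forall>v\<in>V. bary V v x > 0} \<subseteq> interior (convex hull V)" by (simp add: interior_maximal)
  show "interior (convex hull V) \<subseteq> {x. \<forall>v\<in>V. bary V v x > 0}"
  proof safe
    fix x v assume x: "x \<in> interior (convex hull V)" and v: "v \<in> V"
    then obtain e where e: "e > 0" "cball x e \<subseteq> convex hull V" by (meson mem_interior_cball)
    define g where "g = bgrad V v"
    have g: "g \<noteq> 0" using bgrad_nonzero[OF V v] by (simp add: g_def)
    have "x - (e / norm g) *\<^sub>R g \<in> convex hull V" using e g by (intro subsetD[OF e(2)]) (simp add: dist_norm)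
    then have "0 \<le> bary V v (x - (e / norm g) *\<^sub>R g)" using hull_bary[OF V] v by blast
    also have "\<dots> = bary V v x - e * norm g"
      using bary_diff[of V v "x - (e / norm g) *\<^sub>R g" x] g
      by (simp add: g_def[symmetric] dot_square_norm power2_eq_square)
    finally have "bary V v x \<ge> e * norm g" by simp
    then show "bary V v x > 0" using e g by (smt (verit) mult_pos_pos zero_less_norm_iff)
  qed
qed

text \<open>The coordinate stays between 0 and 1 on the tetrahedron and grows by
  \<open>2 r |g|\<close> along the diameter of the ball that is parallel to its gradient
  \<open>g\<close>.\<close>

lemma bgrad_bound:
  assumes V: "tetra V" "v \<in> V" and r: "cball z r \<subseteq> convex hull V" "0 \<le> r"
  shows "2 * r * norm (bgrad V v) \<le> 1"
proof -
  define g where "g = bgrad V v"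
  have g: "g \<noteq> 0" using bgrad_nonzero[OF V] by (simp add: g_def)
  have le1: "bary V v x \<le> 1" if "x \<in> convex hull V" for x
  proof -
    have "bary V v x \<le> (\<Sum>v\<in>V. bary V v x)"
      by (rule member_le_sum) (use that hull_bary[OF V(1)] V tetra_finite in auto)
    then show ?thesis using bary_rep[OF V(1)] by simp
  qed
  have i: "z + (r / norm g) *\<^sub>R g \<in> convex hull V" "z - (r / norm g) *\<^sub>R g \<in> convex hull V"
    using g r(2) by (intro subsetD[OF r(1)]; simp add: dist_norm)+
  have "bary V v (z + (r / norm g) *\<^sub>R g) - bary V v (z - (r / norm g) *\<^sub>R g) = 2 * r * norm g"
    unfolding bary_diff g_def[symmetric] inner_diff_right inner_add_right inner_scaleR_right using g
    by (simp add: dot_square_norm power2_eq_square field_simps)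
  moreover have "bary V v (z - (r / norm g) *\<^sub>R g) \<ge> 0" using i hull_bary[OF V(1)] V(2) by blast
  ultimately show ?thesis using le1[OF i(1)] by (simp add: g_def)
qed

lemma facet_bary:
  assumes V: "tetra V"
  shows "F facet_of convex hull V \<longleftrightarrow> (\<exists>a\<in>V. F = convex hull (V - {a}))"
  using facet_of_convex_hull_affine_independent_alt[of V F] V by (auto simp: tetra_def)

lemma hull_inj:
  assumes V: "tetra V" and "A \<subseteq> V" "B \<subseteq> V" "convex hull A = convex hull B"
  shows "A = B"
proof -
  have "A = {v\<in>V. v \<in> convex hull A}" if "A \<subseteq> V" for A
  proof (rule set_eqI, rule iffI)
    fix v assume "v \<in> A" then show "v \<in> {v\<in>V. v \<in> convex hull A}" using that by (auto intro: hull_inc)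
  next
    fix v assume v: "v \<in> {v\<in>V. v \<in> convex hull A}"
    then have "v \<notin> A \<Longrightarrow> bary V v v = 0" using hull_subset_bary[OF V that] by blast
    then show "v \<in> A" using v bary_vertex[OF V, of v v] by auto
  qed
  from this[OF assms(2)] this[OF assms(3)] show ?thesis using assms(4) by simp
qed

lemma face_bary:
  assumes V: "tetra V"
  shows "F face_of convex hull V \<longleftrightarrow> (\<exists>S\<subseteq>V. F = convex hull S)"
  using face_of_convex_hull_affine_independent[of V F] V by (auto simp: tetra_def)

lemma edge_bary:
  assumes V: "tetra V"
  shows "e edge_of convex hull V \<longleftrightarrow> (\<exists>a\<in>V. \<exists>b\<in>V. a \<noteq> b \<and> e = closed_segment a b)"
proof
  assume "e edge_of convex hull V"
  then obtain S where S: "S \<subseteq> V" "e = convex hull S" and d: "aff_dim e = 1"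
    unfolding edge_of_def face_bary[OF V] by blast
  have "\<not> affine_dependent S" using V S(1) affine_independent_subset by (auto simp: tetra_def)
  then have "card S = 2" using d aff_dim_affine_independent[of S] by (simp add: S aff_dim_convex_hull)
  then obtain a b where "S = {a, b}" "a \<noteq> b" by (meson card_2_iff)
  then show "\<exists>a\<in>V. \<exists>b\<in>V. a \<noteq> b \<and> e = closed_segment a b" using S by (auto simp: segment_convex_hull)
next
  assume "\<exists>a\<in>V. \<exists>b\<in>V. a \<noteq> b \<and> e = closed_segment a b"
  then obtain a b where ab: "a \<in> V" "b \<in> V" "a \<noteq> b" "e = convex hull {a, b}" by (auto simp: segment_convex_hull)
  have "e face_of convex hull V" unfolding face_bary[OF V]
    by (rule exI[of _ "{a, b}"]) (use ab in simp)
  moreover have "aff_dim e = 1" unfolding ab(4) aff_dim_convex_hull using ab(3) by (simp add: aff_dim_2)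
  ultimately show "e edge_of convex hull V" by (simp add: edge_of_def)
qed

lemma bary_opposite_zero:
  assumes V: "tetra V" and "a \<in> V" "x \<in> convex hull (V - {a})"
  shows "bary V a x = 0"
  using assms hull_subset_bary[of V "V - {a}" x] by auto

section \<open>Elements sharing a facet\<close>

text \<open>The coordinates of the two opposite vertices are affine and vanish on the plane of the
  common facet, so they are proportional, with factor \<open>bary W b a\<close>. Were the factor
  nonnegative, points slightly off the centroid of the facet towards \<open>a\<close> would lie in
  both tetrahedra, contrary to \<open>int\<close>.\<close>

lemma shared_facet_opposite:
  assumes V: "tetra V" "a \<in> V" and W: "tetra W" "b \<in> W"
    and eq: "V - {a} = W - {b}"
    and int: "convex hull V \<inter> convex hull W = convex hull (V - {a})"
  shows "bary W b a < 0" "bary W b x = bary W b a * bary V a x"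
proof -
  have fV: "finite V" using V tetra_finite by blast
  show r: "bary W b x = bary W b a * bary V a x" for x
  proof -
    have "bary W b x = (\<Sum>v\<in>V. bary V v x * bary W b v)" by (rule bary_other[OF V(1) W])
    also have "\<dots> = (\<Sum>v\<in>V. if v = a then bary V a x * bary W b a else 0)"
    proof (rule sum.cong)
      fix v assume v: "v \<in> V"
      have "bary W b v = 0" if "v \<noteq> a"
      proof -
        have "v \<in> W - {b}" using v that eq by blast
        then show ?thesis using bary_vertex[OF W] by auto
      qed
      then show "bary V v x * bary W b v = (if v = a then bary V a x * bary W b a else 0)" by simp
    qed simp
    finally show ?thesis using fV V by simp
  qed
  show "bary W b a < 0"
  proof (rule ccontr)
    assume n: "\<not> bary W b a < 0"
    define S where "S = V - {a}"
    have S: "finite S" "card S = 3" using fV V by (auto simp: S_def tetra_def)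
    define p where "p = (\<Sum>v\<in>S. (1/3) *\<^sub>R v)"
    have s1: "sum (\<lambda>v. 1/3 :: real) S = 1" using S by simp
    have pW: "bary W w p = 1/3" if w: "w \<in> S" for w
    proof -
      have wW: "w \<in> W" using w eq S_def by blast
      have "bary W w p = (\<Sum>v\<in>S. 1/3 * bary W w v)" unfolding p_def by (rule bary_comb[OF s1])
      also have "\<dots> = (\<Sum>v\<in>S. if v = w then 1/3 else 0)"
        by (rule sum.cong) (use eq in \<open>auto simp: S_def bary_vertex[OF W(1) wW]\<close>)
      finally show ?thesis using S w by simp
    qed
    have pV: "p \<in> convex hull S"
      using S s1 unfolding p_def convex_hull_finite[OF S(1)] by (intro CollectI exI[of _ "\<lambda>v. 1/3"]) auto
    have pW0: "bary W b p = 0" using bary_opposite_zero[OF W] pV eq S_def by simp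
    define q where "q t = p + t *\<^sub>R (a - p)" for t :: real
    have lim: "((\<lambda>t. bary W w (q t)) \<longlongrightarrow> bary W w p) (at_right 0)" for w
      unfolding q_def bary_def by (auto intro!: tendsto_eq_intros)
    have "eventually (\<lambda>t. bary W w (q t) > 0) (at_right 0)" if "w \<in> S" for w
      using order_tendstoD(1)[OF lim, of 0 w] pW[OF that] by simp
    then have "eventually (\<lambda>t. \<forall>w\<in>S. bary W w (q t) > 0) (at_right 0)" using S(1) by (simp add: eventually_ball_finite)
    moreover have "eventually (\<lambda>t::real. 0 < t \<and> t < 1) (at_right 0)"
      by (auto simp: eventually_at_right_field intro!: exI[of _ 1])
    ultimately have "eventually (\<lambda>t. (\<forall>w\<in>S. bary W w (q t) > 0) \<and> 0 < t \<and> t < 1) (at_right (0::real))"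
      by eventually_elim auto
    then obtain t :: real where t: "\<forall>w\<in>S. bary W w (q t) > 0" "0 < t" "t < 1"
      using eventually_happens[of _ "at_right (0::real)"] by auto
    have "q t \<in> convex hull V"
    proof -
      have "p \<in> convex hull V" using pV hull_mono[of S V convex] by (auto simp: S_def)
      moreover have "a \<in> convex hull V" using V hull_inc by fast
      moreover have "q t = (1 - t) *\<^sub>R p + t *\<^sub>R a" by (simp add: q_def algebra_simps)
      ultimately show ?thesis using convexD[OF convex_convex_hull, of p V a "1 - t" t] t by simp
    qed
    moreover have aq: "bary V a (q t) = t"
    proof -
      have "bary V a p = 0" using bary_opposite_zero[OF V] pV S_def by simp
      then show ?thesis using bary_diff[of V a "q t" p] bary_diff[of V a a p] bary_vertex[OF V V(2)]
        by (simp add: q_def)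
    qed
    have "bary W b (q t) \<ge> 0" using r[of "q t"] n aq t by simp
    then have "q t \<in> convex hull W"
      using hull_bary[OF W(1)] t(1) unfolding S_def eq by (force intro: less_imp_le)
    ultimately have "q t \<in> convex hull (V - {a})" using int by blast
    then show False using bary_opposite_zero[OF V] aq t by simp
  qed
qed

section \<open>Facets and adjacency in a conforming mesh\<close>

lemma third_comb:
  assumes S: "finite S" "card S = 3"
  shows "sum (\<lambda>v. 1/3 :: real) S = 1" "(\<Sum>v\<in>S. (1/3) *\<^sub>R v) \<in> convex hull S"
proof -
  show s1: "sum (\<lambda>v. 1/3 :: real) S = 1" using S by simp
  then show "(\<Sum>v\<in>S. (1/3) *\<^sub>R v) \<in> convex hull S"
    unfolding convex_hull_finite[OF S(1)] by (intro CollectI exI[of _ "\<lambda>v. 1/3"]) auto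
qed

lemma bary_pos_ball:
  assumes V: "tetra V" and p: "\<forall>v\<in>V - {a}. bary V v p > 0"
  shows "\<exists>e>0. \<forall>x\<in>ball p e. \<forall>v\<in>V - {a}. bary V v x > 0"
proof -
  have f: "finite V" using V tetra_finite by blast
  have "{x. \<forall>v\<in>V - {a}. bary V v x > 0} = (\<Inter>v\<in>V - {a}. {x. bary V v x > 0})" by auto
  moreover have "open {x. bary V v x > 0}" for v
    by (rule open_Collect_less) (auto intro: continuous_bary)
  ultimately have "open {x. \<forall>v\<in>V - {a}. bary V v x > 0}" using f by auto
  then have "\<exists>e>0. ball p e \<subseteq> {x. \<forall>v\<in>V - {a}. bary V v x > 0}" using p unfolding open_contains_ball by blast
  then show ?thesis by blast
qed

text \<open>The coordinates of the two opposite vertices have opposite signs, so at every point one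
  of them is nonnegative.\<close>

lemma shared_facet_ball:
  assumes V: "tetra V" "a \<in> V" and W: "tetra W" "b \<in> W"
    and eq: "V - {a} = W - {b}"
    and int: "convex hull V \<inter> convex hull W = convex hull (V - {a})"
    and x: "\<forall>v\<in>V - {a}. bary V v x > 0" "\<forall>v\<in>W - {b}. bary W v x > 0"
  shows "x \<in> convex hull V \<union> convex hull W"
proof (cases "bary V a x \<ge> 0")
  case True
  then have "x \<in> convex hull V" using hull_bary[OF V(1)] x(1) by (metis Diff_iff empty_iff insert_iff less_imp_le)
  then show ?thesis by simp
next
  case False
  note o = shared_facet_opposite[OF V W eq int]
  have "bary W b x \<ge> 0" using o(1) o(2)[of x] False by (simp add: mult_nonpos_nonpos)
  then have "x \<in> convex hull W" using hull_bary[OF W(1)] x(2) by (metis Diff_iff empty_iff insert_iff less_imp_le)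
  then show ?thesis by simp
qed

text \<open>The vertices of a facet are its extreme points, so both vertex sets contain the same
  three. By conformity the intersection is a face of \<open>K\<close> containing the facet; were it
  all of \<open>K\<close>, then \<open>K\<close> would be a face of \<open>K'\<close> with four
  vertices, hence equal to \<open>K'\<close>.\<close>

lemma share_face_data:
  assumes tri: "triangulation T" and K: "K \<in> T" "K' \<in> T" and ne: "K \<noteq> K'"
    and F: "F facet_of K" "F facet_of K'" and V: "tetra V" "K = convex hull V" and W: "tetra W" "K' = convex hull W"
  obtains a b where "a \<in> V" "b \<in> W" "V - {a} = W - {b}" "F = convex hull (V - {a})" "K \<inter> K' = F"
proof -
  obtain a where a: "a \<in> V" "F = convex hull (V - {a})" using F(1) V facet_bary by auto
  obtain b where b: "b \<in> W" "F = convex hull (W - {b})" using F(2) W facet_bary by auto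
  have f: "finite V" "finite W" using V W tetra_finite by auto
  have ai: "\<not> affine_dependent (V - {a})" "\<not> affine_dependent (W - {b})"
    using V W affine_independent_subset[of V "V - {a}"] affine_independent_subset[of W "W - {b}"]
    by (auto simp: tetra_def)
  have "V - {a} = {x. x extreme_point_of convex hull (V - {a})}"
    using extreme_point_of_convex_hull_affine_independent[OF ai(1)] by auto
  also have "\<dots> = {x. x extreme_point_of convex hull (W - {b})}" using a b by simp
  also have "\<dots> = W - {b}" using extreme_point_of_convex_hull_affine_independent[OF ai(2)] by auto
  finally have eq: "V - {a} = W - {b}" .
  have "(K \<inter> K') face_of K" using tri K by (auto simp: triangulation_def)
  then obtain S where S: "S \<subseteq> V" "K \<inter> K' = convex hull S" using face_bary V by auto
  have FK: "F \<subseteq> K \<inter> K'" using F facet_of_imp_subset by blast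
  have sub: "V - {a} \<subseteq> S"
  proof
    fix v assume v: "v \<in> V - {a}"
    then have "v \<in> convex hull S" using FK S a(2) by (auto intro: hull_inc)
    then have "v \<notin> S \<Longrightarrow> bary V v v = 0" using hull_subset_bary[OF V(1) S(1)] v by blast
    then show "v \<in> S" using bary_vertex[OF V(1), of v v] v by auto
  qed
  have "a \<notin> S"
  proof
    assume "a \<in> S"
    then have "S = V" using sub S by auto
    then have sK: "K \<subseteq> K'" using S V by auto
    have "(K' \<inter> K) face_of K'" using tri K by (auto simp: triangulation_def)
    then have "K face_of K'" using sK by (simp add: Int_absorb1)
    then obtain R where R: "R \<subseteq> W" "K = convex hull R" using face_bary W by auto
    have "R = V"
    proof -
      have "\<not> affine_dependent R" using W R affine_independent_subset[of W R] by (auto simp: tetra_def)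
      then have "R = {x. x extreme_point_of convex hull R}" using extreme_point_of_convex_hull_affine_independent by auto
      also have "\<dots> = {x. x extreme_point_of convex hull V}" using R V by simp
      also have "\<dots> = V" using extreme_point_of_convex_hull_affine_independent V by (auto simp: tetra_def)
      finally show ?thesis .
    qed
    then have "V = W" using R V W card_subset_eq[OF f(2), of V] by (simp add: tetra_def)
    then show False using ne V W by simp
  qed
  then have "S = V - {a}" using sub S by blast
  then have "K \<inter> K' = F" using S a by simp
  then show thesis using that a b eq by blast
qed

text \<open>The three apexes would lie pairwise on opposite sides of one plane.\<close>

lemma facet_shared_at_most_twice:
  fixes K1 K2 K3 :: "(real^3) set"
  assumes tri: "triangulation T" and s: "\<And>K. K \<in> T \<Longrightarrow> 3 simplex K"
    and K: "K1 \<in> T" "K2 \<in> T" "K3 \<in> T" and ne: "K1 \<noteq> K2" "K1 \<noteq> K3" "K2 \<noteq> K3"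
    and F: "F facet_of K1" "F facet_of K2" "F facet_of K3"
  shows False
proof -
  obtain V1 V2 V3 where V: "tetra V1" "K1 = convex hull V1" "tetra V2" "K2 = convex hull V2" "tetra V3" "K3 = convex hull V3"
    using s K simplex3_tetra by metis
  obtain a b where 12: "a \<in> V1" "b \<in> V2" "V1 - {a} = V2 - {b}" "F = convex hull (V1 - {a})" "K1 \<inter> K2 = F"
    using share_face_data[OF tri K(1,2) ne(1) F(1,2) V(1-4)] .
  obtain a' c where 13: "a' \<in> V1" "c \<in> V3" "V1 - {a'} = V3 - {c}" "F = convex hull (V1 - {a'})" "K1 \<inter> K3 = F"
    using share_face_data[OF tri K(1,3) ne(2) F(1,3) V(1,2,5,6)] .
  obtain b' c' where 23: "b' \<in> V2" "c' \<in> V3" "V2 - {b'} = V3 - {c'}" "F = convex hull (V2 - {b'})" "K2 \<inter> K3 = F"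
    using share_face_data[OF tri K(2,3) ne(3) F(2,3) V(3-6)] .
  have "V1 - {a} = V1 - {a'}" by (rule hull_inj[OF V(1)]) (use 12 13 in auto)
  then have a: "a' = a" using 12 13 by blast
  have "V2 - {b} = V2 - {b'}" by (rule hull_inj[OF V(3)]) (use 12 23 in auto)
  then have b: "b' = b" using 12 23 by blast
  have "V3 - {c} = V3 - {c'}" using 12 13 23 a b by simp
  then have c: "c' = c" using 13 23 by blast
  note i12 = 12(5)[unfolded 12(4) V(2) V(4)]
  note i13 = 13(5)[unfolded 13(4) V(2) V(6) a]
  note i23 = 23(5)[unfolded 23(4) V(4) V(6) b]
  note o12 = shared_facet_opposite[OF V(1) 12(1) V(3) 12(2,3) i12]
  note o13 = shared_facet_opposite[OF V(1) 12(1) V(5) 13(2) 13(3)[unfolded a] i13]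
  note o23 = shared_facet_opposite(1)[OF V(3) 12(2) V(5) 13(2) 23(3)[unfolded b c] i23]
  have "bary V2 b b = 1" using bary_vertex[OF V(3)] 12 by simp
  then have "bary V1 a b < 0" using o12(1) o12(2)[of b] by (metis mult_nonpos_nonneg not_less not_one_le_zero less_imp_le)
  then have "bary V3 c b > 0" using o13(1) o13(2)[of b] by (simp add: mult_neg_neg)
  then show False using o23 by simp
qed

section \<open>A lemma on graphs of maximal degree two\<close>

text \<open>Ordered pairs: for the symmetric irreflexive relations considered here an edge inside
  \<open>S\<close> counts twice in \<open>arcs r S S\<close>, while an edge leaving \<open>S\<close>
  counts once in \<open>arcs r S (X - S)\<close>. The parity argument rests on this
  difference.\<close>

definition arcs :: "('a \<Rightarrow> 'a \<Rightarrow> bool) \<Rightarrow> 'a set \<Rightarrow> 'a set \<Rightarrow> ('a \<times> 'a) set" where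
  "arcs r S Y = {(a, c). a \<in> S \<and> c \<in> Y \<and> r a c}"

lemma arcs_subset: "arcs r S Y \<subseteq> S \<times> Y"
  by (auto simp: arcs_def)

lemma finite_arcs: "finite S \<Longrightarrow> finite Y \<Longrightarrow> finite (arcs r S Y)"
  using finite_subset[OF arcs_subset] by fast

lemma card_arcs_insert:
  assumes "finite S" "x \<notin> S" and sym: "\<And>a c. r a c \<Longrightarrow> r c a" and irr: "\<And>a. \<not> r a a"
  shows "card (arcs r (insert x S) (insert x S)) = card (arcs r S S) + 2 * card {y\<in>S. r x y}"
proof -
  let ?N = "{y\<in>S. r x y}"
  have eq: "arcs r (insert x S) (insert x S) = arcs r S S \<union> (Pair x ` ?N \<union> (\<lambda>y. (y, x)) ` ?N)"
    using irr sym by (auto simp: arcs_def)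
  have f: "finite (arcs r S S)" "finite ?N" using assms by (auto intro: finite_arcs)
  have "card (Pair x ` ?N \<union> (\<lambda>y. (y, x)) ` ?N) = card (Pair x ` ?N) + card ((\<lambda>y. (y, x)) ` ?N)"
    by (rule card_Un_disjoint) (use f irr in auto)
  also have "\<dots> = 2 * card ?N" by (simp add: card_image inj_on_def)
  finally have 1: "card (Pair x ` ?N \<union> (\<lambda>y. (y, x)) ` ?N) = 2 * card ?N" .
  show ?thesis unfolding eq 1[symmetric]
    by (rule card_Un_disjoint) (use f assms(2) in \<open>auto simp: arcs_def\<close>)
qed

lemma even_card_arcs:
  assumes "finite S" and sym: "\<And>a c. r a c \<Longrightarrow> r c a" and irr: "\<And>a. \<not> r a a"
  shows "even (card (arcs r S S))"
  using assms(1)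
proof (induction S)
  case empty
  then show ?case by (simp add: arcs_def)
next
  case (insert x S)
  then show ?case using card_arcs_insert[where r=r, OF insert(1,2) sym irr] by simp
qed

text \<open>A connected graph has at least \<open>card A - 1\<close> edges, here counted twice. A
  maximal subset with this property that contains \<open>b\<close> could be enlarged by an adjacent
  vertex unless it is all of \<open>A\<close>.\<close>

lemma connected_card_arcs:
  assumes "finite A" "b \<in> A" and sym: "\<And>a c. r a c \<Longrightarrow> r c a" and irr: "\<And>a. \<not> r a a"
    and conn: "\<And>S. S \<subseteq> A \<Longrightarrow> b \<in> S \<Longrightarrow> S \<noteq> A \<Longrightarrow> \<exists>a\<in>S. \<exists>c\<in>A - S. r a c"
  shows "2 * card A \<le> card (arcs r A A) + 2"
proof -
  let ?F = "{S. S \<subseteq> A \<and> b \<in> S \<and> 2 * card S \<le> card (arcs r S S) + 2}"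
  have "finite ?F" using assms(1) by simp
  moreover have "{b} \<in> ?F" using assms(2) by simp
  ultimately have "\<exists>S\<in>?F. {b} \<subseteq> S \<and> (\<forall>T\<in>?F. S \<subseteq> T \<longrightarrow> S = T)" by (rule finite_has_maximal2)
  then obtain S where S: "S \<in> ?F" and S': "\<forall>T\<in>?F. S \<subseteq> T \<longrightarrow> S = T" by (elim bexE conjE)
  show ?thesis
  proof (cases "S = A")
    case False
    have "S \<subseteq> A" "b \<in> S" using S by simp_all
    with False obtain a c where ac: "a \<in> S" "c \<in> A - S" "r a c" using conn[of S] by blast
    have fS: "finite S" using S assms(1) by (auto intro: finite_subset)
    have "a \<in> {y\<in>S. r c y}" using ac sym by blast
    then have "card {y\<in>S. r c y} \<ge> 1" using fS by (simp add: Suc_le_eq card_gt_0_iff) blast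
    then have ins: "insert c S \<in> ?F"
      using S ac fS card_arcs_insert[where r=r and x=c, OF fS _ sym irr] by simp
    have "S = insert c S" using bspec[OF S' ins] by (rule mp) blast
    then show ?thesis using ac by blast
  qed (use S in simp)
qed

lemma card_arcs_degree:
  assumes "finite S" "finite X"
  shows "card (arcs r S X) = (\<Sum>a\<in>S. card {y\<in>X. r a y})"
proof -
  have "arcs r S X = (SIGMA a:S. {y\<in>X. r a y})" by (auto simp: arcs_def)
  then show ?thesis using assms by (simp add: card_SigmaI)
qed

lemma card_arcs_split:
  assumes "finite S" "finite X" "S \<subseteq> X"
  shows "card (arcs r S X) = card (arcs r S S) + card (arcs r S (X - S))"
proof -
  have "arcs r S X = arcs r S S \<union> arcs r S (X - S)" using assms by (auto simp: arcs_def)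
  moreover have "card (arcs r S S \<union> arcs r S (X - S)) = card (arcs r S S) + card (arcs r S (X - S))"
  proof (rule card_Un_disjoint)
    show "finite (arcs r S S)" "finite (arcs r S (X - S))" using assms by (auto intro!: finite_arcs)
    show "arcs r S S \<inter> arcs r S (X - S) = {}" by (auto simp: arcs_def)
  qed
  ultimately show ?thesis by simp
qed

text \<open>In the application \<open>X\<close> is an edge patch, \<open>r\<close> is face adjacency, \<open>Mx\<close> is the subpatch of
  maximal weight and \<open>B\<close> consists of the elements with a boundary face at the edge. If the component
  \<open>M\<close> of \<open>x\<close> in \<open>Mx\<close> missed \<open>B\<close>, then counting arcs in the component of \<open>b\<close> outside \<open>M\<close> would allow
  at most one arc to leave \<open>M\<close>, while the number of such arcs is even.\<close>

lemma component_meets_boundary: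
  fixes r :: "'a \<Rightarrow> 'a \<Rightarrow> bool"
  assumes fin: "finite X" and sym: "\<And>a c. r a c \<Longrightarrow> r c a" and irr: "\<And>a. \<not> r a a" and MX: "Mx \<subseteq> X"
    and deg1: "\<And>a. a \<in> X \<Longrightarrow> a \<in> B \<Longrightarrow> card {y\<in>X. r a y} \<le> 1"
    and deg2: "\<And>a. a \<in> X \<Longrightarrow> a \<notin> B \<Longrightarrow> card {y\<in>X. r a y} = 2"
    and top: "\<And>Z. Z \<subseteq> X \<Longrightarrow> Z \<noteq> {} \<Longrightarrow> (\<forall>a\<in>Z. \<forall>y\<in>X. r a y \<longrightarrow> y \<in> Z) \<Longrightarrow> Z \<inter> B \<noteq> {}"
    and b: "b \<in> Mx" "b \<in> B"
    and low: "\<And>a c. a \<in> X - Mx \<Longrightarrow> c \<in> Mx \<Longrightarrow>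
       (a, c) \<in> {(a, c). a \<in> X \<and> c \<in> X \<and> r a c \<and> (a \<in> Mx \<longrightarrow> c \<in> Mx)}\<^sup>*"
    and x: "x \<in> Mx"
  shows "\<exists>y\<in>Mx \<inter> B. (x, y) \<in> {(a, c). a \<in> Mx \<and> c \<in> Mx \<and> r a c}\<^sup>*"
proof (rule ccontr)
  assume neg: "\<not> ?thesis"
  define RM where "RM = {(a, c). a \<in> Mx \<and> c \<in> Mx \<and> r a c}"
  define Q where "Q = {(a, c). a \<in> X \<and> c \<in> X \<and> r a c \<and> (a \<in> Mx \<longrightarrow> c \<in> Mx)}"
  define M where "M = {y. (x, y) \<in> RM\<^sup>*}"
  have xM: "x \<in> M" by (simp add: M_def)
  have MMx: "M \<subseteq> Mx"
  proof
    fix y assume "y \<in> M"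
    then have "(x, y) \<in> RM\<^sup>*" by (simp add: M_def)
    then show "y \<in> Mx" by (induction) (use x in \<open>auto simp: RM_def\<close>)
  qed
  have MB: "M \<inter> B = {}" using neg MMx by (auto simp: M_def RM_def)
  have Mcl: "c \<in> M" if "a \<in> M" "c \<in> Mx" "r a c" for a c
  proof -
    have "(a, c) \<in> RM" using that MMx by (auto simp: RM_def)
    moreover have "(x, a) \<in> RM\<^sup>*" using that(1) by (simp add: M_def)
    ultimately have "(x, c) \<in> RM\<^sup>*" by (rule rtrancl_into_rtrancl[rotated])
    then show ?thesis by (simp add: M_def)
  qed
  define RA where "RA = {(a, c). a \<in> X - M \<and> c \<in> X - M \<and> r a c}"
  define A where "A = {y. (b, y) \<in> RA\<^sup>*}"
  have bM: "b \<in> X - M" using b MB MX by blast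
  have AX: "A \<subseteq> X - M"
  proof
    fix y assume "y \<in> A"
    then have "(b, y) \<in> RA\<^sup>*" by (simp add: A_def)
    then show "y \<in> X - M" by (induction) (use bM in \<open>auto simp: RA_def\<close>)
  qed
  \<comment> \<open>A step of \<open>Q\<close> that starts in \<open>M\<close> stays in
    \<open>Mx\<close> and hence in \<open>M\<close>. A path ending at \<open>b\<close>, which is
    outside \<open>M\<close>, therefore never visits \<open>M\<close>.\<close>
  have path: "a \<notin> M \<and> (a, b) \<in> RA\<^sup>*" if "(a, b) \<in> Q\<^sup>*" for a
    using that
  proof (induction rule: converse_rtrancl_induct)
    case base
    then show ?case using bM by simp
  next
    case (step a c)
    then have "a \<notin> M" using Mcl MMx by (auto simp: Q_def)
    then have "(a, c) \<in> RA" using step by (auto simp: Q_def RA_def)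
    then show ?case using step \<open>a \<notin> M\<close> by (meson converse_rtrancl_into_rtrancl)
  qed
  have "RA\<inverse> = RA" using sym by (auto simp: RA_def)
  then have RAsym: "(a, c) \<in> RA\<^sup>* \<Longrightarrow> (c, a) \<in> RA\<^sup>*" for a c
    using rtrancl_converseI by metis
  \<comment> \<open>An element outside \<open>M\<close> but adjacent to it cannot lie in
    \<open>Mx\<close>, so by \<open>low\<close> a path joins it to \<open>b\<close>, avoiding
    \<open>M\<close>. All arcs leaving \<open>M\<close> thus end in \<open>A\<close>.\<close>
  have nbr: "L \<in> A" if "m \<in> M" "L \<in> X - M" "r m L" for m L
  proof -
    have "L \<notin> Mx" using Mcl that by blast
    then have "(L, b) \<in> Q\<^sup>*" using low[of L b] that b by (simp add: Q_def)
    then show ?thesis using path RAsym by (auto simp: A_def)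
  qed
  have fA: "finite A" and fM: "finite M" using AX fin MMx MX by (meson finite_subset finite_Diff)+
  have "2 * card A \<le> card (arcs r A A) + 2"
  proof (rule connected_card_arcs[where r=r, OF fA _ sym irr])
    show "b \<in> A" by (simp add: A_def)
    fix S assume S: "S \<subseteq> A" "b \<in> S" "S \<noteq> A"
    show "\<exists>a\<in>S. \<exists>c\<in>A - S. r a c"
    proof (rule ccontr)
      assume n: "\<not> ?thesis"
      have "y \<in> S" if "(b, y) \<in> RA\<^sup>*" for y
        using that
      proof induction
        case (step y z)
        then have "z \<in> A" unfolding A_def by (auto intro: rtrancl.rtrancl_into_rtrancl)
        then show ?case using n step by (auto simp: RA_def)
      qed (use S in auto)
      then show False using S by (auto simp: A_def)
    qed
  qed
  \<comment> \<open>\<open>b\<close> has degree at most 1 because it lies in \<open>B\<close>.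
    Connectedness already uses up \<open>2 * card A - 2\<close> arcs inside \<open>A\<close>, so at
    most one arc can leave \<open>A\<close>.\<close>
  moreover have "card (arcs r A X) + 1 \<le> 2 * card A"
  proof -
    have bA: "b \<in> A" by (simp add: A_def)
    have "card (arcs r A X) = card {y\<in>X. r b y} + (\<Sum>a\<in>A - {b}. card {y\<in>X. r a y})"
      unfolding card_arcs_degree[OF fA fin] by (rule sum.remove[OF fA bA])
    also have "\<dots> \<le> 1 + (\<Sum>a\<in>A - {b}. 2)"
    proof (intro add_mono sum_mono)
      show "card {y\<in>X. r b y} \<le> 1" using deg1 bM b by blast
      fix a assume "a \<in> A - {b}"
      then have "a \<in> X" using AX by blast
      then show "card {y\<in>X. r a y} \<le> 2" using deg1[of a] deg2[of a] by (cases "a \<in> B") auto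
    qed
    also have "\<dots> = 1 + 2 * (card A - 1)" using fA bA by simp
    finally show ?thesis using card_gt_0_iff[of A] fA bA by auto
  qed
  moreover have "card (arcs r A X) = card (arcs r A A) + card (arcs r A (X - A))"
    by (rule card_arcs_split) (use fA fin AX in auto)
  moreover have "card (arcs r M (X - M)) \<le> card (arcs r A (X - A))"
  proof -
    have "(\<lambda>(a, c). (c, a)) ` arcs r M (X - M) \<subseteq> arcs r A (X - A)"
      using nbr sym AX MMx MX by (auto simp: arcs_def)
    then have "card ((\<lambda>(a, c). (c, a)) ` arcs r M (X - M)) \<le> card (arcs r A (X - A))"
      by (rule card_mono[rotated]) (use fA fin in \<open>auto intro: finite_arcs\<close>)
    moreover have "inj_on (\<lambda>(a, c). (c, a)) (arcs r M (X - M))" by (auto simp: inj_on_def)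
    ultimately show ?thesis by (simp add: card_image)
  qed
  ultimately have le1: "card (arcs r M (X - M)) \<le> 1" by linarith
  \<comment> \<open>No element of \<open>M\<close> is in \<open>B\<close>, so all degrees are 2 and
    their sum is even, as is the number of arcs inside \<open>M\<close>. The number of arcs leaving
    \<open>M\<close> is then even and at most 1, hence 0, and \<open>M\<close> is closed under
    adjacency, against \<open>top\<close>.\<close>
  have "card (arcs r M X) = (\<Sum>a\<in>M. 2)"
    unfolding card_arcs_degree[OF fM fin] by (rule sum.cong) (use deg2 MB MMx MX in auto)
  moreover have "card (arcs r M X) = card (arcs r M M) + card (arcs r M (X - M))"
    by (rule card_arcs_split) (use fM fin MMx MX in auto)
  moreover have "even (card (arcs r M M))" by (rule even_card_arcs[where r=r, OF fM sym irr])
  ultimately have "even (card (arcs r M (X - M)))" by (metis dvd_triv_right even_add sum_constant)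
  with le1 have "card (arcs r M (X - M)) = 0" by (metis One_nat_def le_Suc_eq le_zero_eq odd_one)
  then have "arcs r M (X - M) = {}" using fM fin finite_arcs[of M "X - M" r] by simp
  then have "\<forall>a\<in>M. \<forall>y\<in>X. r a y \<longrightarrow> y \<in> M" by (auto simp: arcs_def)
  then show False using top[of M] MB xM MMx MX by blast
qed

section \<open>Stability of the lowest-order Nedelec element\<close>

lemma nedelec_diff:
  assumes "q = (\<lambda>x. a + cross3 b x)"
  shows "q y - q x = cross3 b (y - x)"
  using assms by (simp add: Cross3.right_diff_distrib)

text \<open>Along the edge \<open>q\<close> changes by a multiple of
  \<open>b \<times> (y - x)\<close>, which is orthogonal to the edge. Edge moments are therefore
  values at an end point.\<close>

lemma nedelec_edge_const:
  assumes "q \<in> nedelec_local"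
  shows "q (linepath x y s) \<bullet> (y - x) = q x \<bullet> (y - x)"
proof -
  obtain a b where q: "q = (\<lambda>x. a + cross3 b x)" using assms by (auto simp: nedelec_local_def)
  have "linepath x y s - x = s *\<^sub>R (y - x)" by (simp add: linepath_def algebra_simps)
  then have "q (linepath x y s) - q x = s *\<^sub>R cross3 b (y - x)"
    using nedelec_diff[OF q, of "linepath x y s" x] by (simp add: cross_mult_right)
  then have "(q (linepath x y s) - q x) \<bullet> (y - x) = 0" by (simp add: dot_cross_self)
  then show ?thesis by (simp add: inner_diff_left)
qed

text \<open>For a vertex \<open>x\<close> the affine function \<open>q x \<bullet> (y - x)\<close>
  of \<open>y\<close> is bounded by \<open>D\<close> at the vertices, hence on the hull; between the
  ends of the diameter of the inscribed ball parallel to \<open>q x\<close> it changes by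
  \<open>2 r |q x|\<close>. The bound spreads to the hull because \<open>q\<close> is affine, and
  \<open>b\<close> is read off from \<open>q (z + w) - q z\<close> with \<open>w\<close> of length
  \<open>r\<close> orthogonal to \<open>b\<close>.\<close>

lemma nedelec_stability:
  assumes V: "tetra V" and q: "q = (\<lambda>x. a + cross3 b x)" and r: "cball z r \<subseteq> convex hull V" "0 < r"
    and D: "\<And>x y. x \<in> V \<Longrightarrow> y \<in> V \<Longrightarrow> x \<noteq> y \<Longrightarrow> \<bar>q x \<bullet> (y - x)\<bar> \<le> D" "0 \<le> D"
  shows "\<And>x. x \<in> convex hull V \<Longrightarrow> norm (q x) \<le> D / r" "norm b \<le> 2 * D / r\<^sup>2"
proof -
  have vert: "norm (q x) \<le> D / r" if x: "x \<in> V" for x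
  proof -
    define u where "u = q x"
    have cv: "convex {y. \<bar>u \<bullet> (y - x)\<bar> \<le> D}"
    proof -
      have "{y. \<bar>u \<bullet> (y - x)\<bar> \<le> D} = {y. u \<bullet> y \<le> D + u \<bullet> x} \<inter> {y. u \<bullet> y \<ge> u \<bullet> x - D}"
        by (auto simp: inner_diff_right abs_le_iff)
      then show ?thesis by (simp add: convex_Int convex_halfspace_le convex_halfspace_ge)
    qed
    have "V \<subseteq> {y. \<bar>u \<bullet> (y - x)\<bar> \<le> D}"
      using D(1)[OF x] D(2) by (auto simp: u_def) (metis abs_zero diff_self inner_zero_right)
    then have "convex hull V \<subseteq> {y. \<bar>u \<bullet> (y - x)\<bar> \<le> D}" using cv by (rule hull_minimal)
    then have all: "y \<in> cball z r \<Longrightarrow> \<bar>u \<bullet> (y - x)\<bar> \<le> D" for y using r by blast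
    show ?thesis
    proof (cases "u = 0")
      case False
      define w where "w = (r / norm u) *\<^sub>R u"
      have uw: "u \<bullet> w = r * norm u" using False by (simp add: w_def dot_square_norm power2_eq_square)
      have "norm w = r" using False r by (simp add: w_def)
      then have "z + w \<in> cball z r" "z - w \<in> cball z r" by (auto simp: dist_norm)
      then have "\<bar>u \<bullet> (z + w - x)\<bar> \<le> D" "\<bar>u \<bullet> (z - w - x)\<bar> \<le> D" using all by blast+
      then have "2 * (u \<bullet> w) \<le> 2 * D" by (simp add: inner_diff_right inner_add_right abs_le_iff)
      then show ?thesis using uw r by (simp add: u_def field_simps)
    qed (use D(2) r in \<open>simp add: u_def\<close>)
  qed
  have lin: "q (s *\<^sub>R x + t *\<^sub>R y) = s *\<^sub>R q x + t *\<^sub>R q y" if "s + t = 1" for s t x y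
  proof -
    have "s *\<^sub>R a + t *\<^sub>R a = a" using that by (metis scaleR_add_left scaleR_one)
    then show ?thesis by (simp add: q cross_add_right cross_mult_right scaleR_add_right)
  qed
  have "convex {x. norm (q x) \<le> D / r}"
  proof (rule convexI)
    fix x y and s t :: real
    assume "x \<in> {x. norm (q x) \<le> D / r}" "y \<in> {x. norm (q x) \<le> D / r}" "0 \<le> s" "0 \<le> t" "s + t = 1"
    then have "s *\<^sub>R q x + t *\<^sub>R q y \<in> cball 0 (D / r)"
      using convexD[OF convex_cball, of "q x" 0 "D / r" "q y" s t] by simp
    then show "s *\<^sub>R x + t *\<^sub>R y \<in> {x. norm (q x) \<le> D / r}" using lin \<open>s + t = 1\<close> by simp
  qed
  then have "convex hull V \<subseteq> {x. norm (q x) \<le> D / r}" using vert by (intro hull_minimal) auto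
  then show all: "\<And>x. x \<in> convex hull V \<Longrightarrow> norm (q x) \<le> D / r" by blast
  obtain y where y: "y \<noteq> 0" "orthogonal b y" using orthogonal_to_vector_exists[of b] by auto
  define w where "w = (r / norm y) *\<^sub>R y"
  have nw: "norm w = r" using y r by (simp add: w_def)
  have "b \<bullet> w = 0" using y by (simp add: w_def orthogonal_def)
  then have "(norm (cross3 b w))\<^sup>2 = (norm b * norm w)\<^sup>2" using norm_and_cross_eq_0 norm_cross_dot[of b w] by simp
  then have "norm (cross3 b w) = norm b * r" using nw r by (simp add: power2_eq_iff_nonneg)
  moreover have "cross3 b w = q (z + w) - q z" using nedelec_diff[OF q, of "z + w" z] by simp
  moreover have "norm (q (z + w) - q z) \<le> D / r + D / r"
    by (rule order_trans[OF norm_triangle_ineq4 add_mono]; rule all; rule subsetD[OF r(1)])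
       (use nw r in \<open>auto simp: dist_norm\<close>)
  ultimately have "norm b * r \<le> 2 * D / r" by simp
  then show "norm b \<le> 2 * D / r\<^sup>2" using r by (simp add: field_simps power2_eq_square)
qed

section \<open>The fan of elements around an edge\<close>

definition efacets :: "(real^3) set \<Rightarrow> (real^3) set \<Rightarrow> (real^3) set set" where
  "efacets K e = {F. F facet_of K \<and> e \<subseteq> F}"

text \<open>The combinatorial counterpart of having a boundary face at \<open>e\<close>; in the
  adjacency graph of the patch these are the elements with a missing neighbour. The link to
  \<open>\<Omega>\<close> is made in \<open>boundary_fan_free\<close> and
  \<open>boundary_part_free\<close>.\<close>

definition free_elements :: "(real^3) set set \<Rightarrow> (real^3) set \<Rightarrow> (real^3) set set" where
  "free_elements T e = {K \<in> edge_patch T e. \<exists>F\<in>efacets K e. \<forall>K'\<in>T. F facet_of K' \<longrightarrow> K' = K}"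

lemma segment_in_facet:
  assumes V: "tetra V" "x1 \<in> V" "x2 \<in> V" "a \<in> V"
  shows "closed_segment x1 x2 \<subseteq> convex hull (V - {a}) \<longleftrightarrow> a \<noteq> x1 \<and> a \<noteq> x2"
proof
  assume s: "closed_segment x1 x2 \<subseteq> convex hull (V - {a})"
  then have "x1 \<in> convex hull (V - {a})" "x2 \<in> convex hull (V - {a})" by auto
  then have "bary V a x1 = 0" "bary V a x2 = 0" using bary_opposite_zero[OF V(1,4)] by auto
  then show "a \<noteq> x1 \<and> a \<noteq> x2" using bary_vertex[OF V(1,4,2)] bary_vertex[OF V(1,4,3)] by auto
next
  assume "a \<noteq> x1 \<and> a \<noteq> x2"
  then show "closed_segment x1 x2 \<subseteq> convex hull (V - {a})"
    unfolding segment_convex_hull by (intro hull_mono) (use V in auto)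
qed

lemma efacets_eq:
  assumes V: "tetra V" "x1 \<in> V" "x2 \<in> V"
  shows "efacets (convex hull V) (closed_segment x1 x2) = (\<lambda>a. convex hull (V - {a})) ` (V - {x1, x2})"
  unfolding efacets_def facet_bary[OF V(1)] using segment_in_facet[OF V] by blast

lemma card_efacets:
  assumes V: "tetra V" "x1 \<in> V" "x2 \<in> V" "x1 \<noteq> x2"
  shows "card (efacets (convex hull V) (closed_segment x1 x2)) = 2" "finite (efacets (convex hull V) (closed_segment x1 x2))"
proof -
  have f: "finite V" using V tetra_finite by blast
  have "inj_on (\<lambda>a. convex hull (V - {a})) (V - {x1, x2})"
  proof (rule inj_onI)
    fix a b assume ab: "a \<in> V - {x1, x2}" "b \<in> V - {x1, x2}" "convex hull (V - {a}) = convex hull (V - {b})"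
    have "V - {a} = V - {b}" by (rule hull_inj[OF V(1) _ _ ab(3)]) auto
    then show "a = b" using ab by blast
  qed
  then have "card (efacets (convex hull V) (closed_segment x1 x2)) = card (V - {x1, x2})"
    unfolding efacets_eq[OF V(1-3)] by (rule card_image)
  also have "\<dots> = 2" using V f by (simp add: tetra_def card_Diff_subset)
  finally show "card (efacets (convex hull V) (closed_segment x1 x2)) = 2" .
  then show "finite (efacets (convex hull V) (closed_segment x1 x2))" by (metis card.infinite zero_neq_numeral)
qed

lemma edge_patch_vertices:
  assumes s: "\<And>K. K \<in> T \<Longrightarrow> 3 simplex K" and K: "K \<in> edge_patch T e"
  obtains V x1 x2 where "tetra V" "K = convex hull V" "x1 \<in> V" "x2 \<in> V" "x1 \<noteq> x2" "e = closed_segment x1 x2"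
proof -
  have KT: "K \<in> T" "e edge_of K" using K by (auto simp: edge_patch_def edges_of_def)
  obtain V where V: "tetra V" "K = convex hull V" using s[OF KT(1)] simplex3_tetra by blast
  then obtain a b where "a \<in> V" "b \<in> V" "a \<noteq> b" "e = closed_segment a b" using KT(2) edge_bary by auto
  then show thesis using that V by blast
qed

lemma share_face_sym: "share_face K K' \<Longrightarrow> share_face K' K"
  by (simp add: share_face_def Int_commute)

lemma share_face_irrefl: "\<not> share_face K K"
  by (simp add: share_face_def facet_of_def)

lemma edge_patch_subset: "K \<in> edge_patch T e \<Longrightarrow> e \<subseteq> K"
  by (simp add: edge_patch_def edges_of_def edge_of_imp_subset)

lemma shared_efacet_in_patch:
  assumes tri: "triangulation T" and s: "\<And>K. K \<in> T \<Longrightarrow> 3 simplex K" and K: "K \<in> edge_patch T e"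
    and F: "F \<in> efacets K e" and K': "K' \<in> T" "K' \<noteq> K" "F facet_of K'"
  shows "K' \<in> edge_patch T e" "K \<inter> K' = F" "share_face K K'"
proof -
  have KT: "K \<in> T" using K by (simp add: edge_patch_def)
  have FK: "F facet_of K" "e \<subseteq> F" using F by (auto simp: efacets_def)
  obtain V x1 x2 where V: "tetra V" "K = convex hull V" and x: "x1 \<in> V" "x2 \<in> V" "x1 \<noteq> x2" "e = closed_segment x1 x2"
    by (rule edge_patch_vertices[OF s K])
  obtain W where W: "tetra W" "K' = convex hull W" using s[OF K'(1)] simplex3_tetra by blast
  obtain a b where ab: "a \<in> V" "b \<in> W" "V - {a} = W - {b}" "F = convex hull (V - {a})" "K \<inter> K' = F"
    by (rule share_face_data[OF tri KT K'(1) K'(2)[symmetric] FK(1) K'(3) V W])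
  show "K \<inter> K' = F" by (rule ab(5))
  show "share_face K K'" using ab(5) FK K' by (simp add: share_face_def)
  have "a \<noteq> x1 \<and> a \<noteq> x2" using segment_in_facet[OF V(1) x(1,2) ab(1)] FK(2) x(4) ab(4) by simp
  then have "x1 \<in> W" "x2 \<in> W" using x ab(3) by blast+
  then have "e edge_of K'" unfolding W(2) edge_bary[OF W(1)] using x by blast
  then show "K' \<in> edge_patch T e" using K' by (simp add: edge_patch_def edges_of_def)
qed

text \<open>Intersection with \<open>K\<close> maps its neighbours in the patch bijectively onto the
  facets through \<open>e\<close> that have another owner, since no facet has three owners; and
  there are exactly two facets of \<open>K\<close> through \<open>e\<close>.\<close>

lemma edge_patch_degree:
  assumes tri: "triangulation T" and s: "\<And>K. K \<in> T \<Longrightarrow> 3 simplex K" and K: "K \<in> edge_patch T e"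
  shows "K \<in> free_elements T e \<Longrightarrow> card {K'\<in>edge_patch T e. share_face K K'} \<le> 1"
    "K \<notin> free_elements T e \<Longrightarrow> card {K'\<in>edge_patch T e. share_face K K'} = 2"
proof -
  obtain V x1 x2 where V: "tetra V" "K = convex hull V" and x: "x1 \<in> V" "x2 \<in> V" "x1 \<noteq> x2" "e = closed_segment x1 x2"
    by (rule edge_patch_vertices[OF s K])
  have c2: "card (efacets K e) = 2" "finite (efacets K e)" using card_efacets[OF V(1) x(1-3)] V x by auto
  have KT: "K \<in> T" using K by (simp add: edge_patch_def)
  let ?N = "{K'\<in>edge_patch T e. share_face K K'}"
  let ?S = "{F\<in>efacets K e. \<exists>K'\<in>T. K' \<noteq> K \<and> F facet_of K'}"
  have N: "K' \<in> T \<and> K' \<noteq> K \<and> K \<inter> K' \<in> efacets K e \<and> (K \<inter> K') facet_of K'" if "K' \<in> ?N" for K'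
    using that edge_patch_subset[OF K] edge_patch_subset[of K' T e] share_face_irrefl[of K]
    by (auto simp: edge_patch_def share_face_def efacets_def)
  have "bij_betw (\<lambda>K'. K \<inter> K') ?N ?S"
  proof (rule bij_betw_imageI)
    show "inj_on (\<lambda>K'. K \<inter> K') ?N"
    proof (rule inj_onI)
      fix K1 K2 assume K12: "K1 \<in> ?N" "K2 \<in> ?N" "K \<inter> K1 = K \<inter> K2"
      note n1 = N[OF K12(1)] and n2 = N[OF K12(2)]
      show "K1 = K2"
      proof (rule ccontr)
        assume ne: "K1 \<noteq> K2"
        have "(K \<inter> K1) facet_of K" using n1 by (simp add: efacets_def)
        moreover have "(K \<inter> K1) facet_of K2" using n2 K12(3) by simp
        ultimately show False
          using facet_shared_at_most_twice[OF tri s KT, of K1 K2 "K \<inter> K1"] n1 n2 ne by metis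
      qed
    qed
    show "(\<lambda>K'. K \<inter> K') ` ?N = ?S"
    proof
      show "(\<lambda>K'. K \<inter> K') ` ?N \<subseteq> ?S" using N by blast
      show "?S \<subseteq> (\<lambda>K'. K \<inter> K') ` ?N"
      proof
        fix F assume "F \<in> ?S"
        then obtain K' where F: "F \<in> efacets K e" "K' \<in> T" "K' \<noteq> K" "F facet_of K'" by blast
        note sh = shared_efacet_in_patch[OF tri s K F]
        then show "F \<in> (\<lambda>K'. K \<inter> K') ` ?N" by (intro image_eqI[of _ _ K']) auto
      qed
    qed
  qed
  then have cN: "card ?N = card ?S" by (rule bij_betw_same_card)
  show "K \<in> free_elements T e \<Longrightarrow> card ?N \<le> 1"
  proof -
    assume "K \<in> free_elements T e"
    then obtain F where F: "F \<in> efacets K e" "\<forall>K'\<in>T. F facet_of K' \<longrightarrow> K' = K" by (auto simp: free_elements_def)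
    then have "?S \<subseteq> efacets K e - {F}" by blast
    then have "card ?S \<le> card (efacets K e - {F})" using c2 by (intro card_mono) auto
    then show ?thesis using cN c2 F by simp
  qed
  show "K \<notin> free_elements T e \<Longrightarrow> card ?N = 2"
  proof -
    assume "K \<notin> free_elements T e"
    then have "?S = efacets K e" using K by (auto simp: free_elements_def)
    then show ?thesis using cN c2 by simp
  qed
qed

lemma bary_shared_facet:
  assumes V: "tetra V" "a \<in> V" and W: "tetra W" "b \<in> W" and eq: "V - {a} = W - {b}"
    and x: "bary V a x = 0" and w: "w \<in> V - {a}"
  shows "bary W w x = bary V w x"
proof -
  have fV: "finite V" using V tetra_finite by blast
  have wW: "w \<in> W" using w eq by blast
  have "bary W w x = (\<Sum>v\<in>V. bary V v x * bary W w v)" by (rule bary_other[OF V(1) W(1) wW])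
  also have "\<dots> = (\<Sum>v\<in>V. if v = w then bary V w x else 0)"
  proof (rule sum.cong)
    fix v assume v: "v \<in> V"
    show "bary V v x * bary W w v = (if v = w then bary V w x else 0)"
    proof (cases "v = a")
      case False
      then have "v \<in> W" using v eq by blast
      then show ?thesis using bary_vertex[OF W(1) wW, of v] by auto
    qed (use x w in auto)
  qed simp
  also have "\<dots> = bary V w x" using fV w by simp
  finally show ?thesis .
qed

text \<open>Near such a point the coordinates of the shared vertices stay positive in both
  tetrahedra, so \<open>shared_facet_ball\<close> covers a whole neighbourhood.\<close>

lemma shared_facet_interior:
  assumes V: "tetra V" "a \<in> V" and W: "tetra W" "b \<in> W" and eq: "V - {a} = W - {b}"
    and int: "convex hull V \<inter> convex hull W = convex hull (V - {a})"
    and x: "bary V a x = 0" "\<And>v. v \<in> V - {a} \<Longrightarrow> bary V v x > 0"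
  shows "x \<in> interior (convex hull V \<union> convex hull W)"
proof -
  have "\<forall>w\<in>W - {b}. bary W w x > 0" using bary_shared_facet[OF V W eq x(1)] x(2) eq by simp
  then obtain e2 where e2: "e2 > 0" "\<forall>y\<in>ball x e2. \<forall>v\<in>W - {b}. bary W v y > 0" using bary_pos_ball[OF W(1)] by blast
  have "\<forall>v\<in>V - {a}. bary V v x > 0" using x(2) by blast
  then obtain e1 where e1: "e1 > 0" "\<forall>y\<in>ball x e1. \<forall>v\<in>V - {a}. bary V v y > 0" using bary_pos_ball[OF V(1)] by blast
  have "ball x (min e1 e2) \<subseteq> convex hull V \<union> convex hull W"
  proof
    fix y assume "y \<in> ball x (min e1 e2)"
    then have "y \<in> ball x e1" "y \<in> ball x e2" by auto
    then show "y \<in> convex hull V \<union> convex hull W" using shared_facet_ball[OF V W eq int] e1 e2 by blast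
  qed
  moreover have "x \<in> ball x (min e1 e2)" using e1 e2 by simp
  ultimately show ?thesis using interiorI[OF open_ball] by blast
qed

text \<open>What is removed is the line through the other two vertices. The rest is the union of
  four open half balls, which are convex and can be attached one after another with an
  overlap.\<close>

lemma connected_ball_minus_line:
  assumes V: "tetra V" and y: "y \<in> V" "z \<in> V" "y \<noteq> z" and q: "bary V y q = 0" "bary V z q = 0" and r: "r > 0"
  shows "connected {x \<in> ball q r. bary V y x \<noteq> 0 \<or> bary V z x \<noteq> 0}"
proof -
  define P where "P f s = {x \<in> ball q r. s * bary V f x > 0}" for f and s :: real
  have cP: "connected (P f s)" for f s
  proof -
    have "P f s = ball q r \<inter> {x. (- s) *\<^sub>R bgrad V f \<bullet> x < s * (1 - bgrad V f \<bullet> f)}"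
      by (auto simp: P_def bary_def inner_diff_right algebra_simps)
    moreover have "connected (ball q r \<inter> {x. (- s) *\<^sub>R bgrad V f \<bullet> x < s * (1 - bgrad V f \<bullet> f)})"
      by (intro convex_connected convex_Int convex_ball convex_halfspace_lt)
    ultimately show ?thesis by (simp only:)
  qed
  have ne: "P y s \<inter> P z t \<noteq> {}" if "s \<noteq> 0" "t \<noteq> 0" for s t
  proof -
    \<comment> \<open>The vectors \<open>y - q\<close> and \<open>z - q\<close> are dual to the two
      gradients, so a small multiple of \<open>u\<close> gives the two coordinates the signs of
      \<open>s\<close> and \<open>t\<close>.\<close>
    define u where "u = s *\<^sub>R (y - q) + t *\<^sub>R (z - q)"
    have g: "bgrad V y \<bullet> (y - q) = 1" "bgrad V y \<bullet> (z - q) = 0" "bgrad V z \<bullet> (y - q) = 0" "bgrad V z \<bullet> (z - q) = 1"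
      using bary_diff[of V y y q] bary_diff[of V y z q] bary_diff[of V z y q] bary_diff[of V z z q] q
        bary_vertex[OF V y(1) y(1)] bary_vertex[OF V y(1) y(2)] bary_vertex[OF V y(2) y(1)] bary_vertex[OF V y(2) y(2)] y(3) by auto
    define k where "k = r / (2 * (norm u + 1))"
    have k: "k > 0" "norm (k *\<^sub>R u) < r"
    proof -
      show k0: "k > 0" using r by (simp add: k_def add_nonneg_pos)
      have "norm (k *\<^sub>R u) = r * (norm u / (2 * (norm u + 1)))" using k0 r by (simp add: k_def)
      also have "\<dots> < r * 1" using r by (intro mult_strict_left_mono) (auto simp: divide_less_eq add_nonneg_pos)
      finally show "norm (k *\<^sub>R u) < r" by simp
    qed
    have "bary V y (q + k *\<^sub>R u) = k * s" "bary V z (q + k *\<^sub>R u) = k * t"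
      using bary_diff[of V y "q + k *\<^sub>R u" q] bary_diff[of V z "q + k *\<^sub>R u" q] q g by (simp_all add: u_def inner_add_right)
    moreover have "q + k *\<^sub>R u \<in> ball q r" using k(2) by (simp add: dist_norm)
    ultimately have "q + k *\<^sub>R u \<in> P y s \<inter> P z t" using k(1) that
      by (simp add: P_def mult.left_commute zero_less_mult_iff not_less less_le)
    then show ?thesis by blast
  qed
  have "connected (P y 1 \<union> P z 1)" by (rule connected_Un[OF cP cP ne]) auto
  then have c2: "connected ((P y 1 \<union> P z 1) \<union> P y (-1))" by (rule connected_Un[OF _ cP]) (use ne[of "-1" 1] in auto)
  have "connected (((P y 1 \<union> P z 1) \<union> P y (-1)) \<union> P z (-1))" by (rule connected_Un[OF c2 cP]) (use ne[of 1 "-1"] in auto)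
  moreover have "{x \<in> ball q r. bary V y x \<noteq> 0 \<or> bary V z x \<noteq> 0} = ((P y 1 \<union> P z 1) \<union> P y (-1)) \<union> P z (-1)"
    by (auto simp: P_def)
  ultimately show ?thesis by simp
qed

text \<open>Near \<open>q\<close>, every point of the union off the edge is interior to the union:
  it is interior to its element or lies inside a facet through \<open>e\<close>, which is not free
  and whose other owner is again in \<open>Z\<close>. Off the edge the union is thus open and closed
  in a small ball, and a ball minus a line is connected.\<close>

lemma closed_fan_interior:
  assumes tri: "triangulation T" and s: "\<And>K. K \<in> T \<Longrightarrow> 3 simplex K"
    and Z: "Z \<subseteq> edge_patch T e" "Z \<noteq> {}" "Z \<inter> free_elements T e = {}"
    and cl: "\<And>K K'. K \<in> Z \<Longrightarrow> K' \<in> edge_patch T e \<Longrightarrow> share_face K K' \<Longrightarrow> K' \<in> Z"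
    and e: "e = closed_segment x1 x2" "x1 \<noteq> x2" and q: "q \<in> open_segment x1 x2"
  shows "q \<in> interior (\<Union>Z)"
proof -
  have ZT: "Z \<subseteq> T" using Z by (auto simp: edge_patch_def)
  have fT: "finite T" using tri by (simp add: triangulation_def)
  then have fZ: "finite Z" using ZT finite_subset by blast
  have clS: "closed (\<Union>Z)" using s ZT by (intro closed_Union fZ) (auto intro: closed_simplex)
  have vert: "\<exists>V. tetra V \<and> K = convex hull V \<and> x1 \<in> V \<and> x2 \<in> V" if "K \<in> Z" for K
  proof -
    have KE: "K \<in> edge_patch T e" using that Z(1) by blast
    obtain V a b where "tetra V" "K = convex hull V" "a \<in> V" "b \<in> V" "a \<noteq> b" "e = closed_segment a b"
      by (rule edge_patch_vertices[OF s KE])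
    then show ?thesis using e by (metis closed_segment_eq doubleton_eq_iff)
  qed
  then obtain V where V: "\<And>K. K \<in> Z \<Longrightarrow> tetra (V K)" "\<And>K. K \<in> Z \<Longrightarrow> K = convex hull (V K)"
     "\<And>K. K \<in> Z \<Longrightarrow> x1 \<in> V K" "\<And>K. K \<in> Z \<Longrightarrow> x2 \<in> V K" by metis
  obtain u where u: "q = (1 - u) *\<^sub>R x1 + u *\<^sub>R x2" "0 < u" "u < 1" using q by (auto simp: in_segment)
  have bq: "bary (V K) v q = (if v = x1 then 1 - u else if v = x2 then u else 0)" if K: "K \<in> Z" "v \<in> V K" for K v
  proof -
    have "bary (V K) v q = (1 - u) * bary (V K) v x1 + u * bary (V K) v x2"
      by (simp add: u(1) bary_def inner_simps algebra_simps)
    then show ?thesis using bary_vertex[OF V(1)[OF K(1)] K(2)] V(3,4)[OF K(1)] e(2) by auto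
  qed
  have "\<exists>r>0. \<forall>x\<in>ball q r. bary (V K) x1 x > 0 \<and> bary (V K) x2 x > 0" if K: "K \<in> Z" for K
  proof -
    have "open {x. bary (V K) v x > 0}" for v
      by (rule open_Collect_less) (auto intro: continuous_bary)
    then have "open ({x. bary (V K) x1 x > 0} \<inter> {x. bary (V K) x2 x > 0})" by blast
    moreover have "q \<in> {x. bary (V K) x1 x > 0} \<inter> {x. bary (V K) x2 x > 0}" using bq[OF K] V(3,4)[OF K] u e(2) by auto
    ultimately obtain r where "r > 0" "ball q r \<subseteq> {x. bary (V K) x1 x > 0} \<inter> {x. bary (V K) x2 x > 0}"
      by (meson open_contains_ball)
    then show ?thesis by blast
  qed
  then obtain r0 where r0: "\<And>K. K \<in> Z \<Longrightarrow> r0 K > 0"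
    "\<And>K x. K \<in> Z \<Longrightarrow> x \<in> ball q (r0 K) \<Longrightarrow> bary (V K) x1 x > 0 \<and> bary (V K) x2 x > 0" by metis
  \<comment> \<open>In this ball the coordinates of \<open>x1\<close> and \<open>x2\<close> are
    positive for every element of \<open>Z\<close>, so the only facets met are those through
    \<open>e\<close>.\<close>
  define r where "r = Min (r0 ` Z)"
  have r: "r > 0" unfolding r_def using fZ Z(2) r0(1) by (subst Min_gr_iff) auto
  have rb: "bary (V K) x1 x > 0 \<and> bary (V K) x2 x > 0" if "K \<in> Z" "x \<in> ball q r" for K x
  proof -
    have "r \<le> r0 K" unfolding r_def using fZ that(1) by simp
    then show ?thesis using r0(2)[OF that(1), of x] that(2) by simp
  qed
  have int: "x \<in> interior (\<Union>Z)" if x: "x \<in> ball q r" "K \<in> Z" "x \<in> K" and nz: "\<exists>v\<in>V K - {x1, x2}. bary (V K) v x \<noteq> 0" for x K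
  proof (cases "\<forall>v\<in>V K. bary (V K) v x > 0")
    case True
    then have "x \<in> interior K" using interior_bary[OF V(1)[OF x(2)]] V(2)[OF x(2)] by auto
    then show ?thesis using interior_mono[of K "\<Union>Z"] x(2) by blast
  next
    case False
    have ge: "bary (V K) v x \<ge> 0" if "v \<in> V K" for v using hull_bary[OF V(1)[OF x(2)]] V(2)[OF x(2)] x(3) that by auto
    obtain y where y: "y \<in> V K" "\<not> bary (V K) y x > 0" using False by blast
    then have y0: "bary (V K) y x = 0" using ge[of y] by simp
    have y12: "y \<noteq> x1" "y \<noteq> x2" using rb[OF x(2,1)] y0 by auto
    obtain z where z: "z \<in> V K - {x1, x2}" "bary (V K) z x \<noteq> 0" using nz by blast
    have cV: "card (V K) = 4" "finite (V K)" using V(1)[OF x(2)] tetra_finite by (auto simp: tetra_def)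
    have "{x1, x2, y, z} \<subseteq> V K" using y z V(3,4)[OF x(2)] by auto
    moreover have "z \<noteq> y" using z(2) y0 by blast
    then have "card {x1, x2, y, z} = 4" using y12 z(1) e(2) by auto
    ultimately have VK: "V K = {x1, x2, y, z}" using card_subset_eq[OF cV(2)] cV(1) by metis
    have pos: "bary (V K) v x > 0" if "v \<in> V K - {y}" for v
      using that VK rb[OF x(2,1)] z(2) ge[of z] z(1) by auto
    define F where "F = convex hull (V K - {y})"
    have KE: "K \<in> edge_patch T e" using x(2) Z(1) by blast
    have FE: "F \<in> efacets K e"
      using efacets_eq[OF V(1)[OF x(2)] V(3,4)[OF x(2)]] V(2)[OF x(2)] e(1) y y12 by (auto simp: F_def)
    have "K \<notin> free_elements T e" using Z(3) x(2) by blast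
    then obtain K' where K': "K' \<in> T" "K' \<noteq> K" "F facet_of K'" using FE KE unfolding free_elements_def by blast
    note sh = shared_efacet_in_patch[OF tri s KE FE K']
    have K'Z: "K' \<in> Z" using cl[OF x(2) sh(1,3)] .
    have KT: "K \<in> T" using x(2) ZT by blast
    have FK: "F facet_of K" using FE by (simp add: efacets_def)
    obtain a b where ab: "a \<in> V K" "b \<in> V K'" "V K - {a} = V K' - {b}" "F = convex hull (V K - {a})" "K \<inter> K' = F"
      by (rule share_face_data[OF tri KT K'(1) K'(2)[symmetric] FK K'(3) V(1,2)[OF x(2)] V(1,2)[OF K'Z]])
    have "V K - {a} = V K - {y}" by (rule hull_inj[OF V(1)[OF x(2)]]) (use ab(4) F_def in auto)
    then have "a = y" using ab(1) y(1) by blast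
    then have "x \<in> interior (convex hull (V K) \<union> convex hull (V K'))"
      using shared_facet_interior[OF V(1)[OF x(2)] ab(1) V(1)[OF K'Z] ab(2,3) _ _ pos] ab(4,5) V(2)[OF x(2)] V(2)[OF K'Z] y0 by simp
    then have "x \<in> interior (K \<union> K')" using V(2)[OF x(2)] V(2)[OF K'Z] by simp
    then show ?thesis using interior_mono[of "K \<union> K'" "\<Union>Z"] x(2) K'Z by blast
  qed
  obtain K0 where K0: "K0 \<in> Z" using Z(2) by blast
  have c4: "card (V K0) = 4" "finite (V K0)" using V(1)[OF K0] tetra_finite by (auto simp: tetra_def)
  have "card (V K0 - {x1, x2}) = 2" using c4 V(3,4)[OF K0] e(2) by (simp add: card_Diff_subset)
  then obtain y z where yz: "V K0 - {x1, x2} = {y, z}" "y \<noteq> z" by (meson card_2_iff)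
  then have yzV: "y \<in> V K0" "z \<in> V K0" "y \<noteq> x1" "y \<noteq> x2" "z \<noteq> x1" "z \<noteq> x2" by blast+
  \<comment> \<open>Within the ball the edge is a full line segment, so its complement can be
    described by the coordinates of one fixed element \<open>K0\<close> for all of
    \<open>Z\<close>.\<close>
  define A where "A = {x \<in> ball q r. bary (V K0) y x \<noteq> 0 \<or> bary (V K0) z x \<noteq> 0}"
  have con: "connected A" unfolding A_def
    by (rule connected_ball_minus_line[OF V(1)[OF K0] yzV(1,2) yz(2) _ _ r]) (use bq[OF K0] yzV in auto)
  have notA: "x \<in> e" if x: "x \<in> ball q r" "x \<notin> A" for x
  proof -
    have z0: "bary (V K0) y x = 0" "bary (V K0) z x = 0" using x by (auto simp: A_def)
    have VK0: "V K0 = {x1, x2, y, z}" using yz V(3,4)[OF K0] by blast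
    have "x \<in> convex hull {x1, x2}" using hull_subset_bary[OF V(1)[OF K0], of "{x1, x2}" x] rb[OF K0 x(1)] z0 VK0 by auto
    then show ?thesis by (simp add: e segment_convex_hull)
  qed
  have Ae: "x \<notin> e" if "x \<in> A" for x
  proof
    assume "x \<in> e"
    then have "x \<in> convex hull {x1, x2}" by (simp add: e segment_convex_hull)
    then have "bary (V K0) y x = 0" "bary (V K0) z x = 0"
      using hull_subset_bary[OF V(1)[OF K0], of "{x1, x2}" x] yzV V(3,4)[OF K0] by auto
    then show False using that by (simp add: A_def)
  qed
  have AZ: "x \<in> interior (\<Union>Z)" if x: "x \<in> A" "x \<in> \<Union>Z" for x
  proof -
    obtain K where K: "K \<in> Z" "x \<in> K" using x(2) by blast
    have "\<exists>v\<in>V K - {x1, x2}. bary (V K) v x \<noteq> 0"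
    proof (rule ccontr)
      assume "\<not> ?thesis"
      then have "x \<in> convex hull {x1, x2}"
        using hull_subset_bary[OF V(1)[OF K(1)], of "{x1, x2}" x] V(3,4)[OF K(1)] hull_bary[OF V(1)[OF K(1)], of x] V(2)[OF K(1)] K(2) by auto
      then show False using Ae[OF x(1)] by (simp add: e segment_convex_hull)
    qed
    then show ?thesis using int[of x K] x(1) K by (simp add: A_def)
  qed
  have "A \<subseteq> \<Union>Z"
  proof -
    have "interior (\<Union>Z) \<inter> A = {} \<or> (- \<Union>Z) \<inter> A = {}"
    proof (rule connectedD[OF con open_interior])
      show "open (- \<Union>Z)" by (rule open_Compl[OF clS])
      show "interior (\<Union>Z) \<inter> - \<Union>Z \<inter> A = {}" using interior_subset by blast
      show "A \<subseteq> interior (\<Union>Z) \<union> - \<Union>Z" using AZ by blast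
    qed
    moreover have "interior (\<Union>Z) \<inter> A \<noteq> {}"
    proof -
      have qK: "q \<in> closure (interior K0)"
      proof -
        have "q \<in> K0" using hull_bary[OF V(1)[OF K0], of q] bq[OF K0] u V(2)[OF K0] by auto
        moreover have "convex K0" using V(2)[OF K0] by (metis convex_convex_hull)
        moreover have "interior K0 \<noteq> {}"
        proof -
          have "aff_dim K0 = 3" using s[of K0] K0 ZT aff_dim_simplex by blast
          then show ?thesis using \<open>convex K0\<close> interior_rel_interior_gen[of K0] rel_interior_eq_empty[of K0] by auto
        qed
        ultimately show ?thesis using convex_closure_interior closure_subset by blast
      qed
      then obtain x where x: "x \<in> interior K0" "dist x q < r" using r by (meson closure_approachable)
      have "x \<in> A" using x interior_bary[OF V(1)[OF K0]] V(2)[OF K0] yzV by (auto simp: A_def dist_commute)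
      moreover have "x \<in> interior (\<Union>Z)" using x(1) interior_mono[of K0 "\<Union>Z"] K0 by blast
      ultimately show ?thesis by blast
    qed
    ultimately show ?thesis by blast
  qed
  moreover have "e \<subseteq> \<Union>Z" using edge_patch_subset[of K0 T e] K0 Z(1) by blast
  ultimately have "ball q r \<subseteq> \<Union>Z" using notA by blast
  then show ?thesis using r by (meson centre_in_ball interiorI open_ball)
qed

section \<open>Hausdorff null sets and the boundary of the domain\<close>

lemma hausdorff_measure_zeroI:
  fixes A :: "'a::metric_space set"
  assumes "\<And>\<delta> \<epsilon>. 0 < \<delta> \<Longrightarrow> 0 < \<epsilon> \<Longrightarrow> \<exists>U::nat \<Rightarrow> 'a set. A \<subseteq> (\<Union>i. U i) \<and>
    (\<forall>i. bounded (U i) \<and> diameter (U i) \<le> \<delta>) \<and> (\<Sum>i. ennreal (diameter (U i) powr s)) \<le> ennreal \<epsilon>"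
  shows "hausdorff_measure s A = 0"
proof -
  have "(INF U\<in>{U :: nat \<Rightarrow> 'a set. A \<subseteq> (\<Union>i. U i) \<and> (\<forall>i. bounded (U i) \<and> diameter (U i) \<le> \<delta>)}.
        (\<Sum>i. ennreal (diameter (U i) powr s))) \<le> 0" if \<delta>: "\<delta> \<in> {0<..}" for \<delta>
  proof (rule ennreal_le_epsilon)
    fix \<epsilon> :: real assume \<epsilon>: "0 < \<epsilon>"
    have \<delta>0: "0 < \<delta>" using \<delta> by simp
    obtain U :: "nat \<Rightarrow> 'a set" where U: "A \<subseteq> (\<Union>i. U i) \<and> (\<forall>i. bounded (U i) \<and> diameter (U i) \<le> \<delta>) \<and>
      (\<Sum>i. ennreal (diameter (U i) powr s)) \<le> ennreal \<epsilon>"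
      using assms[OF \<delta>0 \<epsilon>] by (elim exE) (rule that)
    show "(INF U\<in>{U :: nat \<Rightarrow> 'a set. A \<subseteq> (\<Union>i. U i) \<and> (\<forall>i. bounded (U i) \<and> diameter (U i) \<le> \<delta>)}.
        (\<Sum>i. ennreal (diameter (U i) powr s))) \<le> 0 + ennreal \<epsilon>"
    proof (rule INF_lower2)
      show "U \<in> {U. A \<subseteq> (\<Union>i. U i) \<and> (\<forall>i. bounded (U i) \<and> diameter (U i) \<le> \<delta>)}"
        using U by (intro CollectI conjI) (elim conjE; assumption)+
      show "(\<Sum>i. ennreal (diameter (U i) powr s)) \<le> 0 + ennreal \<epsilon>" using U by (simp only: add_0)
    qed
  qed
  then have "hausdorff_measure s A \<le> 0" unfolding hausdorff_measure_def by (rule SUP_least)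
  then show ?thesis by simp
qed

lemma hausdorff_measure_1_subset_doubleton:
  assumes "A \<subseteq> {a, b}" shows "hausdorff_measure 1 A = 0"
proof (rule hausdorff_measure_zeroI)
  fix \<delta> \<epsilon> :: real assume "0 < \<delta>" "0 < \<epsilon>"
  \<comment> \<open>The empty sets are padding for the infinite cover. They and the singletons have
    diameter 0, and \<open>0 powr 1 = 0\<close>.\<close>
  define U where "U i = (if i = 0 then {a} else if i = Suc 0 then {b} else {})" for i :: nat
  have d: "diameter (U i) = 0" "bounded (U i)" for i by (auto simp: U_def)
  have "a \<in> U 0" "b \<in> U (Suc 0)" by (auto simp: U_def)
  then have "A \<subseteq> (\<Union>i. U i)" using assms by blast
  then show "\<exists>U::nat \<Rightarrow> 'a set. A \<subseteq> (\<Union>i. U i) \<and>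
    (\<forall>i. bounded (U i) \<and> diameter (U i) \<le> \<delta>) \<and> (\<Sum>i. ennreal (diameter (U i) powr 1)) \<le> ennreal \<epsilon>"
    by (intro exI[of _ U]) (use d \<open>0 < \<delta>\<close> in auto)
qed

text \<open>Cutting \<open>M\<close> segments of length at most \<open>L\<close> into
  \<open>n\<close> pieces each gives \<open>M n\<close> sets of diameter at most
  \<open>L / n\<close>; the sum of the squared diameters is at most \<open>M L^2 / n\<close>, which
  is small for large \<open>n\<close>.\<close>

lemma hausdorff_measure_2_segments:
  fixes A :: "'a::euclidean_space set"
  assumes P: "finite P" and A: "A \<subseteq> (\<Union>(a, b)\<in>P. closed_segment a b)"
  shows "hausdorff_measure 2 A = 0"
proof (rule hausdorff_measure_zeroI)
  fix \<delta> \<epsilon> :: real assume \<delta>: "0 < \<delta>" and \<epsilon>: "0 < \<epsilon>"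
  obtain xs where xs: "set xs = P" using P finite_list by blast
  define M where "M = length xs"
  define L where "L = 1 + (\<Sum>p\<in>P. norm (snd p - fst p))"
  have L: "L \<ge> 1" "\<And>a b. (a, b) \<in> P \<Longrightarrow> norm (b - a) \<le> L"
  proof -
    show "L \<ge> 1" by (simp add: L_def sum_nonneg)
    fix a b assume "(a, b) \<in> P"
    then have "norm (snd (a, b) - fst (a, b)) \<le> (\<Sum>p\<in>P. norm (snd p - fst p))" by (intro member_le_sum P) auto
    then show "norm (b - a) \<le> L" by (simp add: L_def)
  qed
  obtain n :: nat where n: "real n > max (L / \<delta>) (real M * L\<^sup>2 / \<epsilon>)" using reals_Archimedean2 by blast
  then have n0: "real n > 0" using L \<delta> by (smt (verit) divide_nonneg_pos max_less_iff_conj)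
  then have n1: "n > 0" by simp
  define piece where "piece a b k = (\<lambda>s. a + s *\<^sub>R (b - a)) ` {real k / n..(real k + 1) / n}" for a b :: 'a and k :: nat
  define U where "U i = (if i < M * n then piece (fst (xs ! (i div n))) (snd (xs ! (i div n))) (i mod n) else {})" for i
  have dp: "bounded (piece a b k) \<and> diameter (piece a b k) \<le> L / n" if "(a, b) \<in> P" for a b k
  proof
    have "compact (piece a b k)" unfolding piece_def by (intro compact_continuous_image continuous_intros compact_Icc)
    then show "bounded (piece a b k)" by (rule compact_imp_bounded)
    show "diameter (piece a b k) \<le> L / n"
    proof (rule diameter_le)
      show "piece a b k \<noteq> {} \<or> 0 \<le> L / n" using L by simp
      fix x y assume "x \<in> piece a b k" "y \<in> piece a b k"
      then obtain s t where st: "x = a + s *\<^sub>R (b - a)" "y = a + t *\<^sub>R (b - a)" "s \<in> {real k / n..(real k + 1) / n}" "t \<in> {real k / n..(real k + 1) / n}"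
        unfolding piece_def by blast
      have "x - y = (s - t) *\<^sub>R (b - a)" by (simp add: st algebra_simps)
      then have "norm (x - y) = \<bar>s - t\<bar> * norm (b - a)" by simp
      also have "\<dots> \<le> (1 / n) * L"
      proof (rule mult_mono)
        have "\<bar>s - t\<bar> \<le> (real k + 1) / n - real k / n" using st by auto
        then show "\<bar>s - t\<bar> \<le> 1 / n" by (simp add: diff_divide_distrib[symmetric])
      qed (use L(2)[OF that] in auto)
      finally show "norm (x - y) \<le> L / n" by simp
    qed
  qed
  have dU: "bounded (U i) \<and> diameter (U i) \<le> L / n" for i
  proof (cases "i < M * n")
    case True
    then have "i div n < M" using n1 by (simp add: less_mult_imp_div_less)
    then have "(fst (xs ! (i div n)), snd (xs ! (i div n))) \<in> P" using xs M_def nth_mem by fastforce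
    from dp[OF this] show ?thesis using True by (simp add: U_def)
  qed (use L in \<open>simp add: U_def\<close>)
  have Ln: "L / n \<le> \<delta>" using n n0 \<delta> by (simp add: field_simps)
  have cover: "A \<subseteq> (\<Union>i. U i)"
  proof
    fix x assume "x \<in> A"
    then obtain a b where ab: "(a, b) \<in> P" "x \<in> closed_segment a b" using A by blast
    then obtain j where j: "j < M" "xs ! j = (a, b)" using xs M_def by (metis in_set_conv_nth)
    obtain u where u: "0 \<le> u" "u \<le> 1" "x = a + u *\<^sub>R (b - a)" using ab(2) by (auto simp: in_segment algebra_simps)
    \<comment> \<open>At the end point \<open>u = 1\<close> the floor would give \<open>n\<close>,
      one past the last piece.\<close>
    define k where "k = (if u = 1 then n - 1 else nat \<lfloor>u * n\<rfloor>)"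
    have k: "k < n" "real k / n \<le> u" "u \<le> (real k + 1) / n"
    proof -
      have "k < n \<and> real k \<le> u * n \<and> u * n \<le> real k + 1"
      proof (cases "u = 1")
        case True
        then show ?thesis using n1 by (simp add: k_def of_nat_diff)
      next
        case False
        then have "u * n < 1 * real n" using u n0 by (intro mult_strict_right_mono) auto
        moreover have "0 \<le> u * n" using u by simp
        ultimately show ?thesis using False by (simp add: k_def nat_less_iff floor_less_iff)
      qed
      then show "k < n" "real k / n \<le> u" "u \<le> (real k + 1) / n" using n0 by (auto simp: field_simps)
    qed
    define i where "i = j * n + k"
    have "i div n = j" "i mod n = k" using k(1) by (auto simp: i_def)
    moreover have "i < M * n"
    proof -
      have "i < (j + 1) * n" using k(1) by (simp add: i_def)
      also have "\<dots> \<le> M * n" using j(1) by (intro mult_le_mono1) simp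
      finally show ?thesis .
    qed
    ultimately have "x \<in> U i" using j(2) u k by (auto simp: U_def piece_def)
    then show "x \<in> (\<Union>i. U i)" by blast
  qed
  have "(\<Sum>i. ennreal (diameter (U i) powr 2)) = (\<Sum>i<M*n. ennreal (diameter (U i) powr 2))"
    by (rule suminf_finite) (auto simp: U_def)
  also have "\<dots> \<le> (\<Sum>i<M*n. ennreal ((L / n)\<^sup>2))"
  proof (intro sum_mono ennreal_leI)
    fix i
    have "0 \<le> diameter (U i)" using dU diameter_ge_0 by blast
    then have "diameter (U i) powr 2 = (diameter (U i))\<^sup>2" by simp
    also have "\<dots> \<le> (L / n)\<^sup>2" using dU \<open>0 \<le> diameter (U i)\<close> by (intro power_mono) auto
    finally show "diameter (U i) powr 2 \<le> (L / n)\<^sup>2" .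
  qed
  also have "\<dots> = ennreal (real (M * n) * (L / n)\<^sup>2)" by (simp add: ennreal_of_nat_eq_real_of_nat ennreal_mult)
  also have "real (M * n) * (L / n)\<^sup>2 = real M * L\<^sup>2 / n" using n0 by (simp add: power2_eq_square)
  also have "ennreal \<dots> \<le> ennreal \<epsilon>" using n n0 \<epsilon> by (intro ennreal_leI) (simp add: field_simps)
  finally show "\<exists>U::nat \<Rightarrow> 'a set. A \<subseteq> (\<Union>i. U i) \<and>
    (\<forall>i. bounded (U i) \<and> diameter (U i) \<le> \<delta>) \<and> (\<Sum>i. ennreal (diameter (U i) powr 2)) \<le> ennreal \<epsilon>"
    by (intro exI[of _ U]) (use dU Ln cover in \<open>auto intro: order_trans\<close>)
qed

text \<open>The domain lies on one side of its boundary: a small step from a boundary point against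
  \<open>\<nu>\<close> lands strictly below the graph, where a neighbourhood misses
  \<open>\<Omega>\<close>. This excludes slits, which \<open>polyhedral_domain\<close>
  permits.\<close>

lemma lipschitz_boundary_interior_closure:
  assumes lip: "lipschitz_boundary \<Omega>" and "open \<Omega>" and q: "q \<in> frontier \<Omega>"
  shows "q \<notin> interior (closure \<Omega>)"
proof
  assume "q \<in> interior (closure \<Omega>)"
  then obtain \<epsilon> where \<epsilon>: "\<epsilon> > 0" "ball q \<epsilon> \<subseteq> closure \<Omega>" by (meson mem_interior)
  obtain r \<nu> L and g :: "real^3 \<Rightarrow> real" where r: "r > 0" and \<nu>: "norm \<nu> = 1" and g: "L-lipschitz_on UNIV g"
    and eq: "\<forall>y\<in>ball q r. y \<in> \<Omega> \<longleftrightarrow> g (y - (y \<bullet> \<nu>) *\<^sub>R \<nu>) < y \<bullet> \<nu>"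
    using lip q unfolding lipschitz_boundary_def by metis
  have "q \<notin> \<Omega>" using q \<open>open \<Omega>\<close> by (simp add: frontier_def interior_open)
  then have gq: "g (q - (q \<bullet> \<nu>) *\<^sub>R \<nu>) \<ge> q \<bullet> \<nu>" using eq r by auto
  have nn: "\<nu> \<bullet> \<nu> = 1" using \<nu> by (simp add: dot_square_norm)
  define s where "s = min \<epsilon> r / 2"
  define y where "y = q - s *\<^sub>R \<nu>"
  have s: "s > 0" "s < \<epsilon>" "s < r" using \<epsilon> r by (auto simp: s_def)
  have y: "y \<in> ball q \<epsilon>" "y \<in> ball q r" using s \<nu> by (auto simp: y_def dist_norm)
  have yn: "y \<bullet> \<nu> = q \<bullet> \<nu> - s" by (simp add: y_def inner_diff_left nn)
  have yp: "y - (y \<bullet> \<nu>) *\<^sub>R \<nu> = q - (q \<bullet> \<nu>) *\<^sub>R \<nu>" unfolding yn by (simp add: y_def algebra_simps)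
  have cg: "continuous_on UNIV g" using g lipschitz_on_continuous_on by blast
  have "open {x. x \<bullet> \<nu> < g (x - (x \<bullet> \<nu>) *\<^sub>R \<nu>)}"
    by (rule open_Collect_less) (auto intro!: continuous_intros continuous_on_compose2[OF cg])
  moreover have "y \<in> {x. x \<bullet> \<nu> < g (x - (x \<bullet> \<nu>) *\<^sub>R \<nu>)}" unfolding mem_Collect_eq yp using gq s yn by simp
  ultimately have "open ({x. x \<bullet> \<nu> < g (x - (x \<bullet> \<nu>) *\<^sub>R \<nu>)} \<inter> ball q r)" "y \<in> {x. x \<bullet> \<nu> < g (x - (x \<bullet> \<nu>) *\<^sub>R \<nu>)} \<inter> ball q r"
    using y by auto
  moreover have "({x. x \<bullet> \<nu> < g (x - (x \<bullet> \<nu>) *\<^sub>R \<nu>)} \<inter> ball q r) \<inter> \<Omega> = {}" using eq by auto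
  ultimately have "y \<notin> closure \<Omega>" by (meson disjoint_iff open_Int_closure_eq_empty)
  then show False using y(1) \<epsilon>(2) by blast
qed

lemma boundary_edge_point:
  assumes "\<not> interior_edge \<Omega> e" "e = closed_segment x1 x2"
  shows "\<exists>q\<in>open_segment x1 x2. q \<in> frontier \<Omega>"
proof (rule ccontr)
  assume "\<not> ?thesis"
  then have "e \<inter> frontier \<Omega> \<subseteq> {x1, x2}" using assms(2) by (auto simp: open_segment_def)
  then have "hausdorff_measure 1 (e \<inter> frontier \<Omega>) = 0" by (rule hausdorff_measure_1_subset_doubleton)
  then show False using assms(1) by (simp add: interior_edge_def)
qed

text \<open>Otherwise \<open>closed_fan_interior\<close> would put a boundary point of
  \<open>\<Omega>\<close>, found in the relative interior of \<open>e\<close>, into the interior of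
  the closure of \<open>\<Omega>\<close>.\<close>

lemma boundary_fan_free:
  assumes \<Omega>: "open \<Omega>" "lipschitz_boundary \<Omega>" and tri: "triangulation T" and s: "\<And>K. K \<in> T \<Longrightarrow> 3 simplex K"
    and un: "\<Union>T = closure \<Omega>" and e: "\<not> interior_edge \<Omega> e"
    and Z: "Z \<subseteq> edge_patch T e" "Z \<noteq> {}"
    and cl: "\<And>K K'. K \<in> Z \<Longrightarrow> K' \<in> edge_patch T e \<Longrightarrow> share_face K K' \<Longrightarrow> K' \<in> Z"
  shows "Z \<inter> free_elements T e \<noteq> {}"
proof
  assume n: "Z \<inter> free_elements T e = {}"
  obtain K where K: "K \<in> edge_patch T e" using Z by blast
  obtain V x1 x2 where x: "x1 \<noteq> x2" "e = closed_segment x1 x2"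
    by (rule edge_patch_vertices[OF s K])
  obtain q where q: "q \<in> open_segment x1 x2" "q \<in> frontier \<Omega>" using boundary_edge_point[OF e x(2)] by blast
  have "q \<in> interior (\<Union>Z)" by (rule closed_fan_interior[OF tri s Z n cl x(2,1) q(1)])
  moreover have "\<Union>Z \<subseteq> closure \<Omega>" using Z(1) un by (auto simp: edge_patch_def)
  ultimately have "q \<in> interior (closure \<Omega>)" using interior_mono by blast
  then show False using lipschitz_boundary_interior_closure[OF \<Omega>(2,1) q(2)] by simp
qed

text \<open>If every facet at \<open>e\<close> of a maximal element had a second owner, the relative
  interiors of these facets would be interior to the closure of \<open>\<Omega>\<close>. The
  boundary part would then be contained in finitely many element edges, which have no area.\<close>

lemma boundary_part_free:
  assumes \<Omega>: "open \<Omega>" "lipschitz_boundary \<Omega>" and tri: "triangulation T" and s: "\<And>K. K \<in> T \<Longrightarrow> 3 simplex K"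
    and un: "\<Union>T = closure \<Omega>" and H: "hausdorff_measure 2 (boundary_part \<Omega> \<mu> T e) > 0"
  shows "max_patch \<mu> T e \<inter> free_elements T e \<noteq> {}"
proof
  assume n: "max_patch \<mu> T e \<inter> free_elements T e = {}"
  have fT: "finite T" using tri by (simp add: triangulation_def)
  have "\<exists>V. K \<in> T \<longrightarrow> tetra V \<and> K = convex hull V" for K using s[of K] simplex3_tetra by blast
  then obtain V where V: "\<And>K. K \<in> T \<Longrightarrow> tetra (V K)" "\<And>K. K \<in> T \<Longrightarrow> K = convex hull (V K)" by metis
  define P where "P = (\<Union>K\<in>T. V K \<times> V K)"
  have "finite P" unfolding P_def using fT V(1) tetra_finite by (intro finite_UN_I finite_cartesian_product) auto
  moreover have "boundary_part \<Omega> \<mu> T e \<subseteq> (\<Union>(a, b)\<in>P. closed_segment a b)"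
  proof
    fix x assume "x \<in> boundary_part \<Omega> \<mu> T e"
    then obtain F K where x: "x \<in> frontier \<Omega>" "x \<in> F" and F: "e \<subseteq> F" "K \<in> max_patch \<mu> T e" "F facet_of K"
      by (auto simp: boundary_part_def)
    have KE: "K \<in> edge_patch T e" using F(2) by (simp add: max_patch_def)
    then have KT: "K \<in> T" by (simp add: edge_patch_def)
    have FE: "F \<in> efacets K e" using F by (simp add: efacets_def)
    have "K \<notin> free_elements T e" using n F(2) by blast
    then obtain K' where K': "K' \<in> T" "K' \<noteq> K" "F facet_of K'" using FE KE unfolding free_elements_def by blast
    obtain a b where ab: "a \<in> V K" "b \<in> V K'" "V K - {a} = V K' - {b}" "F = convex hull (V K - {a})" "K \<inter> K' = F"
      by (rule share_face_data[OF tri KT K'(1) K'(2)[symmetric] F(3) K'(3) V[OF KT] V[OF K'(1)]])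
    have i: "convex hull (V K) \<inter> convex hull (V K') = convex hull (V K - {a})"
      using ab(4,5) V(2)[OF KT] V(2)[OF K'(1)] by simp
    have b0: "bary (V K) a x = 0" using bary_opposite_zero[OF V(1)[OF KT] ab(1)] x(2) ab(4) by blast
    have xK: "x \<in> K" using x(2) ab(5) by blast
    have "\<not> (\<forall>v\<in>V K - {a}. bary (V K) v x > 0)"
    proof
      assume "\<forall>v\<in>V K - {a}. bary (V K) v x > 0"
      then have "x \<in> interior (convex hull (V K) \<union> convex hull (V K'))"
        using shared_facet_interior[OF V(1)[OF KT] ab(1) V(1)[OF K'(1)] ab(2,3) i b0] by blast
      then have "x \<in> interior (K \<union> K')" using V(2)[OF KT] V(2)[OF K'(1)] by simp
      moreover have "K \<union> K' \<subseteq> closure \<Omega>" using un KT K'(1) by blast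
      ultimately have "x \<in> interior (closure \<Omega>)" using interior_mono by blast
      then show False using lipschitz_boundary_interior_closure[OF \<Omega>(2,1) x(1)] by simp
    qed
    then obtain v where v: "v \<in> V K - {a}" "\<not> bary (V K) v x > 0" by blast
    have ge: "\<forall>v\<in>V K. bary (V K) v x \<ge> 0" using hull_bary[OF V(1)[OF KT], of x] V(2)[OF KT] xK by simp
    then have v0: "bary (V K) v x = 0" using v by fastforce
    have "x \<in> convex hull (V K - {a, v})"
      using hull_subset_bary[OF V(1)[OF KT], of "V K - {a, v}" x] ge b0 v0 by auto
    moreover have "card (V K - {a, v}) = 2"
      using V(1)[OF KT] ab(1) v(1) tetra_finite[OF V(1)[OF KT]] by (auto simp: tetra_def card_Diff_subset card_insert_if)
    then obtain c d where "V K - {a, v} = {c, d}" by (meson card_2_iff)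
    ultimately have "x \<in> closed_segment c d" "(c, d) \<in> P" using KT by (auto simp: segment_convex_hull P_def)
    then show "x \<in> (\<Union>(a, b)\<in>P. closed_segment a b)" by blast
  qed
  ultimately have "hausdorff_measure 2 (boundary_part \<Omega> \<mu> T e) = 0" by (rule hausdorff_measure_2_segments)
  then show False using H by simp
qed

section \<open>Paths of elements\<close>

lemma successively_rtrancl:
  assumes "successively P Ks" "Ks \<noteq> []"
  shows "(hd Ks, last Ks) \<in> {(a, c). a \<in> set Ks \<and> c \<in> set Ks \<and> P a c}\<^sup>*"
  using assms
proof (induction Ks)
  case (Cons x xs)
  show ?case
  proof (cases xs)
    case (Cons y ys)
    then have "P x y" "successively P xs" using Cons.prems by auto
    then have IH: "(hd xs, last xs) \<in> {(a, c). a \<in> set xs \<and> c \<in> set xs \<and> P a c}\<^sup>*" using Cons.IH Cons by simp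
    have "{(a, c). a \<in> set xs \<and> c \<in> set xs \<and> P a c} \<subseteq> {(a, c). a \<in> set (x # xs) \<and> c \<in> set (x # xs) \<and> P a c}" by auto
    then have "(hd xs, last xs) \<in> {(a, c). a \<in> set (x # xs) \<and> c \<in> set (x # xs) \<and> P a c}\<^sup>*"
      using IH rtrancl_mono by blast
    moreover have "(x, hd xs) \<in> {(a, c). a \<in> set (x # xs) \<and> c \<in> set (x # xs) \<and> P a c}" using \<open>P x y\<close> Cons by simp
    ultimately have "(x, last xs) \<in> {(a, c). a \<in> set (x # xs) \<and> c \<in> set (x # xs) \<and> P a c}\<^sup>*"
      by (rule converse_rtrancl_into_rtrancl[rotated])
    then show ?thesis using Cons by simp
  qed simp
qed simp

lemma successively_hd_le:
  fixes f :: "'a \<Rightarrow> real"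
  assumes "successively (\<lambda>a c. Q a c \<and> f a \<le> f c) Ks" "x \<in> set Ks"
  shows "f (hd Ks) \<le> f x"
  using assms
proof (induction Ks arbitrary: x)
  case (Cons y ys)
  show ?case
  proof (cases ys)
    case (Cons z zs)
    show ?thesis
    proof (cases "x = y")
      case False
      then have "f (hd ys) \<le> f x" using Cons.prems Cons.IH Cons by auto
      moreover have "f y \<le> f (hd ys)" using Cons.prems Cons by simp
      ultimately show ?thesis by simp
    qed simp
  qed (use Cons.prems in simp)
qed simp

lemma max_patch_subset: "max_patch \<mu> T e \<subseteq> edge_patch T e"
  by (auto simp: max_patch_def)

lemma max_patch_upward:
  assumes "K \<in> max_patch \<mu> T e" "K' \<in> edge_patch T e" "inverse (coeff_on \<mu> K) \<le> inverse (coeff_on \<mu> K')"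
  shows "K' \<in> max_patch \<mu> T e"
  using assms unfolding max_patch_def by force

lemma monotone_path_rtrancl:
  assumes "monotone_path \<mu> S K K' Ks"
  shows "(K, K') \<in> {(a, c). a \<in> set Ks \<and> c \<in> set Ks \<and> share_face a c \<and> inverse (coeff_on \<mu> a) \<le> inverse (coeff_on \<mu> c)}\<^sup>*"
  using successively_rtrancl[of "\<lambda>A B. share_face A B \<and> inverse (coeff_on \<mu> A) \<le> inverse (coeff_on \<mu> B)" Ks] assms
  unfolding monotone_path_def by auto

text \<open>The weight \<open>\<mu>^-1\<close> cannot drop along the path and is already maximal at
  its start.\<close>

lemma monotone_path_max:
  assumes p: "monotone_path \<mu> (edge_patch T e) K K' Ks" and K: "K \<in> max_patch \<mu> T e"
  shows "set Ks \<subseteq> max_patch \<mu> T e"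
proof
  fix x assume x: "x \<in> set Ks"
  have "inverse (coeff_on \<mu> (hd Ks)) \<le> inverse (coeff_on \<mu> x)"
    by (rule successively_hd_le[OF _ x, of share_face "\<lambda>K. inverse (coeff_on \<mu> K)"]) (use p in \<open>simp add: monotone_path_def\<close>)
  then show "x \<in> max_patch \<mu> T e" using max_patch_upward[OF K, of x] p x by (auto simp: monotone_path_def)
qed

text \<open>At a boundary edge quasi-monotonicity provides paths only from elements outside the
  maximal subpatch, and the known boundary face might sit in another component of that subpatch than
  \<open>x\<close>. \<open>component_meets_boundary\<close>, applied to face adjacency, closes this
  gap.\<close>

lemma max_component_free:
  assumes \<Omega>: "open \<Omega>" "lipschitz_boundary \<Omega>" and tri: "triangulation T" and s: "\<And>K. K \<in> T \<Longrightarrow> 3 simplex K"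
    and un: "\<Union>T = closure \<Omega>" and qm: "quasi_monotone \<Omega> \<mu> T" and e: "e \<in> mesh_edges T" "\<not> interior_edge \<Omega> e"
    and x: "x \<in> max_patch \<mu> T e"
  shows "\<exists>y\<in>max_patch \<mu> T e \<inter> free_elements T e.
    (x, y) \<in> {(a, c). a \<in> max_patch \<mu> T e \<and> c \<in> max_patch \<mu> T e \<and> share_face a c}\<^sup>*"
proof -
  have q: "\<forall>K\<in>edge_patch T e - max_patch \<mu> T e. \<forall>K'\<in>max_patch \<mu> T e. \<exists>Ks. monotone_path \<mu> (edge_patch T e) K K' Ks"
    and H: "hausdorff_measure 2 (boundary_part \<Omega> \<mu> T e) > 0"
    using qm e unfolding quasi_monotone_def by auto
  have fT: "finite T" using tri by (simp add: triangulation_def)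
  obtain b where b: "b \<in> max_patch \<mu> T e" "b \<in> free_elements T e"
    using boundary_part_free[OF \<Omega> tri s un H] by blast
  show ?thesis
  proof (rule component_meets_boundary[where X="edge_patch T e" and b=b])
    show "finite (edge_patch T e)" using fT by (simp add: edge_patch_def)
    show "\<And>a c. share_face a c \<Longrightarrow> share_face c a" by (rule share_face_sym)
    show "\<And>a. \<not> share_face a a" by (rule share_face_irrefl)
    show "max_patch \<mu> T e \<subseteq> edge_patch T e" by (rule max_patch_subset)
    show "\<And>a. a \<in> edge_patch T e \<Longrightarrow> a \<in> free_elements T e \<Longrightarrow> card {y \<in> edge_patch T e. share_face a y} \<le> 1"
      by (rule edge_patch_degree(1)[OF tri s])
    show "\<And>a. a \<in> edge_patch T e \<Longrightarrow> a \<notin> free_elements T e \<Longrightarrow> card {y \<in> edge_patch T e. share_face a y} = 2"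
      by (rule edge_patch_degree(2)[OF tri s])
    show "\<And>Z. Z \<subseteq> edge_patch T e \<Longrightarrow> Z \<noteq> {} \<Longrightarrow> \<forall>a\<in>Z. \<forall>y\<in>edge_patch T e. share_face a y \<longrightarrow> y \<in> Z \<Longrightarrow> Z \<inter> free_elements T e \<noteq> {}"
      by (rule boundary_fan_free[OF \<Omega> tri s un e(2)]) auto
    show "b \<in> max_patch \<mu> T e" "b \<in> free_elements T e" "x \<in> max_patch \<mu> T e" by (fact b x)+
    fix a c assume ac: "a \<in> edge_patch T e - max_patch \<mu> T e" "c \<in> max_patch \<mu> T e"
    obtain Ks where p: "monotone_path \<mu> (edge_patch T e) a c Ks" using q ac by blast
    have "{(a, c). a \<in> set Ks \<and> c \<in> set Ks \<and> share_face a c \<and> inverse (coeff_on \<mu> a) \<le> inverse (coeff_on \<mu> c)}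
       \<subseteq> {(a, c). a \<in> edge_patch T e \<and> c \<in> edge_patch T e \<and> share_face a c \<and> (a \<in> max_patch \<mu> T e \<longrightarrow> c \<in> max_patch \<mu> T e)}"
      using p max_patch_upward by (auto simp: monotone_path_def)
    then show "(a, c) \<in> {(a, c). a \<in> edge_patch T e \<and> c \<in> edge_patch T e \<and> share_face a c \<and> (a \<in> max_patch \<mu> T e \<longrightarrow> c \<in> max_patch \<mu> T e)}\<^sup>*"
      using monotone_path_rtrancl[OF p] rtrancl_mono by blast
  qed
qed

section \<open>Shape regularity\<close>

lemma inscribed_ball:
  assumes V: "tetra V" and reg: "diameter (convex hull V) \<le> \<sigma> * indiameter (convex hull V)"
  shows "0 < diameter (convex hull V)" "0 < \<sigma>"
    "\<exists>z r. 0 < r \<and> cball z r \<subseteq> convex hull V \<and> diameter (convex hull V) \<le> 4 * \<sigma> * r"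
proof -
  let ?K = "convex hull V"
  have f: "finite V" "card V = 4" using V tetra_finite by (auto simp: tetra_def)
  have bd: "bounded ?K" using f by (simp add: finite_imp_bounded_convex_hull)
  obtain x y where xy: "x \<in> V" "y \<in> V" "x \<noteq> y"
  proof -
    obtain x where x: "x \<in> V" using f by (metis card.empty ex_in_conv zero_neq_numeral)
    have "card (V - {x}) = 3" using f x by simp
    then obtain y where "y \<in> V - {x}" by (metis card.empty ex_in_conv zero_neq_numeral)
    then show thesis using that x by blast
  qed
  have "dist x y \<le> diameter ?K" by (rule diameter_bounded_bound[OF bd]) (use xy hull_inc in fast)+
  then show d0: "0 < diameter ?K" using xy by (smt (verit) zero_less_dist_iff)
  define S where "S = {2 * r | r. 0 \<le> r \<and> (\<exists>x. cball x r \<subseteq> ?K)}"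
  have "x \<in> ?K" using xy(1) by (rule hull_inc)
  then have "cball x 0 \<subseteq> ?K" by simp
  then have S0: "2 * 0 \<in> S" unfolding S_def by (intro CollectI exI[of _ "0::real"] conjI) auto
  have bdd: "bdd_above S"
  proof (rule bdd_aboveI[where M="diameter ?K"])
    fix s assume "s \<in> S"
    then obtain r z where r: "s = 2 * r" "0 \<le> r" "cball z r \<subseteq> ?K" by (auto simp: S_def)
    have "diameter (cball z r) \<le> diameter ?K" by (rule diameter_subset[OF r(3) bd])
    then show "s \<le> diameter ?K" using r by simp
  qed
  have ind: "indiameter ?K = Sup S" by (simp add: indiameter_def S_def)
  have "0 \<le> Sup S" using cSup_upper[OF S0 bdd] by simp
  moreover have p: "0 < \<sigma> * Sup S" using d0 reg ind by simp
  ultimately show \<sigma>: "0 < \<sigma>" by (simp add: zero_less_mult_iff)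
  then have "0 < Sup S" using p by (simp add: zero_less_mult_iff)
  \<comment> \<open>A value above half the supremum avoids proving that the supremum is attained.
    Since \<open>s\<close> is a diameter \<open>2 r\<close>, this turns \<open>\<sigma>\<close> into
    \<open>4 \<sigma>\<close>.\<close>
  then obtain s where s: "s \<in> S" "Sup S / 2 < s" using less_cSupD[of S "Sup S / 2"] S0 by (auto simp: field_simps)
  then obtain r z where r: "s = 2 * r" "cball z r \<subseteq> ?K" by (auto simp: S_def)
  have "0 < r" using r s \<open>0 < Sup S\<close> by simp
  moreover have "diameter ?K \<le> 4 * \<sigma> * r"
  proof -
    have "diameter ?K \<le> \<sigma> * Sup S" using reg ind by simp
    also have "\<dots> \<le> \<sigma> * (4 * r)" using s r \<sigma> by (intro mult_left_mono) auto
    finally show ?thesis by simp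
  qed
  ultimately show "\<exists>z r. 0 < r \<and> cball z r \<subseteq> ?K \<and> diameter ?K \<le> 4 * \<sigma> * r" using r(2) by blast
qed

text \<open>The coordinate of \<open>y\<close> rises from 0 to 1 along the edge, and
  \<open>bgrad_bound\<close> limits its slope to \<open>1 / (2 r)\<close>.\<close>

lemma inscribed_ball_edge:
  assumes V: "tetra V" "x \<in> V" "y \<in> V" "x \<noteq> y" and r: "0 \<le> r" "cball z r \<subseteq> convex hull V"
  shows "2 * r \<le> norm (y - x)"
proof -
  have "1 = bgrad V y \<bullet> (y - x)"
    using bary_diff[of V y y x] bary_vertex[OF V(1,3,3)] bary_vertex[OF V(1,3,2)] V(4) by simp
  also have "\<dots> \<le> norm (bgrad V y) * norm (y - x)" by (rule norm_cauchy_schwarz)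
  finally have "2 * r * 1 \<le> 2 * r * (norm (bgrad V y) * norm (y - x))" using r by (intro mult_left_mono) auto
  also have "\<dots> = (2 * r * norm (bgrad V y)) * norm (y - x)" by simp
  also have "\<dots> \<le> 1 * norm (y - x)" by (intro mult_right_mono bgrad_bound[OF V(1,3) r(2,1)]) auto
  finally show ?thesis by simp
qed

text \<open>The edge length is the common scale of the patch: inscribed balls and diameters of all
  its elements are comparable to it, with factors depending on \<open>\<sigma>\<close> only.\<close>

lemma edge_patch_size:
  assumes s: "\<And>K. K \<in> T \<Longrightarrow> 3 simplex K" and reg: "shape_regular \<sigma> T" and K: "K \<in> edge_patch T (closed_segment x1 x2)"
  shows "0 < \<sigma>" "norm (x2 - x1) \<le> diameter K" "diameter K \<le> 2 * \<sigma> * norm (x2 - x1)" "0 < norm (x2 - x1)"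
    "\<exists>z. cball z (norm (x2 - x1) / (4 * \<sigma>)) \<subseteq> K"
proof -
  obtain V y1 y2 where V: "tetra V" "K = convex hull V" and y: "y1 \<in> V" "y2 \<in> V" "y1 \<noteq> y2" "closed_segment x1 x2 = closed_segment y1 y2"
    by (rule edge_patch_vertices[OF s K])
  have xy: "{x1, x2} = {y1, y2}" using y(4) by (simp add: closed_segment_eq)
  then have l: "norm (x2 - x1) = norm (y2 - y1)" by (metis doubleton_eq_iff norm_minus_commute)
  have "K \<in> T" using K by (simp add: edge_patch_def)
  then have "diameter (convex hull V) \<le> \<sigma> * indiameter (convex hull V)" using reg V by (auto simp: shape_regular_def)
  note ib = inscribed_ball[OF V(1) this]
  show \<sigma>: "0 < \<sigma>" by (rule ib(2))
  have bd: "bounded K" using V tetra_finite by (simp add: finite_imp_bounded_convex_hull)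
  have "dist y2 y1 \<le> diameter K" by (rule diameter_bounded_bound[OF bd]) (use y V hull_inc in auto)
  then show le: "norm (x2 - x1) \<le> diameter K" by (simp add: l dist_norm)
  show "0 < norm (x2 - x1)" using l y(3) by simp
  obtain z r where r: "0 < r" "cball z r \<subseteq> convex hull V" "diameter (convex hull V) \<le> 4 * \<sigma> * r" using ib(3) by blast
  have "2 * r \<le> norm (y2 - y1)" by (rule inscribed_ball_edge[OF V(1) y(1-3) _ r(2)]) (use r in simp)
  then have "4 * \<sigma> * r \<le> 2 * \<sigma> * norm (x2 - x1)" using \<sigma> l by (simp add: mult.assoc)
  then show "diameter K \<le> 2 * \<sigma> * norm (x2 - x1)" using r(3) V(2) by simp
  have "norm (x2 - x1) / (4 * \<sigma>) \<le> r" using le r(3) V(2) \<sigma> by (simp add: field_simps)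
  then have "cball z (norm (x2 - x1) / (4 * \<sigma>)) \<subseteq> K" using r(2) V(2) by (meson subset_cball subset_trans)
  then show "\<exists>z. cball z (norm (x2 - x1) / (4 * \<sigma>)) \<subseteq> K" by blast
qed

text \<open>The intersection is a proper face of \<open>K\<close>, on which the coordinate of some
  vertex vanishes, whereas all coordinates are positive in the interior.\<close>

lemma mesh_interior_disjoint:
  fixes K K' :: "(real^3) set"
  assumes tri: "triangulation T" and s: "\<And>K. K \<in> T \<Longrightarrow> 3 simplex K" and K: "K \<in> T" "K' \<in> T" "K \<noteq> K'"
  shows "interior K \<inter> K' = {}"
proof -
  obtain V where V: "tetra V" "K = convex hull V" using s[OF K(1)] simplex3_tetra by blast
  have f: "(K \<inter> K') face_of K" "(K' \<inter> K) face_of K'" using tri K by (auto simp: triangulation_def)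
  then obtain S where S: "S \<subseteq> V" "K \<inter> K' = convex hull S" using face_bary V by auto
  have "S \<noteq> V"
  proof
    assume "S = V"
    then have "K' \<inter> K = K" using S V by auto
    then have "K face_of K'" using f(2) by simp
    moreover have "convex K'" using s[OF K(2)] by (rule convex_simplex)
    ultimately have "aff_dim K < aff_dim K'" using K(3) by (intro face_of_aff_dim_lt) auto
    then show False using aff_dim_simplex[OF s[OF K(1)]] aff_dim_simplex[OF s[OF K(2)]] by simp
  qed
  then obtain a where a: "a \<in> V - S" using S by blast
  show ?thesis
  proof (rule ccontr)
    assume "\<not> ?thesis"
    then obtain x where x: "x \<in> interior K" "x \<in> K'" by blast
    then have "x \<in> convex hull S" using S interior_subset by blast
    then have "bary V a x = 0" using hull_subset_bary[OF V(1) S(1)] a by blast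
    then show False using x(1) interior_bary[OF V(1)] V(2) a by fastforce
  qed
qed

text \<open>Volume packing: with \<open>l\<close> the edge length, disjoint balls of radius
  \<open>l / (4 \<sigma>)\<close>, one in each element, fit into a ball of radius
  \<open>4 \<sigma> l\<close>, which is \<open>16 \<sigma>^2\<close> times as large.\<close>

lemma card_edge_patch:
  assumes tri: "triangulation T" and s: "\<And>K. K \<in> T \<Longrightarrow> 3 simplex K" and reg: "shape_regular \<sigma> T"
  shows "real (card (edge_patch T (closed_segment x1 x2))) \<le> (16 * \<sigma>\<^sup>2) ^ 3"
proof (cases "edge_patch T (closed_segment x1 x2) = {}")
  case False
  let ?X = "edge_patch T (closed_segment x1 x2)" and ?l = "norm (x2 - x1)"
  obtain K0 where K0: "K0 \<in> ?X" using False by blast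
  have \<sigma>: "0 < \<sigma>" and l: "0 < ?l" by (rule edge_patch_size(1)[OF s reg K0], assumption, rule edge_patch_size(4)[OF s reg K0])
  have fX: "finite ?X" using tri by (simp add: triangulation_def edge_patch_def)
  define r where "r = ?l / (4 * \<sigma>)"
  have r: "r > 0" using \<sigma> l by (simp add: r_def)
  have "\<exists>c. cball c r \<subseteq> K" if "K \<in> ?X" for K unfolding r_def by (rule edge_patch_size(5)[OF s reg that])
  then obtain c where c: "\<And>K. K \<in> ?X \<Longrightarrow> cball (c K) r \<subseteq> K" by metis
  have bi: "ball (c K) r \<subseteq> interior K" if "K \<in> ?X" for K
    by (rule interior_maximal) (use c[OF that] ball_subset_cball in auto)
  have dis: "disjoint_family_on (\<lambda>K. ball (c K) r) ?X"
    unfolding disjoint_family_on_def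
  proof (intro ballI impI)
    fix K K' assume K: "K \<in> ?X" "K' \<in> ?X" "K \<noteq> K'"
    then have "interior K \<inter> K' = {}" using mesh_interior_disjoint[OF tri s, of K K'] by (simp add: edge_patch_def)
    then show "ball (c K) r \<inter> ball (c K') r = {}" using bi[OF K(1)] bi[OF K(2)] interior_subset by blast
  qed
  have mb: "measure lebesgue (ball (p::real^3) t) = unit_ball_vol 3 * t ^ 3" if "t > 0" for p t
    using content_ball[of t p] that by simp
  have sub: "(\<Union>K\<in>?X. ball (c K) r) \<subseteq> ball x1 (4 * \<sigma> * ?l)"
  proof safe
    fix K x assume K: "K \<in> ?X" and x: "x \<in> ball (c K) r"
    have "x \<in> K" using bi[OF K] x interior_subset by blast
    moreover have "x1 \<in> K" using edge_patch_subset[OF K] by auto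
    moreover have "bounded K" using K s by (auto simp: edge_patch_def intro: compact_imp_bounded compact_simplex)
    ultimately have "dist x1 x \<le> diameter K" by (intro diameter_bounded_bound)
    also have "\<dots> \<le> 2 * \<sigma> * ?l" by (rule edge_patch_size(3)[OF s reg K])
    also have "\<dots> < 4 * \<sigma> * ?l" using \<sigma> l by simp
    finally show "x \<in> ball x1 (4 * \<sigma> * ?l)" by simp
  qed
  have "real (card ?X) * (unit_ball_vol 3 * r ^ 3) = (\<Sum>K\<in>?X. measure lebesgue (ball (c K) r))"
    using mb[OF r] by simp
  also have "\<dots> = measure lebesgue (\<Union>K\<in>?X. ball (c K) r)"
    by (rule measure_finite_Union[OF fX _ dis, symmetric])
       (auto, metis emeasure_lborel_ball_finite infinity_ennreal_def less_irrefl)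
  also have "\<dots> \<le> measure lebesgue (ball x1 (4 * \<sigma> * ?l))"
    by (rule measure_mono_fmeasurable[OF sub]) (auto intro!: sets.finite_UN fX)
  also have "\<dots> = unit_ball_vol 3 * (4 * \<sigma> * ?l) ^ 3" by (rule mb) (use \<sigma> l in simp)
  finally have "unit_ball_vol 3 * (real (card ?X) * r ^ 3) \<le> unit_ball_vol 3 * (4 * \<sigma> * ?l) ^ 3" by (simp add: mult_ac)
  then have "real (card ?X) * r ^ 3 \<le> (4 * \<sigma> * ?l) ^ 3" using unit_ball_vol_pos[of 3] by simp
  also have "4 * \<sigma> * ?l = (16 * \<sigma>\<^sup>2) * r" using \<sigma> by (simp add: r_def power2_eq_square)
  also have "((16 * \<sigma>\<^sup>2) * r) ^ 3 = (16 * \<sigma>\<^sup>2) ^ 3 * r ^ 3" by (rule power_mult_distrib)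
  finally show ?thesis using r by simp
qed simp

section \<open>Smooth cutoffs\<close>

text \<open>A smooth step composed with an affine function, coming from a separating plane, that is
  at least 1 on \<open>A\<close> and at most 0 on \<open>B\<close>.\<close>

lemma smooth_separation:
  fixes A B :: "(real^3) set"
  assumes A: "convex A" "compact A" and B: "convex B" "compact B" and dis: "A \<inter> B = {}"
  shows "\<exists>\<eta>. smooth \<eta> \<and> (\<forall>x\<in>A. \<eta> x = (1::real)) \<and> (\<forall>x\<in>B. \<eta> x = 0)"
proof (cases "A = {}")
  case True
  then show ?thesis by (intro exI[of _ "\<lambda>x. 0"]) (simp add: smooth_const)
next
  case False
  obtain a b where ab: "\<forall>x\<in>A. a \<bullet> x < b" "\<forall>x\<in>B. a \<bullet> x > b"
    using separating_hyperplane_compact_closed[OF A False B(1) compact_imp_closed[OF B(2)] dis] by blast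
  obtain x0 where x0: "x0 \<in> A" "\<forall>x\<in>A. a \<bullet> x \<le> a \<bullet> x0"
    using continuous_attains_sup[OF A(2) False, of "\<lambda>x. a \<bullet> x"] continuous_on_inner[OF continuous_on_const continuous_on_id, of A a]
    by blast
  \<comment> \<open>The gap between \<open>A\<close> and the plane, attained by compactness;
    dividing by it lifts the affine function to at least 1 on all of \<open>A\<close>.\<close>
  define d where "d = b - a \<bullet> x0"
  have "a \<bullet> x0 < b" using bspec[OF ab(1) x0(1)] .
  then have d: "d > 0" unfolding d_def by linarith
  obtain s :: "real \<Rightarrow> real" where s: "smooth s" "\<And>x. x \<le> 0 \<Longrightarrow> s x = 0" "\<And>x. x \<ge> 1 \<Longrightarrow> s x = 1"
    "\<And>x. 0 \<le> s x" "\<And>x. s x \<le> 1" using smooth_step_exists by blast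
  define \<eta> where "\<eta> x = s (b / d + (- (1 / d) *\<^sub>R a) \<bullet> x)" for x
  have "smooth (\<lambda>x. b / d + (- (1 / d) *\<^sub>R a) \<bullet> x)"
    by (rule smooth_add[OF smooth_const smooth_linear[OF bounded_linear_inner_right]])
  then have "smooth \<eta>" unfolding \<eta>_def by (rule smooth_compose_real[OF s(1)])
  moreover have arg: "b / d + (- (1 / d) *\<^sub>R a) \<bullet> x = (b - a \<bullet> x) / d" for x by (simp add: diff_divide_distrib)
  have "\<eta> x = 1" if "x \<in> A" for x
  proof -
    have "d \<le> b - a \<bullet> x" using bspec[OF x0(2) that] unfolding d_def by linarith
    then have "1 \<le> (b - a \<bullet> x) / d" by (subst le_divide_eq_1_pos[OF d])
    then show ?thesis unfolding \<eta>_def arg by (rule s(3))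
  qed
  moreover have "\<eta> x = 0" if "x \<in> B" for x
  proof -
    have "b - a \<bullet> x \<le> 0" using bspec[OF ab(2) that] by linarith
    then have "(b - a \<bullet> x) / d \<le> 0" using d by (intro divide_nonpos_pos)
    then show ?thesis unfolding \<eta>_def arg by (rule s(2))
  qed
  ultimately show ?thesis by blast
qed

text \<open>The other three coordinates equal 1/3 at the centroid and have slope at most
  \<open>1 / (2 r)\<close>, so they stay positive within distance \<open>2 r / 3\<close>. In the
  ball only the coordinate of \<open>a\<close> decides membership, and the interior looks like a
  half-space.\<close>

lemma facet_centroid_ball:
  assumes V: "tetra V" "a \<in> V" and r: "cball z r \<subseteq> convex hull V" and \<rho>: "0 < \<rho>" "\<rho> < 2 * r / 3"
  defines "p \<equiv> (\<Sum>v\<in>V - {a}. (1/3) *\<^sub>R v)"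
  shows "bary V a x = bgrad V a \<bullet> (x - p)"
    "\<And>x v. x \<in> cball p \<rho> \<Longrightarrow> v \<in> V - {a} \<Longrightarrow> bary V v x > 0"
    "interior (convex hull V) \<inter> ball p \<rho> = {x. bary V a x > 0} \<inter> ball p \<rho>"
proof -
  define S where "S = V - {a}"
  have fV: "finite V" using V tetra_finite by blast
  have S: "finite S" "card S = 3" using fV V by (auto simp: S_def tetra_def)
  have bp: "bary V v p = (if v \<in> S then 1/3 else 0)" if v: "v \<in> V" for v
  proof -
    have "bary V v p = (\<Sum>w\<in>S. 1/3 * bary V v w)" unfolding p_def S_def[symmetric]
      by (rule bary_comb[OF third_comb(1)[OF S]])
    also have "\<dots> = (\<Sum>w\<in>S. if w = v then 1/3 else 0)"
      by (rule sum.cong) (auto simp: S_def bary_vertex[OF V(1) v])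
    finally show ?thesis using S by simp
  qed
  show "bary V a x = bgrad V a \<bullet> (x - p)" for x
    using bary_diff[of V a x p] bp[OF V(2)] by (simp add: S_def)
  show pos: "bary V v x > 0" if x: "x \<in> cball p \<rho>" and v: "v \<in> V - {a}" for x v
  proof -
    have r0: "0 \<le> r" using \<rho> by simp
    have vV: "v \<in> V" using v by simp
    have "bary V v p - bary V v x = bgrad V v \<bullet> (p - x)" by (rule bary_diff)
    also have "\<dots> \<le> norm (bgrad V v) * norm (p - x)" by (rule norm_cauchy_schwarz)
    also have "\<dots> \<le> norm (bgrad V v) * \<rho>" using x by (intro mult_left_mono) (auto simp: dist_norm)
    also have "\<dots> < 1/3"
    proof -
      have g: "norm (bgrad V v) > 0" using bgrad_nonzero[OF V(1) vV] by simp
      have "norm (bgrad V v) * \<rho> < norm (bgrad V v) * (2 * r / 3)" using g \<rho> by (intro mult_strict_left_mono) auto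
      also have "\<dots> \<le> 1/3" using bgrad_bound[OF V(1) vV r r0] by simp
      finally show ?thesis .
    qed
    finally show ?thesis using bp[OF vV] v by (simp add: S_def)
  qed
  show "interior (convex hull V) \<inter> ball p \<rho> = {x. bary V a x > 0} \<inter> ball p \<rho>"
  proof -
    have "bary V v x > 0" if "x \<in> ball p \<rho>" "bary V a x > 0" "v \<in> V" for x v
      using that pos[of x v] by (cases "v = a") auto
    then show ?thesis unfolding interior_bary[OF V(1)] using V(2) by auto
  qed
qed

section \<open>Meshes fitted to the coefficient\<close>

text \<open>The constants defined in this locale mention no parameter but \<open>\<sigma>\<close>,
  so outside it they are functions of \<open>\<sigma>\<close> alone and can be named before a mesh
  is given.\<close>

locale weighted_mesh =
  fixes \<sigma> :: real and \<Omega> :: "(real^3) set" and P :: "(real^3) set set" and \<mu> :: "real^3 \<Rightarrow> real" and T :: "(real^3) set set"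
  assumes dom: "polyhedral_domain \<Omega>" and lip: "lipschitz_boundary \<Omega>" and part: "polyhedral_partition \<Omega> P"
    and pcp: "piecewise_constant_pos P \<mu>" and fit: "fitted_mesh \<Omega> P T" and reg: "shape_regular \<sigma> T"
    and qm: "quasi_monotone \<Omega> \<mu> T"
begin

lemma tri: "triangulation T" and s3: "K \<in> T \<Longrightarrow> 3 simplex K" and un: "\<Union>T = closure \<Omega>"
  using fit by (auto simp: fitted_mesh_def)

lemma finT: "finite T" using tri by (simp add: triangulation_def)

lemma openO: "open \<Omega>" and boundedO: "bounded \<Omega>"
  using dom by (auto simp: polyhedral_domain_def)

lemma element_subdomain:
  assumes "K \<in> T" obtains D where "D \<in> P" "interior K \<subseteq> D" "D \<subseteq> \<Omega>"
  using fit part assms unfolding fitted_mesh_def polyhedral_partition_def by meson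

lemma interior_sub: "K \<in> T \<Longrightarrow> interior K \<subseteq> \<Omega>"
  using element_subdomain by blast

lemma interior_disj: "K \<in> T \<Longrightarrow> K' \<in> T \<Longrightarrow> K \<noteq> K' \<Longrightarrow> interior K \<inter> K' = {}"
  by (rule mesh_interior_disjoint[OF tri s3])

lemma element_set:
  assumes "K \<in> T"
  shows "open (interior K)" "convex (interior K)" "bounded (interior K)" "interior K \<noteq> {}" "interior K \<in> lmeasurable"
    "compact K" "convex K" "negligible (K - interior K)" "diameter (interior K) \<le> diameter K"
proof -
  have c: "compact K" "convex K" using s3[OF assms] by (auto intro: compact_simplex convex_simplex)
  show "compact K" "convex K" "open (interior K)" by (auto simp: c)
  show "convex (interior K)" by (rule convex_interior[OF c(2)])
  show b: "bounded (interior K)" by (rule bounded_subset[OF compact_imp_bounded[OF c(1)] interior_subset])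
  show "interior K \<in> lmeasurable" by (rule lmeasurable_open[OF b open_interior])
  have "aff_dim K = 3" by (rule aff_dim_simplex[OF s3[OF assms]])
  then show "interior K \<noteq> {}"
    using c(2) interior_rel_interior_gen[of K] rel_interior_eq_empty[of K] by auto
  have "K - interior K \<subseteq> frontier K" using closure_subset[of K] by (auto simp: frontier_def)
  then show "negligible (K - interior K)" using negligible_convex_frontier[OF c(2)] negligible_subset by blast
  show "diameter (interior K) \<le> diameter K" by (rule diameter_subset[OF interior_subset compact_imp_bounded[OF c(1)]])
qed

lemma null_skeleton: "\<Omega> - (\<Union>K\<in>T. interior K) \<in> null_sets lebesgue"
proof -
  have "\<Omega> - (\<Union>K\<in>T. interior K) \<subseteq> (\<Union>K\<in>T. K - interior K)"
    using un closure_subset[of \<Omega>] by blast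
  moreover have "negligible (\<Union>K\<in>T. K - interior K)"
    using finT element_set(8) by (intro negligible_Union) auto
  ultimately show ?thesis using negligible_subset negligible_iff_null_sets by blast
qed

section \<open>Jumps of the element means across faces\<close>

definition gnorm :: "(real^3 \<Rightarrow> real^3) \<Rightarrow> (real^3) set \<Rightarrow> real" where
  "gnorm v K = L2_norm (interior K) (weak_jacobian (interior K) v)"

definition tmean :: "(real^3 \<Rightarrow> real^3) \<Rightarrow> (real^3) set \<Rightarrow> real^3" where
  "tmean v K = mean (interior K) v"

lemma H0_L2: "v \<in> H0_curl \<Omega> \<Longrightarrow> v \<in> L2 \<Omega>"
  by (auto simp: H0_curl_def H_curl_def)

lemma H0_L2_element: "v \<in> H0_curl \<Omega> \<Longrightarrow> K \<in> T \<Longrightarrow> v \<in> L2 (interior K)"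
  using L2_mono[OF H0_L2 _ interior_sub] element_set(1) by simp

text \<open>The factors of \<open>jump_scaling\<close>: \<open>192 \<sigma>^2\<close> is
  \<open>12 h / \<rho>\<close> for \<open>h = 2 \<sigma> l\<close> and
  \<open>\<rho> = l / (8 \<sigma>)\<close>, and the leading root converts \<open>\<rho>\<close> back
  to \<open>l\<close>. The absolute value keeps the constant nonnegative without a sign condition on
  \<open>\<sigma>\<close>.\<close>

definition jump_const :: real where
  "jump_const = sqrt (8 * \<bar>\<sigma>\<bar>) * ((192 * \<sigma>\<^sup>2 + 2) * sqrt (unit_ball_vol 3) / bump_flux)"

lemma jump_const_nonneg: "0 \<le> jump_const"
  using bump_flux_pos by (simp add: jump_const_def)

text \<open>The flux is of order \<open>\<rho>^2\<close> and the error of order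
  \<open>\<rho>^(3/2)\<close>, so the jump is of order \<open>\<rho>^(-1/2)\<close> times the
  gradient norms; the factor \<open>sqrt l\<close> compensates this.\<close>

lemma jump_scaling:
  assumes \<sigma>: "0 < \<sigma>" and l: "0 < l" and A: "bump_flux * (l / (8 * \<sigma>))\<^sup>2 \<le> A"
    and d: "A * \<bar>d\<bar> \<le> (12 * (2 * \<sigma> * l) / (l / (8 * \<sigma>)) + 2) * sqrt (unit_ball_vol 3 * (l / (8 * \<sigma>)) ^ 3) * S"
  shows "\<bar>d\<bar> * sqrt l \<le> jump_const * S"
proof -
  define \<rho> where "\<rho> = l / (8 * \<sigma>)"
  have \<rho>: "\<rho> > 0" using \<sigma> l by (simp add: \<rho>_def)
  have l\<rho>: "l = 8 * \<sigma> * \<rho>" using \<sigma> by (simp add: \<rho>_def)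
  define M where "M = (192 * \<sigma>\<^sup>2 + 2) * sqrt (unit_ball_vol 3)"
  have e1: "12 * (2 * \<sigma> * l) / \<rho> = 192 * \<sigma>\<^sup>2" using \<rho> by (simp add: l\<rho> power2_eq_square)
  have e2: "sqrt (unit_ball_vol 3 * \<rho> ^ 3) = sqrt (unit_ball_vol 3) * (\<rho> * sqrt \<rho>)"
    using \<rho> by (simp add: real_sqrt_mult power3_eq_cube)
  have sr: "sqrt \<rho> * sqrt \<rho> = \<rho>" "sqrt \<rho> > 0" using \<rho> by auto
  have "bump_flux * \<rho>\<^sup>2 * \<bar>d\<bar> \<le> A * \<bar>d\<bar>" using A by (intro mult_right_mono) (auto simp: \<rho>_def)
  also have "\<dots> \<le> M * (\<rho> * sqrt \<rho>) * S"
    using d unfolding \<rho>_def[symmetric] e1 e2 M_def by (simp add: mult_ac)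
  finally have "(\<rho> * sqrt \<rho>) * (bump_flux * (\<bar>d\<bar> * sqrt \<rho>)) \<le> (\<rho> * sqrt \<rho>) * (M * S)"
    using sr by (simp add: power2_eq_square mult_ac)
  then have "bump_flux * (\<bar>d\<bar> * sqrt \<rho>) \<le> M * S" using \<rho> sr by (simp add: mult_le_cancel_left_pos)
  then have "\<bar>d\<bar> * sqrt \<rho> \<le> M / bump_flux * S" using bump_flux_pos by (simp add: field_simps)
  then have "sqrt (8 * \<sigma>) * (\<bar>d\<bar> * sqrt \<rho>) \<le> sqrt (8 * \<sigma>) * (M / bump_flux * S)" by (rule mult_left_mono) (use \<sigma> in simp)
  moreover have "sqrt l = sqrt (8 * \<sigma>) * sqrt \<rho>" by (simp add: l\<rho> real_sqrt_mult)
  ultimately show ?thesis using \<sigma> by (simp add: jump_const_def M_def mult_ac)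
qed

text \<open>For a unit normal \<open>n\<close> orthogonal to \<open>t\<close>, the choice
  \<open>m = t \<times> n\<close> gives \<open>n \<times> m = t\<close>, so the flux picks out
  exactly the component of the mean along the edge.\<close>

lemma tangent_frame:
  fixes g t :: "real^3"
  assumes g: "g \<noteq> 0" "g \<bullet> t = 0" and t: "norm t = 1"
  defines "n \<equiv> (1 / norm g) *\<^sub>R g" and "m \<equiv> cross3 t ((1 / norm g) *\<^sub>R g)"
  shows "norm n = 1" "norm m \<le> 1" "cross3 n m = t" "n \<bullet> x > 0 \<longleftrightarrow> g \<bullet> x > 0" "n \<bullet> x < 0 \<longleftrightarrow> g \<bullet> x < 0"
proof -
  show n: "norm n = 1" using g by (simp add: n_def)
  have "norm m \<le> norm t * norm n" unfolding m_def n_def by (rule norm_cross_le)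
  then show "norm m \<le> 1" using n t by simp
  have "n \<bullet> n = 1" "n \<bullet> t = 0" using n g by (auto simp: dot_square_norm n_def)
  then show "cross3 n m = t" unfolding m_def n_def[symmetric] by (simp add: Lagrange)
  show "n \<bullet> x > 0 \<longleftrightarrow> g \<bullet> x > 0" "n \<bullet> x < 0 \<longleftrightarrow> g \<bullet> x < 0"
    using g(1) by (auto simp: n_def zero_less_divide_iff divide_less_0_iff)
qed

lemma facet_normal_edge:
  assumes V: "tetra V" "a \<in> V" and x: "x1 \<in> V - {a}" "x2 \<in> V - {a}"
  shows "bgrad V a \<bullet> ((1 / norm (x2 - x1)) *\<^sub>R (x2 - x1)) = 0"
  using bary_diff[of V a x2 x1] bary_vertex[OF V, of x1] bary_vertex[OF V, of x2] x by auto

lemma patch_vertices: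
  assumes K: "K \<in> edge_patch T (closed_segment x1 x2)"
  obtains V where "tetra V" "K = convex hull V" "x1 \<in> V" "x2 \<in> V" "x1 \<noteq> x2"
proof -
  obtain V y1 y2 where V: "tetra V" "K = convex hull V" "y1 \<in> V" "y2 \<in> V" "y1 \<noteq> y2" "closed_segment x1 x2 = closed_segment y1 y2"
    by (rule edge_patch_vertices[OF s3 K])
  then have "{x1, x2} = {y1, y2}" by (simp add: closed_segment_eq)
  then show thesis using that V by (metis doubleton_eq_iff)
qed

lemma jump_shared:
  assumes v: "v \<in> H0_curl \<Omega>" and K: "K1 \<in> edge_patch T (closed_segment x1 x2)" "K2 \<in> edge_patch T (closed_segment x1 x2)"
    and sh: "share_face K1 K2" and H: "v \<in> H1 (interior K1)" "v \<in> H1 (interior K2)"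
  defines "t \<equiv> (1 / norm (x2 - x1)) *\<^sub>R (x2 - x1)"
  shows "\<bar>tmean v K1 \<bullet> t - tmean v K2 \<bullet> t\<bar> * sqrt (norm (x2 - x1)) \<le> jump_const * (gnorm v K1 + gnorm v K2)"
proof -
  have KT: "K1 \<in> T" "K2 \<in> T" using K by (auto simp: edge_patch_def)
  have ne: "K1 \<noteq> K2" using sh share_face_irrefl by blast
  let ?l = "norm (x2 - x1)"
  note size1 = edge_patch_size[OF s3 reg K(1)] and size2 = edge_patch_size[OF s3 reg K(2)]
  have \<sigma>: "0 < \<sigma>" and l: "0 < ?l" by (rule size1(1), assumption, rule size1(4))
  have dK: "diameter K1 \<le> 2 * \<sigma> * ?l" "diameter K2 \<le> 2 * \<sigma> * ?l" by (rule size1(3), assumption, rule size2(3))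
  obtain z1 where z1: "cball z1 (?l / (4 * \<sigma>)) \<subseteq> K1" using edge_patch_size(5)[OF s3 reg K(1)] by blast
  obtain z2 where z2: "cball z2 (?l / (4 * \<sigma>)) \<subseteq> K2" using edge_patch_size(5)[OF s3 reg K(2)] by blast
  obtain V where V: "tetra V" "K1 = convex hull V" "x1 \<in> V" "x2 \<in> V" "x1 \<noteq> x2" by (rule patch_vertices[OF K(1)])
  obtain W where W: "tetra W" "K2 = convex hull W" "x1 \<in> W" "x2 \<in> W" by (rule patch_vertices[OF K(2)])
  define F where "F = K1 \<inter> K2"
  have F: "F facet_of K1" "F facet_of K2" using sh by (auto simp: share_face_def F_def)
  obtain a b where ab: "a \<in> V" "b \<in> W" "V - {a} = W - {b}" "F = convex hull (V - {a})" "K1 \<inter> K2 = F"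
    by (rule share_face_data[OF tri KT ne F V(1,2) W(1,2)])
  have eF: "closed_segment x1 x2 \<subseteq> convex hull (V - {a})"
    using edge_patch_subset[OF K(1)] edge_patch_subset[OF K(2)] ab(4) by (auto simp: F_def)
  have xa: "x1 \<in> V - {a}" "x2 \<in> V - {a}" using segment_in_facet[OF V(1,3,4) ab(1)] eF V by auto
  have int: "convex hull V \<inter> convex hull W = convex hull (V - {a})" using ab(4,5) V(2) W(2) by simp
  note opp = shared_facet_opposite[OF V(1) ab(1) W(1) ab(2,3) int]
  \<comment> \<open>\<open>facet_centroid_ball\<close> allows any radius below \<open>2/3\<close> of
    the inscribed radius \<open>l / (4 \<sigma>)\<close> from \<open>edge_patch_size\<close>; half
    of it is taken.\<close>
  define \<rho> where "\<rho> = ?l / (8 * \<sigma>)"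
  have \<rho>: "0 < \<rho>" "\<rho> < 2 * (?l / (4 * \<sigma>)) / 3" using \<sigma> l by (auto simp: \<rho>_def field_simps)
  define p where "p = (\<Sum>v\<in>V - {a}. (1/3) *\<^sub>R v)"
  note c1 = facet_centroid_ball[OF V(1) ab(1) z1[unfolded V(2)] \<rho>, folded p_def]
  have pW: "p = (\<Sum>v\<in>W - {b}. (1/3) *\<^sub>R v)" by (simp add: p_def ab(3))
  note c2 = facet_centroid_ball[OF W(1) ab(2) z2[unfolded W(2)] \<rho>, folded pW]
  define g where "g = bgrad V a"
  define n where "n = (1 / norm g) *\<^sub>R g"
  define m where "m = cross3 t n"
  have g0: "g \<noteq> 0" unfolding g_def by (rule bgrad_nonzero[OF V(1) ab(1)])
  have gt: "g \<bullet> t = 0" unfolding g_def t_def by (rule facet_normal_edge[OF V(1) ab(1) xa])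
  have t1: "norm t = 1" using l by (simp add: t_def)
  note fr = tangent_frame[OF g0 gt t1, folded n_def, folded m_def]
  define HP where "HP = {x. n \<bullet> (x - p) > 0}"
  define HN where "HN = {x. n \<bullet> (x - p) < 0}"
  have oH: "open HP" "open HN" unfolding HP_def HN_def by (intro open_Collect_less continuous_intros)+
  have lH: "HP \<in> sets lebesgue" "HN \<in> sets lebesgue" using oH by auto
  have i1: "interior K1 \<inter> ball p \<rho> = HP \<inter> ball p \<rho>"
    using c1(3) V(2) fr(4) c1(1) by (auto simp: HP_def g_def)
  have i2: "interior K2 \<inter> ball p \<rho> = HN \<inter> ball p \<rho>"
  proof -
    have "bary W b x > 0 \<longleftrightarrow> x \<in> HN" for x
      using opp(1) opp(2)[of x] c1(1)[of x] fr(5)[of "x - p"] by (auto simp: HN_def g_def zero_less_mult_iff)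
    then show ?thesis using c2(3) W(2) by auto
  qed
  obtain A where A: "A \<ge> bump_flux * \<rho>\<^sup>2" "(LINT x:HP|lebesgue. bump_grad p \<rho> x) = - A *\<^sub>R n" "(LINT x:HN|lebesgue. bump_grad p \<rho> x) = A *\<^sub>R n"
    using bump_halfspace[OF \<rho>(1) fr(1), of p] unfolding HP_def HN_def by blast
  let ?X = "\<lambda>K. LINT x:interior K|lebesgue. v x \<bullet> cross3 (bump_grad p \<rho> x) m"
  let ?Y = "\<lambda>K. LINT x:interior K|lebesgue. curl_of_jacobian (weak_jacobian (interior K) v x) \<bullet> (bump p \<rho> x *\<^sub>R m)"
  have green: "(\<Sum>K\<in>{K1, K2}. ?X K) = (\<Sum>K\<in>{K1, K2}. ?Y K)"
  \<comment> \<open>The ball lies in \<open>K1 \<union> K2\<close>, so the constant 1 already serves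
    as cutoff. The interiors of all other elements miss the ball, which is why the goal
    \<open>1 = 0\<close> for them is closed by contradiction.\<close>
  proof (rule green_cutoff[where T=T and U=interior and \<eta>="\<lambda>x. 1", OF v openO boundedO finT])
    show "smooth (\<lambda>x::real^3. 1::real)" by (rule smooth_const)
    show "\<And>K K'. K \<in> T \<Longrightarrow> K' \<in> T \<Longrightarrow> K \<noteq> K' \<Longrightarrow> interior K \<inter> interior K' = {}"
      using interior_disj interior_subset by blast
    fix K x assume Kx: "K \<in> T - {K1, K2}" "x \<in> interior K \<inter> ball p \<rho>"
    have "x \<in> cball p \<rho>" using Kx(2) by simp
    then have "x \<in> convex hull V \<union> convex hull W"
      using shared_facet_ball[OF V(1) ab(1) W(1) ab(2,3) int, of x] c1(2)[of x] c2(2)[of x] by blast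
    then have "x \<in> K1 \<union> K2" using V(2) W(2) by simp
    then show "(1::real) = 0" using interior_disj[of K K1] interior_disj[of K K2] Kx KT by blast
  qed (use interior_sub null_skeleton KT H \<rho>(1) in auto)
  have est1: "\<bar>?X K1 - ?Y K1 - tmean v K1 \<bullet> cross3 (- A *\<^sub>R n) m\<bar> \<le> (12 * (2 * \<sigma> * ?l) / \<rho> + 2) * sqrt (unit_ball_vol 3 * \<rho> ^ 3) * gnorm v K1"
    unfolding tmean_def gnorm_def A(2)[symmetric]
    by (rule element_flux_estimate[OF element_set(1-4)[OF KT(1)] H0_L2_element[OF v KT(1)] H(1) \<rho>(1) fr(2) order_trans[OF element_set(9)[OF KT(1)] dK(1)] lH(1) i1])
  have est2: "\<bar>?X K2 - ?Y K2 - tmean v K2 \<bullet> cross3 (A *\<^sub>R n) m\<bar> \<le> (12 * (2 * \<sigma> * ?l) / \<rho> + 2) * sqrt (unit_ball_vol 3 * \<rho> ^ 3) * gnorm v K2"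
    unfolding tmean_def gnorm_def A(3)[symmetric]
    by (rule element_flux_estimate[OF element_set(1-4)[OF KT(2)] H0_L2_element[OF v KT(2)] H(2) \<rho>(1) fr(2) order_trans[OF element_set(9)[OF KT(2)] dK(2)] lH(2) i2])
  have A0: "0 \<le> A" using A(1) bump_flux_pos zero_le_power2[of \<rho>] by (meson less_imp_le mult_nonneg_nonneg order_trans)
  have cr: "cross3 (- A *\<^sub>R n) m = - A *\<^sub>R t" "cross3 (A *\<^sub>R n) m = A *\<^sub>R t"
    using fr(3) cross_mult_left[of A n m] cross_mult_left[of "-A" n m] by simp_all
  have "?X K1 + ?X K2 = ?Y K1 + ?Y K2" using green ne by simp
  then have "\<bar>A * (tmean v K1 \<bullet> t) - A * (tmean v K2 \<bullet> t)\<bar>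
     \<le> (12 * (2 * \<sigma> * ?l) / \<rho> + 2) * sqrt (unit_ball_vol 3 * \<rho> ^ 3) * gnorm v K1
      + (12 * (2 * \<sigma> * ?l) / \<rho> + 2) * sqrt (unit_ball_vol 3 * \<rho> ^ 3) * gnorm v K2"
    using est1 est2 unfolding cr inner_scaleR_right by (simp only: abs_le_iff) linarith
  then have "\<bar>A * (tmean v K1 \<bullet> t - tmean v K2 \<bullet> t)\<bar>
     \<le> (12 * (2 * \<sigma> * ?l) / \<rho> + 2) * sqrt (unit_ball_vol 3 * \<rho> ^ 3) * (gnorm v K1 + gnorm v K2)"
    by (simp only: right_diff_distrib distrib_left)
  then have "A * \<bar>tmean v K1 \<bullet> t - tmean v K2 \<bullet> t\<bar>
     \<le> (12 * (2 * \<sigma> * ?l) / \<rho> + 2) * sqrt (unit_ball_vol 3 * \<rho> ^ 3) * (gnorm v K1 + gnorm v K2)"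
    using A0 by (simp only: abs_mult abs_of_nonneg)
  then show ?thesis unfolding \<rho>_def by (rule jump_scaling[OF \<sigma> l A(1)[unfolded \<rho>_def]])
qed

text \<open>Behind a free facet the ball may contain pieces of other elements, which the test field
  must not see. Such an element meets \<open>K\<close> in a face that omits a vertex of the free
  facet; the coordinate of that vertex vanishes there but is positive in the ball. Within the ball
  the two are thus disjoint compact convex sets, and the product of the separating functions over
  all other elements is the cutoff.\<close>

lemma free_facet_cutoff:
  assumes K: "K \<in> T" "K = convex hull V" "tetra V" "a \<in> V"
    and free: "\<forall>K'\<in>T. convex hull (V - {a}) facet_of K' \<longrightarrow> K' = K"
    and pos: "\<And>x v. x \<in> cball p \<rho> \<Longrightarrow> v \<in> V - {a} \<Longrightarrow> bary V v x > 0"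
  shows "\<exists>\<eta>::real^3 \<Rightarrow> real. smooth \<eta> \<and> (\<forall>x\<in>K \<inter> cball p \<rho>. \<eta> x = 1) \<and> (\<forall>K'\<in>T - {K}. \<forall>x\<in>K' \<inter> cball p \<rho>. \<eta> x = 0)"
proof -
  have "\<exists>\<eta>::real^3 \<Rightarrow> real. smooth \<eta> \<and> (\<forall>x\<in>K \<inter> cball p \<rho>. \<eta> x = 1) \<and> (\<forall>x\<in>K' \<inter> cball p \<rho>. \<eta> x = 0)"
    if K': "K' \<in> T - {K}" for K'
  proof (rule smooth_separation)
    have K'T: "K' \<in> T" "K' \<noteq> K" using K' by auto
    show "convex (K \<inter> cball p \<rho>)" "convex (K' \<inter> cball p \<rho>)" "compact (K \<inter> cball p \<rho>)" "compact (K' \<inter> cball p \<rho>)"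
      using element_set(6,7)[OF K(1)] element_set(6,7)[OF K'T(1)] by (auto intro: convex_Int compact_Int)
    have f: "(K \<inter> K') face_of K" "(K' \<inter> K) face_of K'" using tri K(1) K'T by (auto simp: triangulation_def)
    then obtain S where S: "S \<subseteq> V" "K \<inter> K' = convex hull S" using face_bary[OF K(3)] K(2) by auto
    have "\<not> V - {a} \<subseteq> S"
    proof
      assume sub: "V - {a} \<subseteq> S"
      show False
      proof (cases "a \<in> S")
        case True
        then have "S = V" using sub S by auto
        then have "K \<subseteq> K'" using S(2) K(2) by auto
        then show False using interior_disj[OF K(1) K'T(1)] K'T(2) element_set(4)[OF K(1)] interior_subset[of K] by blast
      next
        case False
        then have e: "K \<inter> K' = convex hull (V - {a})" using sub S by (metis Diff_empty Diff_insert0 Diff_mono subset_antisym subset_Diff_insert order_refl)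
        have F: "convex hull (V - {a}) facet_of K" using facet_bary[OF K(3)] K by auto
        have "convex hull (V - {a}) face_of K'" using f(2) e by (simp add: Int_commute)
        moreover have "aff_dim (convex hull (V - {a})) = aff_dim K' - 1"
          using F aff_dim_simplex[OF s3[OF K(1)]] aff_dim_simplex[OF s3[OF K'T(1)]] by (simp add: facet_of_def)
        ultimately have "convex hull (V - {a}) facet_of K'" using F by (simp add: facet_of_def)
        then show False using free K'T by blast
      qed
    qed
    then obtain w where w: "w \<in> V - {a}" "w \<notin> S" by blast
    show "(K \<inter> cball p \<rho>) \<inter> (K' \<inter> cball p \<rho>) = {}"
    proof (rule ccontr)
      assume "\<not> ?thesis"
      then obtain x where x: "x \<in> K \<inter> K'" "x \<in> cball p \<rho>" by blast
      then have "bary V w x = 0" using hull_subset_bary[OF K(3) S(1), of x] S(2) w by auto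
      then show False using pos[OF x(2) w(1)] by simp
    qed
  qed
  then have "\<forall>K'. \<exists>\<eta>::real^3 \<Rightarrow> real. K' \<in> T - {K} \<longrightarrow> smooth \<eta> \<and> (\<forall>x\<in>K \<inter> cball p \<rho>. \<eta> x = 1) \<and> (\<forall>x\<in>K' \<inter> cball p \<rho>. \<eta> x = 0)" by blast
  from choice[OF this] obtain \<eta> :: "(real^3) set \<Rightarrow> real^3 \<Rightarrow> real" where \<eta>: "\<forall>K'. K' \<in> T - {K} \<longrightarrow> smooth (\<eta> K') \<and> (\<forall>x\<in>K \<inter> cball p \<rho>. \<eta> K' x = 1) \<and> (\<forall>x\<in>K' \<inter> cball p \<rho>. \<eta> K' x = 0)"
    by (elim exE) (rule that)
  have fT: "finite (T - {K})" using finT by simp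
  show ?thesis
  proof (intro exI[of _ "\<lambda>x. \<Prod>K'\<in>T - {K}. \<eta> K' x"] conjI ballI)
    show "smooth (\<lambda>x. \<Prod>K'\<in>T - {K}. \<eta> K' x)" by (rule smooth_prod[OF fT]) (use \<eta> in blast)
    show "(\<Prod>K'\<in>T - {K}. \<eta> K' x) = 1" if "x \<in> K \<inter> cball p \<rho>" for x
      by (rule prod.neutral) (use \<eta> that in blast)
    show "(\<Prod>K'\<in>T - {K}. \<eta> K' x) = 0" if "K' \<in> T - {K}" "x \<in> K' \<inter> cball p \<rho>" for x K'
      by (rule prod_zero[OF fT]) (use \<eta> that in blast)
  qed
qed

lemma jump_free:
  assumes v: "v \<in> H0_curl \<Omega>" and K: "K \<in> free_elements T (closed_segment x1 x2)" and H: "v \<in> H1 (interior K)"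
  defines "t \<equiv> (1 / norm (x2 - x1)) *\<^sub>R (x2 - x1)"
  shows "\<bar>tmean v K \<bullet> t\<bar> * sqrt (norm (x2 - x1)) \<le> jump_const * gnorm v K"
proof -
  have KE: "K \<in> edge_patch T (closed_segment x1 x2)" using K by (simp add: free_elements_def)
  have KT: "K \<in> T" using KE by (simp add: edge_patch_def)
  let ?l = "norm (x2 - x1)"
  note size = edge_patch_size[OF s3 reg KE]
  have \<sigma>: "0 < \<sigma>" and l: "0 < ?l" by (rule size(1), assumption, rule size(4))
  have dK: "diameter K \<le> 2 * \<sigma> * ?l" by (rule size(3))
  obtain z where z: "cball z (?l / (4 * \<sigma>)) \<subseteq> K" using edge_patch_size(5)[OF s3 reg KE] by blast
  obtain V where V: "tetra V" "K = convex hull V" "x1 \<in> V" "x2 \<in> V" "x1 \<noteq> x2" by (rule patch_vertices[OF KE])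
  obtain F where F: "F \<in> efacets K (closed_segment x1 x2)" "\<forall>K'\<in>T. F facet_of K' \<longrightarrow> K' = K"
    using K by (auto simp: free_elements_def)
  then obtain a where a: "a \<in> V - {x1, x2}" "F = convex hull (V - {a})" using efacets_eq[OF V(1,3,4)] V(2) by auto
  then have aV: "a \<in> V" and xa: "x1 \<in> V - {a}" "x2 \<in> V - {a}" using V by auto
  define \<rho> where "\<rho> = ?l / (8 * \<sigma>)"
  have \<rho>: "0 < \<rho>" "\<rho> < 2 * (?l / (4 * \<sigma>)) / 3" using \<sigma> l by (auto simp: \<rho>_def field_simps)
  define p where "p = (\<Sum>v\<in>V - {a}. (1/3) *\<^sub>R v)"
  note c1 = facet_centroid_ball[OF V(1) aV z[unfolded V(2)] \<rho>, folded p_def]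
  define g where "g = bgrad V a"
  define n where "n = (1 / norm g) *\<^sub>R g"
  define m where "m = cross3 t n"
  have g0: "g \<noteq> 0" unfolding g_def by (rule bgrad_nonzero[OF V(1) aV])
  have gt: "g \<bullet> t = 0" unfolding g_def t_def by (rule facet_normal_edge[OF V(1) aV xa])
  have t1: "norm t = 1" using l by (simp add: t_def)
  note fr = tangent_frame[OF g0 gt t1, folded n_def, folded m_def]
  define HP where "HP = {x. n \<bullet> (x - p) > 0}"
  have "open HP" unfolding HP_def by (intro open_Collect_less continuous_intros)
  then have lH: "HP \<in> sets lebesgue" by auto
  have i1: "interior K \<inter> ball p \<rho> = HP \<inter> ball p \<rho>"
    using c1(3) V(2) fr(4) c1(1) by (auto simp: HP_def g_def)
  obtain A where A: "A \<ge> bump_flux * \<rho>\<^sup>2" "(LINT x:HP|lebesgue. bump_grad p \<rho> x) = - A *\<^sub>R n"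
    using bump_halfspace[OF \<rho>(1) fr(1), of p] unfolding HP_def by blast
  obtain \<eta> :: "real^3 \<Rightarrow> real" where \<eta>: "smooth \<eta>" "\<forall>x\<in>K \<inter> cball p \<rho>. \<eta> x = 1" "\<forall>K'\<in>T - {K}. \<forall>x\<in>K' \<inter> cball p \<rho>. \<eta> x = 0"
    using free_facet_cutoff[OF KT V(2,1) aV F(2)[unfolded a(2)] c1(2)] by blast
  let ?X = "LINT x:interior K|lebesgue. v x \<bullet> cross3 (bump_grad p \<rho> x) m"
  let ?Y = "LINT x:interior K|lebesgue. curl_of_jacobian (weak_jacobian (interior K) v x) \<bullet> (bump p \<rho> x *\<^sub>R m)"
  have "(\<Sum>K\<in>{K}. LINT x:interior K|lebesgue. v x \<bullet> cross3 (bump_grad p \<rho> x) m)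
     = (\<Sum>K\<in>{K}. LINT x:interior K|lebesgue. curl_of_jacobian (weak_jacobian (interior K) v x) \<bullet> (bump p \<rho> x *\<^sub>R m))"
  proof (rule green_cutoff[where T=T and U=interior and \<eta>=\<eta>, OF v openO boundedO finT])
    show "\<And>K K'. K \<in> T \<Longrightarrow> K' \<in> T \<Longrightarrow> K \<noteq> K' \<Longrightarrow> interior K \<inter> interior K' = {}"
      using interior_disj interior_subset by blast
    have s: "x \<in> interior L \<inter> ball p \<rho> \<Longrightarrow> x \<in> L \<inter> cball p \<rho>" for x L using interior_subset ball_subset_cball by blast
    show "\<And>L x. L \<in> {K} \<Longrightarrow> x \<in> interior L \<inter> ball p \<rho> \<Longrightarrow> \<eta> x = 1" using \<eta>(2) s by blast
    show "\<And>L x. L \<in> T - {K} \<Longrightarrow> x \<in> interior L \<inter> ball p \<rho> \<Longrightarrow> \<eta> x = 0" using \<eta>(3) s by blast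
  qed (use interior_sub null_skeleton KT H \<rho>(1) \<eta>(1) in auto)
  then have green: "?X = ?Y" by simp
  have est: "\<bar>?X - ?Y - tmean v K \<bullet> cross3 (- A *\<^sub>R n) m\<bar> \<le> (12 * (2 * \<sigma> * ?l) / \<rho> + 2) * sqrt (unit_ball_vol 3 * \<rho> ^ 3) * gnorm v K"
    unfolding tmean_def gnorm_def A(2)[symmetric]
    by (rule element_flux_estimate[OF element_set(1-4)[OF KT] H0_L2_element[OF v KT] H \<rho>(1) fr(2) order_trans[OF element_set(9)[OF KT] dK] lH i1])
  have A0: "0 \<le> A" using A(1) bump_flux_pos zero_le_power2[of \<rho>] by (meson less_imp_le mult_nonneg_nonneg order_trans)
  have cr: "cross3 (- A *\<^sub>R n) m = - A *\<^sub>R t"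
    using fr(3) cross_mult_left[of "-A" n m] by simp
  have "\<bar>A * (tmean v K \<bullet> t)\<bar> \<le> (12 * (2 * \<sigma> * ?l) / \<rho> + 2) * sqrt (unit_ball_vol 3 * \<rho> ^ 3) * gnorm v K"
    using est green unfolding cr inner_scaleR_right by simp
  then have "A * \<bar>tmean v K \<bullet> t\<bar> \<le> (12 * (2 * \<sigma> * ?l) / \<rho> + 2) * sqrt (unit_ball_vol 3 * \<rho> ^ 3) * gnorm v K"
    using A0 by (simp only: abs_mult abs_of_nonneg)
  then show ?thesis unfolding \<rho>_def by (rule jump_scaling[OF \<sigma> l A(1)[unfolded \<rho>_def]])
qed

end

section \<open>The interpolation error\<close>

text \<open>No measurability is assumed: if one integrand is not measurable, neither is the other,
  and both integrals are 0 by convention.\<close>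

lemma set_integral_cong_null:
  fixes f g :: "real^3 \<Rightarrow> 'b::euclidean_space"
  assumes AB: "negligible (A - B)" "negligible (B - A)" and eq: "\<And>x. x \<in> A \<Longrightarrow> x \<in> B \<Longrightarrow> f x = g x"
  shows "(LINT x:A|lebesgue. f x) = (LINT x:B|lebesgue. g x)"
proof -
  let ?f = "\<lambda>x. indicat_real A x *\<^sub>R f x" and ?g = "\<lambda>x. indicat_real B x *\<^sub>R g x"
  have "negligible ((A - B) \<union> (B - A))" using AB by (rule negligible_Un)
  then have "(A - B) \<union> (B - A) \<in> null_sets lebesgue" by (simp add: negligible_iff_null_sets)
  moreover have "{x \<in> space lebesgue. ?f x \<noteq> ?g x} \<subseteq> (A - B) \<union> (B - A)"
    using eq by (auto simp: indicator_def split: if_splits)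
  ultimately have ae: "AE x in lebesgue. ?f x = ?g x" by (rule AE_I')
  show ?thesis
  proof (cases "?f \<in> borel_measurable lebesgue")
    case True
    then have "?g \<in> borel_measurable lebesgue" by (rule borel_measurable_AE[OF _ ae])
    then show ?thesis unfolding set_lebesgue_integral_def by (rule integral_cong_AE[OF True _ ae])
  next
    case False
    have "AE x in lebesgue. ?g x = ?f x" using ae by (rule AE_mp) (rule AE_I2, simp)
    then have "?g \<notin> borel_measurable lebesgue" using False borel_measurable_AE[of ?g ?f] by blast
    then show ?thesis using False unfolding set_lebesgue_integral_def
      using not_integrable_integral_eq[of lebesgue ?f] not_integrable_integral_eq[of lebesgue ?g]
        borel_measurable_integrable[of lebesgue ?f] borel_measurable_integrable[of lebesgue ?g] by metis
  qed
qed

text \<open>A reachable pair is reachable in at most \<open>card R\<close> steps, so the bound is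
  independent of the length of the path at hand, which may repeat elements.\<close>

lemma rtrancl_increment_bound:
  fixes f :: "'a \<Rightarrow> real"
  assumes xy: "(x, y) \<in> R\<^sup>*" and R: "finite R" and B: "\<And>a c. (a, c) \<in> R \<Longrightarrow> \<bar>f a - f c\<bar> \<le> B" "0 \<le> B"
  shows "\<bar>f x - f y\<bar> \<le> real (card R) * B"
proof -
  have step: "(x, y) \<in> R ^^ n \<Longrightarrow> \<bar>f x - f y\<bar> \<le> real n * B" for n y
  proof (induction n arbitrary: y)
    case (Suc n)
    from Suc.prems obtain z where z: "(x, z) \<in> R ^^ n" "(z, y) \<in> R" by auto
    have "\<bar>f x - f y\<bar> \<le> \<bar>f x - f z\<bar> + \<bar>f z - f y\<bar>" by linarith
    also have "\<dots> \<le> real n * B + B" using Suc.IH[OF z(1)] B(1)[OF z(2)] by linarith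
    finally show ?case by (simp add: algebra_simps)
  qed simp
  obtain n where n: "n \<le> card R" "(x, y) \<in> R ^^ n" using xy rtrancl_finite_eq_relpow[OF R] by auto
  have "real n * B \<le> real (card R) * B" using n(1) B(2) by (intro mult_right_mono) auto
  then show ?thesis using step[OF n(2)] by linarith
qed

lemma affine_agree_open:
  fixes B B' :: "real^3"
  assumes U: "open U" "z \<in> U" and eq: "\<And>x. x \<in> U \<Longrightarrow> A + cross3 B x = A' + cross3 B' x"
  shows "A + cross3 B x = A' + cross3 B' x"
proof -
  obtain \<epsilon> where \<epsilon>: "\<epsilon> > 0" "ball z \<epsilon> \<subseteq> U" using U by (meson open_contains_ball)
  define N where "N = norm (x - z) + 1"
  define k where "k = \<epsilon> / (2 * N)"
  have n0: "N > 0" unfolding N_def by (rule add_nonneg_pos) auto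
  have k: "k > 0" using \<epsilon> n0 by (simp add: k_def)
  have "k * norm (x - z) \<le> k * N" using k by (simp add: N_def)
  also have "\<dots> = \<epsilon> / 2" using n0 by (simp add: k_def)
  finally have "z + k *\<^sub>R (x - z) \<in> ball z \<epsilon>" using \<epsilon> k by (simp add: dist_norm)
  then have 1: "A + cross3 B (z + k *\<^sub>R (x - z)) = A' + cross3 B' (z + k *\<^sub>R (x - z))" using eq \<epsilon> by blast
  have 2: "A + cross3 B z = A' + cross3 B' z" using eq U by blast
  have "k *\<^sub>R cross3 B (x - z) = (A + (cross3 B z + k *\<^sub>R cross3 B (x - z))) - (A + cross3 B z)" by simp
  also have "\<dots> = (A' + (cross3 B' z + k *\<^sub>R cross3 B' (x - z))) - (A' + cross3 B' z)"
    using 1 2 unfolding cross_add_right cross_mult_right by (simp only:)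
  also have "\<dots> = k *\<^sub>R cross3 B' (x - z)" by simp
  finally have "cross3 B (x - z) = cross3 B' (x - z)" using k by simp
  then have 3: "cross3 B x - cross3 B z = cross3 B' x - cross3 B' z" by (simp only: Cross3.right_diff_distrib)
  have "A + cross3 B x = (A + cross3 B z) + (cross3 B x - cross3 B z)" by simp
  also have "\<dots> = (A' + cross3 B' z) + (cross3 B' x - cross3 B' z)" using 2 3 by (simp only:)
  finally show ?thesis by simp
qed

lemma elem_restriction_eq:
  assumes q: "q \<in> nedelec_local" "\<And>x. x \<in> interior K \<Longrightarrow> p x = q x" and ne: "interior K \<noteq> {}"
  shows "elem_restriction K p = q"
  unfolding elem_restriction_def
proof (rule the_equality)
  show "q \<in> nedelec_local \<and> (\<forall>x\<in>interior K. p x = q x)" using q by blast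
  fix q' assume q': "q' \<in> nedelec_local \<and> (\<forall>x\<in>interior K. p x = q' x)"
  obtain a b where ab: "q = (\<lambda>x. a + cross3 b x)" using q(1) by (auto simp: nedelec_local_def)
  obtain a' b' where ab': "q' = (\<lambda>x. a' + cross3 b' x)" using q' by (auto simp: nedelec_local_def)
  obtain z where z: "z \<in> interior K" using ne by auto
  have "q' y = q y" if "y \<in> interior K" for y
    by (rule trans[OF sym[OF bspec[OF conjunct2[OF q'] that]] q(2)[OF that]])
  then have "a' + cross3 b' y = a + cross3 b y" if "y \<in> interior K" for y using that unfolding ab ab' by this
  from affine_agree_open[OF open_interior z this] show "q' = q" unfolding ab ab' by (rule ext)
qed

lemma nedelec_local_combination:
  assumes "finite E" "\<And>e. e \<in> E \<Longrightarrow> q e \<in> nedelec_local"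
  shows "(\<lambda>x. c - (\<Sum>e\<in>E. \<alpha> e *\<^sub>R q e x)) \<in> nedelec_local"
proof -
  have "\<forall>e. \<exists>a b. e \<in> E \<longrightarrow> q e = (\<lambda>x. a + cross3 b x)" using assms(2) by (auto simp: nedelec_local_def)
  then obtain a b where ab: "\<And>e. e \<in> E \<Longrightarrow> q e = (\<lambda>x. a e + cross3 (b e) x)" by metis
  have "(\<Sum>e\<in>E. \<alpha> e *\<^sub>R q e x) = (\<Sum>e\<in>E. \<alpha> e *\<^sub>R a e) + cross3 (\<Sum>e\<in>E. \<alpha> e *\<^sub>R b e) x" for x
    using assms(1) ab by (induction E rule: finite_induct)
      (auto simp: cross_add_left cross_mult_left scaleR_add_right algebra_simps)
  then have "(\<lambda>x. c - (\<Sum>e\<in>E. \<alpha> e *\<^sub>R q e x)) = (\<lambda>x. (c - (\<Sum>e\<in>E. \<alpha> e *\<^sub>R a e)) + cross3 (- (\<Sum>e\<in>E. \<alpha> e *\<^sub>R b e)) x)"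
    by (simp add: cross_minus_left diff_diff_eq)
  then show ?thesis unfolding nedelec_local_def by blast
qed

text \<open>The integrand is constant along the edge. The end points picked by \<open>SOME\<close>
  may come in either order, hence the two cases.\<close>

lemma edge_mean_nedelec:
  assumes q: "q \<in> nedelec_local"
  shows "edge_mean (closed_segment x y) (\<lambda>z. q z \<bullet> (k *\<^sub>R (y - x))) = q x \<bullet> (k *\<^sub>R (y - x))"
proof -
  obtain a b where ab: "(SOME (a, b). closed_segment x y = closed_segment a b) = (a, b)" by fastforce
  have "(\<lambda>(a, b). closed_segment x y = closed_segment a b) (SOME (a, b). closed_segment x y = closed_segment a b)"
    by (rule someI[of _ "(x, y)"]) simp
  then have "{x, y} = {a, b}" using ab by (simp add: closed_segment_eq)
  then have c: "a = x \<and> b = y \<or> a = y \<and> b = x" by (auto simp: doubleton_eq_iff)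
  have yx: "q y \<bullet> (y - x) = q x \<bullet> (y - x)" using nedelec_edge_const[OF q, of x y 1] by (simp add: linepath_def)
  have "q (linepath a b s) \<bullet> (y - x) = q x \<bullet> (y - x)" for s
    using c
  proof
    assume "a = x \<and> b = y" then show ?thesis using nedelec_edge_const[OF q] by simp
  next
    assume "a = y \<and> b = x"
    then show ?thesis using nedelec_edge_const[OF q, of y x s] yx by (simp add: inner_diff_right)
  qed
  then have "integral {0..1} (\<lambda>s. q (linepath a b s) \<bullet> (k *\<^sub>R (y - x))) = q x \<bullet> (k *\<^sub>R (y - x))" by simp
  then show ?thesis unfolding edge_mean_def ab by simp
qed

lemma convex_combination_diff_le:
  fixes f w :: "'a \<Rightarrow> real"
  assumes w: "\<And>i. i \<in> I \<Longrightarrow> 0 \<le> w i" "sum w I = 1" and f: "\<And>i. i \<in> I \<Longrightarrow> \<bar>c - f i\<bar> \<le> B"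
  shows "\<bar>c - (\<Sum>i\<in>I. w i * f i)\<bar> \<le> B"
proof -
  have "c - (\<Sum>i\<in>I. w i * f i) = (\<Sum>i\<in>I. w i * (c - f i))"
    using w(2) by (simp add: right_diff_distrib sum_subtractf flip: sum_distrib_right)
  also have "\<bar>\<dots>\<bar> \<le> (\<Sum>i\<in>I. w i * \<bar>c - f i\<bar>)"
    by (rule order_trans[OF sum_abs]) (simp add: abs_mult w(1))
  also have "\<dots> \<le> (\<Sum>i\<in>I. w i * B)" using w(1) f by (intro sum_mono mult_left_mono) auto
  also have "\<dots> = B" using w(2) by (simp flip: sum_distrib_right)
  finally show ?thesis .
qed

context weighted_mesh
begin

lemma edges_of_patch: "K \<in> T \<Longrightarrow> e \<in> edges_of K \<Longrightarrow> K \<in> edge_patch T e"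
  by (simp add: edge_patch_def)

lemma edges_of_vertices:
  assumes "K \<in> T" obtains V where "tetra V" "K = convex hull V"
    "edges_of K = {closed_segment a b | a b. a \<in> V \<and> b \<in> V \<and> a \<noteq> b}"
proof -
  obtain V where V: "tetra V" "K = convex hull V" using s3[OF assms] simplex3_tetra by blast
  have "edges_of K = {closed_segment a b | a b. a \<in> V \<and> b \<in> V \<and> a \<noteq> b}"
    unfolding edges_of_def V(2) edge_bary[OF V(1)] by blast
  then show thesis using that V by blast
qed

lemma finite_edges_of: "K \<in> T \<Longrightarrow> finite (edges_of K)"
proof -
  assume "K \<in> T"
  then obtain V where V: "tetra V" "edges_of K = {closed_segment a b | a b. a \<in> V \<and> b \<in> V \<and> a \<noteq> b}"
    by (rule edges_of_vertices)
  have "edges_of K \<subseteq> (\<lambda>(a, b). closed_segment a b) ` (V \<times> V)" unfolding V(2) by auto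
  then show ?thesis using tetra_finite[OF V(1)] finite_subset by blast
qed

lemma H1_element:
  assumes v: "v \<in> PH1 (interior (\<Union>(element_patch T K))) P" and L: "L \<in> element_patch T K"
  shows "v \<in> H1 (interior L)"
proof -
  have LT: "L \<in> T" using L by (auto simp: element_patch_def edge_patch_def)
  obtain D where D: "D \<in> P" "interior L \<subseteq> D" using element_subdomain[OF LT] by blast
  have "interior L \<subseteq> interior (\<Union>(element_patch T K))" using L by (intro interior_mono) auto
  then have "interior L \<subseteq> interior (\<Union>(element_patch T K)) \<inter> D" using D by blast
  moreover have "v \<in> H1 (interior (\<Union>(element_patch T K)) \<inter> D)" using v D by (simp add: PH1_def)
  ultimately show ?thesis by (rule H1_restrict[OF _ open_interior, rotated])
qed

lemma coeff_on_element:
  assumes K: "K \<in> T"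
  shows "0 < coeff_on \<mu> K" "\<And>x. x \<in> interior K \<Longrightarrow> \<mu> x = coeff_on \<mu> K"
proof -
  obtain D where D: "D \<in> P" "interior K \<subseteq> D" using element_subdomain[OF K] by blast
  obtain c where c: "c > 0" "\<forall>x\<in>D. \<mu> x = c" using pcp D by (auto simp: piecewise_constant_pos_def)
  obtain z where z: "z \<in> interior K" using element_set(4)[OF K] by blast
  have "coeff_on \<mu> K = c" unfolding coeff_on_def
    by (rule the_equality) (use c D z in auto)
  then show "0 < coeff_on \<mu> K" "\<And>x. x \<in> interior K \<Longrightarrow> \<mu> x = coeff_on \<mu> K" using c D by auto
qed

text \<open>A chain has at most as many steps as there are ordered pairs in the edge patch, by
  \<open>card_edge_patch\<close> at most \<open>((16 \<sigma>^2)^3)^2\<close>, and each step costs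
  \<open>2 * jump_const\<close>.\<close>

definition chain_const :: real where
  "chain_const = ((16 * \<sigma>\<^sup>2) ^ 3)\<^sup>2 * (2 * jump_const)"

lemma chain_const_nonneg: "0 \<le> chain_const"
  using jump_const_nonneg by (simp add: chain_const_def)

lemma chain_jump:
  assumes v: "v \<in> H0_curl \<Omega>" and S: "S \<subseteq> edge_patch T (closed_segment x1 x2)"
    and H: "\<And>K. K \<in> S \<Longrightarrow> v \<in> H1 (interior K) \<and> gnorm v K \<le> \<Lambda>" and \<Lambda>: "0 \<le> \<Lambda>"
    and R: "R \<subseteq> {(K, K'). K \<in> S \<and> K' \<in> S \<and> share_face K K'}" "(K, K') \<in> R\<^sup>*"
  defines "t \<equiv> (1 / norm (x2 - x1)) *\<^sub>R (x2 - x1)"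
  shows "\<bar>tmean v K \<bullet> t - tmean v K' \<bullet> t\<bar> * sqrt (norm (x2 - x1)) \<le> chain_const * \<Lambda>"
proof -
  let ?E = "edge_patch T (closed_segment x1 x2)" and ?s = "sqrt (norm (x2 - x1))"
  have fE: "finite ?E" using finT by (simp add: edge_patch_def)
  have RE: "R \<subseteq> ?E \<times> ?E" using R(1) S by auto
  have fR: "finite R" by (rule finite_subset[OF RE]) (simp add: fE)
  have "card R \<le> card (?E \<times> ?E)" by (rule card_mono[OF _ RE]) (simp add: fE)
  then have "real (card R) \<le> real (card ?E) * real (card ?E)" by (simp add: card_cartesian_product flip: of_nat_mult)
  also have "\<dots> \<le> (16 * \<sigma>\<^sup>2) ^ 3 * (16 * \<sigma>\<^sup>2) ^ 3"
    by (intro mult_mono card_edge_patch[OF tri s3 reg]) auto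
  finally have cR: "real (card R) \<le> ((16 * \<sigma>\<^sup>2) ^ 3)\<^sup>2" by (simp add: power2_eq_square)
  have B: "0 \<le> 2 * jump_const * \<Lambda>" using jump_const_nonneg \<Lambda> by simp
  have "\<bar>tmean v K \<bullet> t * ?s - tmean v K' \<bullet> t * ?s\<bar> \<le> real (card R) * (2 * jump_const * \<Lambda>)"
  proof (rule rtrancl_increment_bound[OF R(2) fR _ B])
    fix a c assume "(a, c) \<in> R"
    then have ac: "a \<in> S" "c \<in> S" "share_face a c" using R(1) by auto
    have "\<bar>tmean v a \<bullet> t * ?s - tmean v c \<bullet> t * ?s\<bar> = \<bar>tmean v a \<bullet> t - tmean v c \<bullet> t\<bar> * ?s"
      by (simp add: abs_mult flip: left_diff_distrib)
    also have "\<dots> \<le> jump_const * (gnorm v a + gnorm v c)" unfolding t_def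
      by (rule jump_shared[OF v]) (use ac S H in auto)
    also have "\<dots> \<le> jump_const * (\<Lambda> + \<Lambda>)"
      using H ac jump_const_nonneg by (intro mult_left_mono add_mono) auto
    finally show "\<bar>tmean v a \<bullet> t * ?s - tmean v c \<bullet> t * ?s\<bar> \<le> 2 * jump_const * \<Lambda>" by simp
  qed
  also have "\<dots> \<le> ((16 * \<sigma>\<^sup>2) ^ 3)\<^sup>2 * (2 * jump_const * \<Lambda>)" using cR B by (rule mult_right_mono)
  finally show ?thesis by (simp add: chain_const_def abs_mult mult.assoc flip: left_diff_distrib)
qed

lemma finite_edge_patch: "finite (edge_patch T e)"
  using finT by (simp add: edge_patch_def)

lemma edge_patch_T: "K \<in> edge_patch T e \<Longrightarrow> K \<in> T"
  by (simp add: edge_patch_def)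

text \<open>Faces are null sets, so the mean over a union of elements is the average of their means
  weighted by volume. Bounds on the distance to each mean then carry over to
  \<open>interp_coeff\<close> by convexity.\<close>

lemma interp_coeff_interior:
  assumes v: "v \<in> H0_curl \<Omega>" and e: "interior_edge \<Omega> e" and ne: "max_patch \<mu> T e \<noteq> {}"
  obtains w where "\<And>K. K \<in> max_patch \<mu> T e \<Longrightarrow> 0 \<le> w K" "(\<Sum>K\<in>max_patch \<mu> T e. w K) = 1"
    "interp_coeff \<Omega> \<mu> T t v e = (\<Sum>K\<in>max_patch \<mu> T e. w K * (tmean v K \<bullet> t e))"
proof -
  let ?X = "max_patch \<mu> T e"
  define U where "U = (\<Union>K\<in>?X. interior K)"
  have XT: "K \<in> T" if "K \<in> ?X" for K using that max_patch_subset edge_patch_T by blast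
  have fX: "finite ?X" by (rule finite_subset[OF max_patch_subset finite_edge_patch])
  have Km: "interior K \<in> lmeasurable" if "K \<in> ?X" for K using element_set(5)[OF XT[OF that]] .
  have Um: "U \<in> lmeasurable" unfolding U_def using fX Km by (intro fmeasurable.finite_UN) auto
  have dis: "interior K \<inter> interior K' = {}" if "K \<in> ?X" "K' \<in> ?X" "K \<noteq> K'" for K K'
    using interior_disj[OF XT[OF that(1)] XT[OF that(2)] that(3)] interior_subset by blast
  have sub: "U \<subseteq> \<Union>?X" unfolding U_def using interior_subset by blast
  have "\<Union>?X - U \<subseteq> (\<Union>K\<in>?X. K - interior K)" unfolding U_def by blast
  moreover have "negligible (\<Union>K\<in>?X. K - interior K)"
    using fX element_set(8)[OF XT] by (intro negligible_Union) auto
  ultimately have neg: "negligible (\<Union>?X - U)" "negligible (U - \<Union>?X)"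
    using negligible_subset sub by (blast, metis Diff_eq_empty_iff negligible_empty)
  have mU: "measure lebesgue (\<Union>?X) = measure lebesgue U"
    by (rule measure_negligible_symdiff[OF Um]) (use neg in \<open>auto intro: negligible_Un\<close>)
  have mS: "measure lebesgue U = (\<Sum>K\<in>?X. measure lebesgue (interior K))"
    unfolding U_def by (rule measure_UNION') (use fX Km dis in \<open>auto simp: pairwise_def disjnt_def\<close>)
  have pos: "0 < measure lebesgue (interior K)" if "K \<in> ?X" for K
  proof -
    have "\<not> negligible (interior K)" using open_not_negligible[OF open_interior element_set(4)[OF XT[OF that]]] .
    then show ?thesis using Km[OF that] by (simp add: negligible_iff_measure measure_nonneg less_le)
  qed
  have mpos: "0 < measure lebesgue U" unfolding mS using fX ne pos by (rule sum_pos)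
  have vU: "v \<in> L2 U"
    by (rule L2_mono[OF H0_L2[OF v]]) (use Um interior_sub XT in \<open>auto simp: U_def fmeasurableD\<close>)
  have "(LINT x:\<Union>?X|lebesgue. v x) \<bullet> t e = (LINT x:U|lebesgue. v x) \<bullet> t e"
    using set_integral_cong_null[OF neg, of v v] by simp
  also have "\<dots> = (LINT x:U|lebesgue. v x \<bullet> t e)"
    by (rule set_integral_inner_left[symmetric, OF L2_set_integrable[OF vU Um]])
  also have "\<dots> = (\<Sum>K\<in>?X. LINT x:interior K|lebesgue. v x \<bullet> t e)"
    by (rule set_integral_partition[OF fX _ _ dis])
       (use Km L2_componentwise_integrable[OF vU Um] in \<open>auto simp: U_def fmeasurableD\<close>)
  also have "\<dots> = (\<Sum>K\<in>?X. measure lebesgue (interior K) * (tmean v K \<bullet> t e))"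
  proof (rule sum.cong[OF refl])
    fix K assume K: "K \<in> ?X"
    have "(LINT x:interior K|lebesgue. v x \<bullet> t e) = (LINT x:interior K|lebesgue. v x) \<bullet> t e"
      by (rule set_integral_inner_left[OF L2_set_integrable[OF H0_L2_element[OF v XT[OF K]] Km[OF K]]])
    then show "(LINT x:interior K|lebesgue. v x \<bullet> t e) = measure lebesgue (interior K) * (tmean v K \<bullet> t e)"
      using pos[OF K] by (simp add: tmean_def mean_def)
  qed
  finally have int: "(LINT x:\<Union>?X|lebesgue. v x) \<bullet> t e = (\<Sum>K\<in>?X. measure lebesgue (interior K) * (tmean v K \<bullet> t e))" .
  show thesis
  proof (rule that[of "\<lambda>K. measure lebesgue (interior K) / measure lebesgue U"])
    show "0 \<le> measure lebesgue (interior K) / measure lebesgue U" for K by simp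
    show "(\<Sum>K\<in>?X. measure lebesgue (interior K) / measure lebesgue U) = 1"
      using mpos mS by (simp flip: sum_divide_distrib)
    show "interp_coeff \<Omega> \<mu> T t v e = (\<Sum>K\<in>?X. measure lebesgue (interior K) / measure lebesgue U * (tmean v K \<bullet> t e))"
      using e int mU by (simp add: interp_coeff_def sum_divide_distrib)
  qed
qed

text \<open>One chain from \<open>K\<close> to the maximal subpatch, one inside that subpatch, and,
  at a boundary edge, the estimate on a free facet.\<close>

definition coeff_const :: real where
  "coeff_const = 2 * chain_const + jump_const"

lemma coeff_const_nonneg: "0 \<le> coeff_const"
  using chain_const_nonneg jump_const_nonneg by (simp add: coeff_const_def)

lemma interp_coeff_error:
  assumes v: "v \<in> H0_curl \<Omega>" and K: "K \<in> T" "e \<in> edges_of K" and e: "e = closed_segment x1 x2"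
    and te: "t e = (1 / norm (x2 - x1)) *\<^sub>R (x2 - x1)" and pc: "path_choice \<mu> T chain"
    and H: "\<And>L. L \<in> set (chain K e) \<union> max_patch \<mu> T e \<Longrightarrow> v \<in> H1 (interior L) \<and> gnorm v L \<le> \<Lambda>" and \<Lambda>: "0 \<le> \<Lambda>"
  shows "\<bar>tmean v K \<bullet> t e - interp_coeff \<Omega> \<mu> T t v e\<bar> * sqrt (norm (x2 - x1)) \<le> coeff_const * \<Lambda>"
proof -
  let ?X = "max_patch \<mu> T e" and ?s = "sqrt (norm (x2 - x1))"
  have em: "e \<in> mesh_edges T" using K by (auto simp: mesh_edges_def)
  have XE: "?X \<subseteq> edge_patch T (closed_segment x1 x2)" using max_patch_subset e by blast
  have "\<exists>K1\<in>?X. \<bar>tmean v K \<bullet> t e - tmean v K1 \<bullet> t e\<bar> * ?s \<le> chain_const * \<Lambda>"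
  proof (cases "K \<in> ?X")
    case True
    then show ?thesis using chain_const_nonneg \<Lambda> by (intro bexI[of _ K]) auto
  next
    case False
    then obtain K1 where K1: "K1 \<in> ?X" "monotone_path \<mu> (edge_patch T e) K K1 (chain K e)"
      using pc K unfolding path_choice_def by metis
    have S: "set (chain K e) \<subseteq> edge_patch T (closed_segment x1 x2)" using K1(2) e by (simp add: monotone_path_def)
    have "\<bar>tmean v K \<bullet> t e - tmean v K1 \<bullet> t e\<bar> * ?s \<le> chain_const * \<Lambda>" unfolding te
      by (rule chain_jump[OF v S _ \<Lambda> _ monotone_path_rtrancl[OF K1(2)]]) (use H in auto)
    then show ?thesis using K1 by blast
  qed
  then obtain K1 where K1: "K1 \<in> ?X" "\<bar>tmean v K \<bullet> t e - tmean v K1 \<bullet> t e\<bar> * ?s \<le> chain_const * \<Lambda>" by blast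
  have "\<bar>tmean v K1 \<bullet> t e - interp_coeff \<Omega> \<mu> T t v e\<bar> * ?s \<le> (chain_const + jump_const) * \<Lambda>"
  proof (cases "interior_edge \<Omega> e")
    case True
    obtain w where w: "\<And>K. K \<in> ?X \<Longrightarrow> 0 \<le> w K" "sum w ?X = 1"
      "interp_coeff \<Omega> \<mu> T t v e = (\<Sum>K\<in>?X. w K * (tmean v K \<bullet> t e))"
      by (rule interp_coeff_interior[where t=t, OF v True]) (use K1 in auto)
    have "\<bar>tmean v K1 \<bullet> t e * ?s - (\<Sum>K\<in>?X. w K * (tmean v K \<bullet> t e * ?s))\<bar> \<le> chain_const * \<Lambda>"
    proof (rule convex_combination_diff_le[OF w(1,2)])
      fix K' assume K': "K' \<in> ?X"
      have "K1 \<in> edge_patch T e" using K1(1) max_patch_subset by blast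
      then obtain Ks where Ks: "monotone_path \<mu> (edge_patch T e) K1 K' Ks"
        using qm em True K' unfolding quasi_monotone_def by meson
      \<comment> \<open>The bounds in \<open>H\<close> cover only the chosen chain and the maximal
        subpatch. This path starts at a maximal element and therefore stays where they hold.\<close>
      have KsX: "set Ks \<subseteq> ?X" by (rule monotone_path_max[OF Ks K1(1)])
      have "\<bar>tmean v K1 \<bullet> t e - tmean v K' \<bullet> t e\<bar> * ?s \<le> chain_const * \<Lambda>" unfolding te
        by (rule chain_jump[OF v XE _ \<Lambda> _ monotone_path_rtrancl[OF Ks]]) (use H KsX in auto)
      then show "\<bar>tmean v K1 \<bullet> t e * ?s - tmean v K' \<bullet> t e * ?s\<bar> \<le> chain_const * \<Lambda>"
        by (simp add: abs_mult flip: left_diff_distrib)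
    qed
    moreover have "tmean v K1 \<bullet> t e * ?s - (\<Sum>K\<in>?X. w K * (tmean v K \<bullet> t e * ?s)) = (tmean v K1 \<bullet> t e - interp_coeff \<Omega> \<mu> T t v e) * ?s"
      unfolding w(3) by (simp add: left_diff_distrib sum_distrib_right mult.assoc)
    ultimately have "\<bar>tmean v K1 \<bullet> t e - interp_coeff \<Omega> \<mu> T t v e\<bar> * ?s \<le> chain_const * \<Lambda>" by (simp add: abs_mult)
    also have "\<dots> \<le> (chain_const + jump_const) * \<Lambda>" using jump_const_nonneg \<Lambda> by (simp add: mult_right_mono)
    finally show ?thesis .
  next
    case False
    \<comment> \<open>The coefficient of a boundary edge is 0, so \<open>K1\<close> has to be linked
      to an element for which \<open>jump_free\<close> bounds the mean itself.\<close>
    obtain y where y: "y \<in> ?X" "y \<in> free_elements T e" "(K1, y) \<in> {(a, c). a \<in> ?X \<and> c \<in> ?X \<and> share_face a c}\<^sup>*"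
      using max_component_free[OF openO lip tri s3 un qm em False K1(1)] by blast
    have Hy: "v \<in> H1 (interior y)" "gnorm v y \<le> \<Lambda>" using H y by auto
    have "\<bar>tmean v K1 \<bullet> t e - tmean v y \<bullet> t e\<bar> * ?s \<le> chain_const * \<Lambda>" unfolding te
      by (rule chain_jump[OF v XE _ \<Lambda> order_refl y(3)]) (use H in auto)
    moreover have "\<bar>tmean v y \<bullet> t e\<bar> * ?s \<le> jump_const * \<Lambda>" unfolding te
      by (rule order_trans[OF jump_free[OF v y(2)[unfolded e] Hy(1)]]) (rule mult_left_mono[OF Hy(2) jump_const_nonneg])
    moreover have "\<bar>tmean v K1 \<bullet> t e\<bar> * ?s \<le> \<bar>tmean v K1 \<bullet> t e - tmean v y \<bullet> t e\<bar> * ?s + \<bar>tmean v y \<bullet> t e\<bar> * ?s"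
      by (simp flip: distrib_right add: mult_right_mono)
    ultimately have "\<bar>tmean v K1 \<bullet> t e\<bar> * ?s \<le> chain_const * \<Lambda> + jump_const * \<Lambda>" by linarith
    then show ?thesis using False by (simp add: interp_coeff_def distrib_right)
  qed
  moreover have "\<bar>tmean v K \<bullet> t e - interp_coeff \<Omega> \<mu> T t v e\<bar> * ?s
      \<le> \<bar>tmean v K \<bullet> t e - tmean v K1 \<bullet> t e\<bar> * ?s + \<bar>tmean v K1 \<bullet> t e - interp_coeff \<Omega> \<mu> T t v e\<bar> * ?s"
    by (simp flip: distrib_right add: mult_right_mono)
  ultimately have "\<bar>tmean v K \<bullet> t e - interp_coeff \<Omega> \<mu> T t v e\<bar> * ?s \<le> chain_const * \<Lambda> + (chain_const + jump_const) * \<Lambda>"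
    using K1(2) by linarith
  also have "\<dots> = coeff_const * \<Lambda>" by (simp add: coeff_const_def algebra_simps)
  finally show ?thesis .
qed

end

section \<open>Weighted norms and the assembly of the two estimates\<close>

context weighted_mesh
begin

text \<open>The values of \<open>\<mu>\<close> on faces are arbitrary, so the norm over the closed
  element is moved to the interior, where the weight is a constant and factors out.\<close>

lemma L2_norm_weighted:
  fixes g :: "real^3 \<Rightarrow> 'b::euclidean_space"
  assumes K: "K \<in> T"
  shows "L2_norm K (\<lambda>x. (\<mu> x powr (-1/2)) *\<^sub>R g x) = L2_norm (interior K) g / sqrt (coeff_on \<mu> K)"
proof -
  let ?m = "coeff_on \<mu> K"
  have p: "?m powr (-1/2) = 1 / sqrt ?m"
    using coeff_on_element(1)[OF K] powr_minus_divide[of ?m "1/2"] by (simp add: powr_half_sqrt)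
  have sub: "interior K - K = {}" using interior_subset by blast
  have "(LINT x:K|lebesgue. (norm ((\<mu> x powr (-1/2)) *\<^sub>R g x))\<^sup>2) = (LINT x:interior K|lebesgue. (norm ((?m powr (-1/2)) *\<^sub>R g x))\<^sup>2)"
    by (rule set_integral_cong_null[OF element_set(8)[OF K]]) (simp_all only: sub negligible_empty coeff_on_element(2)[OF K])
  then have "L2_norm K (\<lambda>x. (\<mu> x powr (-1/2)) *\<^sub>R g x) = L2_norm (interior K) (\<lambda>x. (?m powr (-1/2)) *\<^sub>R g x)"
    unfolding L2_norm_def by (simp only:)
  also have "\<dots> = L2_norm (interior K) g / sqrt ?m"
    unfolding L2_norm_scaleR p using coeff_on_element(1)[OF K] by simp
  finally show ?thesis .
qed

lemma broken_jacobian_element: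
  assumes K: "K \<in> T" "x \<in> interior K"
  shows "broken_jacobian T v x = weak_jacobian (interior K) v x"
proof -
  have "x \<notin> interior L" if "L \<in> T - {K}" for L
    using interior_disj[of L K] interior_subset[of K] K that by blast
  then have "(\<Sum>L\<in>T - {K}. indicator (interior L) x *\<^sub>R weak_jacobian (interior L) v x) = 0"
    by (intro sum.neutral) simp
  then show ?thesis unfolding broken_jacobian_def by (subst sum.remove[OF finT K(1)]) (simp add: K(2))
qed

text \<open>The interior of an element misses every other element, so the weighted integrand is
  pointwise a sum with at most one nonzero term. Outside all the interiors
  \<open>broken_jacobian\<close> is 0.\<close>

lemma broken_jacobian_energy:
  assumes W: "W \<subseteq> T" and H: "\<And>L. L \<in> W \<Longrightarrow> v \<in> H1 (interior L)"
  shows "(L2_norm (\<Union>W) (\<lambda>x. (\<mu> x powr (-1/2)) *\<^sub>R broken_jacobian T v x))\<^sup>2 = (\<Sum>L\<in>W. (gnorm v L)\<^sup>2 / coeff_on \<mu> L)"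
proof -
  let ?b = "\<lambda>x. (norm ((\<mu> x powr (-1/2)) *\<^sub>R broken_jacobian T v x))\<^sup>2"
  let ?g = "\<lambda>L x. (1 / coeff_on \<mu> L) * (indicat_real (interior L) x *\<^sub>R (norm (weak_jacobian (interior L) v x))\<^sup>2)"
  have fW: "finite W" by (rule finite_subset[OF W finT])
  have pt: "indicat_real (\<Union>W) x *\<^sub>R ?b x = (\<Sum>L\<in>W. ?g L x)" for x
  proof (cases "\<exists>K\<in>T. x \<in> interior K")
    case True
    then obtain K where K: "K \<in> T" "x \<in> interior K" by blast
    have other: "x \<notin> L" if "L \<in> T - {K}" for L using interior_disj[of K L] K that by blast
    show ?thesis
    proof (cases "K \<in> W")
      case True
      have c: "0 < coeff_on \<mu> K" by (rule coeff_on_element(1)[OF K(1)])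
      have "(coeff_on \<mu> K powr (-1/2))\<^sup>2 = 1 / coeff_on \<mu> K"
        using c powr_minus_divide[of "coeff_on \<mu> K" "1/2"] by (simp add: powr_half_sqrt power_divide)
      then have "?b x = ?g K x"
        using K(2) by (simp add: power_mult_distrib coeff_on_element(2)[OF K] broken_jacobian_element[OF K])
      moreover have "x \<in> \<Union>W" using True K(2) interior_subset by blast
      moreover have "(\<Sum>L\<in>W - {K}. ?g L x) = 0"
      proof (rule sum.neutral, rule ballI)
        fix L assume "L \<in> W - {K}"
        then have "x \<notin> interior L" using other W interior_subset by blast
        then show "?g L x = 0" by simp
      qed
      ultimately show ?thesis by (subst sum.remove[OF fW True]) simp
    next
      case False
      then have n: "x \<notin> \<Union>W" using other W by blast
      then have "x \<notin> interior L" if "L \<in> W" for L using that interior_subset by blast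
      then show ?thesis using n by simp
    qed
  next
    case False
    then have "broken_jacobian T v x = 0" unfolding broken_jacobian_def by (intro sum.neutral) auto
    moreover have "(\<Sum>L\<in>W. ?g L x) = 0" using False W by (intro sum.neutral) auto
    ultimately show ?thesis by simp
  qed
  have i: "integrable lebesgue (?g L)" if "L \<in> W" for L
    by (rule integrable_mult_right) (rule L2D(2)[OF weak_jacobian_spec(1)[OF H[OF that]]])
  have "(L2_norm (\<Union>W) (\<lambda>x. (\<mu> x powr (-1/2)) *\<^sub>R broken_jacobian T v x))\<^sup>2 = (LINT x|lebesgue. (\<Sum>L\<in>W. ?g L x))"
    unfolding L2_norm_power2 set_lebesgue_integral_def pt ..
  also have "\<dots> = (\<Sum>L\<in>W. LINT x|lebesgue. ?g L x)" by (rule Bochner_Integration.integral_sum[OF i])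
  also have "\<dots> = (\<Sum>L\<in>W. (gnorm v L)\<^sup>2 / coeff_on \<mu> L)"
    by (rule sum.cong[OF refl]) (simp add: gnorm_def L2_norm_power2 set_lebesgue_integral_def)
  finally show ?thesis .
qed

text \<open>Here the order of the weights becomes an estimate: the coefficient of \<open>L\<close>
  is at most that of \<open>K\<close>, which may replace it and later cancels against the weight on
  the left-hand side of the theorem.\<close>

lemma gnorm_le_energy:
  assumes W: "W \<subseteq> T" and H: "\<And>L. L \<in> W \<Longrightarrow> v \<in> H1 (interior L)" and L: "L \<in> W"
    and K: "K \<in> T" "inverse (coeff_on \<mu> K) \<le> inverse (coeff_on \<mu> L)"
  shows "gnorm v L \<le> sqrt (coeff_on \<mu> K) * L2_norm (\<Union>W) (\<lambda>x. (\<mu> x powr (-1/2)) *\<^sub>R broken_jacobian T v x)" (is "_ \<le> _ * ?R")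
proof (rule power2_le_imp_le)
  have LT: "L \<in> T" using L W by blast
  have c: "0 < coeff_on \<mu> K" "0 < coeff_on \<mu> L" using coeff_on_element(1) K LT by auto
  have le: "coeff_on \<mu> L \<le> coeff_on \<mu> K" using K(2) c by simp
  have "(gnorm v L)\<^sup>2 / coeff_on \<mu> L \<le> (\<Sum>L\<in>W. (gnorm v L)\<^sup>2 / coeff_on \<mu> L)"
  proof (rule member_le_sum[OF L _ finite_subset[OF W finT]])
    fix M assume "M \<in> W - {L}"
    then have "0 < coeff_on \<mu> M" using W coeff_on_element(1) by blast
    then show "0 \<le> (gnorm v M)\<^sup>2 / coeff_on \<mu> M" by simp
  qed
  also have "\<dots> = ?R\<^sup>2" by (rule broken_jacobian_energy[OF W H, symmetric])
  finally have "(gnorm v L)\<^sup>2 \<le> coeff_on \<mu> L * ?R\<^sup>2" using c by (simp add: pos_divide_le_eq mult.commute)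
  also have "\<dots> \<le> coeff_on \<mu> K * ?R\<^sup>2" using le by (rule mult_right_mono) simp
  also have "\<dots> = (sqrt (coeff_on \<mu> K) * ?R)\<^sup>2" using c by (simp add: power_mult_distrib)
  finally show "(gnorm v L)\<^sup>2 \<le> (sqrt (coeff_on \<mu> K) * ?R)\<^sup>2" .
  show "0 \<le> sqrt (coeff_on \<mu> K) * ?R" using c by (intro mult_nonneg_nonneg L2_norm_nonneg) simp
qed

text \<open>The constant \<open>c\<close> minus the interpolant is a Nedelec polynomial on
  \<open>K\<close>, and by duality with the basis its tangential values are
  \<open>c \<bullet> t e\<close> minus the coefficients. \<open>nedelec_stability\<close> then
  bounds it; the factor \<open>sqrt |e|\<close> in the assumption supplies the half power of the
  diameter that the volume of \<open>K\<close> complements.\<close>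

lemma interpolant_deviation:
  assumes K: "K \<in> T" and basis: "nedelec_basis \<Omega> T t \<phi>"
    and tan: "\<And>x1 x2. closed_segment x1 x2 \<in> edges_of K \<Longrightarrow> \<exists>y1 y2. closed_segment x1 x2 = closed_segment y1 y2 \<and> y1 \<noteq> y2 \<and>
      t (closed_segment x1 x2) = (1 / norm (y2 - y1)) *\<^sub>R (y2 - y1) \<and>
      \<bar>c \<bullet> t (closed_segment x1 x2) - interp_coeff \<Omega> \<mu> T t v (closed_segment x1 x2)\<bar> * sqrt (norm (y2 - y1)) \<le> B"
    and B: "0 \<le> B"
  shows "\<exists>a b. (\<forall>x\<in>interior K. c - interp \<Omega> \<mu> T t \<phi> v K x = a + cross3 b x) \<and>
    L2_norm (interior K) (\<lambda>x. a + cross3 b x) \<le> 4 * \<sigma> * sqrt (unit_ball_vol 3) * B * diameter K \<and>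
    norm b * sqrt (measure lebesgue (interior K)) \<le> 32 * \<sigma>\<^sup>2 * sqrt (unit_ball_vol 3) * B"
proof -
  let ?h = "diameter K" and ?\<omega> = "unit_ball_vol 3" and ?\<alpha> = "interp_coeff \<Omega> \<mu> T t v"
  obtain V where V: "tetra V" "K = convex hull V" "edges_of K = {closed_segment a b | a b. a \<in> V \<and> b \<in> V \<and> a \<noteq> b}"
    by (rule edges_of_vertices[OF K])
  have em: "e \<in> mesh_edges T" if "e \<in> edges_of K" for e using that K by (auto simp: mesh_edges_def)
  define q where "q e = elem_restriction K (\<phi> e)" for e
  have q: "q e \<in> nedelec_local" "\<And>x. x \<in> interior K \<Longrightarrow> \<phi> e x = q e x" if e: "e \<in> edges_of K" for e
  proof -
    have "\<phi> e \<in> ND0 \<Omega> T" using basis em[OF e] by (simp add: nedelec_basis_def)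
    then obtain p where p: "p \<in> nedelec_local" "\<And>x. x \<in> interior K \<Longrightarrow> \<phi> e x = p x" using K by (auto simp: ND0_def)
    have "q e = p" unfolding q_def by (rule elem_restriction_eq[OF p element_set(4)[OF K]])
    then show "q e \<in> nedelec_local" "\<And>x. x \<in> interior K \<Longrightarrow> \<phi> e x = q e x" using p by auto
  qed
  define Q where "Q = (\<lambda>x. c - (\<Sum>e\<in>edges_of K. ?\<alpha> e *\<^sub>R q e x))"
  have QN: "Q \<in> nedelec_local" unfolding Q_def by (rule nedelec_local_combination[OF finite_edges_of[OF K] q(1)])
  then obtain a b where ab: "Q = (\<lambda>x. a + cross3 b x)" by (auto simp: nedelec_local_def)
  have dev: "c - interp \<Omega> \<mu> T t \<phi> v K x = Q x" if "x \<in> interior K" for x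
    unfolding interp_def Q_def using q(2) that by simp
  have Kd: "?h \<le> \<sigma> * indiameter K" using reg K by (simp add: shape_regular_def)
  note ins = inscribed_ball[OF V(1) Kd[unfolded V(2)], folded V(2)]
  obtain z r where r: "0 < r" "cball z r \<subseteq> K" "?h \<le> 4 * \<sigma> * r" using ins(3) by blast
  have h: "0 < ?h" and \<sigma>: "0 < \<sigma>" using ins by auto
  \<comment> \<open>The bound for \<open>Q x \<bullet> (y - x)\<close>, which is the edge length
    times a tangential value: one half power of the length is in \<open>B\<close>, the other is at
    most \<open>sqrt ?h\<close>.\<close>
  define D where "D = sqrt ?h * B"
  have D0: "0 \<le> D" using h B by (simp add: D_def)
  have mom: "\<bar>Q x \<bullet> (y - x)\<bar> \<le> D" if xy: "x \<in> V" "y \<in> V" "x \<noteq> y" for x y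
  proof -
    let ?e = "closed_segment x y"
    have e: "?e \<in> edges_of K" using V(3) xy by blast
    obtain y1 y2 where y: "?e = closed_segment y1 y2" "y1 \<noteq> y2" "t ?e = (1 / norm (y2 - y1)) *\<^sub>R (y2 - y1)"
      "\<bar>c \<bullet> t ?e - ?\<alpha> ?e\<bar> * sqrt (norm (y2 - y1)) \<le> B" using tan[OF e] by blast
    have "{x, y} = {y1, y2}" using y(1) by (simp add: closed_segment_eq)
    then have cs: "(x = y1 \<and> y = y2) \<or> (x = y2 \<and> y = y1)" by (auto simp: doubleton_eq_iff)
    have ny: "norm (y - x) = norm (y2 - y1)" using cs by (auto simp: norm_minus_commute)
    have d: "edge_mean ?e (\<lambda>x. q e' x \<bullet> t ?e) = (if e' = ?e then 1 else 0)" if "e' \<in> edges_of K" for e'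
      using basis em[OF that] em[OF e] edges_of_patch[OF K e] unfolding nedelec_basis_def q_def by blast
    have m: "edge_mean ?e (\<lambda>x. q e' x \<bullet> t ?e) = q e' y1 \<bullet> t ?e" if "e' \<in> edges_of K" for e'
      unfolding y(1,3) y(3)[unfolded y(1)] by (rule edge_mean_nedelec[OF q(1)[OF that]])
    have "Q y1 \<bullet> t ?e = c \<bullet> t ?e - (\<Sum>e'\<in>edges_of K. ?\<alpha> e' * (q e' y1 \<bullet> t ?e))"
      by (simp add: Q_def inner_diff_left inner_sum_left)
    also have "(\<Sum>e'\<in>edges_of K. ?\<alpha> e' * (q e' y1 \<bullet> t ?e)) = (\<Sum>e'\<in>edges_of K. if e' = ?e then ?\<alpha> e' else 0)"
      using d m by (intro sum.cong[OF refl]) simp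
    also have "\<dots> = ?\<alpha> ?e" using e finite_edges_of[OF K] by simp
    finally have Qt: "Q y1 \<bullet> t ?e = c \<bullet> t ?e - ?\<alpha> ?e" .
    have t0: "y2 - y1 = norm (y2 - y1) *\<^sub>R t ?e" using y(2,3) by simp
    have Q12: "Q y2 \<bullet> (y2 - y1) = Q y1 \<bullet> (y2 - y1)" using nedelec_edge_const[OF QN, of y1 y2 1] by (simp add: linepath_def)
    have "\<bar>Q x \<bullet> (y - x)\<bar> = \<bar>Q y1 \<bullet> (y2 - y1)\<bar>"
      using cs
    proof
      assume "x = y2 \<and> y = y1"
      then have "Q x \<bullet> (y - x) = - (Q y2 \<bullet> (y2 - y1))" by (simp add: inner_diff_right)
      then show ?thesis using Q12 by simp
    qed simp
    also have "\<dots> = norm (y2 - y1) * \<bar>c \<bullet> t ?e - ?\<alpha> ?e\<bar>" by (subst t0) (simp add: abs_mult Qt)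
    also have "\<dots> = sqrt (norm (y2 - y1)) * (\<bar>c \<bullet> t ?e - ?\<alpha> ?e\<bar> * sqrt (norm (y2 - y1)))"
      by (simp add: mult.assoc[symmetric] mult.commute)
    also have "\<dots> \<le> sqrt (norm (y2 - y1)) * B" using y(4) by (intro mult_left_mono) auto
    also have "\<dots> \<le> D"
    proof -
      have "x \<in> K" "y \<in> K" using xy V(2) hull_subset[of V convex] by auto
      then have "norm (y2 - y1) \<le> ?h" using diameter_bounded_bound[OF compact_imp_bounded[OF element_set(6)[OF K]], of y x] ny
        by (simp add: dist_norm)
      then show ?thesis unfolding D_def using B by (intro mult_right_mono) auto
    qed
    finally show ?thesis .
  qed
  note stab = nedelec_stability[OF V(1) ab r(2)[unfolded V(2)] r(1) mom D0, folded V(2)]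
  have hr: "1 / r \<le> 4 * \<sigma> / ?h" using r h by (simp add: field_simps)
  have mK: "sqrt (measure lebesgue (interior K)) \<le> sqrt ?\<omega> * ?h * sqrt ?h"
  proof -
    obtain x0 where x0: "x0 \<in> interior K" using element_set(4)[OF K] by auto
    have bK: "bounded K" using compact_imp_bounded[OF element_set(6)[OF K]] .
    have "interior K \<subseteq> cball x0 ?h"
    proof
      fix x assume "x \<in> interior K"
      then have "x0 \<in> K" "x \<in> K" using x0 interior_subset by auto
      then show "x \<in> cball x0 ?h" unfolding mem_cball by (rule diameter_bounded_bound[OF bK])
    qed
    then have "measure lebesgue (interior K) \<le> measure lebesgue (cball x0 ?h)"
      by (rule measure_mono_fmeasurable) (use element_set(5)[OF K] in \<open>auto simp: fmeasurableD\<close>)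
    also have "\<dots> = ?\<omega> * ?h ^ 3" using content_cball[of ?h x0] h by simp
    finally have "sqrt (measure lebesgue (interior K)) \<le> sqrt (?\<omega> * ?h ^ 3)" by simp
    also have "\<dots> = sqrt ?\<omega> * ?h * sqrt ?h" using h by (simp add: real_sqrt_mult power3_eq_cube)
    finally show ?thesis .
  qed
  have \<omega>: "0 \<le> sqrt ?\<omega>" by simp
  have sh: "sqrt ?h * sqrt ?h = ?h" using h by simp
  have DD: "D / r \<le> D * (4 * \<sigma> / ?h)" using mult_left_mono[OF hr D0] by simp
  have DD0: "0 \<le> D * (4 * \<sigma> / ?h)" using D0 \<sigma> h by (intro mult_nonneg_nonneg divide_nonneg_pos) auto
  have "L2_norm (interior K) Q \<le> D / r * sqrt (measure lebesgue (interior K))"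
  proof (rule L2_bounded(2)[OF element_set(5)[OF K] _ element_set(5)[OF K]])
    have "continuous_on UNIV Q" unfolding ab by (intro continuous_on_add continuous_on_const continuous_on_cross continuous_on_id)
    then have "Q \<in> borel_measurable borel" by (rule borel_measurable_continuous_onI)
    then show "Q \<in> borel_measurable lebesgue" by (intro measurable_completion) simp
    show "norm (Q x) \<le> D / r * indicator (interior K) x" if "x \<in> interior K" for x
      using stab(1)[of x] that interior_subset[of K] by auto
    show "0 \<le> D / r" using D0 r by simp
  qed
  also have "\<dots> \<le> D * (4 * \<sigma> / ?h) * (sqrt ?\<omega> * ?h * sqrt ?h)"
    by (rule mult_mono[OF DD mK DD0]) simp
  also have "\<dots> = 4 * \<sigma> * sqrt ?\<omega> * B * ?h"
    using h sh by (simp add: D_def field_simps)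
  finally have Q1: "L2_norm (interior K) Q \<le> 4 * \<sigma> * sqrt ?\<omega> * B * ?h" .
  have "norm b \<le> 2 * D * (1 / r)\<^sup>2" using stab(2) by (simp add: power_divide)
  also have "\<dots> \<le> 2 * D * (4 * \<sigma> / ?h)\<^sup>2"
    using hr D0 r by (intro mult_left_mono power_mono) auto
  finally have "norm b * sqrt (measure lebesgue (interior K)) \<le> 2 * D * (4 * \<sigma> / ?h)\<^sup>2 * (sqrt ?\<omega> * ?h * sqrt ?h)"
    using mK D0 by (intro mult_mono) auto
  also have "\<dots> = 32 * \<sigma>\<^sup>2 * sqrt ?\<omega> * B"
    using h sh by (simp add: D_def field_simps power2_eq_square)
  finally have Q2: "norm b * sqrt (measure lebesgue (interior K)) \<le> 32 * \<sigma>\<^sup>2 * sqrt ?\<omega> * B" .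
  show ?thesis using dev Q1 Q2 unfolding ab by blast
qed

lemma interpolation_error:
  assumes K: "K \<in> T" and tan: "unit_tangents T t" and basis: "nedelec_basis \<Omega> T t \<phi>" and pc: "path_choice \<mu> T chain"
    and v: "v \<in> H0_curl \<Omega>" "v \<in> PH1 (interior (\<Union>(element_patch T K))) P"
  defines "R \<equiv> L2_norm (monotone_patch \<mu> T chain K) (\<lambda>x. (\<mu> x powr (-1/2)) *\<^sub>R broken_jacobian T v x)"
    and "I \<equiv> interp \<Omega> \<mu> T t \<phi> v K"
  shows "L2_norm K (\<lambda>x. (\<mu> x powr (-1/2)) *\<^sub>R (v x - I x))
      \<le> (3 + 4 * \<sigma> * sqrt (unit_ball_vol 3) * coeff_const) * diameter K * R" (is ?L2)
    "L2_norm K (\<lambda>x. (\<mu> x powr (-1/2)) *\<^sub>R weak_curl (interior K) (\<lambda>y. v y - I y) x)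
      \<le> (2 + 64 * \<sigma>\<^sup>2 * sqrt (unit_ball_vol 3) * coeff_const) * R" (is ?curl)
proof -
  let ?U = "interior K" and ?m = "coeff_on \<mu> K" and ?\<omega> = "sqrt (unit_ball_vol 3)"
  \<comment> \<open>The extended patch as a set of elements, so that the norm over
    \<open>monotone_patch\<close> becomes a sum over \<open>W\<close>. The head of each chain is
    \<open>K\<close>, dropped by \<open>tl\<close> and inserted once.\<close>
  define W where "W = insert K (\<Union>e\<in>edges_of K. set (tl (chain K e)) \<union> max_patch \<mu> T e)"
  have RW: "R = L2_norm (\<Union>W) (\<lambda>x. (\<mu> x powr (-1/2)) *\<^sub>R broken_jacobian T v x)"
  proof -
    have "monotone_patch \<mu> T chain K = \<Union>W" unfolding monotone_patch_def W_def by blast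
    then show ?thesis by (simp add: R_def)
  qed
  have ch: "set (chain K e) \<subseteq> edge_patch T e \<and> (\<forall>L\<in>set (chain K e). inverse ?m \<le> inverse (coeff_on \<mu> L)) \<and>
      chain K e \<noteq> [] \<and> hd (chain K e) = K" if e: "e \<in> edges_of K" for e
  proof (cases "K \<in> max_patch \<mu> T e")
    case True
    then have "chain K e = [K]" using pc K e unfolding path_choice_def by metis
    then show ?thesis using edges_of_patch[OF K e] by simp
  next
    case False
    then obtain K' where "monotone_path \<mu> (edge_patch T e) K K' (chain K e)"
      using pc K e unfolding path_choice_def by metis
    then have p: "chain K e \<noteq> []" "hd (chain K e) = K" "set (chain K e) \<subseteq> edge_patch T e"
      "successively (\<lambda>A B. share_face A B \<and> inverse (coeff_on \<mu> A) \<le> inverse (coeff_on \<mu> B)) (chain K e)"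
      by (auto simp: monotone_path_def)
    then show ?thesis using successively_hd_le[OF p(4)] by metis
  qed
  have mx: "inverse ?m \<le> inverse (coeff_on \<mu> L)" if "e \<in> edges_of K" "L \<in> max_patch \<mu> T e" for e L
    using that edges_of_patch[OF K] by (auto simp: max_patch_def)
  have Wle: "inverse ?m \<le> inverse (coeff_on \<mu> L)" if "L \<in> W" for L
    using that ch mx unfolding W_def by (auto dest: list.set_sel(2)[rotated])
  have Kp: "K \<in> element_patch T K"
  proof -
    obtain V where V: "tetra V" "edges_of K = {closed_segment a b | a b. a \<in> V \<and> b \<in> V \<and> a \<noteq> b}"
      by (rule edges_of_vertices[OF K])
    have "card V = 4" using V(1) by (simp add: tetra_def)
    then obtain a b where "a \<in> V" "b \<in> V" "a \<noteq> b"
      by (metis One_nat_def card_le_Suc0_iff_eq tetra_finite[OF V(1)] numeral_le_one_iff semiring_norm(69))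
    then have "closed_segment a b \<in> edges_of K" using V(2) by blast
    then show ?thesis using edges_of_patch[OF K] by (auto simp: element_patch_def)
  qed
  have Wp: "L \<in> element_patch T K" if "L \<in> W" for L
  proof (cases "L = K")
    case False
    then obtain e where e: "e \<in> edges_of K" "L \<in> set (tl (chain K e)) \<or> L \<in> max_patch \<mu> T e"
      using \<open>L \<in> W\<close> unfolding W_def by blast
    then have "L \<in> edge_patch T e"
      using ch[OF e(1)] max_patch_subset[of \<mu> T e] list.set_sel(2)[of "chain K e" L] by blast
    then show ?thesis using e(1) by (auto simp: element_patch_def)
  qed (simp add: Kp)
  have WT: "W \<subseteq> T" using Wp by (auto simp: element_patch_def edge_patch_def)
  have WH: "v \<in> H1 (interior L)" if "L \<in> W" for L by (rule H1_element[OF v(2) Wp[OF that]])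
  \<comment> \<open>A common bound for the unweighted gradient norms on the extended patch;
    \<open>div\<close> removes the factor \<open>sqrt ?m\<close> again.\<close>
  define \<Lambda> where "\<Lambda> = sqrt ?m * R"
  have m: "0 < ?m" by (rule coeff_on_element(1)[OF K])
  have R0: "0 \<le> R" unfolding R_def by (rule L2_norm_nonneg)
  have \<Lambda>0: "0 \<le> \<Lambda>" using m R0 by (simp add: \<Lambda>_def)
  have gW: "gnorm v L \<le> \<Lambda>" if "L \<in> W" for L
    unfolding \<Lambda>_def RW by (rule gnorm_le_energy[OF WT WH that K Wle[OF that]])
  have KW: "K \<in> W" by (simp add: W_def)
  have chW: "L \<in> W" if "e \<in> edges_of K" "L \<in> set (chain K e) \<union> max_patch \<mu> T e" for e L
  proof -
    have "set (chain K e) = insert K (set (tl (chain K e)))" using ch[OF that(1)] by (metis list.collapse list.simps(15))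
    then show ?thesis using that unfolding W_def by blast
  qed
  have "\<exists>a b. (\<forall>x\<in>?U. tmean v K - I x = a + cross3 b x) \<and>
    L2_norm ?U (\<lambda>x. a + cross3 b x) \<le> 4 * \<sigma> * ?\<omega> * (coeff_const * \<Lambda>) * diameter K \<and>
    norm b * sqrt (measure lebesgue ?U) \<le> 32 * \<sigma>\<^sup>2 * ?\<omega> * (coeff_const * \<Lambda>)"
    unfolding I_def
  proof (rule interpolant_deviation[OF K basis])
    fix x1 x2 assume e: "closed_segment x1 x2 \<in> edges_of K"
    then have "closed_segment x1 x2 \<in> mesh_edges T" using K by (auto simp: mesh_edges_def)
    then obtain y1 y2 where y: "y1 \<noteq> y2" "closed_segment x1 x2 = closed_segment y1 y2"
      "t (closed_segment x1 x2) = (1 / norm (y2 - y1)) *\<^sub>R (y2 - y1)"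
      using tan unfolding unit_tangents_def divide_inverse mult_1 by meson
    have "\<bar>tmean v K \<bullet> t (closed_segment x1 x2) - interp_coeff \<Omega> \<mu> T t v (closed_segment x1 x2)\<bar> * sqrt (norm (y2 - y1)) \<le> coeff_const * \<Lambda>"
      by (rule interp_coeff_error[where t=t and chain=chain and K=K, OF v(1) K e y(2,3) pc _ \<Lambda>0]) (use chW[OF e] gW WH in blast)
    with y show "\<exists>y1 y2. closed_segment x1 x2 = closed_segment y1 y2 \<and> y1 \<noteq> y2 \<and>
      t (closed_segment x1 x2) = (1 / norm (y2 - y1)) *\<^sub>R (y2 - y1) \<and>
      \<bar>tmean v K \<bullet> t (closed_segment x1 x2) - interp_coeff \<Omega> \<mu> T t v (closed_segment x1 x2)\<bar> * sqrt (norm (y2 - y1)) \<le> coeff_const * \<Lambda>"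
      by blast
  qed (simp add: coeff_const_nonneg \<Lambda>0)
  then obtain a b where dev: "\<And>x. x \<in> ?U \<Longrightarrow> tmean v K - I x = a + cross3 b x"
    and Q1: "L2_norm ?U (\<lambda>x. a + cross3 b x) \<le> 4 * \<sigma> * ?\<omega> * (coeff_const * \<Lambda>) * diameter K"
    and Q2: "norm b * sqrt (measure lebesgue ?U) \<le> 32 * \<sigma>\<^sup>2 * ?\<omega> * (coeff_const * \<Lambda>)" by blast
  note U = element_set[OF K]
  define G where "G = weak_jacobian ?U v"
  have G: "G \<in> L2 ?U" "has_weak_jacobian ?U v G" unfolding G_def by (rule weak_jacobian_spec[OF WH[OF KW]])+
  have gK: "L2_norm ?U G \<le> \<Lambda>" using gW[OF KW] by (simp add: gnorm_def G_def)
  have vU: "v \<in> L2 ?U" by (rule H0_L2_element[OF v(1) K])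
  have div: "X / sqrt ?m \<le> Y * R" if "X \<le> Y * \<Lambda>" for X Y
    using that m by (simp add: \<Lambda>_def pos_divide_le_eq mult_ac)
  \<comment> \<open>The polynomial that the interpolant equals in the interior of \<open>K\<close>;
    its curl is \<open>-2 b\<close>, so the bound on \<open>b\<close> controls the curl
    error.\<close>
  define p where "p = (\<lambda>x. (tmean v K - a) + cross3 (- b) x)"
  have Ip: "I x = p x" if "x \<in> ?U" for x using dev[OF that] by (simp add: p_def cross_minus_left algebra_simps)
  note pc' = nedelec_curl[OF U(1,3) p_def]
  have Qn: "(\<lambda>x. a + cross3 b x) \<in> L2 ?U" by (rule nedelec_curl(2)[OF U(1,3) refl])
  have vm: "(\<lambda>x. v x - tmean v K) \<in> L2 ?U" by (rule L2_diff[OF vU L2_const[OF U(5)]])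
  have "L2_norm ?U (\<lambda>x. v x - I x) = L2_norm ?U (\<lambda>x. (v x - tmean v K) + (a + cross3 b x))"
    unfolding L2_norm_def
  proof (rule arg_cong[of _ _ sqrt], rule set_integral_cong_null)
    fix x assume "x \<in> ?U"
    from dev[OF this, symmetric] show "(norm (v x - I x))\<^sup>2 = (norm ((v x - tmean v K) + (a + cross3 b x)))\<^sup>2" by simp
  qed simp_all
  also have "\<dots> \<le> L2_norm ?U (\<lambda>x. v x - tmean v K) + L2_norm ?U (\<lambda>x. a + cross3 b x)"
    by (rule L2_norm_triangle[OF vm Qn])
  also have "\<dots> \<le> 3 * diameter K * \<Lambda> + 4 * \<sigma> * ?\<omega> * (coeff_const * \<Lambda>) * diameter K"
  proof (rule add_mono[OF _ Q1])
    have "L2_norm ?U (\<lambda>x. v x - tmean v K) \<le> 3 * diameter ?U * L2_norm ?U G"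
      unfolding tmean_def by (rule poincare[OF U(1-4) vU G])
    also have "\<dots> \<le> 3 * diameter K * \<Lambda>"
      using U(9) gK L2_norm_nonneg diameter_ge_0[OF U(3)] diameter_ge_0[OF compact_imp_bounded[OF U(6)]] by (intro mult_mono) auto
    finally show "L2_norm ?U (\<lambda>x. v x - tmean v K) \<le> 3 * diameter K * \<Lambda>" .
  qed
  finally have "L2_norm ?U (\<lambda>x. v x - I x) \<le> (3 + 4 * \<sigma> * ?\<omega> * coeff_const) * diameter K * \<Lambda>"
    by (simp add: algebra_simps)
  then show ?L2 unfolding L2_norm_weighted[OF K] by (rule div)
  define w where "w = (\<lambda>x. curl_of_jacobian (G x) - 2 *\<^sub>R (- b))"
  have c2: "(\<lambda>x. 2 *\<^sub>R (- b)) \<in> L2 ?U" by (rule L2_const[OF U(5)])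
  have "has_weak_curl ?U (\<lambda>x. v x - p x) w" unfolding w_def
    by (rule has_weak_curl_diff[OF weak_curl_of_weak_jacobian[OF U(5) vU G] pc'(1) U(5) vU L2_curl_of_jacobian(1)[OF G(1)] pc'(2) c2])
  then have wc: "has_weak_curl ?U (\<lambda>x. v x - I x) w"
  proof -
    have "(LINT x:?U|lebesgue. (v x - I x) \<bullet> classical_curl \<phi> x) = (LINT x:?U|lebesgue. (v x - p x) \<bullet> classical_curl \<phi> x)" for \<phi>
      by (rule set_integral_cong_null) (simp_all add: Ip)
    with \<open>has_weak_curl ?U (\<lambda>x. v x - p x) w\<close> show ?thesis unfolding has_weak_curl_def by (simp only:)
  qed
  have wL: "w \<in> L2 ?U" unfolding w_def by (rule L2_diff[OF L2_curl_of_jacobian(1)[OF G(1)] c2])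
  note wcs = weak_curl_spec[OF U(1,5) wL wc]
  have "L2_norm ?U (weak_curl ?U (\<lambda>y. v y - I y)) = L2_norm ?U w" by (rule L2_norm_cong_AE[OF wcs(1) wL wcs(3)])
  also have "w = (\<lambda>x. curl_of_jacobian (G x) + 2 *\<^sub>R b)" by (simp add: w_def)
  also have "L2_norm ?U \<dots> \<le> L2_norm ?U (\<lambda>x. curl_of_jacobian (G x)) + L2_norm ?U (\<lambda>x. 2 *\<^sub>R b)"
    by (rule L2_norm_triangle[OF L2_curl_of_jacobian(1)[OF G(1)] L2_const[OF U(5)]])
  also have "\<dots> \<le> 2 * \<Lambda> + 64 * \<sigma>\<^sup>2 * ?\<omega> * (coeff_const * \<Lambda>)"
  proof (rule add_mono)
    show "L2_norm ?U (\<lambda>x. curl_of_jacobian (G x)) \<le> 2 * \<Lambda>"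
      using L2_curl_of_jacobian(2)[OF G(1)] gK by linarith
    have "L2_norm ?U (\<lambda>x. 2 *\<^sub>R b) \<le> (2 * norm b) * sqrt (measure lebesgue ?U)"
      by (rule L2_bounded(2)[OF U(5) _ U(5)]) auto
    then show "L2_norm ?U (\<lambda>x. 2 *\<^sub>R b) \<le> 64 * \<sigma>\<^sup>2 * ?\<omega> * (coeff_const * \<Lambda>)" using Q2 by linarith
  qed
  finally have "L2_norm ?U (weak_curl ?U (\<lambda>y. v y - I y)) \<le> (2 + 64 * \<sigma>\<^sup>2 * ?\<omega> * coeff_const) * \<Lambda>"
    by (simp add: algebra_simps)
  then show ?curl unfolding L2_norm_weighted[OF K] by (rule div)
qed

end

theorem theorem4p6:
  fixes \<sigma> :: real
  shows "\<exists>C>0. \<forall>\<Omega> P \<mu> T t \<phi> chain.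
    polyhedral_domain \<Omega> \<and> lipschitz_boundary \<Omega> \<and> polyhedral_partition \<Omega> P \<and>
    piecewise_constant_pos P \<mu> \<and> fitted_mesh \<Omega> P T \<and> shape_regular \<sigma> T \<and>
    unit_tangents T t \<and> nedelec_basis \<Omega> T t \<phi> \<and>
    quasi_monotone \<Omega> \<mu> T \<and> path_choice \<mu> T chain \<longrightarrow>
    (\<forall>K\<in>T. \<forall>v \<in> H0_curl \<Omega>.
       v \<in> H_curl (interior (\<Union>(element_patch T K))) \<inter> PH1 (interior (\<Union>(element_patch T K))) P \<longrightarrow>
       L2_norm K (\<lambda>x. (\<mu> x powr (-1/2)) *\<^sub>R (v x - interp \<Omega> \<mu> T t \<phi> v K x))
         \<le> C * diameter K *
           L2_norm (monotone_patch \<mu> T chain K) (\<lambda>x. (\<mu> x powr (-1/2)) *\<^sub>R broken_jacobian T v x) \<and>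
       L2_norm K (\<lambda>x. (\<mu> x powr (-1/2)) *\<^sub>R
             weak_curl (interior K) (\<lambda>y. v y - interp \<Omega> \<mu> T t \<phi> v K y) x)
         \<le> C * L2_norm (monotone_patch \<mu> T chain K) (\<lambda>x. (\<mu> x powr (-1/2)) *\<^sub>R broken_jacobian T v x))"
proof -
  define c where "c = sqrt (unit_ball_vol 3) * weighted_mesh.coeff_const \<sigma>"
  \<comment> \<open>Dominates both constants of \<open>interpolation_error\<close>. The absolute
    values are taken because the sign of \<open>\<sigma>\<close> is not known before a mesh is
    given.\<close>
  define C where "C = 3 + 4 * \<bar>\<sigma>\<bar> * \<bar>c\<bar> + 64 * \<sigma>\<^sup>2 * \<bar>c\<bar>"
  have C0: "C > 0" unfolding C_def by (intro add_pos_nonneg) auto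
  have "4 * \<sigma> * c \<le> 4 * (\<bar>\<sigma>\<bar> * \<bar>c\<bar>)" using abs_ge_self[of "\<sigma> * c"] by (simp add: abs_mult)
  moreover have "64 * \<sigma>\<^sup>2 * c \<le> 64 * \<sigma>\<^sup>2 * \<bar>c\<bar>" by (intro mult_left_mono) auto
  moreover have "0 \<le> 64 * \<sigma>\<^sup>2 * \<bar>c\<bar>" "0 \<le> 4 * (\<bar>\<sigma>\<bar> * \<bar>c\<bar>)" by auto
  ultimately have C12: "3 + 4 * \<sigma> * c \<le> C" "2 + 64 * \<sigma>\<^sup>2 * c \<le> C" unfolding C_def by linarith+
  show ?thesis
  proof (intro exI[of _ C] conjI allI impI ballI C0)
    fix \<Omega> P \<mu> T t \<phi> chain K v
    assume A: "polyhedral_domain \<Omega> \<and> lipschitz_boundary \<Omega> \<and> polyhedral_partition \<Omega> P \<and>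
      piecewise_constant_pos P \<mu> \<and> fitted_mesh \<Omega> P T \<and> shape_regular \<sigma> T \<and>
      unit_tangents T t \<and> nedelec_basis \<Omega> T t \<phi> \<and> quasi_monotone \<Omega> \<mu> T \<and> path_choice \<mu> T chain"
      and K: "K \<in> T" and v: "v \<in> H0_curl \<Omega>"
      "v \<in> H_curl (interior (\<Union>(element_patch T K))) \<inter> PH1 (interior (\<Union>(element_patch T K))) P"
    interpret weighted_mesh \<sigma> \<Omega> P \<mu> T using A by unfold_locales auto
    have t: "unit_tangents T t" "nedelec_basis \<Omega> T t \<phi>" "path_choice \<mu> T chain" using A by auto
    have v2: "v \<in> PH1 (interior (\<Union>(element_patch T K))) P" using v(2) by blast
    note E = interpolation_error[OF K t v(1) v2]
    let ?R = "L2_norm (monotone_patch \<mu> T chain K) (\<lambda>x. (\<mu> x powr (-1/2)) *\<^sub>R broken_jacobian T v x)"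
    have R: "0 \<le> ?R" by (rule L2_norm_nonneg)
    have h: "0 \<le> diameter K" by (rule diameter_ge_0[OF compact_imp_bounded[OF element_set(6)[OF K]]])
    have c: "4 * \<sigma> * sqrt (unit_ball_vol 3) * coeff_const = 4 * \<sigma> * c" "64 * \<sigma>\<^sup>2 * sqrt (unit_ball_vol 3) * coeff_const = 64 * \<sigma>\<^sup>2 * c"
      by (simp_all add: c_def)
    show "L2_norm K (\<lambda>x. (\<mu> x powr (-1/2)) *\<^sub>R (v x - interp \<Omega> \<mu> T t \<phi> v K x)) \<le> C * diameter K * ?R"
      by (rule order_trans[OF E(1)], unfold c(1)) (intro mult_right_mono C12 h R)
    show "L2_norm K (\<lambda>x. (\<mu> x powr (-1/2)) *\<^sub>R weak_curl (interior K) (\<lambda>y. v y - interp \<Omega> \<mu> T t \<phi> v K y) x) \<le> C * ?R"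
      by (rule order_trans[OF E(2)], unfold c(2)) (intro mult_right_mono C12 R)
  qed
qed

end
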